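(* Let $P\in\Psi^m_{cl}$ have real principal symbol that vanishes of order $2$ at an involutive manifold $\Sigma_2$ with nondegenerate Hessian, and assume that $P$ is of real subprincipal type. Then $P$ satisfies condition $\mathrm{Sub}_r(\Psi)$ if and only if both of the following hold: (i) $\mathrm{Im}\,p_s$ does not change sign on the leaves of $\Sigma_2$; (ii) the sign of $\mathrm{Im}\,p_s$ on the leaves does not change from $-$ to $+$ on the subprincipal bicharacteristics, i.e., the bicharacteristics of $\mathrm{Re}\,p_s$ with respect to the symplectic structure of $\Sigma_2$, for any value of $\mathrm{Re}\,p_s$.
   Context: **Symbols.** $P$ has symbol expansion $p+p_{m-1}+\dots$ with $p_{m-j}$ homogeneous of degree $m-j$ in $\xi$; $p_s=p_{m-1}+\frac i2\sum_j\partial_{x_j}\partial_{\xi_j}p$ is the subprincipal symbol and $p_r=p+p_s$ the refined principal symbol. $\Sigma_2=\{p=0,\ dp=0\}$ is nonradial and involutive (nonradial: Hamilton fields of functions vanishing on $\Sigma_2$ do not have the radial direction). The Hessian of $p$ is nondegenerate on the normal bundle of $\Sigma_2$. **Leaves and signs.** $T\Sigma_2^\sigma\subset T\Sigma_2$ is the symplectic annihilator of $T\Sigma_2$, tangent to the leaves $L$ of $\Sigma_2$; $T^\sigma\Sigma_2=T\Sigma_2/T\Sigma_2^\sigma$ is symplectic. The sign of $\mathrm{Im}\,p_s$ on a leaf $L$ is $\pm1$ if $\pm\mathrm{Im}\,p_s\ge0$ and $\mathrm{Im}\,p_s\not\equiv0$ on $L$, and $0$ if $\mathrm{Im}\,p_s\equiv0$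 on $L$. All statements are microlocal (local on $\Sigma_2$). **Real subprincipal type.** $P$ with real principal symbol is of real subprincipal type if $H_{\mathrm{Re}\,p_s}\subset T\Sigma_2$ (that is, $d\,\mathrm{Re}\,p_s|_{TL}=0$), $d\,\mathrm{Re}\,p_s|_{T^\sigma\Sigma_2}\neq0$, and $H_{\mathrm{Re}\,p_s}$ does not have the radial direction. **Condition $\mathrm{Sub}_r(\Psi)$.** There is a homogeneous $0\ne a\in S^0$ such that $ap_r$ has real principal symbol vanishing of order $2$ at the involutive manifold $\Sigma_2$ with nondegenerate Hessian, $ap_r$ is of real subprincipal type, and $\mathrm{Im}\,ap_r$ does not change sign from $-$ to $+$ on the limits at $\Sigma_2$ of the (oriented) bicharacteristics of $\mathrm{Re}\,ap_r$, where all values of $\mathrm{Re}\,ap_r$ are allowed. Explicitly: after normalizing the order to $m=2$ one can choose homogeneous symplectic coordinates $(x,t,y;\xi,\tau,\eta)$ with $\Sigma_2=\{\xi=0\}$ and $ap_r=\sum a_{jk}\xi_j\xi_k+\tau+if$ modulo terms of order $1$ vanishing on $\Sigma_2$ and lower order terms, $f$ real and homogeneous of degree $1$. The limits at $\Sigma_2$ of (positive multiples of) $H_{\mathrm{Re}\,ap_r}$ when $|\xi|/\sqrt{\tau^2+|\eta|^2}\to0$ are the fields $\partial_t$, $2\sum a_{jk}(x,t,y;0,\tau,\eta)\theta_j\partial_{x_k}$ with $|\theta|=1$ fixed, and $\partial_t+2\varrho\sum a_{jk}(x,t,y;0,\tau,\eta)\theta_j\partial_{x_k}$ with $\varrho\ge0$;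 the limit bicharacteristics are their orbits in $\Sigma_2$.
   Formalization: As the multiplier a can alter bicharacteristics where Re p_s ≠ 0, "only if" is false; proved: iff for a = 1; Sub_r(Ψ) iff (i),(ii) hold for aP for some a; (i),(ii) imply Sub_r(Ψ); Sub_r(Ψ) implies (i), and (ii) at Re p_s = 0. "Not radial" is taken modulo the leaf directions. *)

theory Defs
  imports "HOL-Analysis.Analysis"
begin

section \<open>Smooth functions\<close>

text \<open>Iterated directional derivatives, the head of the list being applied first.\<close>

fun dir_derivs :: "'a list \<Rightarrow> ('a::real_normed_vector \<Rightarrow> 'b::real_normed_vector) \<Rightarrow> 'a \<Rightarrow> 'b" where
  "dir_derivs [] f = f"
| "dir_derivs (v # vs) f = dir_derivs vs (\<lambda>z. frechet_derivative f (at z) v)"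

text \<open>\<open>C\<^sup>\<infinity>\<close> on an \<^emph>\<open>open\<close> set; only the values of \<open>f\<close> on that set matter.\<close>

definition smooth_on :: "'a::real_normed_vector set \<Rightarrow> ('a \<Rightarrow> 'b::real_normed_vector) \<Rightarrow> bool" where
  "smooth_on S f \<longleftrightarrow> (\<forall>vs. \<forall>z\<in>S. dir_derivs vs f differentiable (at z))"


section \<open>Phase space\<close>

text \<open>Everything is microlocal, so the base manifold is an open subset of \<open>real ^ 'n\<close>, and its
  cotangent bundle consists of the points \<open>(x, \<xi>)\<close>. The symplectic form is
  \<open>\<Sum> d\<xi>\<^sub>j \<and> dx\<^sub>j\<close>, so that \<open>df v = \<sigma>(v, H\<^sub>f)\<close>.\<close>

type_synonym 'n phase = "(real ^ 'n) \<times> (real ^ 'n)"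

definition symp :: "'n::finite phase \<Rightarrow> 'n phase \<Rightarrow> real" where
  "symp v w = snd v \<bullet> fst w - fst v \<bullet> snd w"

definition ham :: "('n::finite phase \<Rightarrow> real) \<Rightarrow> 'n phase \<Rightarrow> 'n phase" where
  "ham f z = ((\<chi> j. frechet_derivative f (at z) (0, axis j 1)),
              (\<chi> j. - frechet_derivative f (at z) (axis j 1, 0)))"

definition poisson :: "('n::finite phase \<Rightarrow> real) \<Rightarrow> ('n phase \<Rightarrow> real) \<Rightarrow> 'n phase \<Rightarrow> real" where
  "poisson f g z = frechet_derivative g (at z) (ham f z)"

definition radial :: "'n::finite phase \<Rightarrow> 'n phase" where
  "radial z = (0, snd z)"

definition conic_open :: "'n::finite phase set \<Rightarrow> bool" where
  "conic_open U \<longleftrightarrow> open U \<and> (\<forall>z\<in>U. snd z \<noteq> 0 \<and> (\<forall>t>0. (fst z, t *\<^sub>R snd z) \<in> U))"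

definition homogeneous :: "real \<Rightarrow> 'n::finite phase set \<Rightarrow> ('n phase \<Rightarrow> 'b::real_vector) \<Rightarrow> bool" where
  "homogeneous r U f \<longleftrightarrow> (\<forall>z\<in>U. \<forall>t>0. f (fst z, t *\<^sub>R snd z) = (t powr r) *\<^sub>R f z)"


section \<open>Classical pseudodifferential operators\<close>

definition test_fun :: "(real ^ 'n::finite) set \<Rightarrow> (real ^ 'n \<Rightarrow> complex) \<Rightarrow> bool" where
  "test_fun X u \<longleftrightarrow> smooth_on UNIV u \<and> (\<exists>K. compact K \<and> K \<subseteq> X \<and> (\<forall>x. x \<notin> K \<longrightarrow> u x = 0))"

definition fourier :: "(real ^ 'n::finite \<Rightarrow> complex) \<Rightarrow> real ^ 'n \<Rightarrow> complex" where
  "fourier u \<xi> = (LINT x|lborel. cis (- (x \<bullet> \<xi>)) * u x)"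

text \<open>\<open>s\<close> is a full symbol with classical expansion \<open>\<Sum>\<^sub>j p\<^sub>j\<close>, \<open>p\<^sub>j\<close> being homogeneous of
  degree \<open>m - j\<close>. The estimates with \<open>N = 0\<close> say that \<open>s\<close> is a symbol of order \<open>m\<close>.
  Restricting to \<open>norm \<xi> \<ge> 1\<close> replaces the usual cutoff of \<open>p\<^sub>j\<close> near \<open>\<xi> = 0\<close>.\<close>

definition classical_symbol ::
  "real \<Rightarrow> (real ^ 'n::finite) set \<Rightarrow> ('n phase \<Rightarrow> complex) \<Rightarrow> (nat \<Rightarrow> 'n phase \<Rightarrow> complex) \<Rightarrow> bool" where
  "classical_symbol m X s p \<longleftrightarrow>
     smooth_on (X \<times> UNIV) s \<and>
     (\<forall>j. smooth_on (X \<times> (- {0})) (p j) \<and> homogeneous (m - real j) (X \<times> (- {0})) (p j)) \<and>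
     (\<forall>N K vs ws. compact K \<and> K \<subseteq> X \<longrightarrow>
        (\<exists>C. \<forall>x\<in>K. \<forall>\<xi>. 1 \<le> norm \<xi> \<longrightarrow>
           norm (dir_derivs (map (\<lambda>v. (v, 0)) vs @ map (\<lambda>w. (0, w)) ws)
                   (\<lambda>z. s z - (\<Sum>j<N. p j z)) (x, \<xi>))
             \<le> C * (1 + norm \<xi>) powr (m - real N - real (length ws))))"

text \<open>\<open>P\<close> is the quantization of such a symbol, up to an operator \<open>k\<close> with smooth kernel.\<close>

definition Psi_cl ::
  "real \<Rightarrow> (real ^ 'n::finite) set \<Rightarrow> ((real ^ 'n \<Rightarrow> complex) \<Rightarrow> real ^ 'n \<Rightarrow> complex)
     \<Rightarrow> (nat \<Rightarrow> 'n phase \<Rightarrow> complex) \<Rightarrow> bool" where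
  "Psi_cl m X P p \<longleftrightarrow>
     (\<exists>s k. classical_symbol m X s p \<and> smooth_on (X \<times> X) k \<and>
        (\<forall>u. test_fun X u \<longrightarrow> (\<forall>x\<in>X.
           P u x = (LINT \<xi>|lborel. cis (x \<bullet> \<xi>) * s (x, \<xi>) * fourier u \<xi>) / of_real ((2 * pi) ^ CARD('n))
                   + (LINT y|lborel. k (x, y) * u y))))"

definition subprincipal ::
  "(nat \<Rightarrow> 'n::finite phase \<Rightarrow> complex) \<Rightarrow> 'n phase \<Rightarrow> complex" where
  "subprincipal p z = p 1 z + \<i> / 2 * (\<Sum>j\<in>UNIV. dir_derivs [(0, axis j 1), (axis j 1, 0)] (p 0) z)"


section \<open>The double characteristics\<close>

definition tangent :: "'a::real_normed_vector set \<Rightarrow> 'a \<Rightarrow> 'a set" where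
  "tangent S w = {v. \<exists>\<gamma>. \<gamma> (0::real) = w \<and> (\<forall>\<^sub>F s in nhds 0. \<gamma> s \<in> S) \<and>
                        (\<gamma> has_vector_derivative v) (at 0)}"

text \<open>The symplectic annihilator \<open>T\<Sigma>\<^sup>\<sigma>\<close>. It is spanned by the Hamilton fields of the functions
  vanishing on \<open>\<Sigma>\<close>.\<close>

definition tangent_ann :: "'n::finite phase set \<Rightarrow> 'n phase \<Rightarrow> 'n phase set" where
  "tangent_ann S w = {v. \<forall>v'\<in>tangent S w. symp v v' = 0}"

text \<open>Embedded submanifold, of positive codimension at each of its points.\<close>

definition submanifold :: "'a::real_normed_vector set \<Rightarrow> bool" where
  "submanifold S \<longleftrightarrow>
     (\<forall>w\<in>S. \<exists>W d u. open W \<and> w \<in> W \<and> 0 < d \<and> (\<forall>j<d. smooth_on W (u j :: 'a \<Rightarrow> real)) \<and>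
        S \<inter> W = {z\<in>W. \<forall>j<d. u j z = 0} \<and>
        (\<forall>z\<in>W. \<forall>c. (\<forall>v. (\<Sum>j<d. c j * frechet_derivative (u j) (at z) v) = 0)
                   \<longrightarrow> (\<forall>j<(d::nat). c j = 0)))"

definition hess :: "('n::finite phase \<Rightarrow> real) \<Rightarrow> 'n phase \<Rightarrow> 'n phase \<Rightarrow> 'n phase \<Rightarrow> real" where
  "hess f w v v' = dir_derivs [v', v] f w"

definition Sigma2 :: "'n::finite phase set \<Rightarrow> ('n phase \<Rightarrow> complex) \<Rightarrow> 'n phase set" where
  "Sigma2 U p = {w\<in>U. p w = 0 \<and> (\<forall>v. frechet_derivative p (at w) v = 0)}"

text \<open>\<open>p\<close> is real on \<open>U\<close> and vanishes of order 2 at the nonradial involutive manifold \<open>\<Sigma>\<^sub>2\<close>, with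
  Hessian nondegenerate on the normal bundle.\<close>

definition real_double_char :: "'n::finite phase set \<Rightarrow> ('n phase \<Rightarrow> complex) \<Rightarrow> bool" where
  "real_double_char U p \<longleftrightarrow>
     (\<forall>z\<in>U. Im (p z) = 0) \<and>
     submanifold (Sigma2 U p) \<and>
     (\<forall>w\<in>Sigma2 U p. tangent_ann (Sigma2 U p) w \<subseteq> tangent (Sigma2 U p) w) \<and>
     (\<forall>w\<in>Sigma2 U p. radial w \<notin> tangent_ann (Sigma2 U p) w) \<and>
     (\<forall>w\<in>Sigma2 U p. \<forall>v. (\<forall>v'. hess (\<lambda>z. Re (p z)) w v v' = 0) \<longrightarrow> v \<in> tangent (Sigma2 U p) w)"

text \<open>\<open>q\<close> is the subprincipal symbol, which is invariantly defined only on \<open>\<Sigma>\<^sub>2\<close>. Hence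
  \<open>H\<^bsub>Re q\<^esub>\<close> is invariantly defined there as a section of \<open>T\<Sigma>\<^sub>2 / T\<Sigma>\<^sub>2\<^sup>\<sigma>\<close>, and not having the radial
  direction is understood in this quotient. By the first condition \<open>d Re q\<close> vanishes on
  \<open>T\<Sigma>\<^sub>2\<^sup>\<sigma>\<close>, so the second one says that it does not vanish on the quotient.\<close>

definition real_subprincipal_type ::
  "'n::finite phase set \<Rightarrow> ('n phase \<Rightarrow> complex) \<Rightarrow> ('n phase \<Rightarrow> complex) \<Rightarrow> bool" where
  "real_subprincipal_type U p q \<longleftrightarrow>
     (\<forall>w\<in>Sigma2 U p.
        ham (\<lambda>z. Re (q z)) w \<in> tangent (Sigma2 U p) w \<and>
        (\<exists>v\<in>tangent (Sigma2 U p) w. frechet_derivative (\<lambda>z. Re (q z)) (at w) v \<noteq> 0) \<and>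
        (\<forall>c. ham (\<lambda>z. Re (q z)) w - c *\<^sub>R radial w \<notin> tangent_ann (Sigma2 U p) w))"


section \<open>Leaves and subprincipal bicharacteristics\<close>

text \<open>The leaf through \<open>w\<close>, connected within the given piece \<open>S\<close> of \<open>\<Sigma>\<^sub>2\<close>.\<close>

definition leaf :: "'n::finite phase set \<Rightarrow> 'n phase \<Rightarrow> 'n phase set" where
  "leaf S w = {z. \<exists>\<gamma>. \<gamma> (0::real) = w \<and> \<gamma> 1 = z \<and>
     (\<forall>s\<in>{0..1}. \<gamma> s \<in> S \<and>
        (\<exists>v\<in>tangent_ann S (\<gamma> s). (\<gamma> has_vector_derivative v) (at s within {0..1})))}"

text \<open>Leaves on which \<open>g\<close> changes sign get the value 0; they are excluded separately.\<close>

definition leaf_sign :: "('a \<Rightarrow> real) \<Rightarrow> 'a set \<Rightarrow> int" where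
  "leaf_sign g L =
     (if (\<forall>z\<in>L. 0 \<le> g z) \<and> (\<exists>z\<in>L. g z \<noteq> 0) then 1
      else if (\<forall>z\<in>L. g z \<le> 0) \<and> (\<exists>z\<in>L. g z \<noteq> 0) then -1
      else 0)"

definition no_sign_change_on_leaves ::
  "'n::finite phase set \<Rightarrow> ('n phase \<Rightarrow> complex) \<Rightarrow> ('n phase \<Rightarrow> complex) \<Rightarrow> bool" where
  "no_sign_change_on_leaves U p q \<longleftrightarrow>
     (\<forall>w\<in>Sigma2 U p. \<not> (\<exists>z\<in>leaf (Sigma2 U p) w. \<exists>z'\<in>leaf (Sigma2 U p) w. Im (q z) < 0 \<and> 0 < Im (q z')))"

text \<open>Bicharacteristics of \<open>g\<close> for the symplectic form restricted to \<open>S\<close>, on the level \<open>g = c\<close>. As the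
  restricted form has kernel \<open>TS\<^sup>\<sigma>\<close>, the velocity is determined only modulo \<open>TS\<^sup>\<sigma>\<close>: the curves are
  all the lifts to \<open>S\<close> of the bicharacteristics in the space of leaves.\<close>

definition subprincipal_bichar ::
  "'n::finite phase set \<Rightarrow> ('n phase \<Rightarrow> real) \<Rightarrow> real \<Rightarrow> (real \<Rightarrow> 'n phase) \<Rightarrow> real \<Rightarrow> real \<Rightarrow> bool" where
  "subprincipal_bichar S g c \<gamma> a b \<longleftrightarrow>
     (\<forall>s\<in>{a..b}. \<gamma> s \<in> S \<and> g (\<gamma> s) = c \<and>
        (\<exists>v\<in>tangent S (\<gamma> s). (\<gamma> has_vector_derivative v) (at s within {a..b}) \<and>
           (\<forall>v'\<in>tangent S (\<gamma> s). symp v' v = frechet_derivative g (at (\<gamma> s)) v')))"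

definition no_leaf_sign_change_at ::
  "'n::finite phase set \<Rightarrow> ('n phase \<Rightarrow> complex) \<Rightarrow> ('n phase \<Rightarrow> complex) \<Rightarrow> real \<Rightarrow> bool" where
  "no_leaf_sign_change_at U p q c \<longleftrightarrow>
     (\<forall>\<gamma> a b. subprincipal_bichar (Sigma2 U p) (\<lambda>z. Re (q z)) c \<gamma> a b \<longrightarrow>
        \<not> (\<exists>s s'. a \<le> s \<and> s < s' \<and> s' \<le> b \<and>
              leaf_sign (\<lambda>z. Im (q z)) (leaf (Sigma2 U p) (\<gamma> s)) = -1 \<and>
              leaf_sign (\<lambda>z. Im (q z)) (leaf (Sigma2 U p) (\<gamma> s')) = 1))"


section \<open>Limit bicharacteristics and condition \<open>Sub\<^sub>r(\<Psi>)\<close>\<close>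

text \<open>The functions \<open>\<xi>\<^sub>0, \<dots>, \<xi>\<^bsub>d-1\<^esub>\<close> of homogeneous symplectic coordinates in which
  \<open>\<Sigma>\<^sub>2 = {\<xi> = 0}\<close>. By the homogeneous Darboux theorem, Poisson commuting functions that are
  homogeneous of degree 1 and whose Hamilton fields are linearly independent together with the
  radial field are exactly those that can be completed locally to such coordinates, and then
  \<open>\<partial>/\<partial>x\<^sub>k\<close> is the Hamilton field of \<open>\<xi>\<^sub>k\<close>. The remaining coordinates do not enter below.\<close>

definition sympl_frame ::
  "'n::finite phase set \<Rightarrow> 'n phase set \<Rightarrow> nat \<Rightarrow> (nat \<Rightarrow> 'n phase \<Rightarrow> real) \<Rightarrow> bool" where
  "sympl_frame U S d \<xi> \<longleftrightarrow>
     (\<forall>j<d. smooth_on U (\<xi> j) \<and> homogeneous 1 U (\<xi> j)) \<and>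
     (\<forall>j<d. \<forall>k<d. \<forall>z\<in>U. poisson (\<xi> j) (\<xi> k) z = 0) \<and>
     (\<forall>z\<in>U. \<forall>c r. (\<Sum>j<d. c j *\<^sub>R ham (\<xi> j) z) = r *\<^sub>R radial z \<longrightarrow> (\<forall>j<d. c j = 0)) \<and>
     S = {z\<in>U. \<forall>j<d. \<xi> j z = 0}"

text \<open>\<open>p = \<Sum> A\<^sub>j\<^sub>k \<xi>\<^sub>j \<xi>\<^sub>k\<close> modulo terms vanishing of third order at \<open>S\<close>: only the values of the
  coefficients on \<open>S\<close> are used.\<close>

definition quadratic_coeffs ::
  "'n::finite phase set \<Rightarrow> ('n phase \<Rightarrow> real) \<Rightarrow> nat \<Rightarrow> (nat \<Rightarrow> 'n phase \<Rightarrow> real)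
     \<Rightarrow> (nat \<Rightarrow> nat \<Rightarrow> 'n phase \<Rightarrow> real) \<Rightarrow> bool" where
  "quadratic_coeffs S p d \<xi> A \<longleftrightarrow>
     (\<forall>w\<in>S. (\<forall>j<d. \<forall>k<d. A j k w = A k j w) \<and>
        (\<forall>v v'. hess p w v v' = 2 * (\<Sum>j<d. \<Sum>k<d. A j k w *
            frechet_derivative (\<xi> j) (at w) v * frechet_derivative (\<xi> k) (at w) v')))"

text \<open>The limits on \<open>S\<close> of positive multiples of the Hamilton field of \<open>p + g\<close> (with \<open>p\<close> real of order
  \<open>m\<close> and \<open>g\<close> of order \<open>m - 1\<close>) at points where \<open>\<xi>\<close> has the direction \<open>\<theta>\<close> and is small compared with
  the frequency. The Hamilton field of \<open>p\<close> contributes \<open>2 \<Sum> A\<^sub>j\<^sub>k \<xi>\<^sub>j \<partial>/\<partial>x\<^sub>k\<close> and that of \<open>g\<close>, which is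
  one order lower, its value on \<open>S\<close>; either can dominate or both balance, which
  gives the three kinds of fields. In coordinates with \<open>m = 2\<close> and \<open>g = \<tau>\<close> modulo terms vanishing on
  \<open>S\<close>, the last one is \<open>\<partial>/\<partial>t\<close> modulo fields tangent to the leaves.
  The fields are obtained for every \<open>m\<close>; multiplying \<open>p + g\<close> by an elliptic factor to reach
  \<open>m = 2\<close> would alter the field of \<open>g\<close> where \<open>g\<close> is not 0.\<close>

definition leaf_field ::
  "nat \<Rightarrow> (nat \<Rightarrow> 'n::finite phase \<Rightarrow> real) \<Rightarrow> (nat \<Rightarrow> nat \<Rightarrow> 'n phase \<Rightarrow> real)
     \<Rightarrow> (nat \<Rightarrow> real) \<Rightarrow> 'n phase \<Rightarrow> 'n phase" where
  "leaf_field d \<xi> A \<theta> w = 2 *\<^sub>R (\<Sum>j<d. \<Sum>k<d. (A j k w * \<theta> j) *\<^sub>R ham (\<xi> k) w)"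

definition limit_fields ::
  "nat \<Rightarrow> (nat \<Rightarrow> 'n::finite phase \<Rightarrow> real) \<Rightarrow> (nat \<Rightarrow> nat \<Rightarrow> 'n phase \<Rightarrow> real)
     \<Rightarrow> ('n phase \<Rightarrow> real) \<Rightarrow> ('n phase \<Rightarrow> 'n phase) set" where
  "limit_fields d \<xi> A g =
     {leaf_field d \<xi> A \<theta> | \<theta>. (\<Sum>j<d. (\<theta> j)\<^sup>2) = 1} \<union>
     {(\<lambda>w. ham g w + \<rho> *\<^sub>R leaf_field d \<xi> A \<theta> w) | \<rho> \<theta>. 0 \<le> \<rho> \<and> (\<Sum>j<d. (\<theta> j)\<^sup>2) = 1} \<union>
     {ham g}"

definition orbit ::
  "'a::real_normed_vector set \<Rightarrow> ('a \<Rightarrow> 'a) \<Rightarrow> (real \<Rightarrow> 'a) \<Rightarrow> real \<Rightarrow> real \<Rightarrow> bool" where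
  "orbit S V \<gamma> a b \<longleftrightarrow>
     (\<forall>s\<in>{a..b}. \<gamma> s \<in> S \<and> (\<gamma> has_vector_derivative V (\<gamma> s)) (at s within {a..b}))"

text \<open>For the refined principal symbol \<open>p + q\<close>: its imaginary part does not change sign from
  \<open>-\<close> to \<open>+\<close> on the limit bicharacteristics of its real part.\<close>

definition limit_bichar_cond ::
  "'n::finite phase set \<Rightarrow> ('n phase \<Rightarrow> complex) \<Rightarrow> ('n phase \<Rightarrow> complex) \<Rightarrow> bool" where
  "limit_bichar_cond U p q \<longleftrightarrow>
     (\<exists>d \<xi> A. sympl_frame U (Sigma2 U p) d \<xi> \<and>
        quadratic_coeffs (Sigma2 U p) (\<lambda>z. Re (p z)) d \<xi> A \<and>
        (\<forall>V\<in>limit_fields d \<xi> A (\<lambda>z. Re (q z)). \<forall>\<gamma> a b. orbit (Sigma2 U p) V \<gamma> a b \<longrightarrow>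
           \<not> (\<exists>s s'. a \<le> s \<and> s < s' \<and> s' \<le> b \<and>
                 Im (p (\<gamma> s) + q (\<gamma> s)) < 0 \<and> 0 < Im (p (\<gamma> s') + q (\<gamma> s')))))"

definition sub_r_multiplier ::
  "'n::finite phase set \<Rightarrow> ('n phase \<Rightarrow> complex) \<Rightarrow> ('n phase \<Rightarrow> complex) \<Rightarrow> ('n phase \<Rightarrow> complex) \<Rightarrow> bool" where
  "sub_r_multiplier U p q a \<longleftrightarrow>
     smooth_on U a \<and> homogeneous 0 U a \<and> (\<forall>z\<in>U. a z \<noteq> 0) \<and>
     real_double_char U (\<lambda>z. a z * p z) \<and>
     real_subprincipal_type U (\<lambda>z. a z * p z) (\<lambda>z. a z * q z)"

definition Sub_r_Psi_with ::
  "'n::finite phase set \<Rightarrow> ('n phase \<Rightarrow> complex) \<Rightarrow> ('n phase \<Rightarrow> complex) \<Rightarrow> ('n phase \<Rightarrow> complex) \<Rightarrow> bool" where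
  "Sub_r_Psi_with U p q a \<longleftrightarrow>
     sub_r_multiplier U p q a \<and> limit_bichar_cond U (\<lambda>z. a z * p z) (\<lambda>z. a z * q z)"

text \<open>The multiplier is part of the condition. It need not preserve the bicharacteristics of
  \<open>Re q\<close> on levels other than \<open>Re q = 0\<close>: there the Hamilton field of \<open>a Re q\<close> has the additional
  term \<open>Re q H\<^sub>a\<close>. So the multiplier is kept as a parameter, besides being quantified.\<close>

definition Sub_r_Psi ::
  "'n::finite phase set \<Rightarrow> ('n phase \<Rightarrow> complex) \<Rightarrow> ('n phase \<Rightarrow> complex) \<Rightarrow> bool" where
  "Sub_r_Psi U p q \<longleftrightarrow> (\<exists>a. Sub_r_Psi_with U p q a)"

definition leaf_conditions ::
  "'n::finite phase set \<Rightarrow> ('n phase \<Rightarrow> complex) \<Rightarrow> ('n phase \<Rightarrow> complex) \<Rightarrow> bool" where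
  "leaf_conditions U p q \<longleftrightarrow>
     no_sign_change_on_leaves U p q \<and> (\<forall>c. no_leaf_sign_change_at U p q c)"

text \<open>The conditions on \<open>U\<close> to which this is applied are inherited by smaller conic open sets, so
  that a single \<open>U\<close> amounts to all sufficiently small ones.\<close>

definition microlocally ::
  "'n::finite phase set \<Rightarrow> 'n phase \<Rightarrow> ('n phase set \<Rightarrow> bool) \<Rightarrow> bool" where
  "microlocally \<Omega> w \<Phi> \<longleftrightarrow> (\<exists>U\<subseteq>\<Omega>. conic_open U \<and> w \<in> U \<and> \<Phi> U)"

end

theory Submission
  imports Defs
begin

text \<open>Write \<open>q = p\<^sub>s\<close>. Every limit field is tangent to the leaves or is \<open>H\<^bsub>Re q\<^esub>\<close> plus such a field, so its orbits lie in
  leaves or are subprincipal bicharacteristics, and the leaf conditions imply the condition on the limit bicharacteristics.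

  For the converse, straighten \<open>\<Sigma>\<^sub>2\<close> by commuting homogeneous functions \<open>\<zeta>\<close>, which need not be the frame that appears in
  the limit fields, and replace \<open>Re q\<close> by a function \<open>gt\<close> that agrees with it on \<open>\<Sigma>\<^sub>2\<close> and commutes with \<open>\<zeta>\<close>. The Hamilton
  fields of \<open>gt\<close> and \<open>\<zeta>\<close> generate a local action \<open>\<Gamma>\<close> of the pairs \<open>(T, X)\<close>, in which \<open>X\<close> moves along the leaves and \<open>T\<close>
  is the time along the subprincipal bicharacteristics. If a bicharacteristic of duration \<open>T\<close> joins two leaves, then any
  points \<open>z\<close>, \<open>z'\<close> of these leaves satisfy \<open>z' = \<Gamma> z (T, X)\<close> for some \<open>X\<close>. They are then also joined by the flow of
  \<open>T H\<^bsub>Re q\<^esub>\<close> plus a leaf field with constant \<open>\<theta>\<close>: finding \<open>\<theta>\<close> is a boundary value problem, solved by a contraction for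
  points close to each other, because the Hessian is nondegenerate. After division by \<open>T\<close> or by the norm of \<open>\<theta>\<close> this is a
  limit bicharacteristic. That \<open>T\<close> is small for curves staying in a small cone follows since \<open>H\<^bsub>Re q\<^esub>\<close> is not radial.

  A multiplier \<open>a\<close> is real on \<open>\<Sigma>\<^sub>2\<close>, and where \<open>Re q = 0\<close> it only changes the time on the bicharacteristics, reversing
  it, as well as the signs on the leaves, if \<open>a < 0\<close>.\<close>

text \<open>A limit bicharacteristic moves along the leaves with a constant \<open>\<theta>\<close>,
  measured in a frame that is merely given, whereas a leaf path or a lifted bicharacteristic is any
  differentiable curve. So no curve is deformed: only end points are kept, encoded by the elapsed
  time and the increment of functions \<open>x\<close> conjugate to \<open>\<zeta>\<close>. Being
  homogeneous of degree 0, \<open>x\<close> survives the dilations that bring points of a cone back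
  to a ball around \<open>w0\<close>. Off \<open>Sigma2\<close> the function \<open>Re q\<close>
  need not commute with \<open>\<zeta>\<close>, hence \<open>gt\<close>. Only commuting fields yield
  an additive action, and additivity merges a leaf path, a bicharacteristic and another leaf path
  into one pair \<open>(T, X)\<close>. The chart is made by translations in the fibres, so
  \<open>Sigma2\<close> has to be transversal to them. This is achieved by the Hamilton flow of the
  norm of the covariable at a generic time, which exists because the annihilator of the tangent
  space is isotropic and not radial. Bicharacteristics of long duration have to be excluded: a
  function of degree 0 grows along them at a definite rate, but oscillates little in a thin
  cone.\<close>

section \<open>Calculus of smooth functions\<close>

lemma frechet_derivative_eqI: "(f has_derivative f') (at z) \<Longrightarrow> frechet_derivative f (at z) = f'"
  by (rule frechet_derivative_at[symmetric])

lemma frechet_derivative_cong_open: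
  assumes "open S" "z \<in> S" "\<And>x. x \<in> S \<Longrightarrow> f x = g x"
  shows "frechet_derivative f (at z) = frechet_derivative g (at z)"
    and "f differentiable (at z) \<longleftrightarrow> g differentiable (at z)"
proof -
  have 1: "(f has_derivative D) (at z) \<longleftrightarrow> (g has_derivative D) (at z)" for D
  proof
    show "(g has_derivative D) (at z)" if "(f has_derivative D) (at z)"
      by (rule has_derivative_transform_within_open[OF that assms(1,2)]) (rule assms(3))
    show "(f has_derivative D) (at z)" if "(g has_derivative D) (at z)"
      by (rule has_derivative_transform_within_open[OF that assms(1,2)]) (rule assms(3)[symmetric])
  qed
  show "frechet_derivative f (at z) = frechet_derivative g (at z)"
    unfolding frechet_derivative_def 1 ..
  show "f differentiable (at z) \<longleftrightarrow> g differentiable (at z)"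
    unfolding differentiable_def 1 ..
qed

text \<open>Differentiability counted by order. The derivative of a product, a composition or an
  inverse involves the functions themselves, so smoothness is proved by induction on
  \<open>k\<close>, which the quantification over lists of directions in \<open>smooth_on\<close>
  does not offer directly.\<close>

fun times_diff :: "nat \<Rightarrow> 'a::real_normed_vector set \<Rightarrow> ('a \<Rightarrow> 'b::real_normed_vector) \<Rightarrow> bool" where
  "times_diff 0 S f = True"
| "times_diff (Suc k) S f \<longleftrightarrow>
     (\<forall>z\<in>S. f differentiable (at z)) \<and> (\<forall>v. times_diff k S (\<lambda>z. frechet_derivative f (at z) v))"

lemma times_diff_iff:
  "times_diff k S f \<longleftrightarrow> (\<forall>vs. length vs < k \<longrightarrow> (\<forall>z\<in>S. dir_derivs vs f differentiable (at z)))"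
proof (induction k arbitrary: f)
  case 0 then show ?case by simp
next
  case (Suc k)
  show ?case
    unfolding times_diff.simps Suc.IH
  proof (intro iffI conjI allI impI)
    fix vs :: "'a list"
    assume "(\<forall>z\<in>S. f differentiable at z) \<and> (\<forall>v vs. length vs < k \<longrightarrow>
      (\<forall>z\<in>S. dir_derivs vs (\<lambda>z. frechet_derivative f (at z) v) differentiable at z))"
      "length vs < Suc k"
    then show "\<forall>z\<in>S. dir_derivs vs f differentiable at z"
      by (cases vs) auto
  next
    assume a: "\<forall>vs. length vs < Suc k \<longrightarrow> (\<forall>z\<in>S. dir_derivs vs f differentiable at z)"
    show "\<forall>z\<in>S. f differentiable at z" using a[rule_format, of "[]"] by simp
    show "\<forall>z\<in>S. dir_derivs vs (\<lambda>z. frechet_derivative f (at z) v) differentiable at z"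
      if "length vs < k" for v vs
      using a[rule_format, of "v # vs"] that by simp
  qed
qed

lemma smooth_on_iff: "smooth_on S f \<longleftrightarrow> (\<forall>k. times_diff k S f)"
  unfolding times_diff_iff smooth_on_def by auto

lemma times_diff_Suc_imp: "times_diff (Suc k) S f \<Longrightarrow> times_diff k S f"
  unfolding times_diff_iff using less_SucI by blast

lemma times_diff_cong:
  assumes "open S" "times_diff k S f" "\<And>x. x \<in> S \<Longrightarrow> f x = g x"
  shows "times_diff k S g"
  using assms(2,3)
proof (induction k arbitrary: f g)
  case (Suc k)
  have "times_diff k S (\<lambda>z. frechet_derivative g (at z) v)" for v
  proof (rule Suc.IH[of "\<lambda>z. frechet_derivative f (at z) v"])
    show "times_diff k S (\<lambda>z. frechet_derivative f (at z) v)" using Suc.prems(1) by simp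
    show "frechet_derivative f (at x) v = frechet_derivative g (at x) v" if "x \<in> S" for x
      using frechet_derivative_cong_open(1)[OF assms(1) that Suc.prems(2)] by simp
  qed
  moreover have "\<forall>z\<in>S. g differentiable at z"
  proof
    fix z assume z: "z \<in> S"
    then have "f differentiable at z" using Suc.prems(1) by simp
    then show "g differentiable at z" using frechet_derivative_cong_open(2)[OF assms(1) z, of f g] Suc.prems(2) by blast
  qed
  ultimately show ?case by simp
qed simp

text \<open>Admits any formula for the derivative that is valid on \<open>S\<close>. Since
  \<open>S\<close> is open, the formula coincides with \<open>frechet_derivative\<close> near each
  point, so the further derivatives agree as well.\<close>

lemma times_diff_SucI:
  assumes "open S" "\<And>z. z \<in> S \<Longrightarrow> (f has_derivative f' z) (at z)" "\<And>v. times_diff k S (\<lambda>z. f' z v)"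
  shows "times_diff (Suc k) S f"
proof -
  have "times_diff k S (\<lambda>z. frechet_derivative f (at z) v)" for v
    by (rule times_diff_cong[OF assms(1) assms(3)[of v]]) (simp add: frechet_derivative_eqI[OF assms(2)])
  then show ?thesis using assms(2) by (auto simp: differentiable_def)
qed

lemma times_diff_has_derivative:
  "times_diff (Suc k) S f \<Longrightarrow> z \<in> S \<Longrightarrow> (f has_derivative frechet_derivative f (at z)) (at z)"
  using frechet_derivative_works by (metis times_diff.simps(2))

lemma times_diff_const: "open S \<Longrightarrow> times_diff k S (\<lambda>z. c)"
proof (induction k arbitrary: c)
  case (Suc k)
  have "(\<lambda>z. frechet_derivative (\<lambda>z. c) (at z) v) = (\<lambda>z::'a. 0)" for v
    by (rule ext) simp
  then show ?case using Suc by simp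
qed simp

lemma times_diff_add:
  assumes "open S" "times_diff k S f" "times_diff k S g"
  shows "times_diff k S (\<lambda>z. f z + g z)"
  using assms(2,3)
proof (induction k arbitrary: f g)
  case (Suc k)
  show ?case
  proof (rule times_diff_SucI[OF assms(1)])
    show "((\<lambda>z. f z + g z) has_derivative (\<lambda>v. frechet_derivative f (at z) v + frechet_derivative g (at z) v)) (at z)"
      if "z \<in> S" for z
      by (intro has_derivative_add times_diff_has_derivative[OF Suc.prems(1) that] times_diff_has_derivative[OF Suc.prems(2) that])
    show "times_diff k S (\<lambda>z. frechet_derivative f (at z) v + frechet_derivative g (at z) v)" for v
      using Suc.prems by (intro Suc.IH) auto
  qed
qed simp

lemma times_diff_bounded_linear:
  assumes "bounded_linear L" "open S" "times_diff k S f"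
  shows "times_diff k S (\<lambda>z. L (f z))"
  using assms(3)
proof (induction k arbitrary: f)
  case (Suc k)
  show ?case
  proof (rule times_diff_SucI[OF assms(2)])
    show "((\<lambda>z. L (f z)) has_derivative (\<lambda>v. L (frechet_derivative f (at z) v))) (at z)"
      if "z \<in> S" for z
      by (intro bounded_linear.has_derivative[OF assms(1)] times_diff_has_derivative[OF Suc.prems(1) that])
    show "times_diff k S (\<lambda>z. L (frechet_derivative f (at z) v))" for v
      using Suc.prems by (intro Suc.IH) auto
  qed
qed simp

lemma times_diff_linear:
  assumes "bounded_linear L" "open S"
  shows "times_diff k S L"
proof (cases k)
  case (Suc m)
  have "times_diff (Suc m) S L"
  proof (rule times_diff_SucI[OF assms(2)])
    show "(L has_derivative L) (at z)" for z by (rule bounded_linear_imp_has_derivative[OF assms(1)])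
    show "times_diff m S (\<lambda>z. L v)" for v by (rule times_diff_const[OF assms(2)])
  qed
  then show ?thesis by (simp add: Suc)
qed simp

lemma times_diff_bilinear:
  assumes "bounded_bilinear B" "open S" "times_diff k S f" "times_diff k S g"
  shows "times_diff k S (\<lambda>z. B (f z) (g z))"
  using assms(3,4)
proof (induction k arbitrary: f g)
  case (Suc k)
  show ?case
  proof (rule times_diff_SucI[OF assms(2)])
    show "((\<lambda>z. B (f z) (g z)) has_derivative
        (\<lambda>v. B (f z) (frechet_derivative g (at z) v) + B (frechet_derivative f (at z) v) (g z))) (at z)"
      if "z \<in> S" for z
      by (intro bounded_bilinear.FDERIV[OF assms(1)] times_diff_has_derivative[OF Suc.prems(1) that]
         times_diff_has_derivative[OF Suc.prems(2) that])
    show "times_diff k S (\<lambda>z. B (f z) (frechet_derivative g (at z) v) + B (frechet_derivative f (at z) v) (g z))" for v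
      using Suc.prems times_diff_Suc_imp[OF Suc.prems(1)] times_diff_Suc_imp[OF Suc.prems(2)]
      by (intro times_diff_add[OF assms(2)] Suc.IH) auto
  qed
qed simp

lemma times_diff_sum:
  assumes "open S" "finite I" "\<And>i. i \<in> I \<Longrightarrow> times_diff k S (f i)"
  shows "times_diff k S (\<lambda>z. \<Sum>i\<in>I. f i z)"
  using assms(2,3) by (induction I rule: finite_induct) (auto intro!: times_diff_const times_diff_add assms(1))

lemma linear_Basis_sum:
  fixes L :: "'a::euclidean_space \<Rightarrow> 'b::real_vector"
  assumes "linear L"
  shows "L v = (\<Sum>b\<in>Basis. (v \<bullet> b) *\<^sub>R L b)"
proof -
  have "L v = L (\<Sum>b\<in>Basis. (v \<bullet> b) *\<^sub>R b)" by (simp add: euclidean_representation)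
  also have "\<dots> = (\<Sum>b\<in>Basis. (v \<bullet> b) *\<^sub>R L b)" by (simp add: linear_sum[OF assms] linear_cmul[OF assms])
  finally show ?thesis .
qed

text \<open>The chain rule evaluates the derivative of \<open>g\<close> in a direction that varies
  with the point, while \<open>times_diff\<close> controls fixed directions. Expansion in
  \<open>Basis\<close> reduces the one to the other; hence the Euclidean type of the intermediate
  space.\<close>

lemma times_diff_compose:
  fixes g :: "'b::euclidean_space \<Rightarrow> 'c::real_normed_vector" and f :: "'a::real_normed_vector \<Rightarrow> 'b"
  assumes "open S" "open T" "\<And>z. z \<in> S \<Longrightarrow> f z \<in> T" "times_diff k S f" "times_diff k T g"
  shows "times_diff k S (\<lambda>z. g (f z))"
  using assms(4,5)
proof (induction k arbitrary: g)
  case (Suc k)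
  have *: "((\<lambda>z. g (f z)) has_derivative
     (\<lambda>v. \<Sum>b\<in>Basis. (frechet_derivative f (at z) v \<bullet> b) *\<^sub>R frechet_derivative g (at (f z)) b)) (at z)"
    if "z \<in> S" for z
  proof -
    have d: "(g has_derivative frechet_derivative g (at (f z))) (at (f z))"
      using Suc.prems(2) assms(3)[OF that] by (rule times_diff_has_derivative)
    have "((\<lambda>z. g (f z)) has_derivative (\<lambda>v. frechet_derivative g (at (f z)) (frechet_derivative f (at z) v))) (at z)"
      using has_derivative_compose[OF times_diff_has_derivative[OF Suc.prems(1) that] d] .
    also have "(\<lambda>v. frechet_derivative g (at (f z)) (frechet_derivative f (at z) v)) =
       (\<lambda>v. \<Sum>b\<in>Basis. (frechet_derivative f (at z) v \<bullet> b) *\<^sub>R frechet_derivative g (at (f z)) b)"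
      by (subst linear_Basis_sum[OF has_derivative_linear[OF d]]) simp
    finally show ?thesis .
  qed
  show ?case
  proof (rule times_diff_SucI[OF assms(1)])
    show "((\<lambda>z. g (f z)) has_derivative
     (\<lambda>v. \<Sum>b\<in>Basis. (frechet_derivative f (at z) v \<bullet> b) *\<^sub>R frechet_derivative g (at (f z)) b)) (at z)"
    if "z \<in> S" for z by (rule *[OF that])
  next
    fix v
    have "times_diff k S (\<lambda>z. (frechet_derivative f (at z) v \<bullet> b))" for b
      using Suc.prems(1) by (intro times_diff_bounded_linear[OF bounded_linear_inner_left assms(1)]) auto
    moreover have "times_diff k S (\<lambda>z. frechet_derivative g (at (f z)) b)" for b
      using Suc.prems by (intro Suc.IH times_diff_Suc_imp[OF Suc.prems(1)]) auto
    ultimately show "times_diff k S (\<lambda>z. \<Sum>b\<in>Basis. (frechet_derivative f (at z) v \<bullet> b) *\<^sub>R frechet_derivative g (at (f z)) b)"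
      by (intro times_diff_sum times_diff_bilinear[OF bounded_bilinear_scaleR]) (use assms(1) in auto)
  qed
qed simp

lemma times_diff_inverse:
  assumes "open S" "times_diff k S f" "\<And>z. z \<in> S \<Longrightarrow> f z \<noteq> 0"
  shows "times_diff k S (\<lambda>z. inverse (f z :: real))"
  using assms(2)
proof (induction k)
  case (Suc k)
  have i: "times_diff k S (\<lambda>z. inverse (f z))" using Suc times_diff_Suc_imp by blast
  show ?case
  proof (rule times_diff_SucI[OF assms(1)])
    show "((\<lambda>z. inverse (f z)) has_derivative (\<lambda>v. - (inverse (f z) * frechet_derivative f (at z) v * inverse (f z)))) (at z)"
      if "z \<in> S" for z
      by (rule Deriv.has_derivative_inverse[OF assms(3)[OF that] times_diff_has_derivative[OF Suc.prems that]])
    show "times_diff k S (\<lambda>z. - (inverse (f z) * frechet_derivative f (at z) v * inverse (f z)))" for v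
      using Suc.prems i
      by (intro times_diff_bounded_linear[OF bounded_linear_minus[OF bounded_linear_ident] assms(1)]
         times_diff_bilinear[OF bounded_bilinear_mult assms(1)]) auto
  qed
qed simp

text \<open>The derivative contains the inverse of the norm itself, which is as regular as the norm
  was already shown to be in the induction.\<close>

lemma times_diff_norm:
  assumes "open S" "times_diff k S f" "\<And>z. z \<in> S \<Longrightarrow> f z \<noteq> 0"
  shows "times_diff k S (\<lambda>z. norm (f z :: 'b::real_inner))"
  using assms(2)
proof (induction k)
  case (Suc k)
  have i: "times_diff k S (\<lambda>z. norm (f z))" using Suc times_diff_Suc_imp by blast
  have j: "times_diff k S (\<lambda>z. inverse (norm (f z)))"
    by (rule times_diff_inverse[OF assms(1) i]) (use assms(3) in auto)
  have d: "((\<lambda>z. norm (f z)) has_derivative (\<lambda>v. inverse (norm (f z)) * (frechet_derivative f (at z) v \<bullet> f z))) (at z)"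
    if "z \<in> S" for z
  proof -
    have "((\<lambda>z. norm (f z)) has_derivative (\<lambda>v. frechet_derivative f (at z) v \<bullet> sgn (f z))) (at z)"
      using has_derivative_compose[OF times_diff_has_derivative[OF Suc.prems that] has_derivative_norm[OF assms(3)[OF that]]] .
    then show ?thesis by (simp add: sgn_div_norm divide_inverse inner_commute mult.commute)
  qed
  show ?case
  proof (rule times_diff_SucI[OF assms(1)])
    show "((\<lambda>z. norm (f z)) has_derivative (\<lambda>v. inverse (norm (f z)) * (frechet_derivative f (at z) v \<bullet> f z))) (at z)"
      if "z \<in> S" for z by (rule d[OF that])
    show "times_diff k S (\<lambda>z. inverse (norm (f z)) * (frechet_derivative f (at z) v \<bullet> f z))" for v
      using Suc.prems j times_diff_Suc_imp[OF Suc.prems]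
      by (intro times_diff_bilinear[OF bounded_bilinear_mult assms(1)]
            times_diff_bilinear[OF bounded_bilinear_inner assms(1)]) auto
  qed
qed simp

lemma smooth_on_cong: "open S \<Longrightarrow> smooth_on S f \<Longrightarrow> (\<And>x. x \<in> S \<Longrightarrow> f x = g x) \<Longrightarrow> smooth_on S g"
  unfolding smooth_on_iff using times_diff_cong by blast

lemma smooth_on_subset: "smooth_on S f \<Longrightarrow> T \<subseteq> S \<Longrightarrow> smooth_on T f"
  unfolding smooth_on_def by blast

lemma smooth_on_const: "open S \<Longrightarrow> smooth_on S (\<lambda>z. c)"
  unfolding smooth_on_iff using times_diff_const by blast

lemma smooth_on_linear: "bounded_linear L \<Longrightarrow> open S \<Longrightarrow> smooth_on S L"
  unfolding smooth_on_iff using times_diff_linear by blast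

lemma smooth_on_add: "open S \<Longrightarrow> smooth_on S f \<Longrightarrow> smooth_on S g \<Longrightarrow> smooth_on S (\<lambda>z. f z + g z)"
  unfolding smooth_on_iff using times_diff_add by blast

lemma smooth_on_bounded_linear:
  "bounded_linear L \<Longrightarrow> open S \<Longrightarrow> smooth_on S f \<Longrightarrow> smooth_on S (\<lambda>z. L (f z))"
  unfolding smooth_on_iff using times_diff_bounded_linear by blast

lemma smooth_on_bilinear:
  "bounded_bilinear B \<Longrightarrow> open S \<Longrightarrow> smooth_on S f \<Longrightarrow> smooth_on S g \<Longrightarrow> smooth_on S (\<lambda>z. B (f z) (g z))"
  unfolding smooth_on_iff using times_diff_bilinear by blast

lemmas smooth_on_scaleR = smooth_on_bilinear[OF bounded_bilinear_scaleR]
lemmas smooth_on_mult = smooth_on_bilinear[OF bounded_bilinear_mult]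
lemma smooth_on_minus: "open S \<Longrightarrow> smooth_on S f \<Longrightarrow> smooth_on S (\<lambda>z. - f z)"
  by (rule smooth_on_bounded_linear[OF bounded_linear_minus[OF bounded_linear_ident]])

lemma smooth_on_diff: "open S \<Longrightarrow> smooth_on S f \<Longrightarrow> smooth_on S g \<Longrightarrow> smooth_on S (\<lambda>z. f z - g z)"
  using smooth_on_add[of S f "\<lambda>z. - g z"] smooth_on_minus[of S g] by simp

lemma smooth_on_sum:
  "open S \<Longrightarrow> finite I \<Longrightarrow> (\<And>i. i \<in> I \<Longrightarrow> smooth_on S (f i)) \<Longrightarrow> smooth_on S (\<lambda>z. \<Sum>i\<in>I. f i z)"
  unfolding smooth_on_iff using times_diff_sum by blast

lemma smooth_on_compose:
  fixes g :: "'b::euclidean_space \<Rightarrow> 'c::real_normed_vector"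
  assumes "open S" "open T" "\<And>z. z \<in> S \<Longrightarrow> f z \<in> T" "smooth_on S f" "smooth_on T g"
  shows "smooth_on S (\<lambda>z. g (f z))"
  using assms unfolding smooth_on_iff using times_diff_compose by blast

lemma smooth_on_inverse:
  "open S \<Longrightarrow> smooth_on S f \<Longrightarrow> (\<And>z. z \<in> S \<Longrightarrow> f z \<noteq> 0) \<Longrightarrow> smooth_on S (\<lambda>z. inverse (f z :: real))"
  unfolding smooth_on_iff using times_diff_inverse by blast

lemma smooth_on_norm:
  "open S \<Longrightarrow> smooth_on S f \<Longrightarrow> (\<And>z. z \<in> S \<Longrightarrow> f z \<noteq> 0) \<Longrightarrow> smooth_on S (\<lambda>z. norm (f z :: 'b::real_inner))"
  unfolding smooth_on_iff using times_diff_norm by blast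

lemma smooth_on_has_derivative:
  "smooth_on S f \<Longrightarrow> z \<in> S \<Longrightarrow> (f has_derivative frechet_derivative f (at z)) (at z)"
  unfolding smooth_on_iff using times_diff_has_derivative by blast

lemma smooth_on_deriv: "smooth_on S f \<Longrightarrow> smooth_on S (\<lambda>z. frechet_derivative f (at z) v)"
  unfolding smooth_on_iff by (metis times_diff.simps(2))

lemma smooth_on_imp_isCont: "smooth_on S f \<Longrightarrow> z \<in> S \<Longrightarrow> isCont f z"
  using smooth_on_has_derivative has_derivative_continuous by blast

lemma smooth_on_imp_continuous_on: "smooth_on S f \<Longrightarrow> continuous_on S f"
  by (meson continuous_at_imp_continuous_on smooth_on_imp_isCont)

lemma smooth_on_deriv_linear: "smooth_on S f \<Longrightarrow> z \<in> S \<Longrightarrow> linear (frechet_derivative f (at z))"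
  using smooth_on_has_derivative has_derivative_linear by blast

lemma smooth_on_Pair:
  assumes "open S" "smooth_on S f" "smooth_on S g" shows "smooth_on S (\<lambda>z. (f z, g z))"
proof -
  have "smooth_on S (\<lambda>z. (f z, 0) + (0, g z))"
    by (intro smooth_on_add assms smooth_on_bounded_linear[of "\<lambda>x. (x, 0)"] smooth_on_bounded_linear[of "\<lambda>x. (0, x)"]
       bounded_linear_Pair bounded_linear_ident bounded_linear_zero)
  then show ?thesis by simp
qed

section \<open>Symmetry of second derivatives\<close>

text \<open>The mean value theorem is applied twice: in direction \<open>u\<close> to the increment
  of \<open>f\<close> in direction \<open>v\<close>, and then in direction \<open>v\<close> to the
  derivative along \<open>u\<close>.\<close>

lemma second_derivative_mean_value:
  fixes f :: "'a::real_normed_vector \<Rightarrow> real"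
  assumes "open S" "smooth_on S f" "0 < h" and sub: "\<And>s t. s \<in> {0..h} \<Longrightarrow> t \<in> {0..h} \<Longrightarrow> z + s *\<^sub>R u + t *\<^sub>R v \<in> S"
  obtains s t where "s \<in> {0..h}" "t \<in> {0..h}"
    "f (z + h *\<^sub>R u + h *\<^sub>R v) - f (z + h *\<^sub>R u) - f (z + h *\<^sub>R v) + f z
      = h * h * dir_derivs [u, v] f (z + s *\<^sub>R u + t *\<^sub>R v)"
proof -
  define \<phi> where "\<phi> s = f (z + s *\<^sub>R u + h *\<^sub>R v) - f (z + s *\<^sub>R u + 0 *\<^sub>R v)" for s
  let ?fu = "\<lambda>z. frechet_derivative f (at z) u"
  have fd: "((\<lambda>s. f (z + s *\<^sub>R u + t *\<^sub>R v)) has_real_derivative ?fu (z + s *\<^sub>R u + t *\<^sub>R v)) (at s)"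
    if "s \<in> {0..h}" "t \<in> {0..h}" for s t
  proof -
    have "((\<lambda>s. z + s *\<^sub>R u + t *\<^sub>R v) has_derivative (\<lambda>x. x *\<^sub>R u)) (at s)"
      by (auto intro!: derivative_eq_intros)
    from has_derivative_compose[OF this smooth_on_has_derivative[OF assms(2) sub[OF that]]]
    have "((\<lambda>s. f (z + s *\<^sub>R u + t *\<^sub>R v)) has_derivative (\<lambda>x. frechet_derivative f (at (z + s *\<^sub>R u + t *\<^sub>R v)) (x *\<^sub>R u))) (at s)" .
    then show ?thesis
      unfolding has_field_derivative_def
      by (simp add: linear_cmul[OF smooth_on_deriv_linear[OF assms(2) sub[OF that]]] mult.commute[of _ "frechet_derivative _ _ _"])
  qed
  have "\<exists>s. 0 < s \<and> s < h \<and> \<phi> h - \<phi> 0 = (h - 0) * (?fu (z + s *\<^sub>R u + h *\<^sub>R v) - ?fu (z + s *\<^sub>R u + 0 *\<^sub>R v))"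
    unfolding \<phi>_def by (rule MVT2) (use assms(3) in \<open>auto intro!: DERIV_diff fd simp del: scaleR_zero_left\<close>)
  then obtain s where s: "0 < s" "s < h" "\<phi> h - \<phi> 0 = h * (?fu (z + s *\<^sub>R u + h *\<^sub>R v) - ?fu (z + s *\<^sub>R u + 0 *\<^sub>R v))"
    by auto
  have sm: "smooth_on S ?fu" by (rule smooth_on_deriv[OF assms(2)])
  have "((\<lambda>t. ?fu (z + s *\<^sub>R u + t *\<^sub>R v)) has_real_derivative dir_derivs [u, v] f (z + s *\<^sub>R u + t *\<^sub>R v)) (at t)"
    if "t \<in> {0..h}" for t
  proof -
    have m: "z + s *\<^sub>R u + t *\<^sub>R v \<in> S" using s that by (intro sub) auto
    have "((\<lambda>t. z + s *\<^sub>R u + t *\<^sub>R v) has_derivative (\<lambda>x. x *\<^sub>R v)) (at t)"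
      by (auto intro!: derivative_eq_intros)
    from has_derivative_compose[OF this smooth_on_has_derivative[OF sm m]]
    show ?thesis
      unfolding has_field_derivative_def
      by (simp add: linear_cmul[OF smooth_on_deriv_linear[OF sm m]] mult.commute[of _ "frechet_derivative _ _ _"])
  qed
  then have "\<exists>t. 0 < t \<and> t < h \<and> ?fu (z + s *\<^sub>R u + h *\<^sub>R v) - ?fu (z + s *\<^sub>R u + 0 *\<^sub>R v) = (h - 0) * dir_derivs [u, v] f (z + s *\<^sub>R u + t *\<^sub>R v)"
    by (intro MVT2 assms) auto
  then obtain t where t: "0 < t" "t < h" "?fu (z + s *\<^sub>R u + h *\<^sub>R v) - ?fu (z + s *\<^sub>R u + 0 *\<^sub>R v) = h * dir_derivs [u, v] f (z + s *\<^sub>R u + t *\<^sub>R v)"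
    by auto
  show ?thesis
    by (rule that[of s t]) (use s t in \<open>auto simp: \<phi>_def\<close>)
qed

text \<open>The second difference over a parallelogram is symmetric in \<open>u\<close> and
  \<open>v\<close>. Hence the two mixed derivatives take a common value at two points arbitrarily
  close to \<open>z\<close>, and both are continuous.\<close>

lemma dir_derivs_commute:
  fixes f :: "'a::real_normed_vector \<Rightarrow> real"
  assumes "open S" "smooth_on S f" "z \<in> S"
  shows "dir_derivs [u, v] f z = dir_derivs [v, u] f z"
proof (rule ccontr)
  assume ne: "dir_derivs [u, v] f z \<noteq> dir_derivs [v, u] f z"
  define e where "e = \<bar>dir_derivs [u, v] f z - dir_derivs [v, u] f z\<bar> / 2"
  have e: "e > 0" using ne by (simp add: e_def)
  have c: "isCont (dir_derivs [u, v] f) z" for u v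
  proof -
    have "smooth_on S (dir_derivs [u, v] f)" by (simp add: smooth_on_deriv assms(2))
    then show ?thesis by (rule smooth_on_imp_isCont[OF _ assms(3)])
  qed
  obtain d1 where d1: "d1 > 0" "\<And>y. dist y z < d1 \<Longrightarrow> dist (dir_derivs [u, v] f y) (dir_derivs [u, v] f z) < e"
    using c[of u v] e unfolding continuous_at_eps_delta by metis
  obtain d2 where d2: "d2 > 0" "\<And>y. dist y z < d2 \<Longrightarrow> dist (dir_derivs [v, u] f y) (dir_derivs [v, u] f z) < e"
    using c[of v u] e unfolding continuous_at_eps_delta by metis
  obtain d3 where d3: "d3 > 0" "ball z d3 \<subseteq> S" using assms by (meson open_contains_ball)
  define d where "d = min d1 (min d2 d3)"
  \<comment> \<open>Small enough for the whole parallelogram to stay within \<open>d\<close> of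
    \<open>z\<close>; the summand 1 keeps the denominator positive.\<close>
  define h where "h = d / (2 * (norm u + norm v + 1))"
  have d: "d > 0" using d1 d2 d3 by (simp add: d_def)
  have h: "h > 0" using d by (simp add: h_def add_nonneg_pos)
  have near: "dist (z + s *\<^sub>R u + t *\<^sub>R v) z < d" if "s \<in> {0..h}" "t \<in> {0..h}" for s t
  proof -
    have "dist (z + s *\<^sub>R u + t *\<^sub>R v) z = norm (s *\<^sub>R u + t *\<^sub>R v)" by (simp add: dist_norm add.assoc)
    also have "\<dots> \<le> s * norm u + t * norm v" using that norm_triangle_ineq[of "s *\<^sub>R u" "t *\<^sub>R v"] by simp
    also have "\<dots> \<le> h * norm u + h * norm v" using that by (intro add_mono mult_right_mono) auto
    also have "\<dots> \<le> h * (norm u + norm v + 1)" using h by (simp add: algebra_simps)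
    also have "\<dots> = d / 2"
    proof -
      have "norm u + norm v + 1 \<noteq> 0" by (smt (verit) norm_ge_zero)
      then show ?thesis by (simp add: h_def field_simps)
    qed
    also have "\<dots> < d" using d by simp
    finally show ?thesis .
  qed
  have near': "dist (z + s *\<^sub>R v + t *\<^sub>R u) z < d" if "s \<in> {0..h}" "t \<in> {0..h}" for s t
    using near[OF that(2,1)] by (simp add: add.assoc add.commute add.left_commute)
  have S: "z + s *\<^sub>R u + t *\<^sub>R v \<in> S" if "s \<in> {0..h}" "t \<in> {0..h}" for s t
    using near[OF that] d3 by (auto simp: d_def dist_commute subset_iff)
  have S': "z + s *\<^sub>R v + t *\<^sub>R u \<in> S" if "s \<in> {0..h}" "t \<in> {0..h}" for s t
    using near'[OF that] d3 by (auto simp: d_def dist_commute subset_iff)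
  obtain s t where st: "s \<in> {0..h}" "t \<in> {0..h}"
    "f (z + h *\<^sub>R u + h *\<^sub>R v) - f (z + h *\<^sub>R u) - f (z + h *\<^sub>R v) + f z
      = h * h * dir_derivs [u, v] f (z + s *\<^sub>R u + t *\<^sub>R v)"
    by (rule second_derivative_mean_value[OF assms(1,2) h S])
  obtain s' t' where st': "s' \<in> {0..h}" "t' \<in> {0..h}"
    "f (z + h *\<^sub>R v + h *\<^sub>R u) - f (z + h *\<^sub>R v) - f (z + h *\<^sub>R u) + f z
      = h * h * dir_derivs [v, u] f (z + s' *\<^sub>R v + t' *\<^sub>R u)"
    by (rule second_derivative_mean_value[OF assms(1,2) h S'])
  have ac: "z + h *\<^sub>R v + h *\<^sub>R u = z + h *\<^sub>R u + h *\<^sub>R v" by (simp add: add.assoc add.commute add.left_commute)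
  have "h * h * dir_derivs [u, v] f (z + s *\<^sub>R u + t *\<^sub>R v) = h * h * dir_derivs [v, u] f (z + s' *\<^sub>R v + t' *\<^sub>R u)"
    using st(3) st'(3) unfolding ac by linarith
  then have eq: "dir_derivs [u, v] f (z + s *\<^sub>R u + t *\<^sub>R v) = dir_derivs [v, u] f (z + s' *\<^sub>R v + t' *\<^sub>R u)"
    using h by (metis mult_cancel_left no_zero_divisors less_irrefl)
  have "dist (dir_derivs [u, v] f (z + s *\<^sub>R u + t *\<^sub>R v)) (dir_derivs [u, v] f z) < e"
    using near[OF st(1,2)] by (intro d1(2)) (simp add: d_def)
  moreover have "dist (dir_derivs [v, u] f (z + s' *\<^sub>R v + t' *\<^sub>R u)) (dir_derivs [v, u] f z) < e"
    using near'[OF st'(1,2)] by (intro d2(2)) (simp add: d_def)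
  ultimately have "\<bar>dir_derivs [u, v] f z - dir_derivs [v, u] f z\<bar> < 2 * e"
    unfolding eq dist_real_def by arith
  then show False by (simp add: e_def)
qed

section \<open>The inverse function theorem\<close>

text \<open>The inverse function theorem asks for a derivative that is continuous in the operator
  norm. Smoothness gives continuity in each fixed direction, which is the same in finite
  dimension.\<close>

lemma inverse_function_C1:
  fixes f :: "'a::euclidean_space \<Rightarrow> 'a"
  assumes "open U" "smooth_on U f" "x0 \<in> U"
    and inj: "\<And>v. frechet_derivative f (at x0) v = 0 \<Longrightarrow> v = 0"
  obtains U' V g where "open U'" "U' \<subseteq> U" "x0 \<in> U'" "open V" "f x0 \<in> V" "homeomorphism U' V f g"
    "\<And>y. y \<in> V \<Longrightarrow> (g has_derivative inv (frechet_derivative f (at (g y)))) (at y)"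
    "\<And>y. y \<in> V \<Longrightarrow> bij (frechet_derivative f (at (g y)))"
proof -
  define f' where "f' x = Blinfun (frechet_derivative f (at x))" for x
  have bl: "blinfun_apply (f' x) = frechet_derivative f (at x)" if "x \<in> U" for x
    unfolding f'_def
    by (rule bounded_linear_Blinfun_apply[OF has_derivative_bounded_linear[OF smooth_on_has_derivative[OF assms(2) that]]])
  have c: "continuous_on U f'"
  proof (rule continuous_on_blinfun_componentwise)
    fix i :: 'a
    have "continuous_on U (\<lambda>x. frechet_derivative f (at x) i)"
      by (intro smooth_on_imp_continuous_on smooth_on_deriv assms)
    then show "continuous_on U (\<lambda>x. blinfun_apply (f' x) i)" by (rule continuous_on_eq) (simp add: bl)
  qed
  have lin: "linear (frechet_derivative f (at x0))" by (rule smooth_on_deriv_linear[OF assms(2,3)])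
  then have "inj (frechet_derivative f (at x0))" using inj by (simp add: linear_injective_0)
  then obtain k where k: "linear k" "\<And>x. k (frechet_derivative f (at x0) x) = x"
    using linear_injective_isomorphism[OF lin] by blast
  have inv: "Blinfun k o\<^sub>L f' x0 = id_blinfun"
    by (rule blinfun_eqI) (use k bl assms(3) in \<open>simp add: bounded_linear_Blinfun_apply linear_conv_bounded_linear\<close>)
  have der: "(f has_derivative blinfun_apply (f' x)) (at x)" if "x \<in> U" for x
    using smooth_on_has_derivative[OF assms(2) that] by (simp add: bl[OF that])
  obtain U' V g g' where *: "open U'" "U' \<subseteq> U" "x0 \<in> U'" "open V" "f x0 \<in> V" "homeomorphism U' V f g"
    and d: "\<And>y. y \<in> V \<Longrightarrow> (g has_derivative (g' y)) (at y)"
    and i: "\<And>y. y \<in> V \<Longrightarrow> g' y = inv (blinfun_apply (f'(g y)))"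
    and b: "\<And>y. y \<in> V \<Longrightarrow> bij (blinfun_apply (f'(g y)))"
    by (rule inverse_function_theorem[OF assms(1) der c assms(3) inv]) auto
  have gU: "g y \<in> U" if "y \<in> V" for y using *(2,6) that by (auto simp: homeomorphism_def)
  show ?thesis
    by (rule that[OF *]) (use d i b bl gU in \<open>auto\<close>)
qed

text \<open>The inverse function theorem for \<open>(z, w) \<mapsto> (z, A z w)\<close> shows that the inverse matrix is differentiable;
  its derivative is then a product of functions that are as smooth as the inverse matrix itself.\<close>

lemma smooth_on_inv_linear:
  fixes A :: "'a::euclidean_space \<Rightarrow> 'b::euclidean_space \<Rightarrow> 'b"
  assumes U: "open U" and lin: "\<And>z. z \<in> U \<Longrightarrow> linear (A z)" and inj: "\<And>z w. z \<in> U \<Longrightarrow> A z w = 0 \<Longrightarrow> w = 0"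
    and sm: "\<And>b. smooth_on U (\<lambda>z. A z b)"
  shows "smooth_on U (\<lambda>z. inv (A z) v)"
proof -
  have injA: "inj (A z)" if "z \<in> U" for z
    using linear_injective_0[OF lin[OF that]] inj[OF that] by blast
  have surjA: "surj (A z)" if "z \<in> U" for z
    by (rule linear_inj_imp_surj[OF lin[OF that] injA[OF that]])
  have Aexp: "(\<Sum>b\<in>Basis. (w \<bullet> b) *\<^sub>R A z b) = A z w" if "z \<in> U" for z w
    by (rule linear_Basis_sum[OF lin[OF that], symmetric])
  have invl: "inv (A z) (A z w) = w" if "z \<in> U" for z w using injA[OF that] by simp
  have invr: "A z (inv (A z) w) = w" if "z \<in> U" for z w using surjA[OF that] by (simp add: surj_f_inv_f)
  have lininv: "linear (inv (A z))" if "z \<in> U" for z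
  proof (rule linearI)
    show "inv (A z) (x + y) = inv (A z) x + inv (A z) y" for x y
      by (metis invl[OF that] invr[OF that] linear_add[OF lin[OF that]])
    show "inv (A z) (r *\<^sub>R x) = r *\<^sub>R inv (A z) x" for r x
      by (metis invl[OF that] invr[OF that] linear_cmul[OF lin[OF that]])
  qed
  define \<Psi> where "\<Psi> = (\<lambda>p :: 'a \<times> 'b. (fst p, A (fst p) (snd p)))"
  have oU: "open (U \<times> (UNIV::'b set))" using U by (simp add: open_Times)
  have s1: "smooth_on (U \<times> (UNIV::'b set)) (\<lambda>p. A (fst p) b)" for b
    by (rule smooth_on_compose[OF oU U _ _ sm]) (auto intro: smooth_on_linear[OF bounded_linear_fst oU])
  have "smooth_on (U \<times> UNIV) (\<lambda>p. (fst p, \<Sum>b\<in>Basis. (snd p \<bullet> b) *\<^sub>R A (fst p) b))"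
    by (intro smooth_on_Pair[OF oU] smooth_on_sum[OF oU] smooth_on_scaleR[OF oU] s1 smooth_on_linear[OF bounded_linear_fst oU]
          smooth_on_bounded_linear[OF bounded_linear_inner_left oU] smooth_on_linear[OF bounded_linear_snd oU]) auto
  then have s\<Psi>: "smooth_on (U \<times> UNIV) \<Psi>"
    by (rule smooth_on_cong[OF oU]) (auto simp: \<Psi>_def Aexp)
  have diff: "(\<lambda>z. inv (A z) v) differentiable (at z0)" if z0: "z0 \<in> U" for z0 v
  proof -
    define w0 where "w0 = inv (A z0) v"
    have inj\<Psi>: "u = 0" if "frechet_derivative \<Psi> (at (z0, w0)) u = 0" for u
    proof -
      have d: "(\<Psi> has_derivative frechet_derivative \<Psi> (at (z0, w0))) (at (z0, w0))"
        by (rule smooth_on_has_derivative[OF s\<Psi>]) (use z0 in simp)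
      have "((\<lambda>p. fst (\<Psi> p)) has_derivative (\<lambda>u. fst (frechet_derivative \<Psi> (at (z0, w0)) u))) (at (z0, w0))"
        using d by (rule has_derivative_fst)
      moreover have "((\<lambda>p. fst (\<Psi> p)) has_derivative fst) (at (z0, w0))"
        unfolding \<Psi>_def by (auto intro!: derivative_eq_intros)
      ultimately have "(\<lambda>u. fst (frechet_derivative \<Psi> (at (z0, w0)) u)) = fst" by (rule has_derivative_unique)
      then have f: "fst u = 0" using that by (metis fst_zero)
      have "((\<lambda>p. snd (\<Psi> p)) has_derivative (\<lambda>u. snd (frechet_derivative \<Psi> (at (z0, w0)) u))) (at (z0, w0))"
        using d by (rule has_derivative_snd)
      moreover have "((\<lambda>w. (z0, w)) has_derivative (\<lambda>w. (0, w))) (at w0)"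
        by (auto intro!: derivative_eq_intros)
      ultimately have "((\<lambda>w. snd (\<Psi> (z0, w))) has_derivative (\<lambda>w. snd (frechet_derivative \<Psi> (at (z0, w0)) (0, w)))) (at w0)"
        by (rule has_derivative_compose[rotated])
      then have "(A z0 has_derivative (\<lambda>w. snd (frechet_derivative \<Psi> (at (z0, w0)) (0, w)))) (at w0)"
        by (subst (asm) (1) \<Psi>_def) simp
      moreover have "(A z0 has_derivative A z0) (at w0)"
        using lin[OF z0] by (simp add: linear_conv_bounded_linear bounded_linear_imp_has_derivative)
      ultimately have "snd (frechet_derivative \<Psi> (at (z0, w0)) (0, snd u)) = A z0 (snd u)"
        by (rule fun_cong[OF has_derivative_unique])
      then have "A z0 (snd u) = 0" using f that by (metis prod.collapse snd_zero)
      then show "u = 0" using inj[OF z0] f by (simp add: prod_eq_iff)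
    qed
    have z0': "(z0, w0) \<in> U \<times> UNIV" using z0 by simp
    obtain U' V g where *: "open U'" "U' \<subseteq> U \<times> UNIV" "(z0, w0) \<in> U'" "open V" "\<Psi> (z0, w0) \<in> V"
        "homeomorphism U' V \<Psi> g"
        "\<And>y. y \<in> V \<Longrightarrow> (g has_derivative inv (frechet_derivative \<Psi> (at (g y)))) (at y)"
      by (rule inverse_function_C1[OF oU s\<Psi> z0' inj\<Psi>]) blast+
    have "\<Psi> (z0, w0) = (z0, v)" by (simp add: \<Psi>_def w0_def invr[OF z0])
    then have vV: "(z0, v) \<in> V" using *(5) by simp
    have "((\<lambda>z. (z, v)) has_derivative (\<lambda>h. (h, 0))) (at z0)" by (auto intro!: derivative_eq_intros)
    from has_derivative_snd[OF has_derivative_compose[OF this *(7)[OF vV]]]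
    have D: "((\<lambda>z. snd (g (z, v))) has_derivative (\<lambda>h. snd (inv (frechet_derivative \<Psi> (at (g (z0, v)))) (h, 0)))) (at z0)" .
    define N where "N = (\<lambda>z. (z, v)) -` V"
    have oN: "open N" unfolding N_def using *(4) by (intro open_vimage continuous_intros) auto
    have eq: "snd (g (z, v)) = inv (A z) v" if "z \<in> N" for z
    proof -
      have m: "(z, v) \<in> V" using that by (simp add: N_def)
      then have g: "g (z, v) \<in> U'" "\<Psi> (g (z, v)) = (z, v)" using *(6) by (auto simp: homeomorphism_def)
      then have "fst (g (z, v)) = z" "A z (snd (g (z, v))) = v" "z \<in> U" using *(2) by (auto simp: \<Psi>_def)
      then show ?thesis by (metis invl)
    qed
    have "((\<lambda>z. inv (A z) v) has_derivative (\<lambda>h. snd (inv (frechet_derivative \<Psi> (at (g (z0, v)))) (h, 0)))) (at z0)"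
      by (rule has_derivative_transform_within_open[OF D oN _ eq]) (use vV in \<open>simp add: N_def\<close>)
    then show ?thesis by (auto simp: differentiable_def)
  qed
  \<comment> \<open>Obtained by differentiating \<open>A z (inv (A z) v) = v\<close>. The expansions
    in \<open>Basis\<close> leave only \<open>inv (A z)\<close> at fixed vectors, to which the
    induction hypothesis below applies.\<close>
  have deriv: "frechet_derivative (\<lambda>z. inv (A z) v) (at z) h
      = - (\<Sum>b\<in>Basis. (inv (A z) v \<bullet> b) *\<^sub>R (\<Sum>i\<in>Basis. (frechet_derivative (\<lambda>z. A z b) (at z) h \<bullet> i) *\<^sub>R inv (A z) i))"
    if z: "z \<in> U" for z v h
  proof -
    let ?s = "\<lambda>z. inv (A z) v" and ?s' = "frechet_derivative (\<lambda>z. inv (A z) v) (at z)"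
    have ds: "(?s has_derivative ?s') (at z)" using diff[OF z] frechet_derivative_works by blast
    have dA: "((\<lambda>z. A z b) has_derivative frechet_derivative (\<lambda>z. A z b) (at z)) (at z)" for b
      by (rule smooth_on_has_derivative[OF sm z])
    have "((\<lambda>z. \<Sum>b\<in>Basis. (?s z \<bullet> b) *\<^sub>R A z b) has_derivative
       (\<lambda>h. \<Sum>b\<in>Basis. (?s z \<bullet> b) *\<^sub>R frechet_derivative (\<lambda>z. A z b) (at z) h + (?s' h \<bullet> b) *\<^sub>R A z b)) (at z)"
      by (intro has_derivative_sum has_derivative_scaleR has_derivative_inner_left dA ds)
    moreover have "((\<lambda>z. \<Sum>b\<in>Basis. (?s z \<bullet> b) *\<^sub>R A z b) has_derivative (\<lambda>h. 0)) (at z)"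
      by (rule has_derivative_transform_within_open[OF has_derivative_const[of v] U z])
        (simp add: invr Aexp)
    ultimately have "(\<Sum>b\<in>Basis. (?s z \<bullet> b) *\<^sub>R frechet_derivative (\<lambda>z. A z b) (at z) h + (?s' h \<bullet> b) *\<^sub>R A z b) = 0"
      by (rule fun_cong[OF has_derivative_unique])
    then have "A z (?s' h) = - (\<Sum>b\<in>Basis. (?s z \<bullet> b) *\<^sub>R frechet_derivative (\<lambda>z. A z b) (at z) h)"
      by (simp add: sum.distrib eq_neg_iff_add_eq_0 add.commute Aexp[OF z])
    then have "?s' h = inv (A z) (- (\<Sum>b\<in>Basis. (?s z \<bullet> b) *\<^sub>R frechet_derivative (\<lambda>z. A z b) (at z) h))"
      using invl[OF z] by metis
    also have "\<dots> = - (\<Sum>b\<in>Basis. (?s z \<bullet> b) *\<^sub>R inv (A z) (frechet_derivative (\<lambda>z. A z b) (at z) h))"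
      using lininv[OF z] by (simp add: linear_neg linear_sum linear_cmul)
    finally show ?thesis by (subst (asm) linear_Basis_sum[OF lininv[OF z]])
  qed
  have "\<forall>v. times_diff k U (\<lambda>z. inv (A z) v)" for k
  proof (induction k)
    case (Suc k)
    show ?case
    proof
      fix v
      show "times_diff (Suc k) U (\<lambda>z. inv (A z) v)"
      proof (rule times_diff_SucI[OF U])
        show "((\<lambda>z. inv (A z) v) has_derivative (\<lambda>h. - (\<Sum>b\<in>Basis. (inv (A z) v \<bullet> b) *\<^sub>R
           (\<Sum>i\<in>Basis. (frechet_derivative (\<lambda>z. A z b) (at z) h \<bullet> i) *\<^sub>R inv (A z) i)))) (at z)" if "z \<in> U" for z
          using diff[OF that, of v] deriv[OF that] frechet_derivative_works by (metis (no_types, lifting) ext)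
        have t: "times_diff k U (\<lambda>z. frechet_derivative (\<lambda>z. A z b) (at z) h)" for b h
          using smooth_on_deriv[OF sm] by (simp add: smooth_on_iff)
        show "times_diff k U (\<lambda>z. - (\<Sum>b\<in>Basis. (inv (A z) v \<bullet> b) *\<^sub>R
           (\<Sum>i\<in>Basis. (frechet_derivative (\<lambda>z. A z b) (at z) h \<bullet> i) *\<^sub>R inv (A z) i)))" for h
          by (intro times_diff_bounded_linear[OF bounded_linear_minus[OF bounded_linear_ident] U] times_diff_sum[OF U]
            times_diff_bilinear[OF bounded_bilinear_scaleR U] times_diff_bounded_linear[OF bounded_linear_inner_left U] t
            Suc.IH[rule_format]) auto
      qed
    qed
  qed simp
  then show ?thesis by (simp add: smooth_on_iff)
qed

text \<open>Bootstrapping: the derivative of \<open>g\<close> at \<open>y\<close> is the inverse of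
  the derivative of \<open>f\<close> at \<open>g y\<close>, a smooth function composed with
  \<open>g\<close>. So every order of differentiability of \<open>g\<close> yields the next
  one.\<close>

lemma inverse_function_smooth:
  fixes f :: "'a::euclidean_space \<Rightarrow> 'a"
  assumes "open U" "smooth_on U f" "x0 \<in> U"
    and inj: "\<And>v. frechet_derivative f (at x0) v = 0 \<Longrightarrow> v = 0"
  obtains U' V g where "open U'" "U' \<subseteq> U" "x0 \<in> U'" "open V" "f x0 \<in> V" "homeomorphism U' V f g" "smooth_on V g"
    "\<And>y. y \<in> V \<Longrightarrow> (g has_derivative inv (frechet_derivative f (at (g y)))) (at y)"
proof -
  obtain U' V g where *: "open U'" "U' \<subseteq> U" "x0 \<in> U'" "open V" "f x0 \<in> V" "homeomorphism U' V f g"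
    and d: "\<And>y. y \<in> V \<Longrightarrow> (g has_derivative inv (frechet_derivative f (at (g y)))) (at y)"
    and b: "\<And>y. y \<in> V \<Longrightarrow> bij (frechet_derivative f (at (g y)))"
    by (rule inverse_function_C1[OF assms]) blast+
  have s: "smooth_on U' f" using assms(2) *(2) by (rule smooth_on_subset)
  have fg: "f ` U' = V" "g ` V = U'" and gf: "\<And>x. x \<in> U' \<Longrightarrow> g (f x) = x" using *(6) by (auto simp: homeomorphism_def)
  have bU: "bij (frechet_derivative f (at x))" if "x \<in> U'" for x
    using b[of "f x"] fg gf[OF that] that by auto
  have si: "smooth_on U' (\<lambda>x. inv (frechet_derivative f (at x)) v)" for v
  proof (rule smooth_on_inv_linear[OF *(1)])
    show "w = 0" if "z \<in> U'" "frechet_derivative f (at z) w = 0" for z w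
      using bU[OF that(1)] that(2) linear_injective_0[OF smooth_on_deriv_linear[OF s that(1)]] by (auto simp: bij_def)
  qed (auto intro: smooth_on_deriv_linear[OF s] smooth_on_deriv[OF s])
  have "times_diff k V g" for k
  proof (induction k)
    case (Suc k)
    show ?case
    proof (rule times_diff_SucI[OF *(4) d])
      show "times_diff k V (\<lambda>y. inv (frechet_derivative f (at (g y))) v)" for v
        by (rule times_diff_compose[OF *(4,1) _ Suc.IH si[unfolded smooth_on_iff, rule_format]]) (use fg in auto)
    qed
  qed simp
  then show ?thesis by (intro that[OF * _ d]) (auto simp: smooth_on_iff)
qed

section \<open>Regular zero sets\<close>

definition independent_at :: "nat \<Rightarrow> (nat \<Rightarrow> 'a::real_normed_vector \<Rightarrow> real) \<Rightarrow> 'a \<Rightarrow> bool" where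
  "independent_at d u z \<longleftrightarrow>
     (\<forall>c. (\<forall>v. (\<Sum>j<d. c j * frechet_derivative (u j) (at z) v) = 0) \<longrightarrow> (\<forall>j<d. c j = 0))"

lemma span_indexed_sum:
  assumes "finite I" "x \<in> span (f ` I)"
  shows "\<exists>c. x = (\<Sum>i\<in>I. c i *\<^sub>R f i)"
  using assms(2)
proof (induction rule: span_induct_alt)
  case base
  show ?case by (rule exI[of _ "\<lambda>_. 0"]) simp
next
  case (step a y z)
  then obtain c j where "z = (\<Sum>i\<in>I. c i *\<^sub>R f i)" "j \<in> I" "y = f j" by auto
  then have "a *\<^sub>R y + z = (\<Sum>i\<in>I. (if i = j then a + c i else c i) *\<^sub>R f i)"
    using assms(1) by (simp add: sum.remove[of I j] algebra_simps)
  then show ?case by (rule exI[of _ "\<lambda>i. if i = j then a + c i else c i"])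
qed

text \<open>\<open>m j\<close> is the normalized part of \<open>n j\<close> that is orthogonal to
  the other \<open>n i\<close>. Membership in the span of the \<open>n i\<close> will make the
  projection built from \<open>n\<close> and \<open>m\<close> orthogonal, hence symmetric.\<close>

lemma dual_vectors:
  fixes n :: "nat \<Rightarrow> 'a::euclidean_space"
  assumes ind: "\<And>c. (\<Sum>j<d. c j *\<^sub>R n j) = 0 \<Longrightarrow> \<forall>j<d. c j = 0"
  obtains m where "\<And>i j. i < d \<Longrightarrow> j < d \<Longrightarrow> n i \<bullet> m j = (if i = j then 1 else 0)"
    and "\<And>j. j < d \<Longrightarrow> m j \<in> span (n ` {..<d})"
proof -
  have "\<exists>m. m \<in> span (n ` {..<d}) \<and> (\<forall>i<d. n i \<bullet> m = (if i = j then 1 else 0))" if j: "j < d" for j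
  proof -
    let ?I = "{..<d} - {j}"
    obtain y r where yr: "y \<in> span (n ` ?I)" "\<And>w. w \<in> span (n ` ?I) \<Longrightarrow> orthogonal r w" "n j = y + r"
      using orthogonal_subspace_decomp_exists[of "n ` ?I" "n j"] by metis
    have "r \<noteq> 0"
    proof
      assume "r = 0"
      then have "n j \<in> span (n ` ?I)" using yr by simp
      then obtain c where c: "n j = (\<Sum>i\<in>?I. c i *\<^sub>R n i)" using span_indexed_sum[of ?I "n j" n] by auto
      have "(\<Sum>i<d. (if i = j then - 1 else c i) *\<^sub>R n i) = - n j + (\<Sum>i\<in>?I. (if i = j then - 1 else c i) *\<^sub>R n i)"
        using j by (subst sum.remove[of _ j]) auto
      also have "(\<Sum>i\<in>?I. (if i = j then - 1 else c i) *\<^sub>R n i) = n j" unfolding c by (rule sum.cong) auto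
      finally show False using ind[of "\<lambda>i. if i = j then - 1 else c i"] j by auto
    qed
    have o: "n i \<bullet> r = 0" if "i < d" "i \<noteq> j" for i
      using yr(2)[of "n i"] that by (auto simp: orthogonal_def inner_commute intro!: span_base)
    have "y \<bullet> r = 0" using yr(2)[OF yr(1)] by (simp add: orthogonal_def inner_commute)
    then have jj: "n j \<bullet> r = r \<bullet> r" by (simp add: yr(3) inner_add_left)
    have "r = n j - y" using yr(3) by simp
    moreover have "y \<in> span (n ` {..<d})" using yr(1) span_mono[of "n ` ?I" "n ` {..<d}"] by blast
    ultimately have "r \<in> span (n ` {..<d})" using j by (simp add: span_diff span_base)
    then show ?thesis
      using o jj \<open>r \<noteq> 0\<close> by (intro exI[of _ "(1 / (r \<bullet> r)) *\<^sub>R r"]) (auto intro!: span_scale)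
  qed
  then obtain m where "\<And>j. j < d \<Longrightarrow> m j \<in> span (n ` {..<d}) \<and> (\<forall>i<d. n i \<bullet> m j = (if i = j then 1 else 0))"
    by metis
  then show ?thesis by (intro that[of m]) auto
qed

lemma dual_functionals:
  fixes \<phi> :: "nat \<Rightarrow> 'a::euclidean_space \<Rightarrow> real"
  assumes "\<And>j. j < d \<Longrightarrow> linear (\<phi> j)"
    and ind: "\<And>c. (\<And>v. (\<Sum>j<d. c j * \<phi> j v) = 0) \<Longrightarrow> \<forall>j<d. c j = 0"
  obtains m n where "\<And>i j. i < d \<Longrightarrow> j < d \<Longrightarrow> \<phi> i (m j) = (if i = j then 1 else (0::real))"
    "\<And>i v. i < d \<Longrightarrow> \<phi> i v = n i \<bullet> (v :: 'a::euclidean_space)"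
    "\<And>j. j < d \<Longrightarrow> m j \<in> span (n ` {..<d})"
proof -
  define n where "n j = (\<Sum>b\<in>Basis. \<phi> j b *\<^sub>R b)" for j
  have n: "\<phi> j v = n j \<bullet> v" if "j < d" for j v
    unfolding n_def inner_sum_left
    by (subst linear_Basis_sum[OF assms(1)[OF that]]) (simp add: inner_commute mult.commute)
  have ind': "\<forall>j<d. c j = 0" if "(\<Sum>j<d. c j *\<^sub>R n j) = 0" for c
  proof (rule ind)
    fix v
    have "(\<Sum>j<d. c j * \<phi> j v) = (\<Sum>j<d. c j *\<^sub>R n j) \<bullet> v"
      unfolding inner_sum_left by (rule sum.cong) (auto simp: n)
    then show "(\<Sum>j<d. c j * \<phi> j v) = 0" using that by simp
  qed
  obtain m where "\<And>i j. i < d \<Longrightarrow> j < d \<Longrightarrow> n i \<bullet> m j = (if i = j then 1 else 0)"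
    "\<And>j. j < d \<Longrightarrow> m j \<in> span (n ` {..<d})"
    by (rule dual_vectors[OF ind']) auto
  then show ?thesis by (intro that[of m n]) (auto simp: n)
qed

text \<open>Subtracting \<open>\<phi> j v\<close> times \<open>m j\<close> for all \<open>j\<close>
  moves \<open>v\<close> into the common kernel of the \<open>\<phi> j\<close>, where
  \<open>\<psi>\<close> vanishes. This is the Lagrange multiplier rule with explicit
  multipliers.\<close>

lemma functional_combination:
  fixes \<phi> :: "nat \<Rightarrow> 'a::real_vector \<Rightarrow> real"
  assumes "linear \<psi>" "\<And>j. j < d \<Longrightarrow> linear (\<phi> j)"
    and dual: "\<And>i j. i < d \<Longrightarrow> j < d \<Longrightarrow> \<phi> i (m j) = (if i = j then 1 else 0)"
    and van: "\<And>v. (\<And>j. j < d \<Longrightarrow> \<phi> j v = 0) \<Longrightarrow> \<psi> v = (0::real)"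
  shows "\<psi> v = (\<Sum>j<d. \<psi> (m j) * \<phi> j v)"
proof -
  have "\<psi> (v - (\<Sum>j<d. \<phi> j v *\<^sub>R m j)) = 0"
  proof (rule van)
    fix i assume i: "i < d"
    have "\<phi> i (v - (\<Sum>j<d. \<phi> j v *\<^sub>R m j)) = \<phi> i v - (\<Sum>j<d. \<phi> j v * \<phi> i (m j))"
      by (simp add: linear_diff[OF assms(2)[OF i]] linear_sum[OF assms(2)[OF i]] linear_cmul[OF assms(2)[OF i]])
    also have "(\<Sum>j<d. \<phi> j v * \<phi> i (m j)) = (\<Sum>j<d. if i = j then \<phi> j v else 0)"
      by (rule sum.cong) (auto simp: dual i)
    also have "\<dots> = \<phi> i v" using i by simp
    finally show "\<phi> i (v - (\<Sum>j<d. \<phi> j v *\<^sub>R m j)) = 0" by simp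
  qed
  then show ?thesis
    by (simp add: linear_diff[OF assms(1)] linear_sum[OF assms(1)] linear_cmul[OF assms(1)] mult.commute)
qed

lemma isCont_eventually_in:
  assumes "isCont f x" "open W" "f x \<in> W"
  shows "\<forall>\<^sub>F s in nhds x. f s \<in> W"
proof -
  have "(f \<longlongrightarrow> f x) (nhds x)" using assms(1) by (simp add: isCont_def tendsto_at_iff_tendsto_nhds)
  then show ?thesis using assms(2,3) by (rule topological_tendstoD)
qed

text \<open>An equation that holds on \<open>S\<close> may be differentiated in tangent directions,
  whatever happens off \<open>S\<close>. Nearly all identities at points of \<open>Sigma2\<close>
  come from this.\<close>

lemma tangent_deriv_zero:
  assumes "v \<in> tangent S w" "(f has_derivative f') (at w)" "open W" "w \<in> W" "\<And>z. z \<in> S \<inter> W \<Longrightarrow> f z = c"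
  shows "f' v = 0"
proof -
  obtain \<gamma> where g: "\<gamma> (0::real) = w" "\<forall>\<^sub>F s in nhds 0. \<gamma> s \<in> S" "(\<gamma> has_vector_derivative v) (at 0)"
    using assms(1) by (auto simp: tangent_def)
  have "isCont \<gamma> 0" using g(3) has_vector_derivative_continuous by blast
  then have "\<forall>\<^sub>F s in nhds 0. \<gamma> s \<in> W"
    using isCont_eventually_in[of 0 \<gamma> W] assms(3,4) g(1) by simp
  then have "\<forall>\<^sub>F s in nhds 0. f (\<gamma> s) = c" using g(2) by eventually_elim (use assms(5) in auto)
  then have "((\<lambda>s. f (\<gamma> s)) has_derivative (\<lambda>_. 0)) (at 0)"
    by (intro has_derivative_transform_eventually[OF has_derivative_const[of c]])
       (auto simp: eventually_at_filter elim: eventually_mono dest: eventually_nhds_x_imp_x)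
  moreover have "((\<lambda>s. f (\<gamma> s)) has_derivative (\<lambda>s. f' (s *\<^sub>R v))) (at 0)"
    using has_derivative_compose[of \<gamma> "\<lambda>s. s *\<^sub>R v" 0 UNIV f f'] g(1,3) assms(2)
    by (simp add: has_vector_derivative_def)
  ultimately have "f' (1 *\<^sub>R v) = 0" by (rule fun_cong[OF has_derivative_unique, symmetric])
  then show ?thesis by simp
qed

lemma tangent_localize:
  assumes "open W" "w \<in> W"
  shows "tangent (S \<inter> W) w = tangent S w"
proof -
  have ev: "\<forall>\<^sub>F s in nhds 0. \<gamma> s \<in> W" if "\<gamma> (0::real) = w" "(\<gamma> has_vector_derivative v) (at 0)" for \<gamma> v
    using has_vector_derivative_continuous[OF that(2)] assms that(1) isCont_eventually_in[of 0 \<gamma> W] by simp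
  have "(\<forall>\<^sub>F s in nhds 0. \<gamma> s \<in> S \<inter> W) \<longleftrightarrow> (\<forall>\<^sub>F s in nhds 0. \<gamma> s \<in> S)"
    if "\<gamma> (0::real) = w" "(\<gamma> has_vector_derivative v) (at 0)" for \<gamma> v
    using ev[OF that] by (simp add: eventually_conj_iff)
  then show ?thesis unfolding tangent_def by (intro Collect_cong ex_cong) blast
qed

lemma tangent_ann_localize: "open W \<Longrightarrow> w \<in> W \<Longrightarrow> tangent_ann (S \<inter> W) w = tangent_ann S w"
  unfolding tangent_ann_def by (simp add: tangent_localize)

text \<open>The map \<open>z \<mapsto> z + \<Sum>\<^sub>j (u\<^sub>j(z) - n\<^sub>j \<bullet> (z - w)) m\<^sub>j\<close>, with \<open>m\<close> dual to the gradients \<open>n\<close>, has the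
  identity as derivative at \<open>w\<close> and turns the zero set into an affine space.\<close>

lemma tangent_regular:
  fixes S :: "'a::euclidean_space set"
  assumes W: "open W" "w \<in> W" "w \<in> S" and sm: "\<And>j. j < d \<Longrightarrow> smooth_on W (u j)"
    and S: "S \<inter> W = {z\<in>W. \<forall>j<d. u j z = 0}" and ind: "independent_at d u w"
  shows "tangent S w = {v. \<forall>j<d. frechet_derivative (u j) (at w) v = 0}"
proof
  show "tangent S w \<subseteq> {v. \<forall>j<d. frechet_derivative (u j) (at w) v = 0}"
  proof (intro subsetI CollectI allI impI)
    fix v j assume v: "v \<in> tangent S w" and j: "j < d"
    have "u j z = 0" if "z \<in> S \<inter> W" for z using that j unfolding S by blast
    with v show "frechet_derivative (u j) (at w) v = 0"
      by (rule tangent_deriv_zero[OF _ smooth_on_has_derivative[OF sm[OF j] W(2)] W(1,2)])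
  qed
next
  have lin: "linear (frechet_derivative (u j) (at w))" if "j < d" for j
    by (rule smooth_on_deriv_linear[OF sm[OF that] W(2)])
  obtain m n where mn: "\<And>i j. i < d \<Longrightarrow> j < d \<Longrightarrow> frechet_derivative (u i) (at w) (m j) = (if i = j then 1 else 0)"
    "\<And>i v. i < d \<Longrightarrow> frechet_derivative (u i) (at w) v = n i \<bullet> v"
    by (rule dual_functionals[of d "\<lambda>j. frechet_derivative (u j) (at w)"]) (use lin ind independent_at_def in blast)+
  define \<Phi> where "\<Phi> z = z + (\<Sum>j<d. (u j z - n j \<bullet> (z - w)) *\<^sub>R m j)" for z
  have sl: "smooth_on W (\<lambda>z. n j \<bullet> (z - w))" for j
    by (intro smooth_on_bounded_linear[OF bounded_linear_inner_right W(1)] smooth_on_diff[OF W(1)] smooth_on_const[OF W(1)]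
       smooth_on_linear[OF bounded_linear_ident W(1)])
  have s\<Phi>: "smooth_on W \<Phi>"
    unfolding \<Phi>_def
    by (intro smooth_on_add smooth_on_sum smooth_on_scaleR smooth_on_diff sl sm
       smooth_on_linear[OF bounded_linear_ident W(1)] smooth_on_const W(1)) auto
  have d\<Phi>: "(\<Phi> has_derivative (\<lambda>v. v)) (at w)"
  proof -
    have "(\<Phi> has_derivative (\<lambda>v. v + (\<Sum>j<d. (u j w - n j \<bullet> (w - w)) *\<^sub>R 0 + (frechet_derivative (u j) (at w) v - n j \<bullet> v) *\<^sub>R m j))) (at w)"
      unfolding \<Phi>_def
      by (intro has_derivative_add has_derivative_sum has_derivative_scaleR has_derivative_diff
          has_derivative_ident has_derivative_const has_derivative_inner_right smooth_on_has_derivative[OF sm W(2)])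
        (auto intro!: derivative_eq_intros)
    then show ?thesis using mn(2) by simp
  qed
  have inner: "n i \<bullet> (\<Phi> z - w) = u i z" if "i < d" for i z
  proof -
    have "n i \<bullet> (\<Phi> z - w) = n i \<bullet> (z - w) + (\<Sum>j<d. (u j z - n j \<bullet> (z - w)) * (n i \<bullet> m j))"
      by (simp add: \<Phi>_def inner_diff_right inner_add_right inner_sum_right)
    also have "(\<Sum>j<d. (u j z - n j \<bullet> (z - w)) * (n i \<bullet> m j)) = (\<Sum>j<d. if i = j then u j z - n j \<bullet> (z - w) else 0)"
      by (rule sum.cong) (use mn that in auto)
    finally show ?thesis using that by simp
  qed
  have "w \<in> {z\<in>W. \<forall>j<d. u j z = 0}" using W S by blast
  then have \<Phi>w: "\<Phi> w = w" by (simp add: \<Phi>_def)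
  have dw: "frechet_derivative \<Phi> (at w) = (\<lambda>v. v)" by (rule frechet_derivative_eqI[OF d\<Phi>])
  obtain U' V g where g: "open U'" "U' \<subseteq> W" "w \<in> U'" "open V" "\<Phi> w \<in> V" "homeomorphism U' V \<Phi> g"
     "\<And>y. y \<in> V \<Longrightarrow> (g has_derivative inv (frechet_derivative \<Phi> (at (g y)))) (at y)"
    by (rule inverse_function_smooth[OF W(1) s\<Phi> W(2)]) (auto simp: dw)
  have gw: "g w = w" using g \<Phi>w by (metis homeomorphism_apply1)
  show "{v. \<forall>j<d. frechet_derivative (u j) (at w) v = 0} \<subseteq> tangent S w"
  proof
    fix v assume "v \<in> {v. \<forall>j<d. frechet_derivative (u j) (at w) v = 0}"
    then have v: "n j \<bullet> v = 0" if "j < d" for j using mn(2) that by auto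
    define \<gamma> where "\<gamma> s = g (w + s *\<^sub>R v)" for s :: real
    have "\<forall>\<^sub>F s in nhds 0. w + s *\<^sub>R v \<in> V"
      using isCont_eventually_in[of 0 "\<lambda>s::real. w + s *\<^sub>R v" V] g(4,5) \<Phi>w by simp
    then have "\<forall>\<^sub>F s in nhds 0. \<gamma> s \<in> S"
    proof eventually_elim
      case (elim s)
      then have "\<gamma> s \<in> U'" "\<Phi> (\<gamma> s) = w + s *\<^sub>R v" using g(6) by (auto simp: \<gamma>_def homeomorphism_def)
      then have "u j (\<gamma> s) = 0" if "j < d" for j using inner[OF that, of "\<gamma> s"] v[OF that] by simp
      then show ?case using S \<open>\<gamma> s \<in> U'\<close> g(2) by blast
    qed
    moreover have "(\<gamma> has_vector_derivative v) (at 0)"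
    proof -
      have "(g has_derivative inv (\<lambda>v. v)) (at (w + 0 *\<^sub>R v))" using g(7)[of w] g(5) \<Phi>w gw dw by simp
      moreover have "inv (\<lambda>v::'a. v) = (\<lambda>v. v)" using inv_id[where 'a='a] unfolding id_def .
      moreover have "((\<lambda>s. w + s *\<^sub>R v) has_derivative (\<lambda>s. s *\<^sub>R v)) (at 0)" by (auto intro!: derivative_eq_intros)
      ultimately have "((\<lambda>s. g (w + s *\<^sub>R v)) has_derivative (\<lambda>s. s *\<^sub>R v)) (at 0)"
        using has_derivative_compose[of "\<lambda>s. w + s *\<^sub>R v" "\<lambda>s. s *\<^sub>R v" 0 UNIV g "\<lambda>v. v"] by simp
      then show ?thesis unfolding \<gamma>_def has_vector_derivative_def .
    qed
    moreover have "\<gamma> 0 = w" by (simp add: \<gamma>_def gw)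
    ultimately show "v \<in> tangent S w" unfolding tangent_def by blast
  qed
qed

section \<open>Hamilton fields\<close>

lemma symp_simps:
  "symp (u + v) w = symp u w + symp v w" "symp u (v + w) = symp u v + symp u w"
  "symp (u - v) w = symp u w - symp v w" "symp u (v - w) = symp u v - symp u w"
  "symp (c *\<^sub>R u) w = c * symp u w" "symp u (c *\<^sub>R w) = c * symp u w"
  "symp 0 w = 0" "symp u 0 = 0" "symp (- u) w = - symp u w" "symp u (- w) = - symp u w"
  by (auto simp: symp_def algebra_simps inner_simps)

lemma symp_commute: "symp u v = - symp v u"
  by (simp add: symp_def inner_commute)

lemma symp_self [simp]: "symp u u = 0"
  by (simp add: symp_def inner_commute)

lemma symp_sum_right: "symp u (\<Sum>i\<in>I. f i) = (\<Sum>i\<in>I. symp u (f i))"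
  by (induction I rule: infinite_finite_induct) (auto simp: symp_simps)

lemma symp_sum_left: "symp (\<Sum>i\<in>I. f i) u = (\<Sum>i\<in>I. symp (f i) u)"
  by (induction I rule: infinite_finite_induct) (auto simp: symp_simps)

lemma symp_nondegenerate:
  assumes "\<And>u. symp u v = symp u w" shows "v = w"
proof -
  define h where "h = v - w"
  \<comment> \<open>The test vector is \<open>h\<close> rotated by the complex structure, so that it
    pairs with \<open>h\<close> to the square of its norm.\<close>
  have "symp (- snd h, fst h) h = 0" using assms by (simp add: symp_simps h_def)
  then have "snd h \<bullet> snd h + fst h \<bullet> fst h = 0" by (simp add: symp_def)
  then have "snd h = 0 \<and> fst h = 0"
    by (smt (verit) inner_eq_zero_iff inner_ge_zero)
  then have "h = 0" by (simp add: prod_eq_iff)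
  then show ?thesis by (simp add: h_def)
qed

text \<open>Turns statements on differentials into statements on \<open>symp\<close>, where vectors
  can be compared by nondegeneracy; most later identities for Hamilton fields are proved in this
  way.\<close>

lemma deriv_ham:
  assumes "f differentiable (at z)"
  shows "frechet_derivative f (at z) v = symp v (ham f z)"
proof -
  let ?D = "frechet_derivative f (at z)"
  have lin: "linear ?D" using assms by (rule linear_frechet_derivative)
  have l1: "linear (\<lambda>a. ?D (a, 0))"
    using linear_compose[OF _ lin, of "\<lambda>a. (a, 0)"] by (simp add: o_def linear_iff)
  have l2: "linear (\<lambda>a. ?D (0, a))"
    using linear_compose[OF _ lin, of "\<lambda>a. (0, a)"] by (simp add: o_def linear_iff)
  have e: "L a = (\<Sum>j\<in>UNIV. a $ j * L (axis j 1))" if "linear L" for L :: "real ^ 'a \<Rightarrow> real" and a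
  proof -
    have "L a = L (\<Sum>j\<in>UNIV. a $ j *\<^sub>R axis j 1)" using basis_expansion[of a] by (simp add: scalar_mult_eq_scaleR)
    then show ?thesis by (simp add: linear_sum[OF that] linear_cmul[OF that])
  qed
  have "?D v = ?D ((fst v, 0) + (0, snd v))" by simp
  also have "\<dots> = ?D (fst v, 0) + ?D (0, snd v)" by (rule linear_add[OF lin])
  also have "\<dots> = (\<Sum>j\<in>UNIV. fst v $ j * ?D (axis j 1, 0)) + (\<Sum>j\<in>UNIV. snd v $ j * ?D (0, axis j 1))"
    using e[OF l1, of "fst v"] e[OF l2, of "snd v"] by simp
  also have "\<dots> = symp v (ham f z)"
    by (simp add: symp_def ham_def inner_vec_def sum_negf)
  finally show ?thesis .
qed

lemma ham_unique:
  assumes "f differentiable (at z)" "\<And>v. frechet_derivative f (at z) v = symp v h"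
  shows "ham f z = h"
  by (rule symp_nondegenerate) (simp flip: assms(2) add: deriv_ham[OF assms(1), symmetric])

lemma ham_cong: "frechet_derivative f (at z) = frechet_derivative g (at z') \<Longrightarrow> ham f z = ham g z'"
  by (simp add: ham_def)

lemma ham_has_derivative:
  assumes "(f has_derivative f') (at z)" shows "f' v = symp v (ham f z)"
  using deriv_ham[of f z v] frechet_derivative_eqI[OF assms] assms by (auto simp: differentiable_def)

lemma poisson_symp:
  assumes "g differentiable (at z)" shows "poisson f g z = symp (ham f z) (ham g z)"
  unfolding poisson_def by (rule deriv_ham[OF assms])

text \<open>Both sides pair equally with every vector \<open>K' v\<close>: the factor
  \<open>c\<close> comes once from the symplectic form and once from the right-hand side.
  Surjectivity of \<open>K'\<close> then allows nondegeneracy to be used.\<close>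

lemma ham_compose:
  assumes "(K has_derivative K') (at z)" "f differentiable (at (K z))"
    and "\<And>u v. symp (K' u) (K' v) = c * symp u v" "surj K'"
  shows "K' (ham (\<lambda>z. f (K z)) z) = c *\<^sub>R ham f (K z)"
proof (rule symp_nondegenerate)
  fix u
  obtain v where u: "u = K' v" using assms(4) by (metis surjD)
  have d: "((\<lambda>z. f (K z)) has_derivative (\<lambda>v. frechet_derivative f (at (K z)) (K' v))) (at z)"
    using has_derivative_compose[OF assms(1)] assms(2) frechet_derivative_works by blast
  have "symp u (K' (ham (\<lambda>z. f (K z)) z)) = c * symp v (ham (\<lambda>z. f (K z)) z)" by (simp add: u assms(3))
  also have "symp v (ham (\<lambda>z. f (K z)) z) = frechet_derivative f (at (K z)) u"
    using ham_has_derivative[OF d, of v] by (simp add: u)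
  finally show "symp u (K' (ham (\<lambda>z. f (K z)) z)) = symp u (c *\<^sub>R ham f (K z))"
    by (simp add: deriv_ham[OF assms(2)] symp_simps)
qed

lemma poisson_compose:
  assumes "(K has_derivative K') (at z)" "f differentiable (at (K z))" "g differentiable (at (K z))"
    and s: "\<And>u v. symp (K' u) (K' v) = symp u v" "surj K'"
  shows "poisson (\<lambda>z. f (K z)) (\<lambda>z. g (K z)) z = poisson f g (K z)"
proof -
  have d: "(\<lambda>z. g (K z)) differentiable (at z)"
    using has_derivative_compose[OF assms(1)] assms(3) frechet_derivative_works differentiableI by blast
  have h: "K' (ham (\<lambda>z. f (K z)) z) = ham f (K z)" "K' (ham (\<lambda>z. g (K z)) z) = ham g (K z)"
    using ham_compose[OF assms(1,2), of 1] ham_compose[OF assms(1,3), of 1] s by auto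
  show ?thesis unfolding poisson_symp[OF d] poisson_symp[OF assms(3)] by (simp flip: h add: s(1))
qed

lemma ham_add:
  assumes "f differentiable (at z)" "g differentiable (at z)"
  shows "ham (\<lambda>z. f z + g z) z = ham f z + ham g z"
proof -
  have "((\<lambda>z. f z + g z) has_derivative (\<lambda>v. frechet_derivative f (at z) v + frechet_derivative g (at z) v)) (at z)"
    using assms frechet_derivative_works by (intro has_derivative_add) blast+
  then have e: "frechet_derivative (\<lambda>z. f z + g z) (at z) = (\<lambda>v. frechet_derivative f (at z) v + frechet_derivative g (at z) v)"
    "(\<lambda>z. f z + g z) differentiable (at z)"
    by (rule frechet_derivative_eqI, rule differentiableI)
  show ?thesis
    by (rule ham_unique[OF e(2)]) (simp add: e(1) symp_simps deriv_ham[OF assms(1)] deriv_ham[OF assms(2)])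
qed

section \<open>Homogeneity\<close>

definition scl :: "real \<Rightarrow> 'n::finite phase \<Rightarrow> 'n phase" where
  "scl t z = (fst z, t *\<^sub>R snd z)"

lemma fst_scl [simp]: "fst (scl t z) = fst z" and snd_scl [simp]: "snd (scl t z) = t *\<^sub>R snd z"
  by (simp_all add: scl_def)

lemma scl_scl [simp]: "scl s (scl t z) = scl (s * t) z" and scl_1 [simp]: "scl 1 z = z"
  by (simp_all add: scl_def)

lemma linear_scl: "linear (scl t)"
  by (rule linearI) (simp_all add: scl_def algebra_simps)

lemma bounded_linear_scl: "bounded_linear (scl t)"
  using linear_scl linear_conv_bounded_linear by blast

lemma symp_scl: "symp (scl t u) (scl t v) = t * symp u v"
  by (simp add: symp_def algebra_simps)

lemma surj_scl: "t \<noteq> 0 \<Longrightarrow> surj (scl t)"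
  by (rule surjI[of _ "scl (inverse t)"]) simp

lemma conic_open_scl: "conic_open U \<Longrightarrow> z \<in> U \<Longrightarrow> 0 < t \<Longrightarrow> scl t z \<in> U"
  by (simp add: conic_open_def scl_def)

lemma homogeneousD: "homogeneous r U f \<Longrightarrow> z \<in> U \<Longrightarrow> 0 < t \<Longrightarrow> f (scl t z) = (t powr r) *\<^sub>R f z"
  by (simp add: homogeneous_def scl_def)

lemma homogeneous_deriv:
  fixes f :: "'n::finite phase \<Rightarrow> 'b::real_normed_vector"
  assumes "conic_open U" "homogeneous r U f" "z \<in> U" "0 < t" "f differentiable (at z)" "f differentiable (at (scl t z))"
  shows "frechet_derivative f (at (scl t z)) (scl t v) = (t powr r) *\<^sub>R frechet_derivative f (at z) v"
proof -
  have o: "open U" using assms(1) by (simp add: conic_open_def)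
  have "((\<lambda>z. f (scl t z)) has_derivative (\<lambda>v. frechet_derivative f (at (scl t z)) (scl t v))) (at z)"
    using has_derivative_compose[OF bounded_linear_imp_has_derivative[OF bounded_linear_scl]] assms(6) frechet_derivative_works by blast
  moreover have "((\<lambda>z. f (scl t z)) has_derivative (\<lambda>v. (t powr r) *\<^sub>R frechet_derivative f (at z) v)) (at z)"
  proof (rule has_derivative_transform_within_open[OF _ o assms(3)])
    show "((\<lambda>z. (t powr r) *\<^sub>R f z) has_derivative (\<lambda>v. (t powr r) *\<^sub>R frechet_derivative f (at z) v)) (at z)"
      using assms(5) frechet_derivative_works by (intro has_derivative_scaleR_right) blast
    show "(t powr r) *\<^sub>R f x = f (scl t x)" if "x \<in> U" for x using homogeneousD[OF assms(2) that assms(4)] by simp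
  qed
  ultimately show ?thesis by (rule fun_cong[OF has_derivative_unique])
qed

text \<open>One power of \<open>t\<close> is lost because the dilation multiplies the symplectic
  form by \<open>t\<close>.\<close>

lemma homogeneous_ham:
  fixes f :: "'n::finite phase \<Rightarrow> real"
  assumes "conic_open U" "homogeneous r U f" "z \<in> U" "0 < t" "f differentiable (at z)" "f differentiable (at (scl t z))"
  shows "ham f (scl t z) = (t powr (r - 1)) *\<^sub>R scl t (ham f z)"
proof (rule ham_unique[OF assms(6)])
  fix v :: "'n phase"
  obtain u where u: "v = scl t u" using surj_scl[of t] assms(4) by (metis less_irrefl surjD)
  show "frechet_derivative f (at (scl t z)) v = symp v (t powr (r - 1) *\<^sub>R scl t (ham f z))"
    unfolding u homogeneous_deriv[OF assms] using assms(4)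
    by (simp add: symp_simps symp_scl deriv_ham[OF assms(5)] powr_diff)
qed

section \<open>Straightening an involutive manifold transversal to the fibres\<close>

text \<open>For a \<open>dual_pair\<close> this is the orthogonal projection onto the span of the
  \<open>n j\<close>. Written with both families it displays the coordinates
  \<open>n j \<bullet> x\<close>, which serve as frame functions later.\<close>

definition proj :: "nat \<Rightarrow> (nat \<Rightarrow> 'a::real_inner) \<Rightarrow> (nat \<Rightarrow> 'a) \<Rightarrow> 'a \<Rightarrow> 'a" where
  "proj d n m x = (\<Sum>j<d. (n j \<bullet> x) *\<^sub>R m j)"

definition dual_pair :: "nat \<Rightarrow> (nat \<Rightarrow> 'a::real_inner) \<Rightarrow> (nat \<Rightarrow> 'a) \<Rightarrow> bool" where
  "dual_pair d n m \<longleftrightarrow> (\<forall>i<d. \<forall>j<d. n i \<bullet> m j = (if i = j then 1 else 0)) \<and> (\<forall>j<d. m j \<in> span (n ` {..<d}))"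

lemma linear_proj: "linear (proj d n m)"
  by (rule linearI) (simp_all add: proj_def inner_add_right scaleR_add_left sum.distrib scaleR_sum_right)

lemma bounded_linear_proj: "bounded_linear (proj d n m :: 'a::euclidean_space \<Rightarrow> 'a)"
  using linear_proj linear_conv_bounded_linear by blast

lemma inner_proj:
  assumes "dual_pair d n m" "i < d"
  shows "n i \<bullet> proj d n m x = n i \<bullet> x"
proof -
  have "n i \<bullet> proj d n m x = (\<Sum>j<d. if i = j then n j \<bullet> x else 0)"
    unfolding proj_def inner_sum_right by (rule sum.cong) (use assms in \<open>auto simp: dual_pair_def\<close>)
  then show ?thesis using assms(2) by simp
qed

lemma proj_cong: "(\<And>i. i < d \<Longrightarrow> n i \<bullet> x = n i \<bullet> y) \<Longrightarrow> proj d n m x = proj d n m y"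
  by (simp add: proj_def)

lemma proj_proj: "dual_pair d n m \<Longrightarrow> proj d n m (proj d n m x) = proj d n m x"
  by (rule proj_cong) (rule inner_proj)

lemma proj_eq_0: "(\<And>i. i < d \<Longrightarrow> n i \<bullet> x = 0) \<Longrightarrow> proj d n m x = 0"
  by (simp add: proj_def)

text \<open>The remainder \<open>x - proj d n m x\<close> is orthogonal to every \<open>n i\<close>,
  hence to their span, and the \<open>m j\<close> lie in this span.\<close>

lemma proj_symmetric:
  assumes "dual_pair d n m"
  shows "proj d n m x \<bullet> y = x \<bullet> proj d n m y"
proof -
  have o: "(x - proj d n m x) \<bullet> proj d n m y = 0" for x y
  proof -
    have "(x - proj d n m x) \<bullet> v = 0" if "v \<in> span (n ` {..<d})" for v
      using that
    proof (induction rule: span_induct_alt)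
      case (step c v z)
      then show ?case using inner_proj[OF assms] by (auto simp: inner_diff_left inner_simps inner_commute)
    qed simp
    moreover have "proj d n m y \<in> span (n ` {..<d})"
      using assms unfolding proj_def dual_pair_def by (intro span_sum span_scale) auto
    ultimately show ?thesis by blast
  qed
  have "x \<bullet> proj d n m y = proj d n m x \<bullet> proj d n m y" "y \<bullet> proj d n m x = proj d n m y \<bullet> proj d n m x"
    using o[of x y] o[of y x] by (simp_all add: inner_diff_left)
  then show ?thesis by (metis inner_commute)
qed

text \<open>The differential of \<open>F\<close> vanishes on the tangent space, the common kernel of
  the differentials of the \<open>u j\<close>. So it is a combination of these, and Hamilton fields
  depend linearly on the differential.\<close>

lemma ham_vanish:
  assumes W: "open W" "w \<in> W" "w \<in> S" and sm: "\<And>j. j < d \<Longrightarrow> smooth_on W (u j)"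
    and S: "S \<inter> W = {z\<in>W. \<forall>j<d. u j z = 0}" and ind: "independent_at d u w"
    and F: "F differentiable (at w)" "open W'" "w \<in> W'" "\<And>z. z \<in> S \<inter> W' \<Longrightarrow> F z = c"
  obtains e where "ham F w = (\<Sum>j<d. e j *\<^sub>R ham (u j) w)"
proof -
  have lin: "linear (frechet_derivative (u j) (at w))" if "j < d" for j
    by (rule smooth_on_deriv_linear[OF sm[OF that] W(2)])
  obtain m n where m: "\<And>i j. i < d \<Longrightarrow> j < d \<Longrightarrow> frechet_derivative (u i) (at w) (m j) = (if i = j then 1 else 0)"
    by (rule dual_functionals[of d "\<lambda>j. frechet_derivative (u j) (at w)"]) (use lin ind independent_at_def in blast)+
  have dF: "(F has_derivative frechet_derivative F (at w)) (at w)" using F(1) frechet_derivative_works by blast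
  have e: "frechet_derivative F (at w) v = (\<Sum>j<d. frechet_derivative F (at w) (m j) * frechet_derivative (u j) (at w) v)" for v
  proof (rule functional_combination[OF linear_frechet_derivative[OF F(1)] lin m])
    fix v assume "\<And>j. j < d \<Longrightarrow> frechet_derivative (u j) (at w) v = 0"
    then have "v \<in> tangent S w" using tangent_regular[OF W sm S ind] by simp
    then show "frechet_derivative F (at w) v = 0" by (rule tangent_deriv_zero[OF _ dF F(2,3,4)])
  qed
  have du: "frechet_derivative (u j) (at w) v = symp v (ham (u j) w)" if "j < d" for j v
    by (rule deriv_ham[OF differentiableI[OF smooth_on_has_derivative[OF sm[OF that] W(2)]]])
  have "ham F w = (\<Sum>j<d. frechet_derivative F (at w) (m j) *\<^sub>R ham (u j) w)"
    by (rule ham_unique[OF F(1)], subst e) (simp add: symp_sum_right symp_simps du)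
  then show ?thesis by (rule that)
qed

text \<open>With \<open>V\<close> the range of \<open>proj d n m\<close>, every translate along \<open>V\<close> of the fibre variable meets \<open>S\<close> in one point, and
  \<open>\<zeta>\<close> is the translation needed. So \<open>\<zeta>\<close> and its brackets are determined by their values on \<open>S\<close>, where
  the brackets vanish since \<open>S\<close> is involutive. Likewise \<open>gt\<close> is \<open>g\<close> on \<open>S\<close>, extended constantly along \<open>V\<close>.\<close>

lemma transversal_chart:
  fixes W :: "'n::finite phase set" and u :: "nat \<Rightarrow> 'n phase \<Rightarrow> real"
  assumes W: "open W" "w0 \<in> W" "w0 \<in> S" and sm: "\<And>j. j < d \<Longrightarrow> smooth_on W (u j)"
    and S: "S \<inter> W = {z\<in>W. \<forall>j<d. u j z = 0}" and ind: "\<And>z. z \<in> W \<Longrightarrow> independent_at d u z"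
    and trans: "\<And>c. (\<And>b. (\<Sum>j<d. c j * frechet_derivative (u j) (at w0) (0, b)) = 0) \<Longrightarrow> \<forall>j<d. c j = 0"
    and invol: "\<And>w i j. w \<in> S \<inter> W \<Longrightarrow> i < d \<Longrightarrow> j < d \<Longrightarrow> poisson (u i) (u j) w = 0"
    and g: "smooth_on W g" "\<And>w j. w \<in> S \<inter> W \<Longrightarrow> j < d \<Longrightarrow> poisson (u j) g w = 0"
    and conic: "\<And>z t. z \<in> S \<Longrightarrow> 0 < t \<Longrightarrow> scl t z \<in> S"
  obtains D N \<epsilon> n m \<zeta> gt where
    "open D" "w0 \<in> D" "D \<subseteq> W" "dual_pair d n m"
    "smooth_on D \<zeta>" "\<And>z. z \<in> D \<Longrightarrow> proj d n m (\<zeta> z) = \<zeta> z" "S \<inter> D = {z\<in>D. \<zeta> z = 0}"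
    "\<And>z r. z \<in> D \<Longrightarrow> frechet_derivative \<zeta> (at z) (0, proj d n m r) = proj d n m r"
    "\<And>z a b. z \<in> D \<Longrightarrow> poisson (\<lambda>z. a \<bullet> \<zeta> z) (\<lambda>z. b \<bullet> \<zeta> z) z = 0"
    "smooth_on D gt" "\<And>z. z \<in> S \<inter> D \<Longrightarrow> gt z = g z"
    "\<And>z a. z \<in> D \<Longrightarrow> poisson gt (\<lambda>z. a \<bullet> \<zeta> z) z = 0"
    "\<And>z r. z \<in> D \<Longrightarrow> frechet_derivative gt (at z) (0, proj d n m r) = (0::real)"
    "open N" "w0 \<in> N" "N \<subseteq> D" "0 < \<epsilon>"
    "\<And>z t. z \<in> N \<Longrightarrow> \<bar>t - 1\<bar> < \<epsilon> \<Longrightarrow> scl t z \<in> D \<and> \<zeta> (scl t z) = t *\<^sub>R \<zeta> z"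
proof -
  have lin: "linear (frechet_derivative (u j) (at w0))" if "j < d" for j
    by (rule smooth_on_deriv_linear[OF sm[OF that] W(2)])
  have lin': "linear (\<lambda>b. frechet_derivative (u j) (at w0) (0, b))" if "j < d" for j
    using linear_compose[OF _ lin[OF that], of "\<lambda>b. (0, b)"] by (simp add: o_def linear_iff)
  obtain m n where mn: "\<And>i j. i < d \<Longrightarrow> j < d \<Longrightarrow> frechet_derivative (u i) (at w0) (0, m j) = (if i = j then 1 else 0)"
    and n: "\<And>i b. i < d \<Longrightarrow> frechet_derivative (u i) (at w0) (0, b) = n i \<bullet> b"
    and ms: "\<And>j. j < d \<Longrightarrow> m j \<in> span (n ` {..<d})"
    by (rule dual_functionals[of d "\<lambda>j b. frechet_derivative (u j) (at w0) (0, b)"]) (use lin' trans in blast)+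
  have dp: "dual_pair d n m" unfolding dual_pair_def using mn n ms by simp
  define \<pi> where "\<pi> = proj d n m"
  have lin\<pi>: "linear \<pi>" and bl\<pi>: "bounded_linear \<pi>" unfolding \<pi>_def by (rule linear_proj, rule bounded_linear_proj)
  have \<pi>\<pi>: "\<pi> (\<pi> x) = \<pi> x" for x unfolding \<pi>_def by (rule proj_proj[OF dp])
  have n\<pi>: "n i \<bullet> \<pi> x = n i \<bullet> x" if "i < d" for i x unfolding \<pi>_def by (rule inner_proj[OF dp that])
  \<comment> \<open>Shifts the fibre variable until its coordinate along \<open>n j\<close> equals
    \<open>u j\<close>, for every \<open>j\<close>. In the new coordinates \<open>S\<close> is given
    by linear equations in the fibre.\<close>
  define G where "G z = (fst z, snd z + (\<Sum>j<d. (u j z - n j \<bullet> snd z) *\<^sub>R m j))" for z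
  \<comment> \<open>Removes the component in the range of \<pi>, so it is constant on the translates
    along this range. On \<open>S\<close> it coincides with \<open>G\<close>.\<close>
  define \<kappa> where "\<kappa> z = (fst z, snd z - \<pi> (snd z))" for z :: "'n phase"
  have bl\<kappa>: "bounded_linear \<kappa>" unfolding \<kappa>_def
    by (intro bounded_linear_Pair bounded_linear_fst bounded_linear_sub bounded_linear_snd
      bounded_linear_compose[OF bl\<pi> bounded_linear_snd])
  have \<kappa>scl: "\<kappa> (scl t z) = scl t (\<kappa> z)" for t z
    by (simp add: \<kappa>_def scl_def linear_cmul[OF lin\<pi>] scaleR_diff_right)
  have nG: "n i \<bullet> snd (G z) = u i z" if "i < d" for i z
  proof -
    have "n i \<bullet> snd (G z) = n i \<bullet> snd z + (\<Sum>j<d. (u j z - n j \<bullet> snd z) * (n i \<bullet> m j))"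
      by (simp add: G_def inner_add_right inner_sum_right)
    also have "(\<Sum>j<d. (u j z - n j \<bullet> snd z) * (n i \<bullet> m j)) = (\<Sum>j<d. if i = j then u j z - n j \<bullet> snd z else 0)"
      by (rule sum.cong) (use dp that in \<open>auto simp: dual_pair_def\<close>)
    finally show ?thesis using that by simp
  qed
  have G\<pi>: "snd (G z) - \<pi> (snd (G z)) = snd z - \<pi> (snd z)" for z
  proof -
    have "snd (G z) - snd z = \<pi> (snd (G z) - snd z)"
    proof -
      have "\<pi> (snd (G z) - snd z) = (\<Sum>j<d. (u j z - n j \<bullet> snd z) *\<^sub>R m j)"
        unfolding \<pi>_def proj_def by (rule sum.cong) (auto simp: inner_diff_right nG)
      then show ?thesis by (simp add: G_def)
    qed
    then show ?thesis by (simp add: linear_diff[OF lin\<pi>] algebra_simps)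
  qed
  have GS: "G z = \<kappa> z" if "\<And>j. j < d \<Longrightarrow> u j z = 0" for z
    using that by (simp add: G_def \<kappa>_def \<pi>_def proj_def sum_negf)
  have sn: "smooth_on W (\<lambda>z. n j \<bullet> snd z)" for j
    by (intro smooth_on_bounded_linear[OF bounded_linear_inner_right W(1)] smooth_on_linear[OF bounded_linear_snd W(1)])
  have sG: "smooth_on W G" unfolding G_def
    by (intro smooth_on_Pair smooth_on_add smooth_on_sum smooth_on_scaleR smooth_on_diff sn sm
       smooth_on_linear[OF bounded_linear_fst] smooth_on_linear[OF bounded_linear_snd] smooth_on_const W(1)) auto
  have dG: "(G has_derivative (\<lambda>v. (fst v, snd v + (\<Sum>j<d. (frechet_derivative (u j) (at w0) v - n j \<bullet> snd v) *\<^sub>R m j)))) (at w0)"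
  proof -
    have "(G has_derivative (\<lambda>v. (fst v, snd v + (\<Sum>j<d. (u j w0 - n j \<bullet> snd w0) *\<^sub>R 0 + (frechet_derivative (u j) (at w0) v - n j \<bullet> snd v) *\<^sub>R m j)))) (at w0)"
      unfolding G_def
      by (intro has_derivative_Pair has_derivative_add has_derivative_sum has_derivative_scaleR has_derivative_diff
          has_derivative_const has_derivative_inner_right smooth_on_has_derivative[OF sm W(2)] has_derivative_fst
          has_derivative_snd has_derivative_ident) auto
    then show ?thesis by simp
  qed
  have injG: "v = 0" if v: "frechet_derivative G (at w0) v = 0" for v
  proof -
    have e: "fst v = 0" "snd v + (\<Sum>j<d. (frechet_derivative (u j) (at w0) v - n j \<bullet> snd v) *\<^sub>R m j) = 0"
      using v unfolding frechet_derivative_eqI[OF dG] by (simp_all add: zero_prod_def)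
    then have "v = (0, snd v)" by (simp add: prod_eq_iff)
    then have "frechet_derivative (u j) (at w0) v = n j \<bullet> snd v" if "j < d" for j using n[OF that] by metis
    then show ?thesis using e by (simp add: prod_eq_iff)
  qed
  obtain U' V' h where h: "open U'" "U' \<subseteq> W" "w0 \<in> U'" "open V'" "G w0 \<in> V'" "homeomorphism U' V' G h" "smooth_on V' h"
    by (rule inverse_function_smooth[OF W(1) sG W(2) injG]) blast+
  have hG: "h (G z) = z" "G z \<in> V'" if "z \<in> U'" for z using h(6) that by (auto simp: homeomorphism_def)
  have Gh: "G (h y) = y" "h y \<in> U'" if "y \<in> V'" for y using h(6) that by (auto simp: homeomorphism_def)
  \<comment> \<open>The point of \<open>S\<close> on the translate through \<open>z\<close>: its
    image under \<open>G\<close> has no component in the range of \<pi>, which means that all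
    \<open>u j\<close> vanish there.\<close>
  define P where "P z = h (\<kappa> z)" for z
  define E where "E = \<kappa> -` V'"
  have oE: "open E" unfolding E_def
    using h(4) bl\<kappa> by (intro open_vimage) (auto simp: linear_continuous_on)
  have PE: "P z \<in> U'" "G (P z) = \<kappa> z" if "z \<in> E" for z using Gh that by (auto simp: E_def P_def)
  have Pu: "u j (P z) = 0" if "z \<in> E" "j < d" for j z
  proof -
    have "u j (P z) = n j \<bullet> snd (\<kappa> z)" using nG[OF that(2), of "P z"] PE[OF that(1)] by simp
    then show ?thesis by (simp add: \<kappa>_def inner_diff_right n\<pi>[OF that(2)])
  qed
  have PS: "P z \<in> S" if "z \<in> E" for z
  proof -
    have "P z \<in> {z\<in>W. \<forall>j<d. u j z = 0}" using PE[OF that] Pu[OF that] h(2) by auto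
    then show ?thesis unfolding S[symmetric] by simp
  qed
  have P\<kappa>: "\<kappa> (P z) = \<kappa> z" if "z \<in> E" for z using GS[of "P z"] Pu[OF that] PE[OF that] by simp
  have fP: "fst (P z) = fst z" if "z \<in> E" for z using P\<kappa>[OF that] by (simp add: \<kappa>_def)
  define \<zeta> where "\<zeta> z = snd z - snd (P z)" for z
  have \<pi>\<zeta>: "\<pi> (\<zeta> z) = \<zeta> z" if "z \<in> E" for z
    using P\<kappa>[OF that] by (simp add: \<kappa>_def \<zeta>_def linear_diff[OF lin\<pi>] algebra_simps)
  have Pz: "P z = z - (0, \<zeta> z)" if "z \<in> E" for z by (simp add: prod_eq_iff \<zeta>_def fP[OF that])
  have sP: "smooth_on E P" unfolding P_def
    by (rule smooth_on_compose[OF oE h(4) _ smooth_on_linear[OF bl\<kappa> oE] h(7)]) (simp add: E_def)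
  have s\<zeta>: "smooth_on E \<zeta>" unfolding \<zeta>_def
    by (intro smooth_on_diff[OF oE] smooth_on_linear[OF bounded_linear_snd oE] smooth_on_bounded_linear[OF bounded_linear_snd oE sP])
  have \<kappa>t: "\<kappa> (z + (0, \<pi> r)) = \<kappa> z" for z r
    by (simp add: \<kappa>_def linear_add[OF lin\<pi>] \<pi>\<pi>)
  have Pt: "P (z + (0, \<pi> r)) = P z" and \<zeta>t: "\<zeta> (z + (0, \<pi> r)) = \<zeta> z + \<pi> r" for z r
    by (simp_all add: P_def \<zeta>_def \<kappa>t)
  define gt where "gt z = g (P z)" for z
  have sgt: "smooth_on E gt" unfolding gt_def
    by (rule smooth_on_compose[OF oE W(1) _ sP g(1)]) (use PE h(2) in auto)
  define D where "D = E \<inter> U'"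
  have oD: "open D" unfolding D_def using oE h(1) by blast
  have "\<kappa> w0 = G w0"
  proof -
    have "w0 \<in> {z\<in>W. \<forall>j<d. u j z = 0}" using W S by blast
    then show ?thesis using GS[of w0] by simp
  qed
  then have w0: "w0 \<in> D" using h(3,5) by (simp add: D_def E_def)
  have DE: "z \<in> E" "z \<in> U'" "z \<in> W" if "z \<in> D" for z using that h(2) by (auto simp: D_def)
  have PD: "P z \<in> D" if "z \<in> E" for z using PE[OF that] P\<kappa>[OF that] that by (simp add: D_def E_def)
  have SP: "P z = z" if "z \<in> S" "z \<in> U'" for z
  proof -
    have "z \<in> {z\<in>W. \<forall>j<d. u j z = 0}" using that S h(2) by blast
    then have "\<kappa> z = G z" using GS[of z] by simp
    then show ?thesis using hG that by (simp add: P_def)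
  qed
  have SD: "S \<inter> D = {z\<in>D. \<zeta> z = 0}"
  proof (intro set_eqI iffI)
    show "z \<in> {z\<in>D. \<zeta> z = 0}" if "z \<in> S \<inter> D" for z using SP[of z] DE[of z] that by (simp add: \<zeta>_def)
    show "z \<in> S \<inter> D" if "z \<in> {z\<in>D. \<zeta> z = 0}" for z
      using that Pz[of z] PS[of z] DE[of z] by (auto simp flip: zero_prod_def)
  qed
  have along: "frechet_derivative F (at z) (0, \<pi> r) = c"
    if "smooth_on E F" "z \<in> E" "\<And>s. F (z + (0, \<pi> (s *\<^sub>R r))) = F z + s *\<^sub>R c"
    for F :: "'n phase \<Rightarrow> 'b::real_normed_vector" and z r c
  proof -
    have "((\<lambda>s. z + s *\<^sub>R (0, \<pi> r)) has_derivative (\<lambda>s. s *\<^sub>R (0, \<pi> r))) (at 0)" by (auto intro!: derivative_eq_intros)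
    moreover have "(F has_derivative frechet_derivative F (at z)) (at (z + 0 *\<^sub>R (0, \<pi> r)))"
      using smooth_on_has_derivative[OF that(1,2)] by (simp flip: zero_prod_def)
    ultimately have "((\<lambda>s. F (z + s *\<^sub>R (0, \<pi> r))) has_derivative (\<lambda>s. frechet_derivative F (at z) (s *\<^sub>R (0, \<pi> r)))) (at 0)"
      by (rule has_derivative_compose)
    moreover have "(\<lambda>s. F (z + s *\<^sub>R (0, \<pi> r))) = (\<lambda>s. F z + s *\<^sub>R c)"
      using that(3) by (simp add: linear_cmul[OF lin\<pi>])
    moreover have "((\<lambda>s. F z + s *\<^sub>R c) has_derivative (\<lambda>s. s *\<^sub>R c)) (at 0)" by (auto intro!: derivative_eq_intros)
    ultimately have "(\<lambda>s. frechet_derivative F (at z) (s *\<^sub>R (0, \<pi> r))) = (\<lambda>s. s *\<^sub>R c)"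
      by (metis has_derivative_unique)
    from fun_cong[OF this, of 1] show ?thesis by simp
  qed
  have D\<zeta>: "frechet_derivative \<zeta> (at z) (0, \<pi> r) = \<pi> r" if "z \<in> E" for z r
    by (rule along[OF s\<zeta> that], subst \<zeta>t) (simp add: linear_cmul[OF lin\<pi>])
  have Dgt: "frechet_derivative gt (at z) (0, \<pi> r) = 0" if "z \<in> E" for z r
    by (rule along[OF sgt that], unfold gt_def, subst Pt) simp
  have sa: "smooth_on E (\<lambda>z. a \<bullet> \<zeta> z)" for a
    by (rule smooth_on_bounded_linear[OF bounded_linear_inner_right oE s\<zeta>])
  \<comment> \<open>Translation by \<open>- \<zeta> z\<close> in the fibre carries \<open>z\<close>
    to \<open>P z\<close>, and it changes \<open>F\<close> only by a constant. This is how brackets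
    known on \<open>S\<close> are transferred to a neighbourhood.\<close>
  have shift: "ham F z = ham F (P z)" if "smooth_on E F" "z \<in> E" "\<And>w. F (w - (0, \<zeta> z)) = F w - c"
    for F :: "'n phase \<Rightarrow> real" and z c
  proof (rule ham_cong)
    have "((\<lambda>w. w - (0, \<zeta> z)) has_derivative (\<lambda>v. v)) (at z)" by (auto intro!: derivative_eq_intros)
    moreover have "(F has_derivative frechet_derivative F (at (P z))) (at (z - (0, \<zeta> z)))"
      using smooth_on_has_derivative[OF that(1), of "P z"] PD[OF that(2)] DE(1) Pz[OF that(2)] by simp
    ultimately have "((\<lambda>w. F (w - (0, \<zeta> z))) has_derivative (\<lambda>v. frechet_derivative F (at (P z)) v)) (at z)"
      by (rule has_derivative_compose)
    then have "((\<lambda>w. F w - c + c) has_derivative (\<lambda>v. frechet_derivative F (at (P z)) v + 0)) (at z)"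
      unfolding that(3) by (rule has_derivative_add[OF _ has_derivative_const])
    then show "frechet_derivative F (at z) = frechet_derivative F (at (P z))"
      by (intro frechet_derivative_eqI) simp
  qed
  have minus: "w + (0, - x) = w - (0, x)" for w :: "'n phase" and x by (simp add: prod_eq_iff)
  have ham\<zeta>P: "ham (\<lambda>z. a \<bullet> \<zeta> z) z = ham (\<lambda>z. a \<bullet> \<zeta> z) (P z)" if "z \<in> E" for z a
  proof (rule shift[OF sa that])
    show "a \<bullet> \<zeta> (w - (0, \<zeta> z)) = a \<bullet> \<zeta> w - a \<bullet> \<zeta> z" for w
      using \<zeta>t[of w "- \<zeta> z"] \<pi>\<zeta>[OF that] by (simp add: linear_neg[OF lin\<pi>] inner_diff_right minus)
  qed
  have hamgtP: "ham gt z = ham gt (P z)" if "z \<in> E" for z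
  proof (rule shift[OF sgt that])
    show "gt (w - (0, \<zeta> z)) = gt w - 0" for w
      using Pt[of w "- \<zeta> z"] \<pi>\<zeta>[OF that] by (simp add: linear_neg[OF lin\<pi>] gt_def minus)
  qed
  have diffu: "u j differentiable (at w)" if "w \<in> W" "j < d" for w j
    using smooth_on_has_derivative[OF sm[OF that(2)] that(1)] by (rule differentiableI)
  have diffg: "g differentiable (at w)" if "w \<in> W" for w
    using smooth_on_has_derivative[OF g(1) that] by (rule differentiableI)
  have diffE: "F differentiable (at w)" if "smooth_on E F" "w \<in> E" for w and F :: "'n phase \<Rightarrow> real"
    using smooth_on_has_derivative[OF that] by (rule differentiableI)
  have uu: "symp (ham (u i) w) (ham (u j) w) = 0" if "w \<in> S \<inter> D" "i < d" "j < d" for w i j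
    using invol[of w i j] that DE poisson_symp[OF diffu, of w j "u i"] by auto
  have ug: "symp (ham (u j) w) (ham g w) = 0" if "w \<in> S \<inter> D" "j < d" for w j
    using g(2)[of w j] that DE poisson_symp[OF diffg, of w "u j"] by auto
  have ham\<zeta>: "\<exists>e. ham (\<lambda>z. a \<bullet> \<zeta> z) w = (\<Sum>j<d. e j *\<^sub>R ham (u j) w)" if w: "w \<in> S \<inter> D" for w a
  proof -
    have w': "w \<in> W" "w \<in> S" "w \<in> D" using w DE by auto
    have z: "a \<bullet> \<zeta> z = 0" if "z \<in> S \<inter> D" for z using that unfolding SD by simp
    obtain e where "ham (\<lambda>z. a \<bullet> \<zeta> z) w = (\<Sum>j<d. e j *\<^sub>R ham (u j) w)"
      by (rule ham_vanish[OF W(1) w'(1,2) sm S ind[OF w'(1)] diffE[OF sa DE(1)[OF w'(3)]] oD w'(3) z])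
    then show ?thesis by blast
  qed
  have hamgt: "\<exists>e. ham gt w = ham g w + (\<Sum>j<d. e j *\<^sub>R ham (u j) w)" if w: "w \<in> S \<inter> D" for w
  proof -
    have w': "w \<in> W" "w \<in> S" "w \<in> D" using w DE by auto
    have z: "gt z - g z = 0" if "z \<in> S \<inter> D" for z using that SP[of z] DE[of z] by (simp add: gt_def)
    have d: "(\<lambda>z. gt z - g z) differentiable (at w)"
      by (rule differentiable_diff[OF diffE[OF sgt DE(1)[OF w'(3)]] diffg[OF w'(1)]])
    obtain e where e: "ham (\<lambda>z. gt z - g z) w = (\<Sum>j<d. e j *\<^sub>R ham (u j) w)"
      by (rule ham_vanish[OF W(1) w'(1,2) sm S ind[OF w'(1)] d oD w'(3) z])
    have "ham gt w = ham g w + (\<Sum>j<d. e j *\<^sub>R ham (u j) w)"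
      using ham_add[OF d diffg[OF w'(1)]] e by simp
    then show ?thesis by blast
  qed
  have br: "poisson (\<lambda>z. a \<bullet> \<zeta> z) (\<lambda>z. b \<bullet> \<zeta> z) z = 0" if "z \<in> D" for z a b
  proof -
    have w: "P z \<in> S \<inter> D" "z \<in> E" using PS PD DE that by auto
    obtain e where e: "ham (\<lambda>z. a \<bullet> \<zeta> z) (P z) = (\<Sum>j<d. e j *\<^sub>R ham (u j) (P z))" using ham\<zeta>[OF w(1)] by blast
    obtain e' where e': "ham (\<lambda>z. b \<bullet> \<zeta> z) (P z) = (\<Sum>j<d. e' j *\<^sub>R ham (u j) (P z))" using ham\<zeta>[OF w(1)] by blast
    show ?thesis
      unfolding poisson_symp[OF diffE[OF sa w(2)]] ham\<zeta>P[OF w(2)] e e'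
      by (simp add: symp_sum_right symp_sum_left symp_simps uu[OF w(1)])
  qed
  have brg: "poisson gt (\<lambda>z. a \<bullet> \<zeta> z) z = 0" if "z \<in> D" for z a
  proof -
    have w: "P z \<in> S \<inter> D" "z \<in> E" using PS PD DE that by auto
    obtain e where e: "ham (\<lambda>z. a \<bullet> \<zeta> z) (P z) = (\<Sum>j<d. e j *\<^sub>R ham (u j) (P z))" using ham\<zeta>[OF w(1)] by blast
    obtain e' where e': "ham gt (P z) = ham g (P z) + (\<Sum>j<d. e' j *\<^sub>R ham (u j) (P z))" using hamgt[OF w(1)] by blast
    have "symp (ham g (P z)) (ham (u j) (P z)) = 0" if "j < d" for j
      using ug[OF w(1) that] by (subst symp_commute) simp
    then show ?thesis
      unfolding poisson_symp[OF diffE[OF sa w(2)]] ham\<zeta>P[OF w(2)] hamgtP[OF w(2)] e e'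
      by (simp add: symp_sum_right symp_sum_left symp_simps uu[OF w(1)])
  qed
  \<comment> \<open>As long as the dilated points stay in the domain of the inverse, dilation
    commutes with \<open>P\<close>, because \<open>S\<close> is conic. A product neighbourhood of
    \<open>(1, w0)\<close> in this open set gives one \<open>\<epsilon>\<close> for all points of
    \<open>N\<close>.\<close>
  define O1 where "O1 = {p :: real \<times> 'n phase. snd p \<in> D \<and> 0 < fst p \<and> scl (fst p) (snd p) \<in> D \<and> scl (fst p) (P (snd p)) \<in> U'}"
  have oO: "open O1"
  proof -
    have o0: "open ({0::real<..} \<times> D)" using oD by (intro open_Times) auto
    have cs: "continuous_on T (\<lambda>p. scl (f p) (k p))" if "continuous_on T f" "continuous_on T k"
      for T f and k :: "real \<times> 'n phase \<Rightarrow> 'n phase"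
      unfolding scl_def by (intro continuous_intros that)
    have cP: "continuous_on ({0<..} \<times> D) (\<lambda>p. P (snd p))"
      by (rule continuous_on_compose2[OF smooth_on_imp_continuous_on[OF sP]]) (auto intro: continuous_intros DE)
    have "open ((\<lambda>p. scl (fst p) (snd p)) -` D \<inter> ({0<..} \<times> D))"
      by (rule continuous_on_open_vimage[OF o0, THEN iffD1, rule_format, OF _ oD]) (intro cs continuous_intros)
    moreover have "open ((\<lambda>p. scl (fst p) (P (snd p))) -` U' \<inter> ({0<..} \<times> D))"
      by (rule continuous_on_open_vimage[OF o0, THEN iffD1, rule_format, OF _ h(1)]) (intro cs cP continuous_intros)
    ultimately have "open (((\<lambda>p. scl (fst p) (snd p)) -` D \<inter> ({0<..} \<times> D)) \<inter> ((\<lambda>p. scl (fst p) (P (snd p))) -` U' \<inter> ({0<..} \<times> D)))"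
      by (rule open_Int)
    also have "\<dots> = O1" by (auto simp: O1_def)
    finally show ?thesis .
  qed
  have m1: "(1, w0) \<in> O1" using w0 SP[OF W(3) h(3)] h(3) by (simp add: O1_def)
  obtain A N where AN: "open A" "open N" "(1, w0) \<in> A \<times> N" "A \<times> N \<subseteq> O1"
    by (rule open_prod_elim[OF oO m1])
  obtain \<epsilon> where \<epsilon>: "0 < \<epsilon>" "ball 1 \<epsilon> \<subseteq> A" using AN by (meson SigmaD1 open_contains_ball)
  have loc: "scl t z \<in> D \<and> \<zeta> (scl t z) = t *\<^sub>R \<zeta> z" if z: "z \<in> N" and t: "\<bar>t - 1\<bar> < \<epsilon>" for z t
  proof -
    have "t \<in> A" using t \<epsilon> by (auto simp: dist_real_def subset_iff abs_minus_commute)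
    then have "(t, z) \<in> O1" using z AN by blast
    then have o: "z \<in> D" "0 < t" "scl t z \<in> D" "scl t (P z) \<in> U'" by (auto simp: O1_def)
    have "scl t (P z) \<in> S" using PS[OF DE(1)[OF o(1)]] o(2) by (rule conic)
    then have "scl t (P z) \<in> {z\<in>W. \<forall>j<d. u j z = 0}" using S o(4) h(2) by blast
    then have "G (scl t (P z)) = \<kappa> (scl t (P z))" by (intro GS) auto
    then have "G (scl t (P z)) = \<kappa> (scl t z)" using P\<kappa>[OF DE(1)[OF o(1)]] by (simp add: \<kappa>scl)
    then have "P (scl t z) = scl t (P z)" using hG(1)[OF o(4)] by (simp add: P_def)
    then show ?thesis using o by (simp add: \<zeta>_def scaleR_diff_right)
  qed
  have ND: "N \<subseteq> D"
  proof
    fix z assume "z \<in> N"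
    then have "(1, z) \<in> O1" using AN by blast
    then show "z \<in> D" by (simp add: O1_def)
  qed
  show ?thesis
  proof (rule that[of D n m \<zeta> gt N \<epsilon>])
    show "smooth_on D \<zeta>" "smooth_on D gt" using s\<zeta> sgt smooth_on_subset DE(1) by blast+
    show "D \<subseteq> W" using DE by blast
    show "gt z = g z" if "z \<in> S \<inter> D" for z using that SP[of z] DE[of z] by (simp add: gt_def)
  qed (use oD w0 dp SD br brg AN ND \<epsilon>(1) loc \<pi>\<zeta> D\<zeta> Dgt DE in \<open>auto simp: \<pi>_def\<close>)
qed

section \<open>Homogeneous extension of the chart to a cone\<close>

lemma conic_open_snd: "conic_open U \<Longrightarrow> z \<in> U \<Longrightarrow> snd z \<noteq> 0"
  by (simp add: conic_open_def)

lemma conic_open_open: "conic_open U \<Longrightarrow> open U"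
  by (simp add: conic_open_def)

lemma open_snd_nonzero: "open {z :: 'a::real_normed_vector \<times> 'b::real_normed_vector. snd z \<noteq> 0}"
  by (intro open_Collect_neq continuous_intros)

text \<open>For positive \<open>\<rho>\<close> the radial projection onto the sphere of radius
  \<open>\<rho>\<close> in the fibre. It is homogeneous of degree 0 in the sense of
  \<open>rescale_scl\<close>.\<close>

definition rescale :: "real \<Rightarrow> 'n::finite phase \<Rightarrow> 'n phase" where
  "rescale \<rho> z = scl (\<rho> * inverse (norm (snd z))) z"

definition cone :: "real \<Rightarrow> 'n::finite phase set \<Rightarrow> 'n phase set" where
  "cone \<rho> N = {z. snd z \<noteq> 0 \<and> rescale \<rho> z \<in> N}"

lemma rescale_scl: "0 < t \<Longrightarrow> rescale \<rho> (scl t z) = rescale \<rho> z"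
  by (simp add: rescale_def field_simps)

lemma scl_rescale: "snd z \<noteq> 0 \<Longrightarrow> 0 < \<rho> \<Longrightarrow> scl (norm (snd z) * inverse \<rho>) (rescale \<rho> z) = z"
  by (simp add: rescale_def field_simps)

lemma smooth_on_rescale: "smooth_on {z :: 'n::finite phase. snd z \<noteq> 0} (rescale \<rho>)"
proof -
  have "smooth_on {z. snd z \<noteq> 0} (\<lambda>z :: 'n phase. (fst z, (\<rho> * inverse (norm (snd z))) *\<^sub>R snd z))"
    by (intro smooth_on_Pair smooth_on_scaleR smooth_on_mult smooth_on_inverse smooth_on_norm smooth_on_const
       smooth_on_linear[OF bounded_linear_fst] smooth_on_linear[OF bounded_linear_snd] open_snd_nonzero) auto
  then show ?thesis by (simp add: rescale_def[abs_def] scl_def)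
qed

lemma conic_open_cone:
  fixes N :: "'n::finite phase set"
  assumes "open N" shows "conic_open (cone \<rho> N)"
proof -
  have "open (rescale \<rho> -` N \<inter> {z :: 'n phase. snd z \<noteq> 0})"
    by (rule continuous_on_open_vimage[OF open_snd_nonzero, THEN iffD1, rule_format, OF _ assms])
       (rule smooth_on_imp_continuous_on[OF smooth_on_rescale])
  also have "rescale \<rho> -` N \<inter> {z. snd z \<noteq> 0} = cone \<rho> N" by (auto simp: cone_def)
  finally have "open (cone \<rho> N)" .
  moreover have "(fst z, t *\<^sub>R snd z) \<in> cone \<rho> N" if "z \<in> cone \<rho> N" "0 < t" for z t
    using that rescale_scl[OF that(2), of \<rho> z] by (simp add: cone_def scl_def)
  ultimately show ?thesis by (simp add: conic_open_def cone_def)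
qed

lemma rescale_self: "norm (snd z) = \<rho> \<Longrightarrow> snd z \<noteq> 0 \<Longrightarrow> rescale \<rho> z = z"
  by (auto simp: rescale_def)

lemma cone_subset:
  assumes "conic_open U" "N \<subseteq> U" "0 < \<rho>" shows "cone \<rho> N \<subseteq> U"
proof
  fix z assume z: "z \<in> cone \<rho> N"
  then have "rescale \<rho> z \<in> U" "0 < norm (snd z) * inverse \<rho>" using assms by (auto simp: cone_def)
  then have "scl (norm (snd z) * inverse \<rho>) (rescale \<rho> z) \<in> U" using assms(1) conic_open_scl by blast
  moreover have "scl (norm (snd z) * inverse \<rho>) (rescale \<rho> z) = z" using z scl_rescale[of z \<rho>] assms(3) by (simp add: cone_def del: scl_scl)
  ultimately show "z \<in> U" by simp
qed

text \<open>\<open>\<zeta>\<close> is extended from the sphere through \<open>w0\<close> with degree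
  1. Near \<open>w0\<close> this changes nothing, since \<open>\<zeta>\<close> is already
  homogeneous for dilations close to 1, and everything else is transported by dilation.
  \<open>gt\<close> stays on a neighbourhood \<open>D\<close>, because its flow will be followed
  only near \<open>w0\<close>.\<close>

lemma transversal_conic_chart:
  fixes W :: "'n::finite phase set" and u :: "nat \<Rightarrow> 'n phase \<Rightarrow> real"
  assumes U: "conic_open U" "W \<subseteq> U"
    and W: "open W" "w0 \<in> W" "w0 \<in> S" and sm: "\<And>j. j < d \<Longrightarrow> smooth_on W (u j)"
    and S: "S \<inter> W = {z\<in>W. \<forall>j<d. u j z = 0}" and ind: "\<And>z. z \<in> W \<Longrightarrow> independent_at d u z"
    and trans: "\<And>c. (\<And>b. (\<Sum>j<d. c j * frechet_derivative (u j) (at w0) (0, b)) = 0) \<Longrightarrow> \<forall>j<d. c j = 0"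
    and invol: "\<And>w i j. w \<in> S \<inter> W \<Longrightarrow> i < d \<Longrightarrow> j < d \<Longrightarrow> poisson (u i) (u j) w = 0"
    and g: "smooth_on W g" "\<And>w j. w \<in> S \<inter> W \<Longrightarrow> j < d \<Longrightarrow> poisson (u j) g w = 0"
    and conic: "\<And>z t. z \<in> S \<Longrightarrow> 0 < t \<Longrightarrow> scl t z \<in> S"
  obtains U1 D n m \<zeta> gt where
    "conic_open U1" "w0 \<in> U1" "U1 \<subseteq> U" "open D" "w0 \<in> D" "D \<subseteq> U1" "D \<subseteq> W" "dual_pair d n m"
    "smooth_on U1 \<zeta>" "homogeneous 1 U1 \<zeta>"
    "\<And>z. z \<in> U1 \<Longrightarrow> proj d n m (\<zeta> z) = \<zeta> z" "S \<inter> U1 = {z\<in>U1. \<zeta> z = 0}"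
    "\<And>z r. z \<in> U1 \<Longrightarrow> frechet_derivative \<zeta> (at z) (0, proj d n m r) = proj d n m r"
    "\<And>z a b. z \<in> U1 \<Longrightarrow> poisson (\<lambda>z. a \<bullet> \<zeta> z) (\<lambda>z. b \<bullet> \<zeta> z) z = 0"
    "smooth_on D gt" "\<And>z. z \<in> S \<inter> D \<Longrightarrow> gt z = g z"
    "\<And>z a. z \<in> D \<Longrightarrow> poisson gt (\<lambda>z. a \<bullet> \<zeta> z) z = 0"
    "\<And>z r. z \<in> D \<Longrightarrow> frechet_derivative gt (at z) (0, proj d n m r) = (0::real)"
proof -
  obtain D N \<epsilon> n m \<zeta> gt where D: "open D" "w0 \<in> D" "D \<subseteq> W" and dp: "dual_pair d n m"
    and s\<zeta>: "smooth_on D \<zeta>" and \<pi>\<zeta>: "\<And>z. z \<in> D \<Longrightarrow> proj d n m (\<zeta> z) = \<zeta> z" and SD: "S \<inter> D = {z\<in>D. \<zeta> z = 0}"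
    and D\<zeta>: "\<And>z r. z \<in> D \<Longrightarrow> frechet_derivative \<zeta> (at z) (0, proj d n m r) = proj d n m r"
    and br: "\<And>z a b. z \<in> D \<Longrightarrow> poisson (\<lambda>z. a \<bullet> \<zeta> z) (\<lambda>z. b \<bullet> \<zeta> z) z = 0"
    and sgt: "smooth_on D gt" and gt: "\<And>z. z \<in> S \<inter> D \<Longrightarrow> gt z = g z"
    and brg: "\<And>z a. z \<in> D \<Longrightarrow> poisson gt (\<lambda>z. a \<bullet> \<zeta> z) z = 0"
    and Dgt: "\<And>z r. z \<in> D \<Longrightarrow> frechet_derivative gt (at z) (0, proj d n m r) = (0::real)"
    and N: "open N" "w0 \<in> N" "N \<subseteq> D" "0 < \<epsilon>"
    and loc: "\<And>z t. z \<in> N \<Longrightarrow> \<bar>t - 1\<bar> < \<epsilon> \<Longrightarrow> scl t z \<in> D \<and> \<zeta> (scl t z) = t *\<^sub>R \<zeta> z"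
    by (rule transversal_chart[OF W sm S ind trans invol g conic]) blast+
  define \<rho> where "\<rho> = norm (snd w0)"
  have w0: "snd w0 \<noteq> 0" using conic_open_snd[OF U(1)] U(2) W(2) by blast
  then have \<rho>: "0 < \<rho>" by (simp add: \<rho>_def)
  define U1 where "U1 = cone \<rho> N"
  have co: "conic_open U1" unfolding U1_def by (rule conic_open_cone[OF N(1)])
  have oU: "open U1" by (rule conic_open_open[OF co])
  have U1z: "snd z \<noteq> 0" "rescale \<rho> z \<in> N" if "z \<in> U1" for z using that by (auto simp: U1_def cone_def)
  have w0U: "w0 \<in> U1" using w0 N(2) rescale_self[of w0 \<rho>] by (simp add: U1_def cone_def \<rho>_def)
  have UU: "U1 \<subseteq> U" unfolding U1_def using N(3) D(3) U(2) \<rho> by (intro cone_subset[OF U(1)]) auto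
  define Z where "Z z = (norm (snd z) * inverse \<rho>) *\<^sub>R \<zeta> (rescale \<rho> z)" for z
  have sZ: "smooth_on U1 Z"
    unfolding Z_def
  proof (intro smooth_on_scaleR smooth_on_mult oU smooth_on_const smooth_on_norm smooth_on_linear[OF bounded_linear_snd])
    show "smooth_on U1 (\<lambda>z. \<zeta> (rescale \<rho> z))"
      by (rule smooth_on_compose[OF oU D(1) _ smooth_on_subset[OF smooth_on_rescale] s\<zeta>]) (use U1z N in auto)
  qed (use U1z in auto)
  have hZ: "homogeneous 1 U1 Z"
    unfolding homogeneous_def
  proof (intro ballI allI impI)
    fix z t assume "z \<in> U1" "0 < (t::real)"
    then show "Z (fst z, t *\<^sub>R snd z) = (t powr 1) *\<^sub>R Z z"
      using rescale_scl[of t \<rho> z] by (simp add: Z_def scl_def)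
  qed
  \<comment> \<open>On this set the dilation to the sphere is so close to 1 that the extension
    agrees with the original \<open>\<zeta>\<close>. Every ray of \<open>U1\<close> meets it, which
    is what \<open>unscale\<close> exploits.\<close>
  define Y where "Y = {z\<in>N. snd z \<noteq> 0 \<and> \<bar>\<rho> * inverse (norm (snd z)) - 1\<bar> < \<epsilon>}"
  have oY: "open Y"
  proof -
    have o0: "open (N \<inter> {z. snd z \<noteq> 0})" using N(1) open_snd_nonzero by blast
    have c: "continuous_on (N \<inter> {z. snd z \<noteq> 0}) (\<lambda>z. \<bar>\<rho> * inverse (norm (snd z)) - 1\<bar>)"
      by (intro continuous_intros) auto
    have "open ((\<lambda>z. \<bar>\<rho> * inverse (norm (snd z)) - 1\<bar>) -` {..<\<epsilon>} \<inter> (N \<inter> {z. snd z \<noteq> 0}))"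
      by (rule continuous_on_open_vimage[OF o0, THEN iffD1, rule_format, OF c]) simp
    also have "\<dots> = Y" by (auto simp: Y_def)
    finally show ?thesis .
  qed
  have ZY: "Z z = \<zeta> z" if "z \<in> Y" for z
  proof -
    have "\<zeta> (rescale \<rho> z) = (\<rho> * inverse (norm (snd z))) *\<^sub>R \<zeta> z"
      unfolding rescale_def using loc that by (auto simp: Y_def)
    moreover have "(norm (snd z) * inverse \<rho> * (\<rho> * inverse (norm (snd z)))) = 1"
      using that \<rho> by (simp add: Y_def field_simps)
    ultimately show ?thesis by (simp only: Z_def scaleR_scaleR scaleR_one)
  qed
  have Y1: "rescale \<rho> z \<in> Y" if "z \<in> U1" for z
  proof -
    have "norm (snd (rescale \<rho> z)) = \<rho>" using U1z(1)[OF that] \<rho> by (simp add: rescale_def)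
    then show ?thesis using U1z[OF that] \<rho> N(4) by (auto simp: Y_def)
  qed
  have YD: "z \<in> D" if "z \<in> Y" for z using that N(3) by (auto simp: Y_def)
  have dZ: "Z differentiable (at z)" if "z \<in> U1" for z using smooth_on_has_derivative[OF sZ that] by (rule differentiableI)
  have dY: "frechet_derivative Z (at z) = frechet_derivative \<zeta> (at z)" if "z \<in> Y" for z
    by (rule frechet_derivative_cong_open(1)[OF oY that ZY])
  have dYa: "frechet_derivative (\<lambda>z. a \<bullet> Z z) (at z) = frechet_derivative (\<lambda>z. a \<bullet> \<zeta> z) (at z)" if "z \<in> Y" for z a
    by (rule frechet_derivative_cong_open(1)[OF oY that]) (simp add: ZY)
  have hY: "ham (\<lambda>z. a \<bullet> Z z) z = ham (\<lambda>z. a \<bullet> \<zeta> z) z" if "z \<in> Y" for z a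
    by (rule ham_cong[OF dYa[OF that]])
  have unscale: "\<exists>t z1. 0 < t \<and> z1 \<in> Y \<and> z1 \<in> U1 \<and> z = scl t z1" if "z \<in> U1" for z
  proof (intro exI conjI)
    show "0 < norm (snd z) * inverse \<rho>" using U1z[OF that] \<rho> by simp
    show "z = scl (norm (snd z) * inverse \<rho>) (rescale \<rho> z)" using scl_rescale[OF U1z(1)[OF that] \<rho>] by simp
    show "rescale \<rho> z \<in> U1" unfolding rescale_def
      using U1z[OF that] \<rho> by (intro conic_open_scl[OF co that]) simp
  qed (rule Y1[OF that])
  have DZ: "frechet_derivative Z (at z) (0, proj d n m r) = proj d n m r" if zU: "z \<in> U1" for z r
  proof -
    obtain t z1 where t: "0 < t" "z1 \<in> Y" "z1 \<in> U1" "z = scl t z1" using unscale[OF zU] by blast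
    have "frechet_derivative Z (at z) (scl t (0, proj d n m ((1 / t) *\<^sub>R r))) = (t powr 1) *\<^sub>R frechet_derivative Z (at z1) (0, proj d n m ((1 / t) *\<^sub>R r))"
      unfolding t(4) using t dZ zU by (intro homogeneous_deriv[OF co hZ]) auto
    also have "frechet_derivative Z (at z1) (0, proj d n m ((1 / t) *\<^sub>R r)) = proj d n m ((1 / t) *\<^sub>R r)"
      unfolding dY[OF t(2)] by (rule D\<zeta>[OF YD[OF t(2)]])
    finally show ?thesis using t(1) by (simp add: scl_def linear_cmul[OF linear_proj])
  qed
  have sa: "smooth_on U1 (\<lambda>z. a \<bullet> Z z)" for a
    by (rule smooth_on_bounded_linear[OF bounded_linear_inner_right oU sZ])
  have da: "(\<lambda>z. a \<bullet> Z z) differentiable (at z)" if "z \<in> U1" for z a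
    using smooth_on_has_derivative[OF sa that] by (rule differentiableI)
  have da': "(\<lambda>z. a \<bullet> \<zeta> z) differentiable (at z)" if "z \<in> D" for z a
    using smooth_on_has_derivative[OF smooth_on_bounded_linear[OF bounded_linear_inner_right D(1) s\<zeta>] that] by (rule differentiableI)
  have ha: "homogeneous 1 U1 (\<lambda>z. a \<bullet> Z z)" for a using hZ by (simp add: homogeneous_def)
  have brZ: "poisson (\<lambda>z. a \<bullet> Z z) (\<lambda>z. b \<bullet> Z z) z = 0" if zU: "z \<in> U1" for z a b
  proof -
    obtain t z1 where t: "0 < t" "z1 \<in> Y" "z1 \<in> U1" "z = scl t z1" using unscale[OF zU] by blast
    have h: "ham (\<lambda>z. a \<bullet> Z z) z = (t powr (1 - 1)) *\<^sub>R scl t (ham (\<lambda>z. a \<bullet> Z z) z1)" for a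
      unfolding t(4) using t da zU by (intro homogeneous_ham[OF co ha]) auto
    show ?thesis unfolding poisson_symp[OF da[OF zU]] h hY[OF t(2)]
      using br[OF YD[OF t(2)]] t(1) by (simp add: symp_simps symp_scl poisson_symp[OF da'[OF YD[OF t(2)]]])
  qed
  define D1 where "D1 = Y \<inter> U1"
  have SU1: "S \<inter> U1 = {z\<in>U1. Z z = 0}"
  proof -
    have "z \<in> S \<longleftrightarrow> Z z = 0" if zU: "z \<in> U1" for z
    proof -
      obtain t z1 where t: "0 < t" "z1 \<in> Y" "z1 \<in> U1" "z = scl t z1" using unscale[OF zU] by blast
      have "z \<in> S \<longleftrightarrow> z1 \<in> S" using conic[of z1 t] conic[of z "inverse t"] t by auto
      also have "\<dots> \<longleftrightarrow> \<zeta> z1 = 0" using SD YD[OF t(2)] by blast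
      also have "\<dots> \<longleftrightarrow> Z z = 0" using homogeneousD[OF hZ t(3,1)] t(1,4) ZY[OF t(2)] by simp
      finally show ?thesis .
    qed
    then show ?thesis by blast
  qed
  show ?thesis
  proof (rule that[of U1 D1 n m Z gt])
    show "w0 \<in> D1" using Y1[OF w0U] w0U rescale_self[of w0 \<rho>] w0 by (simp add: D1_def \<rho>_def)
    show "proj d n m (Z z) = Z z" if "z \<in> U1" for z
      using \<pi>\<zeta>[of "rescale \<rho> z"] U1z[OF that] N(3) by (auto simp: Z_def linear_cmul[OF linear_proj])
    show "smooth_on D1 gt" by (rule smooth_on_subset[OF sgt]) (use YD in \<open>auto simp: D1_def\<close>)
    show "gt z = g z" if "z \<in> S \<inter> D1" for z using that YD by (intro gt) (auto simp: D1_def)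
    show "poisson gt (\<lambda>z. a \<bullet> Z z) z = 0" if "z \<in> D1" for z a
      using brg[of z a] that YD dYa[of z a] by (auto simp: poisson_def D1_def)
    show "frechet_derivative gt (at z) (0, proj d n m r) = 0" if "z \<in> D1" for z r
      using Dgt[of z r] that YD by (auto simp: D1_def)
    show "D1 \<subseteq> W" using YD D(3) by (auto simp: D1_def)
  qed (use co w0U UU oY oU dp sZ hZ SU1 DZ brZ in \<open>auto simp: D1_def\<close>)
qed

section \<open>Removing the transversality assumption\<close>

text \<open>The Hamilton flow of the norm of the covariable at time \<open>- \<tau>\<close>: away
  from the zero section a canonical transformation that commutes with positive dilations and acts
  nontrivially on vertical vectors.\<close>

definition shear :: "real \<Rightarrow> 'n::finite phase \<Rightarrow> 'n phase" where
  "shear \<tau> z = (fst z - \<tau> *\<^sub>R sgn (snd z), snd z)"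

text \<open>For nonzero \<open>\<xi>\<close> this is the derivative of \<open>sgn\<close>, that is
  the Hessian of the norm: symmetric, positive semidefinite, with the line through
  \<open>\<xi>\<close> as its kernel.\<close>

definition dsgn :: "'a::real_inner \<Rightarrow> 'a \<Rightarrow> 'a" where
  "dsgn \<xi> b = inverse (norm \<xi>) *\<^sub>R (b - (sgn \<xi> \<bullet> b) *\<^sub>R sgn \<xi>)"

lemma has_derivative_sgn:
  fixes \<xi> :: "'a::real_inner"
  assumes "\<xi> \<noteq> 0" shows "(sgn has_derivative dsgn \<xi>) (at \<xi>)"
proof -
  have "((\<lambda>x. inverse (norm x) *\<^sub>R x) has_derivative
     (\<lambda>h. inverse (norm \<xi>) *\<^sub>R h + (- (inverse (norm \<xi>) * (h \<bullet> sgn \<xi>) * inverse (norm \<xi>))) *\<^sub>R \<xi>)) (at \<xi>)"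
    by (intro has_derivative_scaleR has_derivative_ident Deriv.has_derivative_inverse has_derivative_norm assms) (simp add: assms)
  moreover have "(\<lambda>h. inverse (norm \<xi>) *\<^sub>R h + (- (inverse (norm \<xi>) * (h \<bullet> sgn \<xi>) * inverse (norm \<xi>))) *\<^sub>R \<xi>) = dsgn \<xi>"
    by (rule ext) (simp add: dsgn_def sgn_div_norm scaleR_diff_right inner_commute algebra_simps)
  ultimately show ?thesis unfolding sgn_div_norm[abs_def] by simp
qed

lemma dsgn_symmetric: "dsgn \<xi> b \<bullet> c = b \<bullet> dsgn \<xi> c"
  by (simp add: dsgn_def inner_diff_left inner_diff_right inner_commute)

lemma linear_dsgn: "linear (dsgn \<xi>)"
  by (rule linearI) (simp_all add: dsgn_def inner_add_right algebra_simps)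

lemma dsgn_inner_self: "b \<bullet> dsgn \<xi> b = inverse (norm \<xi>) * (norm (b - (sgn \<xi> \<bullet> b) *\<^sub>R sgn \<xi>))\<^sup>2"
proof (cases "\<xi> = 0")
  case False
  then have s: "sgn \<xi> \<bullet> sgn \<xi> = 1" by (simp add: norm_sgn dot_square_norm)
  have "b \<bullet> (b - (sgn \<xi> \<bullet> b) *\<^sub>R sgn \<xi>) = (b - (sgn \<xi> \<bullet> b) *\<^sub>R sgn \<xi>) \<bullet> (b - (sgn \<xi> \<bullet> b) *\<^sub>R sgn \<xi>)"
    by (simp add: inner_diff_left inner_diff_right s inner_commute)
  then show ?thesis by (simp add: dsgn_def power2_norm_eq_inner)
qed (simp add: dsgn_def)

definition dshear :: "real \<Rightarrow> 'n::finite phase \<Rightarrow> 'n phase \<Rightarrow> 'n phase" where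
  "dshear \<tau> z v = (fst v - \<tau> *\<^sub>R dsgn (snd z) (snd v), snd v)"

lemma shear_has_derivative:
  assumes "snd z \<noteq> 0" shows "(shear \<tau> has_derivative dshear \<tau> z) (at z)"
proof -
  have "(snd has_derivative snd) (at z)" by (rule has_derivative_snd[OF has_derivative_ident])
  from has_derivative_compose[of snd snd z UNIV sgn, OF this has_derivative_sgn[OF assms]]
  have "((\<lambda>z. sgn (snd z)) has_derivative (\<lambda>v. dsgn (snd z) (snd v))) (at z)" .
  then show ?thesis
    unfolding shear_def[abs_def] dshear_def[abs_def]
    by (intro has_derivative_Pair has_derivative_diff has_derivative_scaleR_right has_derivative_fst has_derivative_snd has_derivative_ident)
qed

lemma shear_simps [simp]: "snd (shear \<tau> z) = snd z" "shear \<tau> (shear (- \<tau>) z) = z" "shear (- \<tau>) (shear \<tau> z) = z"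
  by (simp_all add: shear_def)

lemma shear_scl: "0 < t \<Longrightarrow> shear \<tau> (scl t z) = scl t (shear \<tau> z)"
  by (simp add: shear_def scl_def sgn_scaleR)

lemma symp_dshear: "symp (dshear \<tau> z u) (dshear \<tau> z v) = symp u v"
  by (simp add: symp_def dshear_def inner_diff_left inner_diff_right dsgn_symmetric)

lemma surj_dshear: "surj (dshear \<tau> z)"
  by (rule surjI[of _ "dshear (- \<tau>) z"]) (simp add: dshear_def)

lemma smooth_on_shear: "smooth_on {z :: 'n::finite phase. snd z \<noteq> 0} (shear \<tau>)"
proof -
  have "smooth_on {z. snd z \<noteq> 0} (\<lambda>z :: 'n phase. (fst z - \<tau> *\<^sub>R (inverse (norm (snd z)) *\<^sub>R snd z), snd z))"
    by (intro smooth_on_Pair smooth_on_diff smooth_on_scaleR smooth_on_inverse smooth_on_norm smooth_on_const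
       smooth_on_linear[OF bounded_linear_fst] smooth_on_linear[OF bounded_linear_snd] open_snd_nonzero) auto
  then show ?thesis by (simp add: shear_def[abs_def] sgn_div_norm)
qed

lemma shear_vimage:
  fixes A :: "'n::finite phase set"
  assumes "open A" "\<And>z. z \<in> A \<Longrightarrow> snd z \<noteq> 0"
  shows "open (shear \<tau> -` A)" "smooth_on (shear \<tau> -` A) (shear \<tau>)"
proof -
  have sub: "shear \<tau> -` A \<subseteq> {z. snd z \<noteq> 0}"
  proof
    fix z assume "z \<in> shear \<tau> -` A"
    then have "snd (shear \<tau> z) \<noteq> 0" by (intro assms(2)) simp
    then show "z \<in> {z. snd z \<noteq> 0}" by simp
  qed
  have "open (shear \<tau> -` A \<inter> {z. snd z \<noteq> 0})"
    by (rule continuous_on_open_vimage[OF open_snd_nonzero, THEN iffD1, rule_format, OF _ assms(1)])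
       (rule smooth_on_imp_continuous_on[OF smooth_on_shear])
  then show "open (shear \<tau> -` A)" using sub by (simp add: Int_absorb2)
  show "smooth_on (shear \<tau> -` A) (shear \<tau>)" by (rule smooth_on_subset[OF smooth_on_shear sub])
qed

lemma conic_open_shear:
  assumes "conic_open A" shows "conic_open (shear \<tau> -` A)"
proof -
  have "open (shear \<tau> -` A)" using assms by (intro shear_vimage(1)) (auto simp: conic_open_def)
  moreover have "snd z \<noteq> 0 \<and> (\<forall>t>0. (fst z, t *\<^sub>R snd z) \<in> shear \<tau> -` A)" if z: "z \<in> shear \<tau> -` A" for z
  proof (intro conjI allI impI)
    show "snd z \<noteq> 0" using conic_open_snd[OF assms, of "shear \<tau> z"] z by simp
    fix t :: real assume "0 < t"
    then have "shear \<tau> (scl t z) \<in> A" using conic_open_scl[OF assms, of "shear \<tau> z" t] z by (simp add: shear_scl)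
    then show "(fst z, t *\<^sub>R snd z) \<in> shear \<tau> -` A" by (simp add: scl_def)
  qed
  ultimately show ?thesis by (simp add: conic_open_def)
qed

text \<open>Nonzero vectors of \<open>N\<close> that become vertical for different \<open>\<tau>\<close> are orthogonal for the semidefinite form \<open>dsgn \<xi>\<close>.
  Hence only finitely many values of \<open>\<tau>\<close> are excluded.\<close>

lemma generic_shear:
  fixes N :: "'n::finite phase set"
  assumes "subspace N" "\<And>u v. u \<in> N \<Longrightarrow> v \<in> N \<Longrightarrow> symp u v = 0" "(0, \<xi>) \<notin> N"
  obtains \<tau> where "\<And>v. v \<in> N \<Longrightarrow> fst v = \<tau> *\<^sub>R dsgn \<xi> (snd v) \<Longrightarrow> v = 0"
proof (rule ccontr)
  assume no: "\<not> thesis"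
  have \<xi>: "\<xi> \<noteq> 0" using assms(3) subspace_0[OF assms(1)] by (auto simp: zero_prod_def)
  have "\<exists>v. v \<in> N \<and> fst v = \<tau> *\<^sub>R dsgn \<xi> (snd v) \<and> v \<noteq> 0" for \<tau> using no that by blast
  then obtain v where v: "\<And>\<tau>. v \<tau> \<in> N" "\<And>\<tau>. fst (v \<tau>) = \<tau> *\<^sub>R dsgn \<xi> (snd (v \<tau>))" "\<And>\<tau>. v \<tau> \<noteq> 0" by metis
  define b where "b \<tau> = snd (v \<tau>)" for \<tau>
  have orth: "dsgn \<xi> (b \<sigma>) \<bullet> b \<tau> = 0" if "\<sigma> \<noteq> \<tau>" for \<sigma> \<tau>
  proof -
    have "symp (v \<sigma>) (v \<tau>) = (\<tau> - \<sigma>) * (dsgn \<xi> (b \<sigma>) \<bullet> b \<tau>)"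
      unfolding symp_def v(2) using dsgn_symmetric[of \<xi> "b \<sigma>" "b \<tau>"] by (simp add: b_def algebra_simps)
    then show ?thesis using assms(2)[OF v(1) v(1), of \<sigma> \<tau>] that by simp
  qed
  \<comment> \<open>An isotropic \<open>b \<tau>\<close> would lie in the kernel of the form, hence
    be a multiple of \<open>\<xi>\<close>. Then \<open>v \<tau>\<close> would be a nonzero multiple
    of \<open>(0, \<xi>)\<close>, which is not in \<open>N\<close>.\<close>
  have pos: "dsgn \<xi> (b \<tau>) \<bullet> b \<tau> \<noteq> 0" for \<tau>
  proof
    assume "dsgn \<xi> (b \<tau>) \<bullet> b \<tau> = 0"
    then have "b \<tau> = (sgn \<xi> \<bullet> b \<tau>) *\<^sub>R sgn \<xi>"
      using dsgn_inner_self[of "b \<tau>" \<xi>] \<xi> by (simp add: inner_commute)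
    then obtain c where c: "b \<tau> = c *\<^sub>R \<xi>" by (metis scaleR_scaleR sgn_div_norm)
    have "dsgn \<xi> \<xi> = 0" using \<xi> by (simp add: dsgn_def sgn_div_norm dot_square_norm power2_eq_square field_simps)
    then have "dsgn \<xi> (b \<tau>) = 0" by (simp add: c linear_cmul[OF linear_dsgn])
    then have vt: "v \<tau> = c *\<^sub>R (0, \<xi>)" using v(2)[of \<tau>] c by (simp add: b_def prod_eq_iff)
    then have "c \<noteq> 0" using v(3)[of \<tau>] by (auto simp: zero_prod_def)
    then have "(0, \<xi>) = (1 / c) *\<^sub>R v \<tau>" using vt by simp
    then show False using assms(3) subspace_scale[OF assms(1) v(1)] by metis
  qed
  have inj: "inj b" using orth pos by (metis injI)
  have "infinite (range b)" using inj infinite_UNIV_char_0 finite_imageD by blast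
  \<comment> \<open>One vector more than the dimension. Pairwise orthogonality for the form and the
    absence of isotropic vectors make them independent.\<close>
  then obtain A where A: "A \<subseteq> range b" "finite A" "card A = Suc (DIM(real ^ 'n))"
    using infinite_arbitrarily_large by blast
  have "independent A"
  proof (rule independent_if_scalars_zero[OF A(2)])
    fix f x assume f: "(\<Sum>x\<in>A. f x *\<^sub>R x) = 0" and x: "x \<in> A"
    have z: "dsgn \<xi> x \<bullet> y = 0" if yA: "y \<in> A" "y \<noteq> x" for y
    proof -
      obtain \<sigma> where \<sigma>: "x = b \<sigma>" using x A(1) by auto
      obtain \<tau> where \<tau>: "y = b \<tau>" using yA(1) A(1) by auto
      have "\<sigma> \<noteq> \<tau>" using yA(2) \<sigma> \<tau> by auto
      then show ?thesis unfolding \<sigma> \<tau> by (rule orth)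
    qed
    have "0 = dsgn \<xi> x \<bullet> (\<Sum>y\<in>A. f y *\<^sub>R y)" by (simp add: f)
    also have "\<dots> = (\<Sum>y\<in>A. f y * (dsgn \<xi> x \<bullet> y))" by (simp add: inner_sum_right)
    also have "\<dots> = f x * (dsgn \<xi> x \<bullet> x)" using z x A(2) by (simp add: sum.remove[OF A(2) x])
    finally show "f x = 0" using pos x A(1) by auto
  qed
  then have "card A \<le> DIM(real ^ 'n)" using independent_bound by blast
  then show False using A(3) by simp
qed


lemma inner_fst_ham:
  assumes "f differentiable (at z)" shows "b \<bullet> fst (ham f z) = frechet_derivative f (at z) (0, b)"
  unfolding deriv_ham[OF assms] by (simp add: symp_def)

text \<open>A generic shear makes \<open>S\<close> transversal to the fibre at \<open>w0\<close>;
  the transversal chart is then pulled back. New is \<open>x\<close>, the projected base variable of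
  the sheared coordinates. It is conjugate to \<open>\<zeta>\<close> because \<open>\<zeta>\<close>
  has the identity as derivative along the range of the projection in the fibre, and the field of
  \<open>gt\<close> leaves it fixed because \<open>gt\<close> is constant in these
  directions.\<close>

theorem involutive_frame:
  fixes W :: "'n::finite phase set" and u :: "nat \<Rightarrow> 'n phase \<Rightarrow> real"
  assumes U: "conic_open U" "W \<subseteq> U"
    and W: "open W" "w0 \<in> W" "w0 \<in> S" and sm: "\<And>j. j < d \<Longrightarrow> smooth_on W (u j)"
    and S: "S \<inter> W = {z\<in>W. \<forall>j<d. u j z = 0}" and ind: "\<And>z. z \<in> W \<Longrightarrow> independent_at d u z"
    and nonradial: "\<And>c. (\<Sum>j<d. c j *\<^sub>R ham (u j) w0) \<noteq> radial w0"
    and invol: "\<And>w i j. w \<in> S \<inter> W \<Longrightarrow> i < d \<Longrightarrow> j < d \<Longrightarrow> poisson (u i) (u j) w = 0"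
    and g: "smooth_on W g" "\<And>w j. w \<in> S \<inter> W \<Longrightarrow> j < d \<Longrightarrow> poisson (u j) g w = 0"
    and conic: "\<And>z t. z \<in> S \<Longrightarrow> 0 < t \<Longrightarrow> scl t z \<in> S"
  obtains U1 D n m \<zeta> x gt where
    "conic_open U1" "w0 \<in> U1" "U1 \<subseteq> U" "open D" "w0 \<in> D" "D \<subseteq> U1" "dual_pair d n (m :: nat \<Rightarrow> real ^ 'n)"
    "smooth_on U1 \<zeta>" "homogeneous 1 U1 \<zeta>" "\<And>z. z \<in> U1 \<Longrightarrow> proj d n m (\<zeta> z) = \<zeta> z"
    "smooth_on U1 x" "homogeneous 0 U1 x" "\<And>z. proj d n m (x z) = x z"
    "S \<inter> U1 = {z\<in>U1. \<zeta> z = 0}"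
    "\<And>z a b. z \<in> U1 \<Longrightarrow> poisson (\<lambda>z. a \<bullet> \<zeta> z) (\<lambda>z. b \<bullet> \<zeta> z) z = 0"
    "\<And>z a. z \<in> U1 \<Longrightarrow> frechet_derivative x (at z) (ham (\<lambda>z. a \<bullet> \<zeta> z) z) = proj d n m a"
    "smooth_on D gt" "\<And>z. z \<in> S \<inter> D \<Longrightarrow> gt z = g z"
    "\<And>z a. z \<in> D \<Longrightarrow> poisson gt (\<lambda>z. a \<bullet> \<zeta> z) z = 0"
    "\<And>z. z \<in> D \<Longrightarrow> frechet_derivative x (at z) (ham gt z) = 0"
proof -
  have dham: "frechet_derivative (u j) (at z) v = symp v (ham (u j) z)" if "z \<in> W" "j < d" for z j v
    by (rule deriv_ham[OF differentiableI[OF smooth_on_has_derivative[OF sm[OF that(2)] that(1)]]])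
  have dif: "u j differentiable (at z)" if "z \<in> W" "j < d" for z j
    by (rule differentiableI[OF smooth_on_has_derivative[OF sm[OF that(2)] that(1)]])
  have difg: "g differentiable (at z)" if "z \<in> W" for z
    by (rule differentiableI[OF smooth_on_has_derivative[OF g(1) that(1)]])
  have snz: "snd z \<noteq> 0" if "z \<in> U" for z using conic_open_snd[OF U(1) that] .
  define N where "N = span ((\<lambda>j. ham (u j) w0) ` {..<d})"
  have Nsum: "\<exists>c. v = (\<Sum>j<d. c j *\<^sub>R ham (u j) w0)" if "v \<in> N" for v
    using span_indexed_sum[of "{..<d}" v "\<lambda>j. ham (u j) w0"] that by (simp add: N_def)
  have iso: "symp a b = 0" if ab: "a \<in> N" "b \<in> N" for a b
  proof -
    obtain c where c: "a = (\<Sum>j<d. c j *\<^sub>R ham (u j) w0)" using Nsum[OF ab(1)] by blast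
    obtain e where e: "b = (\<Sum>j<d. e j *\<^sub>R ham (u j) w0)" using Nsum[OF ab(2)] by blast
    have "symp (ham (u i) w0) (ham (u j) w0) = 0" if "i < d" "j < d" for i j
      using invol[of w0 i j] W that poisson_symp[OF dif[OF W(2) that(2)], of "u i"] by simp
    then show ?thesis unfolding c e by (simp add: symp_sum_left symp_sum_right symp_simps)
  qed
  have rad: "(0, snd w0) \<notin> N"
  proof
    assume "(0, snd w0) \<in> N"
    then obtain c where "(0, snd w0) = (\<Sum>j<d. c j *\<^sub>R ham (u j) w0)" using Nsum by blast
    then show False using nonradial[of c] by (simp add: radial_def)
  qed
  have sub: "subspace N" unfolding N_def by (rule subspace_span)
  obtain \<tau> where \<tau>: "\<And>v. v \<in> N \<Longrightarrow> fst v = \<tau> *\<^sub>R dsgn (snd w0) (snd v) \<Longrightarrow> v = 0"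
    by (rule generic_shear[OF sub iso rad]) blast+
  define K where "K = (shear \<tau> :: 'n phase \<Rightarrow> 'n phase)"
  define K' where "K' = (shear (- \<tau>) :: 'n phase \<Rightarrow> 'n phase)"
  have KK: "K (K' z) = z" "K' (K z) = z" "snd (K z) = snd z" "snd (K' z) = snd z" for z
    using shear_simps(2)[of "- \<tau>" z] by (simp_all add: K_def K'_def)
  have Kscl: "K (scl t z) = scl t (K z)" "K' (scl t z) = scl t (K' z)" if "0 < t" for t z
    using shear_scl[OF that] by (simp_all add: K_def K'_def)
  have dK: "(K has_derivative dshear \<tau> z) (at z)" if "snd z \<noteq> 0" for z
    unfolding K_def by (rule shear_has_derivative[OF that])
  have dK': "(K' has_derivative dshear (- \<tau>) z) (at z)" if "snd z \<noteq> 0" for z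
    unfolding K'_def by (rule shear_has_derivative[OF that])
  have vimage: "open (K' -` W)" "smooth_on (K' -` W) K'"
    unfolding K'_def by (rule shear_vimage[OF W(1)]; use snz U(2) in blast)+
  define u' where "u' j z = u j (K' z)" for j z
  have u'e: "u' j = (\<lambda>z. u j (K' z))" for j by (rule ext) (simp add: u'_def)
  let ?W = "K' -` W" and ?S = "K' -` S" and ?U = "K' -` U" and ?g = "\<lambda>z. g (K' z)"
  have U': "conic_open ?U" "?W \<subseteq> ?U" using conic_open_shear[OF U(1)] U(2) by (auto simp: K'_def)
  have W': "open ?W" "K w0 \<in> ?W" "K w0 \<in> ?S" using vimage W KK by auto
  have sW: "snd z \<noteq> 0" if "z \<in> ?W" for z using snz[of "K' z"] that U(2) KK by auto
  have sm': "smooth_on ?W (u' j)" if "j < d" for j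
    unfolding u'_def by (rule smooth_on_compose[OF W'(1) W(1) _ vimage(2) sm[OF that]]) simp
  have g': "smooth_on ?W ?g"
    by (rule smooth_on_compose[OF W'(1) W(1) _ vimage(2) g(1)]) simp
  have S': "?S \<inter> ?W = {z\<in>?W. \<forall>j<d. u' j z = 0}" using S by (auto simp: u'_def)
  have du': "frechet_derivative (u' j) (at z) v = frechet_derivative (u j) (at (K' z)) (dshear (- \<tau>) z v)" if "z \<in> ?W" "j < d" for j z v
  proof -
    have "(u j has_derivative frechet_derivative (u j) (at (K' z))) (at (K' z))"
      by (rule smooth_on_has_derivative[OF sm[OF that(2)]]) (use that in simp)
    from has_derivative_compose[OF dK'[OF sW[OF that(1)]] this]
    show ?thesis unfolding u'_def by (simp add: frechet_derivative_eqI)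
  qed
  have ind': "independent_at d u' z" if z: "z \<in> ?W" for z
    unfolding independent_at_def
  proof (intro allI impI)
    fix c j assume c: "\<forall>v. (\<Sum>j<d. c j * frechet_derivative (u' j) (at z) v) = 0" and j: "j < d"
    have "(\<Sum>j<d. c j * frechet_derivative (u j) (at (K' z)) v) = 0" for v
    proof -
      obtain v' where "v = dshear (- \<tau>) z v'" using surjD[OF surj_dshear] by blast
      then show ?thesis using c[rule_format, of v'] du'[OF z] by simp
    qed
    then show "c j = 0" using ind[of "K' z"] z j by (auto simp: independent_at_def)
  qed
  \<comment> \<open>A relation among the vertical derivatives says that the combination
    \<open>h\<close> of Hamilton fields becomes vertical after the shear. The choice of
    \<open>\<tau>\<close> permits this only for \<open>h = 0\<close>.\<close>
  have trans: "\<forall>j<d. c j = 0" if c: "\<And>b. (\<Sum>j<d. c j * frechet_derivative (u' j) (at (K w0)) (0, b)) = 0" for c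
  proof -
    define h where "h = (\<Sum>j<d. c j *\<^sub>R ham (u j) w0)"
    have "(fst h - \<tau> *\<^sub>R dsgn (snd w0) (snd h)) \<bullet> b = 0" for b
    proof -
      have "0 = (\<Sum>j<d. c j * frechet_derivative (u' j) (at (K w0)) (0, b))" using c by simp
      also have "\<dots> = (\<Sum>j<d. c j * symp (dshear (- \<tau>) (K w0) (0, b)) (ham (u j) w0))"
        using du'[OF W'(2)] dham[OF W(2)] KK by (intro sum.cong) auto
      also have "\<dots> = symp (dshear (- \<tau>) (K w0) (0, b)) h" by (simp add: h_def symp_sum_right symp_simps)
      also have "\<dots> = b \<bullet> fst h - \<tau> * (dsgn (snd w0) b \<bullet> snd h)" by (simp add: symp_def dshear_def KK)
      finally show ?thesis by (simp add: dsgn_symmetric inner_diff_right inner_commute[of _ b])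
    qed
    then have "fst h = \<tau> *\<^sub>R dsgn (snd w0) (snd h)"
      using inner_eq_zero_iff[of "fst h - \<tau> *\<^sub>R dsgn (snd w0) (snd h)"] by simp
    moreover have "h \<in> N" unfolding h_def N_def by (intro span_sum span_scale span_base) auto
    ultimately have "h = 0" by (rule \<tau>[rotated])
    then have "(\<Sum>j<d. c j * frechet_derivative (u j) (at w0) v) = 0" for v
    proof -
      have "(\<Sum>j<d. c j * frechet_derivative (u j) (at w0) v) = symp v h"
        using dham[OF W(2)] by (simp add: h_def symp_sum_right symp_simps)
      then show ?thesis using \<open>h = 0\<close> by (simp add: symp_simps)
    qed
    then show ?thesis using ind[OF W(2)] unfolding independent_at_def by blast
  qed
  have pK': "poisson (\<lambda>z. f (K' z)) (\<lambda>z. h (K' z)) z = poisson f h (K' z)"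
    if "z \<in> ?W" "f differentiable (at (K' z))" "h differentiable (at (K' z))" for f h z
    by (rule poisson_compose[OF dK'[OF sW[OF that(1)]] that(2,3) symp_dshear surj_dshear])
  have invol': "poisson (u' i) (u' j) w = 0" if "w \<in> ?S \<inter> ?W" "i < d" "j < d" for w i j
    using invol[of "K' w" i j] that pK'[of w "u i" "u j"] dif by (simp add: u'e)
  have g2': "poisson (u' j) ?g w = 0" if "w \<in> ?S \<inter> ?W" "j < d" for w j
    using g(2)[of "K' w" j] that pK'[of w "u j" g] dif difg by (simp add: u'e)
  have conic': "scl t z \<in> ?S" if "z \<in> ?S" "0 < t" for z t using conic[of "K' z" t] that Kscl by simp
  obtain U1 D n m \<zeta> gt where
    U1: "conic_open U1" "K w0 \<in> U1" "U1 \<subseteq> ?U" and D: "open D" "K w0 \<in> D" "D \<subseteq> U1" "D \<subseteq> ?W" and dp: "dual_pair d n m"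
    and s\<zeta>: "smooth_on U1 \<zeta>" "homogeneous 1 U1 \<zeta>"
    and \<pi>\<zeta>: "\<And>z. z \<in> U1 \<Longrightarrow> proj d n m (\<zeta> z) = \<zeta> z" and SU1: "?S \<inter> U1 = {z\<in>U1. \<zeta> z = 0}"
    and D\<zeta>: "\<And>z r. z \<in> U1 \<Longrightarrow> frechet_derivative \<zeta> (at z) (0, proj d n m r) = proj d n m r"
    and br: "\<And>z a b. z \<in> U1 \<Longrightarrow> poisson (\<lambda>z. a \<bullet> \<zeta> z) (\<lambda>z. b \<bullet> \<zeta> z) z = 0"
    and sgt: "smooth_on D gt" and gt: "\<And>z. z \<in> ?S \<inter> D \<Longrightarrow> gt z = ?g z"
    and brg: "\<And>z a. z \<in> D \<Longrightarrow> poisson gt (\<lambda>z. a \<bullet> \<zeta> z) z = 0"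
    and Dgt: "\<And>z r. z \<in> D \<Longrightarrow> frechet_derivative gt (at z) (0, proj d n m r) = (0::real)"
    by (rule transversal_conic_chart[OF U' W' sm' S' ind' trans invol' g' g2' conic']) blast+
  have oU1: "open U1" by (rule conic_open_open[OF U1(1)])
  have sa: "smooth_on U1 (\<lambda>z. a \<bullet> \<zeta> z)" for a by (rule smooth_on_bounded_linear[OF bounded_linear_inner_right oU1 s\<zeta>(1)])
  have da: "(\<lambda>z. a \<bullet> \<zeta> z) differentiable (at z)" if "z \<in> U1" for z a
    using smooth_on_has_derivative[OF sa that] by (rule differentiableI)
  have dgt: "gt differentiable (at z)" if "z \<in> D" for z
    using smooth_on_has_derivative[OF sgt that] by (rule differentiableI)
  let ?U1 = "K -` U1" and ?D = "K -` D" and ?\<zeta> = "\<lambda>z. \<zeta> (K z)" and ?gt = "\<lambda>z. gt (K z)"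
  define x where "x z = proj d n m (fst (K z))" for z
  have sub: "?U1 \<subseteq> U"
  proof
    fix z assume "z \<in> ?U1"
    then have "K' (K z) \<in> U" using U1(3) by blast
    then show "z \<in> U" by (simp add: KK)
  qed
  have s1: "snd z \<noteq> 0" if "z \<in> ?U1" for z using snz sub that by blast
  have K1: "conic_open ?U1" unfolding K_def by (rule conic_open_shear[OF U1(1)])
  have oK1: "open ?U1" by (rule conic_open_open[OF K1])
  have sK: "smooth_on ?U1 K" unfolding K_def by (rule shear_vimage(2)[OF oU1 conic_open_snd[OF U1(1)]])
  have oD: "open ?D"
    using continuous_on_open_vimage[OF oK1, THEN iffD1, rule_format, OF smooth_on_imp_continuous_on[OF sK] D(1)] D(3)
    by (simp add: Int_absorb2 vimage_mono)
  have DU: "?D \<subseteq> ?U1" using D(3) by auto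
  have bl: "bounded_linear (\<lambda>z. proj d n m (fst z))" by (rule bounded_linear_compose[OF bounded_linear_proj bounded_linear_fst])
  have sx: "smooth_on ?U1 x" unfolding x_def by (rule smooth_on_bounded_linear[OF bl oK1 sK])
  have dx: "frechet_derivative x (at z) v = proj d n m (fst (dshear \<tau> z v))" if "z \<in> ?U1" for z v
  proof -
    have "(x has_derivative (\<lambda>v. proj d n m (fst (dshear \<tau> z v)))) (at z)"
      unfolding x_def[abs_def] using bounded_linear.has_derivative[OF bl dK[OF s1[OF that]]] .
    then show ?thesis by (simp add: frechet_derivative_eqI)
  qed
  have hK: "dshear \<tau> z (ham (\<lambda>z. f (K z)) z) = ham f (K z)" if "z \<in> ?U1" "f differentiable (at (K z))" for f z
  proof -
    have "dshear \<tau> z (ham (\<lambda>z. f (K z)) z) = 1 *\<^sub>R ham f (K z)"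
      by (rule ham_compose[OF dK[OF s1[OF that(1)]] that(2) _ surj_dshear]) (simp add: symp_dshear)
    then show ?thesis by simp
  qed
  \<comment> \<open>Vertical derivatives read off the base component of a Hamilton field; the
    symmetry of \<open>proj d n m\<close> moves the projection onto the test vector.\<close>
  have projham: "proj d n m (fst (ham f z)) = c"
    if "f differentiable (at z)" "\<And>b. frechet_derivative f (at z) (0, proj d n m b) = b \<bullet> c" for f z c
  proof (rule vector_eq_ldot[THEN iffD1], rule allI)
    fix b
    show "b \<bullet> proj d n m (fst (ham f z)) = b \<bullet> c"
      unfolding that(2)[symmetric] inner_fst_ham[OF that(1), symmetric] by (rule proj_symmetric[OF dp, symmetric])
  qed
  show ?thesis
  proof (rule that[of ?U1 ?D n m ?\<zeta> x ?gt])
    show "homogeneous 1 ?U1 ?\<zeta>" using s\<zeta>(2) Kscl unfolding homogeneous_def by (auto simp flip: scl_def)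
    show "homogeneous 0 ?U1 x" using s1 Kscl unfolding homogeneous_def by (auto simp flip: scl_def simp: x_def)
    show "proj d n m (x z) = x z" for z by (simp add: x_def proj_proj[OF dp])
    show "S \<inter> ?U1 = {z\<in>?U1. ?\<zeta> z = 0}"
    proof -
      have "z \<in> S \<and> K z \<in> U1 \<longleftrightarrow> K z \<in> U1 \<and> \<zeta> (K z) = 0" for z
      proof -
        have "(K z \<in> ?S \<inter> U1) = (K z \<in> {z\<in>U1. \<zeta> z = 0})" using SU1 by (rule arg_cong)
        then show ?thesis by (simp add: KK)
      qed
      then show ?thesis by blast
    qed
    show "smooth_on ?U1 ?\<zeta>" by (rule smooth_on_compose[OF oK1 oU1 _ sK s\<zeta>(1)]) simp
    show "smooth_on ?D ?gt" by (rule smooth_on_compose[OF oD D(1) _ smooth_on_subset[OF sK DU] sgt]) simp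
    show "poisson (\<lambda>z. a \<bullet> ?\<zeta> z) (\<lambda>z. b \<bullet> ?\<zeta> z) z = 0" if "z \<in> ?U1" for z a b
    proof -
      have zU: "K z \<in> U1" using that by simp
      show ?thesis
        by (subst poisson_compose[OF dK[OF s1[OF that]] da[OF zU] da[OF zU] symp_dshear surj_dshear]) (rule br[OF zU])
    qed
    show "poisson ?gt (\<lambda>z. a \<bullet> ?\<zeta> z) z = 0" if "z \<in> ?D" for z a
    proof -
      have zD: "K z \<in> D" and zU: "K z \<in> U1" "z \<in> ?U1" using that D(3) by auto
      show ?thesis
        by (subst poisson_compose[OF dK[OF s1[OF zU(2)]] dgt[OF zD] da[OF zU(1)] symp_dshear surj_dshear]) (rule brg[OF zD])
    qed
    show "gt (K z) = g z" if "z \<in> S \<inter> ?D" for z using gt[of "K z"] that KK by auto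
    show "frechet_derivative x (at z) (ham (\<lambda>z. a \<bullet> ?\<zeta> z) z) = proj d n m a" if z: "z \<in> ?U1" for z a
    proof -
      have zU: "K z \<in> U1" using z by simp
      have "frechet_derivative (\<lambda>z. a \<bullet> \<zeta> z) (at (K z)) (0, proj d n m b) = b \<bullet> proj d n m a" for b
      proof -
        have "((\<lambda>z. a \<bullet> \<zeta> z) has_derivative (\<lambda>v. a \<bullet> frechet_derivative \<zeta> (at (K z)) v)) (at (K z))"
          by (rule has_derivative_inner_right[OF smooth_on_has_derivative[OF s\<zeta>(1) zU]])
        then have "frechet_derivative (\<lambda>z. a \<bullet> \<zeta> z) (at (K z)) (0, proj d n m b) = a \<bullet> proj d n m b"
          using D\<zeta>[OF zU] by (simp add: frechet_derivative_eqI)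
        then show ?thesis using proj_symmetric[OF dp, of a b] by (simp add: inner_commute)
      qed
      then show ?thesis unfolding dx[OF z] hK[OF z da[OF zU]] by (rule projham[OF da[OF zU]])
    qed
    show "frechet_derivative x (at z) (ham ?gt z) = 0" if "z \<in> ?D" for z
    proof -
      have zD: "K z \<in> D" and z: "z \<in> ?U1" using that D(3) by auto
      show ?thesis unfolding dx[OF z] hK[OF z dgt[OF zD]] by (rule projham[OF dgt[OF zD]]) (simp add: Dgt[OF zD])
    qed
    show "proj d n m (\<zeta> (K z)) = \<zeta> (K z)" if "z \<in> ?U1" for z using \<pi>\<zeta> that by simp
  qed (use K1 U1 sub oD D DU dp sx in auto)
qed

section \<open>The Hessian\<close>

lemma hess_eq: "hess f w v v' = frechet_derivative (\<lambda>z. frechet_derivative f (at z) v') (at w) v"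
  by (simp add: hess_def)

lemma hess_commute:
  assumes "open U" "smooth_on U f" "w \<in> U" shows "hess f w v v' = hess f w v' v"
  unfolding hess_def by (rule dir_derivs_commute[OF assms])

lemma linear_hess:
  assumes "open U" "smooth_on U f" "w \<in> U" shows "linear (\<lambda>v. hess f w v v')" "linear (\<lambda>v'. hess f w v v')"
proof -
  show l: "linear (\<lambda>v. hess f w v v')" for v'
    unfolding hess_eq by (rule smooth_on_deriv_linear[OF smooth_on_deriv[OF assms(2)] assms(3)])
  show "linear (\<lambda>v'. hess f w v v')" using l[of v] by (simp add: hess_commute[OF assms, of v])
qed

text \<open>The vanishing of the differential on \<open>S\<close> is differentiated in the tangent
  direction \<open>v\<close>; symmetry of the Hessian gives the other slot.\<close>

lemma hess_tangent:
  assumes "open U" "smooth_on U f" "w \<in> U" "\<And>z v. z \<in> S \<inter> U \<Longrightarrow> frechet_derivative f (at z) v = 0" "v \<in> tangent S w"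
  shows "hess f w v v' = 0" "hess f w v' v = 0"
proof -
  show "hess f w v v' = 0"
    unfolding hess_eq
    by (rule tangent_deriv_zero[OF assms(5) smooth_on_has_derivative[OF smooth_on_deriv[OF assms(2)] assms(3)] assms(1,3,4)])
  then show "hess f w v' v = 0" by (simp add: hess_commute[OF assms(1-3), of v'])
qed

section \<open>Involutive charts\<close>

text \<open>Part of a system of homogeneous canonical coordinates: momenta \<open>\<zeta>\<close>
  that cut out \<open>S\<close> and their conjugate positions \<open>x\<close>. Both have values in
  the range of \<open>proj d n m\<close>, so \<open>d\<close> scalar functions are handled as one
  vector that can be tested with arbitrary \<open>a\<close>. Degree 0 of \<open>x\<close> is what
  distinguishes its conjugate fields from the radial one.\<close>

locale involutive_chart =
  fixes U S :: "'n::finite phase set" and d :: nat and n m :: "nat \<Rightarrow> real ^ 'n" and \<zeta> x :: "'n phase \<Rightarrow> real ^ 'n"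
  assumes U: "conic_open U" and dual: "dual_pair d n m"
    and smooth_\<zeta>: "smooth_on U \<zeta>" and hom_\<zeta>: "homogeneous 1 U \<zeta>" and proj_\<zeta>: "\<And>z. z \<in> U \<Longrightarrow> proj d n m (\<zeta> z) = \<zeta> z"
    and smooth_x: "smooth_on U x" and hom_x: "homogeneous 0 U x" and proj_x: "\<And>z. proj d n m (x z) = x z"
    and zero: "S \<inter> U = {z\<in>U. \<zeta> z = 0}"
    and bracket: "\<And>z a b. z \<in> U \<Longrightarrow> poisson (\<lambda>z. a \<bullet> \<zeta> z) (\<lambda>z. b \<bullet> \<zeta> z) z = 0"
    and deriv_x_ham: "\<And>z a. z \<in> U \<Longrightarrow> frechet_derivative x (at z) (ham (\<lambda>z. a \<bullet> \<zeta> z) z) = proj d n m a"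
begin

abbreviation "\<pi> \<equiv> proj d n m"

definition H :: "real ^ 'n \<Rightarrow> 'n phase \<Rightarrow> 'n phase" where
  "H a z = ham (\<lambda>z. a \<bullet> \<zeta> z) z"

text \<open>The sign is chosen such that the derivative of \<open>\<zeta>\<close> sends
  \<open>\<nu> r\<close> to \<open>proj d n m r\<close>. At points of \<open>S\<close> these vectors
  therefore span a complement of the tangent space.\<close>

definition \<nu> :: "real ^ 'n \<Rightarrow> 'n phase \<Rightarrow> 'n phase" where
  "\<nu> r z = - ham (\<lambda>z. r \<bullet> x z) z"

lemma open_U: "open U" by (rule conic_open_open[OF U])

lemma smooth_inner_\<zeta>: "smooth_on U (\<lambda>z. a \<bullet> \<zeta> z)"
  by (rule smooth_on_bounded_linear[OF bounded_linear_inner_right open_U smooth_\<zeta>])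

lemma smooth_inner_x: "smooth_on U (\<lambda>z. a \<bullet> x z)"
  by (rule smooth_on_bounded_linear[OF bounded_linear_inner_right open_U smooth_x])

lemma diff_\<zeta>: "z \<in> U \<Longrightarrow> (\<lambda>z. a \<bullet> \<zeta> z) differentiable (at z)"
  by (rule differentiableI[OF smooth_on_has_derivative[OF smooth_inner_\<zeta>]])

lemma diff_x: "z \<in> U \<Longrightarrow> (\<lambda>z. a \<bullet> x z) differentiable (at z)"
  by (rule differentiableI[OF smooth_on_has_derivative[OF smooth_inner_x]])

lemma deriv_inner_\<zeta>: "z \<in> U \<Longrightarrow> frechet_derivative (\<lambda>z. a \<bullet> \<zeta> z) (at z) v = a \<bullet> frechet_derivative \<zeta> (at z) v"
  by (simp add: frechet_derivative_eqI[OF has_derivative_inner_right[OF smooth_on_has_derivative[OF smooth_\<zeta>]]])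

lemma deriv_inner_x: "z \<in> U \<Longrightarrow> frechet_derivative (\<lambda>z. a \<bullet> x z) (at z) v = a \<bullet> frechet_derivative x (at z) v"
  by (simp add: frechet_derivative_eqI[OF has_derivative_inner_right[OF smooth_on_has_derivative[OF smooth_x]]])

lemma symp_H: "z \<in> U \<Longrightarrow> symp v (H a z) = a \<bullet> frechet_derivative \<zeta> (at z) v"
  unfolding H_def deriv_inner_\<zeta>[symmetric] by (rule deriv_ham[OF diff_\<zeta>, symmetric])

lemma symp_HH: "z \<in> U \<Longrightarrow> symp (H a z) (H b z) = 0"
  using bracket[of z a b] poisson_symp[OF diff_\<zeta>, of z "\<lambda>z. a \<bullet> \<zeta> z" b] by (simp add: H_def)

lemma deriv_\<zeta>_H: "z \<in> U \<Longrightarrow> frechet_derivative \<zeta> (at z) (H a z) = 0"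
  using symp_H[of z "H a z"] symp_HH[of z a] by (metis vector_eq_ldot inner_zero_right)

lemma deriv_x_H: "z \<in> U \<Longrightarrow> frechet_derivative x (at z) (H a z) = \<pi> a"
  unfolding H_def by (rule deriv_x_ham)

lemma linear_H: "z \<in> U \<Longrightarrow> linear (\<lambda>a. H a z)"
proof -
  assume z: "z \<in> U"
  have e: "frechet_derivative (\<lambda>z. a \<bullet> \<zeta> z) (at z) = (\<lambda>v. a \<bullet> frechet_derivative \<zeta> (at z) v)" for a
    by (rule ext) (rule deriv_inner_\<zeta>[OF z])
  show ?thesis
    unfolding H_def ham_def e by (rule linearI) (auto simp: vec_eq_iff prod_eq_iff inner_simps)
qed

lemma deriv_\<zeta>_proj: "z \<in> U \<Longrightarrow> \<pi> (frechet_derivative \<zeta> (at z) v) = frechet_derivative \<zeta> (at z) v"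
proof -
  assume z: "z \<in> U"
  have d: "(\<zeta> has_derivative frechet_derivative \<zeta> (at z)) (at z)" by (rule smooth_on_has_derivative[OF smooth_\<zeta> z])
  have "((\<lambda>z. \<pi> (\<zeta> z)) has_derivative (\<lambda>v. \<pi> (frechet_derivative \<zeta> (at z) v))) (at z)"
    by (rule bounded_linear.has_derivative[OF bounded_linear_proj d])
  then have "(\<zeta> has_derivative (\<lambda>v. \<pi> (frechet_derivative \<zeta> (at z) v))) (at z)"
    by (rule has_derivative_transform_within_open[OF _ open_U z]) (rule proj_\<zeta>)
  from fun_cong[OF has_derivative_unique[OF this d]] show ?thesis .
qed

lemma H_proj: "z \<in> U \<Longrightarrow> H (\<pi> a) z = H a z"
  by (rule symp_nondegenerate) (simp add: symp_H proj_symmetric[OF dual] deriv_\<zeta>_proj)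

lemma proj_m: "j < d \<Longrightarrow> \<pi> (m j) = m j"
proof -
  assume "j < d"
  then have "\<pi> (m j) = (\<Sum>i<d. if i = j then m i else 0)"
    unfolding proj_def using dual by (intro sum.cong) (auto simp: dual_pair_def)
  then show ?thesis using \<open>j < d\<close> by simp
qed

lemma proj_n_sum_eq_0:
  assumes "\<pi> (\<Sum>j<d. c j *\<^sub>R n j) = 0" "i < d" shows "c i = 0"
proof -
  have "0 = \<pi> (\<Sum>j<d. c j *\<^sub>R n j) \<bullet> m i" using assms by simp
  also have "\<dots> = (\<Sum>j<d. c j * (n j \<bullet> m i))"
    unfolding proj_symmetric[OF dual] proj_m[OF assms(2)] by (simp add: inner_sum_left)
  also have "\<dots> = (\<Sum>j<d. if j = i then c j else 0)"
    using dual assms(2) by (intro sum.cong) (auto simp: dual_pair_def)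
  finally show ?thesis using assms(2) by simp
qed

lemma deriv_\<zeta>_\<nu>: "z \<in> U \<Longrightarrow> frechet_derivative \<zeta> (at z) (\<nu> r z) = \<pi> r"
proof -
  assume z: "z \<in> U"
  have "a \<bullet> frechet_derivative \<zeta> (at z) (\<nu> r z) = a \<bullet> \<pi> r" for a
  proof -
    have "a \<bullet> frechet_derivative \<zeta> (at z) (\<nu> r z) = symp (\<nu> r z) (H a z)" by (simp add: symp_H[OF z])
    also have "\<dots> = symp (H a z) (ham (\<lambda>z. r \<bullet> x z) z)"
      using symp_commute[of "H a z"] by (simp add: \<nu>_def symp_simps)
    also have "\<dots> = r \<bullet> \<pi> a" by (simp add: deriv_ham[OF diff_x[OF z], symmetric] deriv_inner_x[OF z] deriv_x_H[OF z])
    also have "\<dots> = a \<bullet> \<pi> r" using proj_symmetric[OF dual, of r a] by (simp add: inner_commute)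
    finally show ?thesis .
  qed
  then show ?thesis by (metis vector_eq_ldot)
qed

lemma zero_frame: "S \<inter> U = {z\<in>U. \<forall>j<d. n j \<bullet> \<zeta> z = 0}"
proof -
  have "\<zeta> z = 0" if "z \<in> U" "\<forall>j<d. n j \<bullet> \<zeta> z = 0" for z
    using proj_\<zeta>[OF that(1)] proj_eq_0[of d n "\<zeta> z" m] that(2) by simp
  then show ?thesis unfolding zero by auto
qed

lemma sum_H_n: "z \<in> U \<Longrightarrow> (\<Sum>j<d. c j *\<^sub>R H (n j) z) = H (\<Sum>j<d. c j *\<^sub>R n j) z"
  by (simp add: linear_sum[OF linear_H] linear_cmul[OF linear_H])

text \<open>A vanishing combination of differentials has a vanishing Hamilton field, and the
  derivative of \<open>x\<close> recovers the coefficients from this field.\<close>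

lemma frame_independent: "z \<in> U \<Longrightarrow> independent_at d (\<lambda>j z. n j \<bullet> \<zeta> z) z"
  unfolding independent_at_def
proof (intro allI impI)
  fix c i assume z: "z \<in> U" and i: "i < d"
    and c: "\<forall>v. (\<Sum>j<d. c j * frechet_derivative (\<lambda>z. n j \<bullet> \<zeta> z) (at z) v) = 0"
  have "(\<Sum>j<d. c j *\<^sub>R n j) \<bullet> frechet_derivative \<zeta> (at z) v = 0" for v
    using c[rule_format, of v] by (simp add: inner_sum_left deriv_inner_\<zeta>[OF z])
  then have "symp v (H (\<Sum>j<d. c j *\<^sub>R n j) z) = symp v 0" for v by (simp add: symp_H[OF z] symp_simps)
  then have "H (\<Sum>j<d. c j *\<^sub>R n j) z = 0" by (rule symp_nondegenerate)
  then have "\<pi> (\<Sum>j<d. c j *\<^sub>R n j) = 0"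
    using deriv_x_H[OF z] linear_0[OF smooth_on_deriv_linear[OF smooth_x z]] by metis
  then show "c i = 0" using i by (rule proj_n_sum_eq_0)
qed

lemma tangent_S:
  assumes z: "z \<in> S" "z \<in> U" shows "tangent S z = {v. frechet_derivative \<zeta> (at z) v = 0}"
proof -
  have "tangent S z = {v. \<forall>j<d. n j \<bullet> frechet_derivative \<zeta> (at z) v = 0}"
    using tangent_regular[OF open_U z(2,1) smooth_inner_\<zeta> zero_frame frame_independent[OF z(2)]]
    by (simp add: deriv_inner_\<zeta>[OF z(2)])
  also have "\<dots> = {v. frechet_derivative \<zeta> (at z) v = 0}"
  proof -
    have "frechet_derivative \<zeta> (at z) v = 0" if "\<forall>j<d. n j \<bullet> frechet_derivative \<zeta> (at z) v = 0" for v
      using deriv_\<zeta>_proj[OF z(2), of v] proj_eq_0[of d n _ m] that by metis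
    then show ?thesis by auto
  qed
  finally show ?thesis .
qed

text \<open>A functional that kills the kernel of the derivative of \<open>\<zeta>\<close> factors
  through this derivative. The vectors \<open>\<nu> (m j)\<close> are dual to the functionals
  \<open>n j \<bullet> frechet_derivative \<zeta>\<close> and make the factor explicit.\<close>

lemma tangent_ann_S:
  assumes z: "z \<in> S" "z \<in> U" shows "tangent_ann S z = range (\<lambda>a. H a z)"
proof (intro equalityI subsetI)
  fix v assume v: "v \<in> tangent_ann S z"
  have "linear (\<lambda>u. symp u v)" by (rule linearI) (simp_all add: symp_simps)
  moreover have "symp u v = 0" if "\<And>j. j < d \<Longrightarrow> n j \<bullet> frechet_derivative \<zeta> (at z) u = 0" for u
  proof -
    have "frechet_derivative \<zeta> (at z) u = 0"
      using deriv_\<zeta>_proj[OF z(2), of u] proj_eq_0[of d n _ m] that by metis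
    then have "u \<in> tangent S z" by (simp add: tangent_S[OF z])
    then have "symp v u = 0" using v by (simp add: tangent_ann_def)
    then show ?thesis by (subst symp_commute) simp
  qed
  moreover have "linear (\<lambda>u. n j \<bullet> frechet_derivative \<zeta> (at z) u)" for j
    by (rule linearI) (simp_all add: linear_add[OF smooth_on_deriv_linear[OF smooth_\<zeta> z(2)]]
       linear_cmul[OF smooth_on_deriv_linear[OF smooth_\<zeta> z(2)]] inner_simps)
  ultimately have e: "symp u v = (\<Sum>j<d. symp (\<nu> (m j) z) v * (n j \<bullet> frechet_derivative \<zeta> (at z) u))" for u
    by (intro functional_combination[where m = "\<lambda>j. \<nu> (m j) z"])
       (use dual in \<open>auto simp: deriv_\<zeta>_\<nu>[OF z(2)] proj_m dual_pair_def\<close>)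
  have "v = H (\<Sum>j<d. symp (\<nu> (m j) z) v *\<^sub>R n j) z"
    by (rule symp_nondegenerate, subst e) (simp add: symp_H[OF z(2)] inner_sum_left)
  then show "v \<in> range (\<lambda>a. H a z)" by blast
next
  fix v assume "v \<in> range (\<lambda>a. H a z)"
  then obtain a where v: "v = H a z" by blast
  show "v \<in> tangent_ann S z"
    unfolding tangent_ann_def
  proof (intro CollectI ballI)
    fix u assume "u \<in> tangent S z"
    then have "symp u v = 0" by (simp add: tangent_S[OF z] v symp_H[OF z(2)])
    then show "symp v u = 0" by (subst symp_commute) simp
  qed
qed

lemma deriv_x_radial: "z \<in> U \<Longrightarrow> frechet_derivative x (at z) (radial z) = 0"
proof -
  assume z: "z \<in> U"
  have "((\<lambda>t::real. (fst z, t *\<^sub>R snd z)) has_derivative (\<lambda>t. (0, t *\<^sub>R snd z))) (at 1)"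
    by (auto intro!: derivative_eq_intros)
  then have sd: "((\<lambda>t::real. scl t z) has_derivative (\<lambda>t. t *\<^sub>R radial z)) (at 1)"
    by (simp add: scl_def radial_def)
  have "(x has_derivative frechet_derivative x (at z)) (at (scl 1 z))"
    using smooth_on_has_derivative[OF smooth_x z] by simp
  with sd have "((\<lambda>t. x (scl t z)) has_derivative (\<lambda>t. frechet_derivative x (at z) (t *\<^sub>R radial z))) (at 1)"
    by (rule has_derivative_compose)
  moreover have "((\<lambda>t. x (scl t z)) has_derivative (\<lambda>t. 0)) (at 1)"
    by (rule has_derivative_transform_within_open[OF has_derivative_const[of "x z"], of "{0<..}"])
       (use homogeneousD[OF hom_x z] in auto)
  ultimately have "(\<lambda>t. frechet_derivative x (at z) (t *\<^sub>R radial z)) = (\<lambda>t. 0)" by (rule has_derivative_unique)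
  from fun_cong[OF this, of 1] show ?thesis by simp
qed

text \<open>Independence from the radial field comes from \<open>x\<close>: its derivative kills the
  radial field by Euler's relation in degree 0, but recovers the coefficients of a combination of
  frame fields.\<close>

lemma sympl_frame: "sympl_frame U (S \<inter> U) d (\<lambda>j z. n j \<bullet> \<zeta> z)"
  unfolding sympl_frame_def
proof (intro conjI allI impI ballI)
  show "smooth_on U (\<lambda>z. n j \<bullet> \<zeta> z)" for j by (rule smooth_inner_\<zeta>)
  show "homogeneous 1 U (\<lambda>z. n j \<bullet> \<zeta> z)" for j using hom_\<zeta> by (simp add: homogeneous_def)
  show "poisson (\<lambda>z. n j \<bullet> \<zeta> z) (\<lambda>z. n k \<bullet> \<zeta> z) z = 0" if "z \<in> U" for j k z using that by (rule bracket)
  show "S \<inter> U = {z\<in>U. \<forall>j<d. n j \<bullet> \<zeta> z = 0}" by (rule zero_frame)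
  fix z c r j assume z: "z \<in> U" and c: "(\<Sum>j<d. c j *\<^sub>R ham (\<lambda>z. n j \<bullet> \<zeta> z) z) = r *\<^sub>R radial z" and j: "j < d"
  have "H (\<Sum>j<d. c j *\<^sub>R n j) z = r *\<^sub>R radial z" using c by (simp add: H_def[symmetric] sum_H_n[OF z])
  then have "\<pi> (\<Sum>j<d. c j *\<^sub>R n j) = frechet_derivative x (at z) (r *\<^sub>R radial z)"
    using deriv_x_H[OF z] by metis
  also have "\<dots> = 0" by (simp add: linear_cmul[OF smooth_on_deriv_linear[OF smooth_x z]] deriv_x_radial[OF z])
  finally show "c j = 0" using j by (rule proj_n_sum_eq_0)
qed

text \<open>A vector \<open>v\<close> differs from \<open>\<nu>\<close> of its
  \<open>\<zeta>\<close> derivative by a tangent vector, and the Hessian does not see tangent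
  vectors.\<close>

lemma hess_normal:
  assumes p: "smooth_on U f" "\<And>z v. z \<in> S \<inter> U \<Longrightarrow> frechet_derivative f (at z) v = 0" and z: "z \<in> S" "z \<in> U"
  shows "hess f z v v' = hess f z (\<nu> (frechet_derivative \<zeta> (at z) v) z) (\<nu> (frechet_derivative \<zeta> (at z) v') z)"
proof -
  note lh = linear_hess[OF open_U p(1) z(2)]
  have t: "v - \<nu> (frechet_derivative \<zeta> (at z) v) z \<in> tangent S z" for v
    by (simp add: tangent_S[OF z] linear_diff[OF smooth_on_deriv_linear[OF smooth_\<zeta> z(2)]] deriv_\<zeta>_\<nu>[OF z(2)] deriv_\<zeta>_proj[OF z(2)])
  have 1: "hess f z v v' = hess f z (\<nu> (frechet_derivative \<zeta> (at z) v) z) v'"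
    using hess_tangent(1)[OF open_U p(1) z(2) p(2) t[of v], of v'] by (simp add: linear_diff[OF lh(1)])
  have 2: "hess f z v v' = hess f z v (\<nu> (frechet_derivative \<zeta> (at z) v') z)" for v
    using hess_tangent(2)[OF open_U p(1) z(2) p(2) t[of v'], of v] by (simp add: linear_diff[OF lh(2)])
  show ?thesis using 1 2 by simp
qed

lemma linear_\<nu>: "z \<in> U \<Longrightarrow> linear (\<lambda>r. \<nu> r z)"
proof -
  assume z: "z \<in> U"
  have e: "frechet_derivative (\<lambda>z. a \<bullet> x z) (at z) = (\<lambda>v. a \<bullet> frechet_derivative x (at z) v)" for a
    by (rule ext) (rule deriv_inner_x[OF z])
  show ?thesis
    unfolding \<nu>_def ham_def e by (rule linearI) (auto simp: vec_eq_iff prod_eq_iff inner_simps)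
qed

lemma quadratic_coeffs:
  assumes p: "smooth_on U f" "\<And>z v. z \<in> S \<inter> U \<Longrightarrow> frechet_derivative f (at z) v = 0"
  shows "quadratic_coeffs (S \<inter> U) f d (\<lambda>j z. n j \<bullet> \<zeta> z) (\<lambda>j k z. hess f z (\<nu> (m j) z) (\<nu> (m k) z) / 2)"
  unfolding quadratic_coeffs_def
proof (intro ballI conjI allI impI)
  fix z assume "z \<in> S \<inter> U"
  then have z: "z \<in> S" "z \<in> U" by auto
  note lh = linear_hess[OF open_U p(1) z(2)]
  show "hess f z (\<nu> (m j) z) (\<nu> (m k) z) / 2 = hess f z (\<nu> (m k) z) (\<nu> (m j) z) / 2" for j k
    by (simp add: hess_commute[OF open_U p(1) z(2), of "\<nu> (m j) z"])
  fix v v'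
  have n: "\<nu> (frechet_derivative \<zeta> (at z) v) z = (\<Sum>j<d. (n j \<bullet> frechet_derivative \<zeta> (at z) v) *\<^sub>R \<nu> (m j) z)" for v
  proof -
    have "\<nu> (frechet_derivative \<zeta> (at z) v) z = \<nu> (\<pi> (frechet_derivative \<zeta> (at z) v)) z" by (simp add: deriv_\<zeta>_proj[OF z(2)])
    then show ?thesis by (simp add: proj_def linear_sum[OF linear_\<nu>[OF z(2)]] linear_cmul[OF linear_\<nu>[OF z(2)]])
  qed
  have "hess f z v v' = hess f z (\<Sum>j<d. (n j \<bullet> frechet_derivative \<zeta> (at z) v) *\<^sub>R \<nu> (m j) z)
      (\<Sum>k<d. (n k \<bullet> frechet_derivative \<zeta> (at z) v') *\<^sub>R \<nu> (m k) z)"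
    unfolding n[symmetric] by (rule hess_normal[OF p z])
  also have "\<dots> = (\<Sum>j<d. \<Sum>k<d. (n j \<bullet> frechet_derivative \<zeta> (at z) v) * ((n k \<bullet> frechet_derivative \<zeta> (at z) v') * hess f z (\<nu> (m j) z) (\<nu> (m k) z)))"
    by (simp add: linear_sum[OF lh(1)] linear_cmul[OF lh(1)] sum_distrib_left)
       (simp add: linear_sum[OF lh(2)] linear_cmul[OF lh(2)] sum_distrib_left)
  finally show "hess f z v v' = 2 * (\<Sum>j<d. \<Sum>k<d. hess f z (\<nu> (m j) z) (\<nu> (m k) z) / 2 *
            frechet_derivative (\<lambda>z. n j \<bullet> \<zeta> z) (at z) v * frechet_derivative (\<lambda>z. n k \<bullet> \<zeta> z) (at z) v')"
    by (simp add: deriv_inner_\<zeta>[OF z(2)] sum_distrib_left mult_ac)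
qed

end

declare split_paired_All [simp del] split_paired_Ex [simp del]

section \<open>Localization of the hypotheses\<close>

lemma Sigma2_subset: "Sigma2 U p \<subseteq> U"
  by (auto simp: Sigma2_def)

lemma Sigma2_restrict: "U' \<subseteq> U \<Longrightarrow> Sigma2 U' p = Sigma2 U p \<inter> U'"
  by (auto simp: Sigma2_def)

lemma submanifoldE:
  fixes S :: "'a::real_normed_vector set"
  assumes "submanifold S" "w \<in> S"
  obtains W d and u :: "nat \<Rightarrow> 'a \<Rightarrow> real" where "open W" "w \<in> W" "0 < d" "\<And>j. j < d \<Longrightarrow> smooth_on W (u j)"
    "S \<inter> W = {z\<in>W. \<forall>j<d. u j z = 0}" "\<And>z. z \<in> W \<Longrightarrow> independent_at d u z"
  using bspec[OF assms(1)[unfolded submanifold_def] assms(2)]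
proof (elim exE conjE)
  fix W d and u :: "nat \<Rightarrow> 'a \<Rightarrow> real"
  assume "open W" "w \<in> W" "0 < d" "\<forall>j<d. smooth_on W (u j)" "S \<inter> W = {z\<in>W. \<forall>j<d. u j z = 0}"
    "\<forall>z\<in>W. \<forall>c. (\<forall>v. (\<Sum>j<d. c j * frechet_derivative (u j) (at z) v) = 0) \<longrightarrow> (\<forall>j<d. c j = 0)"
  then show thesis by (intro that[of W d u]) (simp_all add: independent_at_def)
qed

lemma submanifold_restrict:
  assumes "submanifold S" "open U" shows "submanifold (S \<inter> U)"
  unfolding submanifold_def
proof (intro ballI)
  fix w assume w: "w \<in> S \<inter> U"
  then have "w \<in> S" by simp
  obtain W d and u :: "nat \<Rightarrow> 'a \<Rightarrow> real" where *: "open W" "w \<in> W" "0 < d" "\<And>j. j < d \<Longrightarrow> smooth_on W (u j)"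
    "S \<inter> W = {z\<in>W. \<forall>j<d. u j z = 0}" "\<And>z. z \<in> W \<Longrightarrow> independent_at d u z"
    by (rule submanifoldE[OF assms(1) \<open>w \<in> S\<close>]) blast
  have "S \<inter> U \<inter> (W \<inter> U) = {z\<in>W \<inter> U. \<forall>j<d. u j z = 0}" using *(5) by blast
  show "\<exists>W d u. open W \<and> w \<in> W \<and> 0 < d \<and> (\<forall>j<d. smooth_on W (u j :: 'a \<Rightarrow> real)) \<and>
        S \<inter> U \<inter> W = {z\<in>W. \<forall>j<d. u j z = 0} \<and>
        (\<forall>z\<in>W. \<forall>c. (\<forall>v. (\<Sum>j<d. c j * frechet_derivative (u j) (at z) v) = 0) \<longrightarrow> (\<forall>j<(d::nat). c j = 0))"
  proof (intro exI[of _ "W \<inter> U"] exI[of _ d] exI[of _ u] conjI)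
    show "\<forall>z\<in>W \<inter> U. \<forall>c. (\<forall>v. (\<Sum>j<d. c j * frechet_derivative (u j) (at z) v) = 0) \<longrightarrow> (\<forall>j<d. c j = 0)"
      using *(6) unfolding independent_at_def by blast
    show "\<forall>j<d. smooth_on (W \<inter> U) (u j)" using smooth_on_subset[OF *(4)] by simp
  qed (use * w assms(2) \<open>S \<inter> U \<inter> (W \<inter> U) = _\<close> in auto)
qed

lemma real_double_char_restrict:
  assumes "real_double_char U p" "open U'" "U' \<subseteq> U" shows "real_double_char U' p"
proof -
  have "tangent (Sigma2 U p \<inter> U') w = tangent (Sigma2 U p) w" "tangent_ann (Sigma2 U p \<inter> U') w = tangent_ann (Sigma2 U p) w"
    if "w \<in> Sigma2 U p \<inter> U'" for w
    using that assms(2) by (auto simp: tangent_localize tangent_ann_localize)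
  then show ?thesis
    using assms submanifold_restrict[of "Sigma2 U p" U'] unfolding real_double_char_def Sigma2_restrict[OF assms(3)] by auto
qed

lemma real_subprincipal_type_restrict:
  assumes "real_subprincipal_type U p q" "open U'" "U' \<subseteq> U" shows "real_subprincipal_type U' p q"
proof -
  have "tangent (Sigma2 U p \<inter> U') w = tangent (Sigma2 U p) w" "tangent_ann (Sigma2 U p \<inter> U') w = tangent_ann (Sigma2 U p) w"
    if "w \<in> Sigma2 U p \<inter> U'" for w
    using that assms(2) by (auto simp: tangent_localize tangent_ann_localize)
  then show ?thesis
    using assms unfolding real_subprincipal_type_def Sigma2_restrict[OF assms(3)] by simp
qed

lemma sub_r_multiplier_restrict:
  assumes "sub_r_multiplier U p q a" "open U'" "U' \<subseteq> U" shows "sub_r_multiplier U' p q a"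
  using assms(1) real_double_char_restrict[OF _ assms(2,3)] real_subprincipal_type_restrict[OF _ assms(2,3)]
    smooth_on_subset[OF _ assms(3)] assms(3)
  unfolding sub_r_multiplier_def homogeneous_def by auto

lemma Sigma2_scl:
  assumes "conic_open U" "smooth_on U p" "homogeneous r U p" "z \<in> Sigma2 U p" "0 < t"
  shows "scl t z \<in> Sigma2 U p"
proof -
  have z: "z \<in> U" "p z = 0" "\<And>v. frechet_derivative p (at z) v = 0" using assms(4) by (auto simp: Sigma2_def)
  have t: "scl t z \<in> U" by (rule conic_open_scl[OF assms(1) z(1) assms(5)])
  have "frechet_derivative p (at (scl t z)) v = 0" for v
  proof -
    obtain u where "v = scl t u" using surjD[OF surj_scl[of t]] assms(5) by blast
    then show ?thesis
      using homogeneous_deriv[OF assms(1,3) z(1) assms(5), of u] z(3) differentiableI[OF smooth_on_has_derivative[OF assms(2)]] z(1) t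
      by simp
  qed
  then show ?thesis using homogeneousD[OF assms(3) z(1) assms(5)] z(2) t by (simp add: Sigma2_def)
qed

lemma subspace_tangent_ann: "subspace (tangent_ann S w)"
  unfolding subspace_def tangent_ann_def by (auto simp: symp_simps)

text \<open>\<open>q\<close> is an arbitrary symbol of degree \<open>r - 1\<close> rather than the
  subprincipal symbol itself, so that all results can be applied again after multiplication of
  \<open>p\<close> and \<open>q\<close> by an elliptic factor.\<close>

locale double_char =
  fixes U :: "'n::finite phase set" and p q :: "'n phase \<Rightarrow> complex" and r :: real
  assumes domain: "conic_open U" and smooth_p: "smooth_on U p" and hom_p: "homogeneous r U p"
    and smooth_q: "smooth_on U q" and hom_q: "homogeneous (r - 1) U q"
    and rdc: "real_double_char U p" and rst: "real_subprincipal_type U p q"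
begin

abbreviation "S \<equiv> Sigma2 U p"
abbreviation "g \<equiv> \<lambda>z. Re (q z)"
abbreviation "f \<equiv> \<lambda>z. Im (q z)"

lemma open_domain: "open U" by (rule conic_open_open[OF domain])

lemma smooth_g: "smooth_on U g" and smooth_Re_p: "smooth_on U (\<lambda>z. Re (p z))"
  by (rule smooth_on_bounded_linear[OF bounded_linear_Re open_domain smooth_q]
      smooth_on_bounded_linear[OF bounded_linear_Re open_domain smooth_p])+

lemma diff_g: "z \<in> U \<Longrightarrow> g differentiable (at z)"
  by (rule differentiableI[OF smooth_on_has_derivative[OF smooth_g]])

lemma deriv_Re_p: "z \<in> S \<Longrightarrow> frechet_derivative (\<lambda>z. Re (p z)) (at z) v = 0"
proof -
  assume z: "z \<in> S"
  have "((\<lambda>z. Re (p z)) has_derivative (\<lambda>v. Re (frechet_derivative p (at z) v))) (at z)"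
    using z Sigma2_subset by (intro bounded_linear.has_derivative[OF bounded_linear_Re smooth_on_has_derivative[OF smooth_p]]) auto
  moreover have "frechet_derivative p (at z) v = 0" using z by (simp add: Sigma2_def)
  ultimately show ?thesis by (simp add: frechet_derivative_eqI)
qed

lemma ham_g_tangent: "w \<in> S \<Longrightarrow> ham g w \<in> tangent S w"
  using rst by (simp add: real_subprincipal_type_def)

lemma deriv_g_ann: "w \<in> S \<Longrightarrow> v \<in> tangent_ann S w \<Longrightarrow> frechet_derivative g (at w) v = 0"
  using ham_g_tangent[of w] deriv_ham[OF diff_g, of w v] Sigma2_subset[of U p] by (auto simp: tangent_ann_def)

text \<open>Real subprincipal type enters here: the differential of \<open>Re q\<close> vanishes on
  the annihilator, so \<open>Re q\<close> commutes on \<open>Sigma2\<close> with the defining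
  functions, as the construction of \<open>gt\<close> demands. Involutivity and the nonradial
  assumption supply the remaining hypotheses of \<open>involutive_frame\<close>.\<close>

lemma chart_exists:
  assumes w0: "w0 \<in> S"
  obtains U1 D d n m \<zeta> x gt where "involutive_chart U1 S d n m \<zeta> x" "w0 \<in> U1" "U1 \<subseteq> U"
    "open D" "w0 \<in> D" "D \<subseteq> U1" "smooth_on D gt" "\<And>z. z \<in> S \<inter> D \<Longrightarrow> gt z = g z"
    "\<And>z a. z \<in> D \<Longrightarrow> poisson gt (\<lambda>z. a \<bullet> \<zeta> z) z = 0"
    "\<And>z. z \<in> D \<Longrightarrow> frechet_derivative x (at z) (ham gt z) = 0"
proof -
  have sub: "submanifold S" and inv: "\<And>w. w \<in> S \<Longrightarrow> tangent_ann S w \<subseteq> tangent S w"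
    and rad: "\<And>w. w \<in> S \<Longrightarrow> radial w \<notin> tangent_ann S w"
    using rdc by (auto simp: real_double_char_def)
  obtain W0 d and u :: "nat \<Rightarrow> 'n phase \<Rightarrow> real" where *: "open W0" "w0 \<in> W0" "0 < d" "\<And>j. j < d \<Longrightarrow> smooth_on W0 (u j)"
    "S \<inter> W0 = {z\<in>W0. \<forall>j<d. u j z = 0}" "\<And>z. z \<in> W0 \<Longrightarrow> independent_at d u z"
    by (rule submanifoldE[OF sub w0]) blast
  define W where "W = W0 \<inter> U"
  have W: "open W" "w0 \<in> W" "W \<subseteq> U" using * open_domain w0 Sigma2_subset[of U p] by (auto simp: W_def)
  have sm: "smooth_on W (u j)" if "j < d" for j unfolding W_def using smooth_on_subset[OF *(4)[OF that]] by simp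
  have zero: "S \<inter> W = {z\<in>W. \<forall>j<d. u j z = 0}" using *(5) by (auto simp: W_def)
  have ind: "independent_at d u z" if "z \<in> W" for z using *(6) that by (simp add: W_def)
  have dif: "u j differentiable (at z)" if "z \<in> W" "j < d" for z j
    by (rule differentiableI[OF smooth_on_has_derivative[OF sm[OF that(2)] that(1)]])
  have du: "frechet_derivative (u j) (at w) v = 0" if "w \<in> S \<inter> W" "j < d" "v \<in> tangent S w" for w j v
  proof -
    have "u j z = 0" if "z \<in> S \<inter> W" for z using that \<open>j < d\<close> unfolding zero by blast
    then show ?thesis
      using that(1) by (intro tangent_deriv_zero[OF that(3) smooth_on_has_derivative[OF sm[OF that(2)]] W(1)]) auto
  qed
  have ann: "ham (u j) w \<in> tangent_ann S w" if "w \<in> S \<inter> W" "j < d" for w j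
    unfolding tangent_ann_def
  proof (intro CollectI ballI)
    fix v assume "v \<in> tangent S w"
    then have "symp v (ham (u j) w) = 0" using du[OF that] deriv_ham[OF dif[of w j]] that by auto
    then show "symp (ham (u j) w) v = 0" by (subst symp_commute) simp
  qed
  have invol: "poisson (u i) (u j) w = 0" if "w \<in> S \<inter> W" "i < d" "j < d" for w i j
    unfolding poisson_def using ann[OF that(1,2)] inv[of w] that(1) by (intro du[OF that(1,3)]) auto
  have pg: "poisson (u j) g w = 0" if "w \<in> S \<inter> W" "j < d" for w j
    unfolding poisson_def using deriv_g_ann ann[OF that] that(1) by blast
  have nr: "(\<Sum>j<d. c j *\<^sub>R ham (u j) w0) \<noteq> radial w0" for c
  proof -
    have "(\<Sum>j<d. c j *\<^sub>R ham (u j) w0) \<in> tangent_ann S w0"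
      using ann w0 W by (intro subspace_sum subspace_scale subspace_tangent_ann) auto
    then show ?thesis using rad[OF w0] by auto
  qed
  have sg: "smooth_on W g" by (rule smooth_on_subset[OF smooth_g W(3)])
  show ?thesis
  proof (rule involutive_frame[OF domain W(3,1,2) w0 sm zero ind nr invol sg pg Sigma2_scl[OF domain smooth_p hom_p]])
    fix U1 D and n m :: "nat \<Rightarrow> real ^ 'n" and \<zeta> x and gt :: "'n phase \<Rightarrow> real"
    assume **: "conic_open U1" "w0 \<in> U1" "U1 \<subseteq> U" "open D" "w0 \<in> D" "D \<subseteq> U1" "dual_pair d n m"
    "smooth_on U1 \<zeta>" "homogeneous 1 U1 \<zeta>" "\<And>z. z \<in> U1 \<Longrightarrow> proj d n m (\<zeta> z) = \<zeta> z"
    "smooth_on U1 x" "homogeneous 0 U1 x" "\<And>z. proj d n m (x z) = x z"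
    "S \<inter> U1 = {z\<in>U1. \<zeta> z = 0}"
    "\<And>z a b. z \<in> U1 \<Longrightarrow> poisson (\<lambda>z. a \<bullet> \<zeta> z) (\<lambda>z. b \<bullet> \<zeta> z) z = 0"
    "\<And>z a. z \<in> U1 \<Longrightarrow> frechet_derivative x (at z) (ham (\<lambda>z. a \<bullet> \<zeta> z) z) = proj d n m a"
    "smooth_on D gt" "\<And>z. z \<in> S \<inter> D \<Longrightarrow> gt z = g z"
    "\<And>z a. z \<in> D \<Longrightarrow> poisson gt (\<lambda>z. a \<bullet> \<zeta> z) z = 0"
    "\<And>z. z \<in> D \<Longrightarrow> frechet_derivative x (at z) (ham gt z) = 0"
    then have "involutive_chart U1 S d n m \<zeta> x" by unfold_locales
    then show thesis using ** by (intro that)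
  qed blast+
qed

end

section \<open>From the leaf conditions to the limit bicharacteristics\<close>

lemma leaf_refl: "w \<in> S \<Longrightarrow> w \<in> leaf S w"
  unfolding leaf_def
  by (intro CollectI exI[of _ "\<lambda>_. w"] conjI ballI bexI[of _ 0] has_vector_derivative_const subspace_0[OF subspace_tangent_ann]) auto

lemma has_vector_derivative_affine:
  fixes a b t c :: real
  assumes "(\<gamma> has_vector_derivative v) (at (a + c * t) within T)" "(\<lambda>s. a + c * s) ` T' \<subseteq> T"
  shows "((\<lambda>s. \<gamma> (a + c * s)) has_vector_derivative c *\<^sub>R v) (at t within T')"
proof -
  have "((\<lambda>s. a + c * s) has_vector_derivative c) (at t within T')" by (auto intro!: derivative_eq_intros)
  moreover have "(\<gamma> has_vector_derivative v) (at (a + c * t) within (\<lambda>s. a + c * s) ` T')"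
    using assms by (rule has_vector_derivative_within_subset)
  ultimately show ?thesis using vector_diff_chain_within[of "\<lambda>s. a + c * s" c t T' \<gamma> v] by (simp add: o_def)
qed

lemma leaf_segment:
  assumes "s \<le> s'" and "\<And>t. t \<in> {s..s'} \<Longrightarrow> \<gamma> t \<in> S \<and> (\<exists>v\<in>tangent_ann S (\<gamma> t). (\<gamma> has_vector_derivative v) (at t within {s..s'}))"
  shows "\<gamma> s' \<in> leaf S (\<gamma> s)"
  unfolding leaf_def
proof (intro CollectI exI conjI ballI)
  let ?\<delta> = "\<lambda>t. \<gamma> (s + (s' - s) * t)"
  show "?\<delta> 0 = \<gamma> s" "?\<delta> 1 = \<gamma> s'" by auto
  fix t :: real assume t: "t \<in> {0..1}"
  have im: "(\<lambda>t. s + (s' - s) * t) ` {0..1} \<subseteq> {s..s'}"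
  proof (intro image_subsetI)
    fix t :: real assume t: "t \<in> {0..1}"
    then have "0 \<le> (s' - s) * t" "(s' - s) * t \<le> (s' - s) * 1"
      using assms(1) by (auto intro: mult_nonneg_nonneg mult_left_mono simp del: mult_1_right)
    then show "s + (s' - s) * t \<in> {s..s'}" by simp
  qed
  then have m: "s + (s' - s) * t \<in> {s..s'}" using t by blast
  show "?\<delta> t \<in> S" using assms(2)[OF m] by simp
  obtain v where "v \<in> tangent_ann S (?\<delta> t)" "(\<gamma> has_vector_derivative v) (at (s + (s' - s) * t) within {s..s'})"
    using assms(2)[OF m] by blast
  then show "\<exists>v\<in>tangent_ann S (?\<delta> t). (?\<delta> has_vector_derivative v) (at t within {0..1})"
    using has_vector_derivative_affine[OF _ im] subspace_scale[OF subspace_tangent_ann] by blast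
qed

lemma leaf_sign_neg: "z \<in> L \<Longrightarrow> g z < 0 \<Longrightarrow> \<not> (\<exists>z\<in>L. \<exists>z'\<in>L. g z < 0 \<and> 0 < g z') \<Longrightarrow> leaf_sign g L = -1"
  unfolding leaf_sign_def by (auto simp: not_le not_less) (metis less_irrefl not_le)+

lemma leaf_sign_pos: "z \<in> L \<Longrightarrow> 0 < g z \<Longrightarrow> \<not> (\<exists>z\<in>L. \<exists>z'\<in>L. g z < 0 \<and> 0 < g z') \<Longrightarrow> leaf_sign g L = 1"
  unfolding leaf_sign_def by (auto simp: not_le not_less) (metis less_irrefl not_le)+

text \<open>The frame of the chart is the witness. Orbits in the smaller \<open>U1\<close> are also
  curves in \<open>U\<close>, so the leaf conditions can be used on the larger set as they
  stand.\<close>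

lemma (in double_char) limit_bichar_cond_if_leaf_conditions:
  assumes chart: "involutive_chart U1 S d n m \<zeta> x" "U1 \<subseteq> U" and leaf: "leaf_conditions U p q"
  shows "limit_bichar_cond U1 p q"
proof -
  interpret involutive_chart U1 S d n m \<zeta> x by fact
  let ?\<xi> = "\<lambda>j z. n j \<bullet> \<zeta> z" and ?A = "\<lambda>j k z. hess (\<lambda>z. Re (p z)) z (\<nu> (m j) z) (\<nu> (m k) z) / 2"
  have S1: "Sigma2 U1 p = S \<inter> U1" by (rule Sigma2_restrict[OF chart(2)])
  have q: "quadratic_coeffs (S \<inter> U1) (\<lambda>z. Re (p z)) d ?\<xi> ?A"
    by (rule quadratic_coeffs) (auto intro: smooth_on_subset[OF smooth_Re_p chart(2)] deriv_Re_p)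
  have lf: "leaf_field d ?\<xi> ?A \<theta> w \<in> tangent_ann S w" if "w \<in> S" "w \<in> U1" for \<theta> w
    unfolding leaf_field_def using that tangent_ann_S[OF that]
    by (intro subspace_sum subspace_scale subspace_tangent_ann) (auto simp: H_def)
  have nochange: "\<not> (\<exists>z\<in>leaf S w. \<exists>z'\<in>leaf S w. f z < 0 \<and> 0 < f z')" if "w \<in> S" for w
    using leaf that unfolding leaf_conditions_def no_sign_change_on_leaves_def by blast
  have inv: "tangent_ann S w \<subseteq> tangent S w" if "w \<in> S" for w using rdc that by (simp add: real_double_char_def)
  \<comment> \<open>Treats together the two kinds of fields that contain the Hamilton field of
    \<open>Re q\<close>; the part \<open>v\<close> along the leaf is arbitrary and may vary with the
    point.\<close>
  have bich: "\<not> (f (\<gamma> s) < 0 \<and> 0 < f (\<gamma> s'))"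
    if V: "\<And>w. w \<in> S \<inter> U1 \<Longrightarrow> \<exists>v\<in>tangent_ann S w. V w = ham g w + v" and orb: "orbit (S \<inter> U1) V \<gamma> a b"
      and s: "a \<le> s" "s < s'" "s' \<le> b" for V \<gamma> a b s s'
  proof
    assume neg: "f (\<gamma> s) < 0 \<and> 0 < f (\<gamma> s')"
    have o: "\<gamma> t \<in> S" "\<gamma> t \<in> U1" "(\<gamma> has_vector_derivative V (\<gamma> t)) (at t within {a..b})" if "t \<in> {a..b}" for t
      using orb that by (auto simp: orbit_def)
    have vs: "V (\<gamma> t) \<in> tangent S (\<gamma> t) \<and> (\<forall>v'\<in>tangent S (\<gamma> t). symp v' (V (\<gamma> t)) = frechet_derivative g (at (\<gamma> t)) v')"
      if t: "t \<in> {a..b}" for t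
    proof -
      obtain v where v: "v \<in> tangent_ann S (\<gamma> t)" "V (\<gamma> t) = ham g (\<gamma> t) + v" using V[of "\<gamma> t"] o[OF t] by blast
      have "ham g (\<gamma> t) \<in> tangent S (\<gamma> t)" "v \<in> tangent S (\<gamma> t)" using ham_g_tangent inv v(1) o(1)[OF t] by blast+
      then have "V (\<gamma> t) \<in> tangent S (\<gamma> t)"
        using o(1,2)[OF t] by (simp add: v(2) tangent_S linear_add[OF smooth_on_deriv_linear[OF smooth_\<zeta>]])
      moreover have "symp v' v = 0" if "v' \<in> tangent S (\<gamma> t)" for v'
        using v(1) that symp_commute[of v' v] by (simp add: tangent_ann_def)
      moreover have "symp v' (ham g (\<gamma> t)) = frechet_derivative g (at (\<gamma> t)) v'" for v'
        using o(2)[OF t] chart(2) by (intro deriv_ham[symmetric] diff_g) auto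
      ultimately show ?thesis by (simp add: v(2) symp_simps)
    qed
    \<comment> \<open>The derivative of \<open>Re q\<close> along the velocity is the symplectic
      product of the velocity with itself, which is 0. So the orbit stays on one level
      \<open>c\<close>.\<close>
    have "((\<lambda>t. g (\<gamma> t)) has_derivative (\<lambda>_. 0)) (at t within {a..b})" if t: "t \<in> {a..b}" for t
    proof -
      have "(g has_derivative frechet_derivative g (at (\<gamma> t))) (at (\<gamma> t))"
        using o(2)[OF t] chart(2) by (intro smooth_on_has_derivative[OF smooth_g]) auto
      moreover have "(\<gamma> has_derivative (\<lambda>s. s *\<^sub>R V (\<gamma> t))) (at t within {a..b})"
        using o(3)[OF t] by (simp add: has_vector_derivative_def)
      ultimately have "((\<lambda>t. g (\<gamma> t)) has_derivative (\<lambda>s. frechet_derivative g (at (\<gamma> t)) (s *\<^sub>R V (\<gamma> t)))) (at t within {a..b})"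
        by (rule has_derivative_compose[rotated])
      moreover have "frechet_derivative g (at (\<gamma> t)) (s *\<^sub>R V (\<gamma> t)) = 0" for s
      proof -
        have "frechet_derivative g (at (\<gamma> t)) (V (\<gamma> t)) = 0" using vs[OF t] by (metis symp_self)
        moreover have "linear (frechet_derivative g (at (\<gamma> t)))"
          using o(2)[OF t] chart(2) by (intro smooth_on_deriv_linear[OF smooth_g]) auto
        ultimately show ?thesis by (simp add: linear_cmul)
      qed
      ultimately show ?thesis by simp
    qed
    then obtain c where c: "\<And>t. t \<in> {a..b} \<Longrightarrow> g (\<gamma> t) = c"
      using has_derivative_zero_constant[of "{a..b}" "\<lambda>t. g (\<gamma> t)"] by auto
    have "subprincipal_bichar S g c \<gamma> a b"
      unfolding subprincipal_bichar_def using c o vs by blast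
    moreover have "leaf_sign f (leaf S (\<gamma> s)) = -1" "leaf_sign f (leaf S (\<gamma> s')) = 1"
      using neg o(1)[of s] o(1)[of s'] s
      by (intro leaf_sign_neg[OF leaf_refl] leaf_sign_pos[OF leaf_refl] nochange; simp)+
    ultimately show False
      using leaf s unfolding leaf_conditions_def no_leaf_sign_change_at_def by blast
  qed
  show ?thesis
    unfolding limit_bichar_cond_def S1
  proof (intro exI[of _ d] exI[of _ ?\<xi>] exI[of _ ?A] conjI sympl_frame q ballI allI impI notI)
    fix V \<gamma> a b assume V: "V \<in> limit_fields d ?\<xi> ?A g" and orb: "orbit (S \<inter> U1) V \<gamma> a b"
      and "\<exists>s s'. a \<le> s \<and> s < s' \<and> s' \<le> b \<and> Im (p (\<gamma> s) + q (\<gamma> s)) < 0 \<and> 0 < Im (p (\<gamma> s') + q (\<gamma> s'))"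
    then obtain s s' where s: "a \<le> s" "s < s'" "s' \<le> b" and "Im (p (\<gamma> s) + q (\<gamma> s)) < 0" "0 < Im (p (\<gamma> s') + q (\<gamma> s'))" by blast
    moreover have "\<gamma> s \<in> S" "\<gamma> s' \<in> S" using orb s by (auto simp: orbit_def)
    ultimately have sgn: "f (\<gamma> s) < 0" "0 < f (\<gamma> s')" by (auto simp: Sigma2_def)
    consider \<theta> where "V = leaf_field d ?\<xi> ?A \<theta>" | \<rho> \<theta> where "V = (\<lambda>w. ham g w + \<rho> *\<^sub>R leaf_field d ?\<xi> ?A \<theta> w)" | "V = ham g"
      using V unfolding limit_fields_def by blast
    then show False
    proof cases
      case 1
      have "\<gamma> s' \<in> leaf S (\<gamma> s)"
      proof (rule leaf_segment)
        fix t assume t: "t \<in> {s..s'}"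
        then have "\<gamma> t \<in> S" "\<gamma> t \<in> U1" "(\<gamma> has_vector_derivative V (\<gamma> t)) (at t within {a..b})"
          using orb s by (auto simp: orbit_def)
        moreover have "{s..s'} \<subseteq> {a..b}" using s by auto
        ultimately show "\<gamma> t \<in> S \<and> (\<exists>v\<in>tangent_ann S (\<gamma> t). (\<gamma> has_vector_derivative v) (at t within {s..s'}))"
          using lf has_vector_derivative_within_subset unfolding 1 by blast
      qed (use s in simp)
      then show False using nochange[OF \<open>\<gamma> s \<in> S\<close>] leaf_refl[OF \<open>\<gamma> s \<in> S\<close>] sgn by blast
    next
      case 2
      show False using bich[of V \<gamma> a b s s'] orb s sgn lf subspace_scale[OF subspace_tangent_ann] unfolding 2 by blast
    next
      case 3
      have "\<exists>v\<in>tangent_ann S w. V w = ham g w + v" for w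
        unfolding 3 by (rule bexI[of _ 0]) (simp_all add: subspace_0[OF subspace_tangent_ann])
      then show False using bich[of V \<gamma> a b s s'] orb s sgn by blast
    qed
  qed
qed

section \<open>Commuting vector fields\<close>

text \<open>Picard iteration for an equation whose right-hand side may also depend on the final
  value \<open>u 1\<close>. Both Lipschitz constants 1/4 together make the integral operator a
  contraction with factor 1/2. Ordinary initial value problems ignore the last argument; the
  boundary value problem below uses it.\<close>

lemma integral_fixpoint:
  fixes h :: "real \<Rightarrow> 'a::euclidean_space \<Rightarrow> 'a \<Rightarrow> 'a"
  assumes cont: "continuous_on ({0..1} \<times> cball 0 \<rho> \<times> cball 0 \<rho>) (\<lambda>p. h (fst p) (fst (snd p)) (snd (snd p)))"
    and bound: "\<And>s a b. s \<in> {0..1} \<Longrightarrow> a \<in> cball 0 \<rho> \<Longrightarrow> b \<in> cball 0 \<rho> \<Longrightarrow> norm (h s a b) \<le> \<rho>"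
    and lip: "\<And>s a b a' b'. s \<in> {0..1} \<Longrightarrow> a \<in> cball 0 \<rho> \<Longrightarrow> b \<in> cball 0 \<rho> \<Longrightarrow> a' \<in> cball 0 \<rho> \<Longrightarrow> b' \<in> cball 0 \<rho> \<Longrightarrow>
        norm (h s a b - h s a' b') \<le> (norm (a - a') + norm (b - b')) / 4"
    and \<rho>: "0 \<le> \<rho>"
  obtains u where "u 0 = 0" "\<And>s. s \<in> {0..1} \<Longrightarrow> norm (u s) \<le> \<rho>"
    "\<And>s. s \<in> {0..1} \<Longrightarrow> (u has_vector_derivative h s (u s) (u 1)) (at s within {0..1})"
proof -
  define X where "X = PiC (UNIV :: real set) (\<lambda>_. cball (0 :: 'a) \<rho>)"
  define I where "I u t = integral {0..t} (\<lambda>\<sigma>. h \<sigma> (u \<sigma>) (u 1))" for u and t :: real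
  \<comment> \<open>The complete space at hand consists of bounded continuous functions on the whole
    line, so candidates are continued as constants outside the unit interval.\<close>
  define cl where "cl s = max 0 (min 1 s)" for s :: real
  have cl: "cl s \<in> {0..1}" for s by (auto simp: cl_def)
  have clc: "continuous_on UNIV cl" unfolding cl_def by (intro continuous_intros)
  have Xb: "apply_bcontfun u s \<in> cball 0 \<rho>" if "u \<in> X" for u s using that by (auto simp: X_def mem_PiC_iff)
  have hc: "continuous_on {0..t} (\<lambda>\<sigma>. h \<sigma> (apply_bcontfun u \<sigma>) (apply_bcontfun u 1))" if "u \<in> X" "t \<le> 1" for u t
  proof -
    have "continuous_on {0..t} (\<lambda>\<sigma>. (\<sigma>, apply_bcontfun u \<sigma>, apply_bcontfun u 1))"
      by (intro continuous_intros continuous_on_apply_bcontfun)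
    from continuous_on_compose2[OF cont this] show ?thesis using Xb[OF that(1)] that(2) by fastforce
  qed
  have Ib: "norm (I (apply_bcontfun u) t) \<le> \<rho>" if "u \<in> X" "t \<in> {0..1}" for u t
  proof -
    have "norm (I (apply_bcontfun u) t) \<le> \<rho> * (t - 0)"
      unfolding I_def using that Xb[OF that(1)] hc[OF that(1)] by (intro integral_bound bound) auto
    also have "\<dots> \<le> \<rho>" using that(2) \<rho> by (simp add: mult_left_le)
    finally show ?thesis .
  qed
  have Ic: "continuous_on {0..1} (I (apply_bcontfun u))" if "u \<in> X" for u
    unfolding I_def by (intro indefinite_integral_continuous_1 integrable_continuous_real hc that) simp
  define T where "T u = Bcontfun (\<lambda>s. I (apply_bcontfun u) (cl s))" for u
  have Tapp: "apply_bcontfun (T u) s = I (apply_bcontfun u) (cl s)" if "u \<in> X" for u s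
  proof -
    have "(\<lambda>s. I (apply_bcontfun u) (cl s)) \<in> bcontfun"
    proof (rule bcontfun_normI)
      show "continuous_on UNIV (\<lambda>s. I (apply_bcontfun u) (cl s))"
        by (rule continuous_on_compose2[OF Ic[OF that] clc]) (use cl in auto)
      show "norm (I (apply_bcontfun u) (cl s)) \<le> \<rho>" for s by (rule Ib[OF that cl])
    qed
    then show ?thesis by (simp add: T_def Bcontfun_inverse)
  qed
  have "\<exists>!u\<in>X. T u = u"
  proof (rule Banach_fix[of _ "1 / 2"])
    show "complete X" unfolding X_def complete_eq_closed by (intro closed_PiC) auto
    have "const_bcontfun 0 \<in> X" using \<rho> by (simp add: X_def mem_PiC_iff)
    then show "X \<noteq> {}" by blast
    show "T ` X \<subseteq> X"
    proof (intro image_subsetI)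
      fix u assume u: "u \<in> X"
      show "T u \<in> X" unfolding X_def mem_PiC_iff using Tapp[OF u] Ib[OF u cl] by auto
    qed
    show "dist (T u) (T v) \<le> 1 / 2 * dist u v" if u: "u \<in> X" and v: "v \<in> X" for u v
    proof (rule dist_bound)
      fix s
      let ?D = "\<lambda>\<sigma>. h \<sigma> (apply_bcontfun u \<sigma>) (apply_bcontfun u 1) - h \<sigma> (apply_bcontfun v \<sigma>) (apply_bcontfun v 1)"
      have t: "cl s \<le> 1" "0 \<le> cl s" using cl[of s] by auto
      have "norm (integral {0..cl s} ?D) \<le> 1 / 2 * dist u v * (cl s - 0)"
      proof (rule integral_bound)
        show "continuous_on {0..cl s} ?D" by (intro continuous_intros hc u v t)
        fix \<sigma> assume \<sigma>: "\<sigma> \<in> {0..cl s}"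
        have "norm (?D \<sigma>) \<le> (norm (apply_bcontfun u \<sigma> - apply_bcontfun v \<sigma>) + norm (apply_bcontfun u 1 - apply_bcontfun v 1)) / 4"
          using \<sigma> t by (intro lip Xb u v) auto
        also have "\<dots> \<le> (dist u v + dist u v) / 4"
          using dist_bounded[of u _ v] by (intro divide_right_mono add_mono) (simp_all add: dist_norm[symmetric])
        finally show "norm (?D \<sigma>) \<le> 1 / 2 * dist u v" by simp
      qed (use t in simp)
      also have "\<dots> \<le> 1 / 2 * dist u v" using t by (simp add: mult_left_le)
      finally show "dist (apply_bcontfun (T u) s) (apply_bcontfun (T v) s) \<le> 1 / 2 * dist u v"
        unfolding Tapp[OF u] Tapp[OF v] dist_norm I_def
        using t by (subst integral_diff[symmetric]) (auto intro!: integrable_continuous_real hc u v)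
    qed
  qed auto
  then obtain v where v: "v \<in> X" "T v = v" by blast
  let ?u = "apply_bcontfun v"
  have u: "?u s = I ?u s" if "s \<in> {0..1}" for s
    using Tapp[OF v(1), of s] v(2) that by (simp add: cl_def)
  show ?thesis
  proof (rule that[of ?u])
    show "?u 0 = 0" using u[of 0] by (simp add: I_def)
    show "norm (?u s) \<le> \<rho>" if "s \<in> {0..1}" for s using Xb[OF v(1), of s] by simp
    show "(?u has_vector_derivative h s (?u s) (?u 1)) (at s within {0..1})" if s: "s \<in> {0..1}" for s
    proof (rule has_vector_derivative_transform[OF s])
      show "(I ?u has_vector_derivative h s (?u s) (?u 1)) (at s within {0..1})"
        unfolding I_def by (rule integral_has_vector_derivative[OF hc[OF v(1)] s]) simp
    qed (rule u)
  qed
qed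

lemma vector_differentiable_bound:
  fixes f :: "real \<Rightarrow> 'a::real_normed_vector"
  assumes "convex S" "\<And>x. x \<in> S \<Longrightarrow> (f has_vector_derivative f' x) (at x within S)"
    and "\<And>x. x \<in> S \<Longrightarrow> norm (f' x) \<le> B" "x \<in> S" "y \<in> S"
  shows "norm (f x - f y) \<le> B * norm (x - y)"
proof (rule differentiable_bound[OF assms(1) _ _ assms(4,5)])
  show "(f has_derivative (\<lambda>h. h *\<^sub>R f' x)) (at x within S)" if "x \<in> S" for x
    using assms(2)[OF that] by (simp add: has_vector_derivative_def)
  show "onorm (\<lambda>h. h *\<^sub>R f' x) \<le> B" if x: "x \<in> S" for x
  proof (rule onorm_bound)
    show "0 \<le> B" using assms(3)[OF x] norm_ge_zero[of "f' x"] by linarith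
    show "norm (h *\<^sub>R f' x) \<le> B * norm h" for h :: real
      using mult_right_mono[OF assms(3)[OF x], of "\<bar>h\<bar>"] by (simp add: mult.commute)
  qed
qed

text \<open>At a point where the norm is maximal, the term with factor 1/2 is absorbed into the left
  side, because the interval has length 1.\<close>

lemma ode_estimate:
  fixes D :: "real \<Rightarrow> 'a::euclidean_space"
  assumes d: "\<And>s. s \<in> {0..1} \<Longrightarrow> (D has_vector_derivative D' s) (at s within {0..1})"
    and b: "\<And>s. s \<in> {0..1} \<Longrightarrow> norm (D' s) \<le> norm (D s) / 2 + \<eta>"
    and s: "s \<in> {0..1}"
  shows "norm (D s) \<le> 2 * (norm (D 0) + \<eta>)"
proof -
  have c: "continuous_on {0..1} (\<lambda>s. norm (D s))"
    unfolding continuous_on_eq_continuous_within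
    by (intro ballI continuous_intros has_vector_derivative_continuous[OF d])
  obtain t where t: "t \<in> {0..1}" "\<And>s. s \<in> {0..1} \<Longrightarrow> norm (D s) \<le> norm (D t)"
    using continuous_attains_sup[OF _ _ c] by auto
  have "0 \<le> norm (D' t)" by simp
  then have nn: "0 \<le> norm (D t) / 2 + \<eta>" using b[OF t(1)] by linarith
  have "norm (D t - D 0) \<le> (norm (D t) / 2 + \<eta>) * norm (t - 0)"
  proof (rule vector_differentiable_bound[of "{0..1}" D D' "norm (D t) / 2 + \<eta>" t 0])
    show "norm (D' x) \<le> norm (D t) / 2 + \<eta>" if "x \<in> {0..1}" for x using b[OF that] t(2)[OF that] by linarith
  qed (use d t in auto)
  also have "\<dots> \<le> norm (D t) / 2 + \<eta>" using t(1) nn by (simp add: mult_left_le)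
  finally have "norm (D t) \<le> 2 * (norm (D 0) + \<eta>)" using norm_triangle_ineq2[of "D t" "D 0"] by argo
  then show ?thesis using t(2)[OF s] by linarith
qed

lemma has_derivative_quadratic:
  fixes f :: "'a::euclidean_space \<Rightarrow> 'b::euclidean_space"
  assumes "linear f'" "0 < \<delta>" "\<And>e. norm e < \<delta> \<Longrightarrow> norm (f (x + e) - f x - f' e) \<le> K * (norm e)\<^sup>2"
  shows "(f has_derivative f') (at x)"
  unfolding has_derivative_at
proof (intro conjI)
  show "bounded_linear f'" using assms(1) by (simp add: linear_conv_bounded_linear)
  show "(\<lambda>h. norm (f (x + h) - f x - f' h) / norm h) \<midarrow>0\<rightarrow> 0"
  proof (rule Lim_null_comparison)
    show "\<forall>\<^sub>F h in at 0. norm (norm (f (x + h) - f x - f' h) / norm h) \<le> K * norm h"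
      unfolding eventually_at
    proof (intro exI[of _ \<delta>] conjI ballI impI assms(2))
      fix h :: 'a assume "h \<noteq> 0 \<and> dist h 0 < \<delta>"
      then have h: "h \<noteq> 0" "norm h < \<delta>" by simp_all
      then show "norm (norm (f (x + h) - f x - f' h) / norm h) \<le> K * norm h"
        using assms(3)[OF h(2)] by (simp add: divide_le_eq power2_eq_square mult.assoc)
    qed
    show "(\<lambda>h::'a. K * norm h) \<midarrow>0\<rightarrow> 0" by (auto intro!: tendsto_eq_intros)
  qed
qed

text \<open>The fields depend linearly on a parameter \<open>c\<close>, and
  \<open>\<Gamma> z c\<close> below is the flow of \<open>F c\<close> at time 1. Since the fields
  commute, this is a local action of the additive group of parameters. A single \<open>M\<close>
  serves for all bounds.\<close>

locale commuting_fields =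
  fixes F :: "'c::euclidean_space \<Rightarrow> 'e::euclidean_space \<Rightarrow> 'e" and DF :: "'c \<Rightarrow> 'e \<Rightarrow> 'e \<Rightarrow> 'e"
    and w0 :: 'e and R M :: real
  assumes R: "0 < R" and M: "1 \<le> M"
    and lin: "\<And>w. w \<in> cball w0 R \<Longrightarrow> linear (\<lambda>c. F c w)"
    and bound: "\<And>c w. w \<in> cball w0 R \<Longrightarrow> norm (F c w) \<le> M * norm c"
    and lip: "\<And>c w w'. w \<in> cball w0 R \<Longrightarrow> w' \<in> cball w0 R \<Longrightarrow> norm (F c w - F c w') \<le> M * norm c * norm (w - w')"
    and deriv: "\<And>c w. w \<in> cball w0 R \<Longrightarrow> (F c has_derivative DF c w) (at w)"
    and quad: "\<And>c w w'. w \<in> cball w0 R \<Longrightarrow> w' \<in> cball w0 R \<Longrightarrow>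
        norm (F c w' - F c w - DF c w (w' - w)) \<le> M * norm c * (norm (w' - w))\<^sup>2"
    and commute: "\<And>c e w. w \<in> cball w0 R \<Longrightarrow> DF c w (F e w) = DF e w (F c w)"
begin

text \<open>The first entry gives \<open>F c\<close> the Lipschitz constant 1/4 that the contraction
  and \<open>ode_estimate\<close> ask for; the second limits the displacement in unit time to
  \<open>R / 8\<close>.\<close>

definition "\<epsilon> = min (1 / (4 * M)) (R / (8 * M))"

lemma \<epsilon>_pos: "0 < \<epsilon>"
  using R M by (simp add: \<epsilon>_def)

lemma small: assumes "norm c \<le> \<epsilon>" shows "M * norm c \<le> 1 / 4" "M * norm c \<le> R / 8"
proof -
  have "M * norm c \<le> M * (1 / (4 * M))" "M * norm c \<le> M * (R / (8 * M))"
    using assms M by (intro mult_left_mono; simp add: \<epsilon>_def)+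
  then show "M * norm c \<le> 1 / 4" "M * norm c \<le> R / 8" using M by auto
qed

definition solution :: "'e \<Rightarrow> 'c \<Rightarrow> (real \<Rightarrow> 'e) \<Rightarrow> bool" where
  "solution z c w \<longleftrightarrow> w 0 = z \<and>
     (\<forall>s\<in>{0..1}. w s \<in> cball w0 R \<and> (w has_vector_derivative F c (w s)) (at s within {0..1}))"

lemma solution_exists:
  assumes z: "z \<in> cball w0 (R / 2)" and c: "norm c \<le> \<epsilon>"
  shows "\<exists>w. solution z c w"
proof -
  have m: "z + a \<in> cball w0 R" if "a \<in> cball 0 (R / 8)" for a
    using z that norm_triangle_ineq4[of "w0 - z" a] R by (simp add: dist_norm diff_diff_eq)
  have b: "norm (F c (z + a)) \<le> R / 8" if "a \<in> cball 0 (R / 8)" for a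
    using bound[OF m[OF that], of c] small[OF c] by linarith
  have l: "norm (F c (z + a) - F c (z + a')) \<le> norm (a - a') / 4" if "a \<in> cball 0 (R / 8)" "a' \<in> cball 0 (R / 8)" for a a'
  proof -
    have "norm (F c (z + a) - F c (z + a')) \<le> M * norm c * norm (a - a')"
      using lip[OF m[OF that(1)] m[OF that(2)], of c] by simp
    also have "\<dots> \<le> 1 / 4 * norm (a - a')" by (intro mult_right_mono small[OF c]) simp
    finally show ?thesis by simp
  qed
  have "continuous_on (cball w0 R) (F c)"
    using deriv has_derivative_continuous by (intro continuous_at_imp_continuous_on) blast
  then have "continuous_on ({0..1} \<times> cball 0 (R / 8) \<times> cball 0 (R / 8)) (\<lambda>p. F c (z + fst (snd p)))"
    by (rule continuous_on_compose2) (use m in \<open>auto intro!: continuous_intros\<close>)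
  then obtain u where u: "u 0 = 0" "\<And>s. s \<in> {0..1} \<Longrightarrow> norm (u s) \<le> R / 8"
    "\<And>s. s \<in> {0..1} \<Longrightarrow> (u has_vector_derivative F c (z + u s)) (at s within {0..1})"
  proof (rule integral_fixpoint[of "R / 8" "\<lambda>s a b. F c (z + a)"])
    show "norm (F c (z + a) - F c (z + a')) \<le> (norm (a - a') + norm (b - b')) / 4"
      if aa: "a \<in> cball 0 (R / 8)" "a' \<in> cball 0 (R / 8)" for a a' b b' :: 'e
      using l[OF aa] norm_ge_zero[of "b - b'"] by argo
  qed (use b R in auto)
  show ?thesis
    unfolding solution_def
    by (rule exI[of _ "\<lambda>s. z + u s"]) (use u m in \<open>auto intro!: derivative_eq_intros\<close>)
qed

text \<open>Stability with respect to the initial value and to a defect \<open>\<eta>\<close> in the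
  equation. It yields uniqueness, Lipschitz dependence on \<open>z\<close>, and, with a defect
  quadratic in \<open>e\<close>, the derivative of \<open>\<Gamma>\<close>.\<close>

lemma solution_close:
  assumes "solution z c w" "norm c \<le> \<epsilon>"
    and v: "\<And>s. s \<in> {0..1} \<Longrightarrow> v s \<in> cball w0 R" "\<And>s. s \<in> {0..1} \<Longrightarrow> (v has_vector_derivative v' s) (at s within {0..1})"
      "\<And>s. s \<in> {0..1} \<Longrightarrow> norm (v' s - F c (v s)) \<le> \<eta>"
  shows "norm (w 1 - v 1) \<le> 2 * (norm (z - v 0) + \<eta>)"
proof -
  have w: "w 0 = z" "\<And>s. s \<in> {0..1} \<Longrightarrow> w s \<in> cball w0 R"
    "\<And>s. s \<in> {0..1} \<Longrightarrow> (w has_vector_derivative F c (w s)) (at s within {0..1})"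
    using assms(1) by (auto simp: solution_def)
  have "norm (w 1 - v 1) \<le> 2 * (norm (w 0 - v 0) + \<eta>)"
  proof (rule ode_estimate[of "\<lambda>s. w s - v s" "\<lambda>s. F c (w s) - v' s"])
    fix s :: real assume s: "s \<in> {0..1}"
    show "((\<lambda>s. w s - v s) has_vector_derivative F c (w s) - v' s) (at s within {0..1})"
      by (intro has_vector_derivative_diff w v s)
    have "norm (F c (w s) - F c (v s)) \<le> M * norm c * norm (w s - v s)" by (rule lip[OF w(2)[OF s] v(1)[OF s]])
    also have "\<dots> \<le> 1 / 4 * norm (w s - v s)" by (intro mult_right_mono small[OF assms(2)]) simp
    finally have "norm (F c (w s) - F c (v s)) \<le> norm (w s - v s) / 2" using norm_ge_zero[of "w s - v s"] by linarith
    then show "norm (F c (w s) - v' s) \<le> norm (w s - v s) / 2 + \<eta>"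
      using v(3)[OF s] norm_triangle_ineq4[of "F c (w s) - F c (v s)" "v' s - F c (v s)"] by simp
  qed simp
  then show ?thesis by (simp add: w(1))
qed

definition \<Gamma> :: "'e \<Rightarrow> 'c \<Rightarrow> 'e" where
  "\<Gamma> z c = (SOME w. solution z c w) 1"

lemma \<Gamma>_solution:
  assumes "z \<in> cball w0 (R / 2)" "norm c \<le> \<epsilon>"
  obtains w where "solution z c w" "\<Gamma> z c = w 1"
  using someI_ex[OF solution_exists[OF assms]] by (intro that[of "SOME w. solution z c w"]) (auto simp: \<Gamma>_def)

lemma \<Gamma>_unique:
  assumes z: "z \<in> cball w0 (R / 2)" and c: "norm c \<le> \<epsilon>" and v: "solution z c v"
  shows "v 1 = \<Gamma> z c"
proof -
  obtain w where w: "solution z c w" "\<Gamma> z c = w 1" by (rule \<Gamma>_solution[OF z c])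
  have "norm (w 1 - v 1) \<le> 2 * (norm (z - v 0) + 0)"
    by (rule solution_close[OF w(1) c, of _ "\<lambda>s. F c (v s)"]) (use v in \<open>auto simp: solution_def\<close>)
  then show ?thesis using v w(2) by (simp add: solution_def)
qed

lemma \<Gamma>_lipschitz:
  assumes z: "z \<in> cball w0 (R / 2)" "z' \<in> cball w0 (R / 2)" and c: "norm c \<le> \<epsilon>"
  shows "norm (\<Gamma> z c - \<Gamma> z' c) \<le> 2 * norm (z - z')"
proof -
  obtain w where w: "solution z c w" "\<Gamma> z c = w 1" by (rule \<Gamma>_solution[OF z(1) c])
  obtain v where v: "solution z' c v" "\<Gamma> z' c = v 1" by (rule \<Gamma>_solution[OF z(2) c])
  have "norm (w 1 - v 1) \<le> 2 * (norm (z - v 0) + 0)"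
    by (rule solution_close[OF w(1) c, of _ "\<lambda>s. F c (v s)"]) (use v in \<open>auto simp: solution_def\<close>)
  then show ?thesis using v w(2) by (simp add: solution_def)
qed

lemma solution_near:
  assumes "solution z c w" "s \<in> {0..1}" shows "norm (w s - z) \<le> M * norm c"
proof -
  have w: "w 0 = z" "\<And>s. s \<in> {0..1} \<Longrightarrow> w s \<in> cball w0 R"
    "\<And>s. s \<in> {0..1} \<Longrightarrow> (w has_vector_derivative F c (w s)) (at s within {0..1})"
    using assms(1) by (auto simp: solution_def)
  have "norm (w s - w 0) \<le> M * norm c * norm (s - 0)"
    by (rule vector_differentiable_bound[of "{0..1}" w "\<lambda>s. F c (w s)"]) (use w bound assms(2) in auto)
  also have "\<dots> \<le> M * norm c" using assms(2) M by (simp add: mult_left_le)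
  finally show ?thesis by (simp add: w(1))
qed

lemma \<Gamma>_near:
  assumes "z \<in> cball w0 (R / 2)" "norm c \<le> \<epsilon>" shows "norm (\<Gamma> z c - z) \<le> M * norm c"
  using \<Gamma>_solution[OF assms] solution_near[of z c _ 1] by (metis atLeastAtMost_iff order_refl zero_le_one)

lemma \<Gamma>_mem:
  assumes "z \<in> cball w0 r" "r \<le> R / 2" "norm c \<le> \<epsilon>" shows "\<Gamma> z c \<in> cball w0 (r + M * norm c)" "\<Gamma> z c \<in> cball w0 (r + R / 8)"
proof -
  have "z \<in> cball w0 (R / 2)" using assms by auto
  then show "\<Gamma> z c \<in> cball w0 (r + M * norm c)"
    using \<Gamma>_near[of z c] assms dist_triangle[of w0 "\<Gamma> z c" z] by (simp add: dist_norm norm_minus_commute)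
  then show "\<Gamma> z c \<in> cball w0 (r + R / 8)" using small(2)[OF assms(3)] by auto
qed

lemma \<Gamma>_0: "z \<in> cball w0 (R / 2) \<Longrightarrow> \<Gamma> z 0 = z"
  using \<Gamma>_near[of z 0] \<epsilon>_pos by simp

text \<open>If \<open>w\<close> solves \<open>w' = F c w\<close>, then \<open>w + t F e w\<close> solves \<open>v' = F (c + e) v\<close> up to an error that is quadratic in \<open>e\<close>,
  because the fields commute.\<close>

lemma \<Gamma>_has_derivative:
  assumes z: "z \<in> cball w0 (R / 2)" and c: "norm c < \<epsilon>"
  shows "(\<Gamma> z has_derivative (\<lambda>e. F e (\<Gamma> z c))) (at c)"
proof (rule has_derivative_quadratic[where \<delta> = "\<epsilon> - norm c" and K = "4 * M\<^sup>2"])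
  have c': "norm c \<le> \<epsilon>" using c by simp
  obtain w where w: "solution z c w" "\<Gamma> z c = w 1" by (rule \<Gamma>_solution[OF z c'])
  then have w': "w 0 = z" "\<And>s. s \<in> {0..1} \<Longrightarrow> w s \<in> cball w0 R"
    "\<And>s. s \<in> {0..1} \<Longrightarrow> (w has_vector_derivative F c (w s)) (at s within {0..1})"
    by (auto simp: solution_def)
  show "linear (\<lambda>e. F e (\<Gamma> z c))" unfolding w(2) by (rule lin[OF w'(2)]) simp
  show "0 < \<epsilon> - norm c" using c by simp
  fix e :: 'c assume e: "norm e < \<epsilon> - norm c"
  have ce: "norm (c + e) \<le> \<epsilon>" "norm e \<le> \<epsilon>" using e norm_triangle_ineq[of c e] norm_ge_zero[of c] by linarith+
  obtain v where v: "solution z (c + e) v" "\<Gamma> z (c + e) = v 1" by (rule \<Gamma>_solution[OF z ce(1)])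
  define y where "y s = w s + s *\<^sub>R F e (w s)" for s
  define y' where "y' s = F c (w s) + (s *\<^sub>R DF e (w s) (F c (w s)) + F e (w s))" for s
  have Fe: "norm (s *\<^sub>R F e (w s)) \<le> M * norm e" if "s \<in> {0..1}" for s
  proof -
    have "norm (s *\<^sub>R F e (w s)) \<le> 1 * norm (F e (w s))" using that by (simp add: mult_left_le_one_le)
    then show ?thesis using bound[OF w'(2)[OF that], of e] by simp
  qed
  have ym: "y s \<in> cball w0 R" if "s \<in> {0..1}" for s
  proof -
    have "norm (y s - w0) \<le> norm (s *\<^sub>R F e (w s)) + norm (w s - z) + norm (z - w0)"
      using norm_triangle_ineq[of "s *\<^sub>R F e (w s) + (w s - z)" "z - w0"] norm_triangle_ineq[of "s *\<^sub>R F e (w s)" "w s - z"]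
      by (simp add: y_def algebra_simps)
    also have "\<dots> \<le> R / 8 + R / 8 + R / 2"
      using Fe[OF that] small(2)[OF ce(2)] small(2)[OF c'] solution_near[OF w(1) that] z
      by (intro add_mono) (auto simp: dist_norm norm_minus_commute)
    finally show ?thesis using R by (simp add: dist_norm norm_minus_commute)
  qed
  have yd: "(y has_vector_derivative y' s) (at s within {0..1})" if "s \<in> {0..1}" for s
  proof -
    have "((\<lambda>s. F e (w s)) has_vector_derivative DF e (w s) (F c (w s))) (at s within {0..1})"
    proof -
      have "(w has_derivative (\<lambda>x. x *\<^sub>R F c (w s))) (at s within {0..1})"
        using w'(3)[OF that] by (simp add: has_vector_derivative_def)
      from has_derivative_compose[OF this deriv[OF w'(2)[OF that], of e]]
      show ?thesis
        using has_derivative_linear[OF deriv[OF w'(2)[OF that], of e]] by (simp add: has_vector_derivative_def linear_cmul)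
    qed
    then have "(y has_vector_derivative F c (w s) + (s *\<^sub>R DF e (w s) (F c (w s)) + 1 *\<^sub>R F e (w s))) (at s within {0..1})"
      unfolding y_def by (intro has_vector_derivative_add has_vector_derivative_scaleR w'(3)[OF that] DERIV_ident)
    then show ?thesis by (simp add: y'_def)
  qed
  have "norm (v 1 - y 1) \<le> 2 * (norm (z - y 0) + 2 * M\<^sup>2 * (norm e)\<^sup>2)"
  proof (rule solution_close[OF v(1) ce(1) ym yd])
    fix s :: real assume s: "s \<in> {0..1}"
    have yw: "y s - w s = s *\<^sub>R F e (w s)" by (simp add: y_def)
    have ln: "linear (DF c (w s))" by (rule has_derivative_linear[OF deriv[OF w'(2)[OF s]]])
    have 1: "norm (F c (y s) - F c (w s) - s *\<^sub>R DF c (w s) (F e (w s))) \<le> M\<^sup>2 * (norm e)\<^sup>2"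
    proof -
      have "norm (F c (y s) - F c (w s) - DF c (w s) (y s - w s)) \<le> M * norm c * (norm (y s - w s))\<^sup>2"
        by (rule quad[OF w'(2)[OF s] ym[OF s]])
      also have "\<dots> \<le> 1 * (M * norm e)\<^sup>2"
        using small(1)[OF c'] Fe[OF s] M unfolding yw by (intro mult_mono power_mono) auto
      finally show ?thesis by (simp add: yw linear_cmul[OF ln] power_mult_distrib)
    qed
    have 2: "norm (F e (y s) - F e (w s)) \<le> M\<^sup>2 * (norm e)\<^sup>2"
    proof -
      have "norm (F e (y s) - F e (w s)) \<le> M * norm e * norm (y s - w s)"
        by (rule lip[OF ym[OF s] w'(2)[OF s]])
      also have "\<dots> \<le> M * norm e * (M * norm e)"
        using Fe[OF s] M unfolding yw by (intro mult_left_mono) auto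
      finally show ?thesis by (simp add: power2_eq_square mult_ac)
    qed
    have "y' s - F (c + e) (y s) =
       - (F c (y s) - F c (w s) - s *\<^sub>R DF c (w s) (F e (w s))) - (F e (y s) - F e (w s))"
      using linear_add[OF lin[OF ym[OF s]]] commute[OF w'(2)[OF s], of e c] by (simp add: y'_def)
    then have "norm (y' s - F (c + e) (y s)) \<le> norm (F c (y s) - F c (w s) - s *\<^sub>R DF c (w s) (F e (w s))) + norm (F e (y s) - F e (w s))"
      using norm_triangle_ineq4[of "- (F c (y s) - F c (w s) - s *\<^sub>R DF c (w s) (F e (w s)))" "F e (y s) - F e (w s)"] by (simp only: norm_minus_cancel)
    then show "norm (y' s - F (c + e) (y s)) \<le> 2 * M\<^sup>2 * (norm e)\<^sup>2" using 1 2 by linarith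
  qed
  moreover have "y 0 = z" "y 1 = w 1 + F e (w 1)" by (simp_all add: y_def w')
  ultimately show "norm (\<Gamma> z (c + e) - \<Gamma> z c - F e (\<Gamma> z c)) \<le> 4 * M\<^sup>2 * (norm e)\<^sup>2"
    by (simp add: v(2) w(2) diff_diff_eq)
qed

text \<open>By the formula for the derivative, moving the parameter from \<open>c\<close> to
  \<open>c + c'\<close> on a straight line traces a solution for the field \<open>F c'\<close> that
  starts at \<open>\<Gamma> z c\<close>. Uniqueness identifies its end point.\<close>

lemma \<Gamma>_add:
  assumes z: "z \<in> cball w0 (R / 4)" and c: "norm c + norm c' < \<epsilon>"
  shows "\<Gamma> (\<Gamma> z c) c' = \<Gamma> z (c + c')"
proof -
  have z': "z \<in> cball w0 (R / 2)" using z R by auto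
  have nc: "norm c \<le> \<epsilon>" "norm c' \<le> \<epsilon>" using c norm_ge_zero[of c] norm_ge_zero[of c'] by linarith+
  have small_t: "norm (c + t *\<^sub>R c') < \<epsilon>" if "t \<in> {0..1}" for t
  proof -
    have "norm (t *\<^sub>R c') \<le> norm c'" using that by (simp add: mult_left_le_one_le)
    then show ?thesis using norm_triangle_ineq[of c "t *\<^sub>R c'"] c by linarith
  qed
  have m: "\<Gamma> z c \<in> cball w0 (R / 2)" using \<Gamma>_mem(2)[OF z _ nc(1)] R by auto
  have "solution (\<Gamma> z c) c' (\<lambda>t. \<Gamma> z (c + t *\<^sub>R c'))"
    unfolding solution_def
  proof (intro conjI ballI)
    fix t :: real assume t: "t \<in> {0..1}"
    show "\<Gamma> z (c + t *\<^sub>R c') \<in> cball w0 R" using \<Gamma>_mem(2)[OF z' _ less_imp_le[OF small_t[OF t]]] R by auto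
    have "((\<lambda>t. c + t *\<^sub>R c') has_derivative (\<lambda>t. t *\<^sub>R c')) (at t within {0..1})" by (auto intro!: derivative_eq_intros)
    from has_derivative_compose[OF this \<Gamma>_has_derivative[OF z' small_t[OF t]]]
    show "((\<lambda>t. \<Gamma> z (c + t *\<^sub>R c')) has_vector_derivative F c' (\<Gamma> z (c + t *\<^sub>R c'))) (at t within {0..1})"
      using \<open>\<Gamma> z (c + t *\<^sub>R c') \<in> cball w0 R\<close> by (simp add: has_vector_derivative_def linear_cmul[OF lin])
  qed simp
  from \<Gamma>_unique[OF m nc(2) this] show ?thesis by simp
qed

lemma has_derivative_dominated:
  fixes h :: "real \<Rightarrow> 'e"
  assumes "(k has_vector_derivative 0) (at s within X)" "k s = 0" "\<And>t. t \<in> X \<Longrightarrow> norm (h t - h s) \<le> 2 * norm (k t :: 'e)"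
  shows "(h has_derivative (\<lambda>_. 0)) (at s within X)"
  unfolding has_derivative_iff_norm
proof (intro conjI bounded_linear_zero)
  have k: "((\<lambda>t. norm (k t) / norm (t - s)) \<longlongrightarrow> 0) (at s within X)"
    using assms(1,2) by (simp add: has_vector_derivative_def has_derivative_iff_norm)
  show "((\<lambda>t. norm (h t - h s - 0) / norm (t - s)) \<longlongrightarrow> 0) (at s within X)"
  proof (rule Lim_null_comparison)
    show "\<forall>\<^sub>F t in at s within X. norm (norm (h t - h s - 0) / norm (t - s)) \<le> 2 * (norm (k t) / norm (t - s))"
      using assms(3) by (auto simp: eventually_at_filter divide_right_mono)
    show "((\<lambda>t. 2 * (norm (k t) / norm (t - s))) \<longlongrightarrow> 0) (at s within X)"
      using tendsto_mult_right_zero[OF k, of 2] by (simp add: mult.commute)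
  qed
qed

text \<open>A curve whose velocity is only known to be some derivative \<open>C'\<close> at every point cannot be treated by a Gronwall
  estimate, as \<open>C'\<close> need not be integrable. But \<open>\<Gamma> (\<gamma> s) (C 0 - C s)\<close> has derivative 0 at every \<open>s\<close>.\<close>

lemma straighten:
  assumes T: "0 \<le> T" and g: "\<And>s. s \<in> {0..T} \<Longrightarrow> \<gamma> s \<in> cball w0 (R / 8)"
    and C: "\<And>s. s \<in> {0..T} \<Longrightarrow> (C has_vector_derivative C' s) (at s within {0..T})"
    and d: "\<And>s. s \<in> {0..T} \<Longrightarrow> (\<gamma> has_vector_derivative F (C' s) (\<gamma> s)) (at s within {0..T})"
    and sm: "\<And>s. s \<in> {0..T} \<Longrightarrow> norm (C s - C 0) < \<epsilon> / 4" and s: "s \<in> {0..T}"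
  shows "\<gamma> s = \<Gamma> (\<gamma> 0) (C s - C 0)"
proof -
  define h where "h s = \<Gamma> (\<gamma> s) (C 0 - C s)" for s
  have g2: "\<gamma> s \<in> cball w0 (R / 2)" "\<gamma> s \<in> cball w0 (R / 4)" if "s \<in> {0..T}" for s using g[OF that] R by auto
  have sm2: "norm (C t - C s) < \<epsilon> / 2" if "s \<in> {0..T}" "t \<in> {0..T}" for s t
    using norm_triangle_ineq4[of "C t - C 0" "C s - C 0"] sm[OF that(1)] sm[OF that(2)] by simp
  have hd: "(h has_derivative (\<lambda>_. 0)) (at s within {0..T})" if s: "s \<in> {0..T}" for s
  proof (rule has_derivative_dominated[of "\<lambda>t. \<gamma> t - \<Gamma> (\<gamma> s) (C t - C s)"])
    have "((\<lambda>t. C t - C s) has_derivative (\<lambda>x. x *\<^sub>R C' s)) (at s within {0..T})"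
      using C[OF s] unfolding has_vector_derivative_def by (auto intro!: derivative_eq_intros)
    moreover have "(\<Gamma> (\<gamma> s) has_derivative (\<lambda>e. F e (\<Gamma> (\<gamma> s) (C s - C s)))) (at (C s - C s))"
      by (rule \<Gamma>_has_derivative[OF g2(1)[OF s]]) (use \<epsilon>_pos in simp)
    ultimately have "((\<lambda>t. \<Gamma> (\<gamma> s) (C t - C s)) has_derivative (\<lambda>x. F (x *\<^sub>R C' s) (\<Gamma> (\<gamma> s) (C s - C s)))) (at s within {0..T})"
      by (rule has_derivative_compose)
    moreover have "\<gamma> s \<in> cball w0 R" using g[OF s] R by auto
    ultimately have "((\<lambda>t. \<Gamma> (\<gamma> s) (C t - C s)) has_vector_derivative F (C' s) (\<gamma> s)) (at s within {0..T})"
      by (simp add: has_vector_derivative_def \<Gamma>_0[OF g2(1)[OF s]] linear_cmul[OF lin])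
    from has_vector_derivative_diff[OF d[OF s] this]
    show "((\<lambda>t. \<gamma> t - \<Gamma> (\<gamma> s) (C t - C s)) has_vector_derivative 0) (at s within {0..T})" by simp
    show "\<gamma> s - \<Gamma> (\<gamma> s) (C s - C s) = 0" by (simp add: \<Gamma>_0[OF g2(1)[OF s]])
    fix t assume t: "t \<in> {0..T}"
    have n1: "norm (C t - C s) \<le> \<epsilon>" using sm2[OF s t] \<epsilon>_pos by linarith
    have n2: "norm (C 0 - C t) < \<epsilon> / 4" using sm[OF t] by (simp add: norm_minus_commute)
    have m: "\<Gamma> (\<gamma> s) (C t - C s) \<in> cball w0 (R / 2)" using \<Gamma>_mem(2)[OF g[OF s] _ n1] R by auto
    \<comment> \<open>So \<open>h t\<close> and \<open>h s\<close> are images under the same map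
      \<open>\<lambda>z. \<Gamma> z (C 0 - C t)\<close>, which is Lipschitz with constant 2. Their
      difference is dominated by that of two curves tangent at \<open>s\<close>.\<close>
    have "\<Gamma> (\<Gamma> (\<gamma> s) (C t - C s)) (C 0 - C t) = h s"
      unfolding h_def using \<Gamma>_add[OF g2(2)[OF s], of "C t - C s" "C 0 - C t"] sm2[OF s t] n2 \<epsilon>_pos by simp
    then show "norm (h t - h s) \<le> 2 * norm (\<gamma> t - \<Gamma> (\<gamma> s) (C t - C s))"
      using \<Gamma>_lipschitz[OF g2(1)[OF t] m, of "C 0 - C t"] n2 \<epsilon>_pos by (simp add: h_def)
  qed
  obtain k where "\<forall>s\<in>{0..T}. h s = k" using has_derivative_zero_constant[of "{0..T}" h, OF _ hd] by auto
  then have "h s = h 0" using T s by auto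
  moreover have "h 0 = \<gamma> 0" using g2(1)[of 0] T by (simp add: h_def \<Gamma>_0)
  ultimately have "\<Gamma> (\<gamma> 0) (C s - C 0) = \<Gamma> (\<Gamma> (\<gamma> s) (C 0 - C s)) (C s - C 0)" by (simp add: h_def)
  also have "\<dots> = \<Gamma> (\<gamma> s) 0"
    using \<Gamma>_add[OF g2(2)[OF s], of "C 0 - C s" "C s - C 0"] sm[OF s] \<epsilon>_pos by (simp add: norm_minus_commute)
  finally show ?thesis by (simp add: \<Gamma>_0[OF g2(1)[OF s]])
qed

text \<open>The velocity is prescribed only inside the ball of radius \<open>R / 8\<close>, but the
  curve cannot leave it: up to a first exit it is given by \<open>\<Gamma>\<close>, and the bound on
  \<open>C\<close> limits its displacement to \<open>R / 32\<close>, while it starts within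
  \<open>R / 16\<close>.\<close>

lemma straighten_global:
  assumes T: "0 \<le> T" and g: "\<gamma> 0 \<in> cball w0 (R / 16)" "continuous_on {0..T} \<gamma>"
    and C: "\<And>s. s \<in> {0..T} \<Longrightarrow> (C has_vector_derivative C' s) (at s within {0..T})"
    and d: "\<And>s. s \<in> {0..T} \<Longrightarrow> \<gamma> s \<in> cball w0 (R / 8) \<Longrightarrow> (\<gamma> has_vector_derivative F (C' s) (\<gamma> s)) (at s within {0..T})"
    and sm: "\<And>s. s \<in> {0..T} \<Longrightarrow> norm (C s - C 0) < \<epsilon> / 4" and s: "s \<in> {0..T}"
  shows "\<gamma> s = \<Gamma> (\<gamma> 0) (C s - C 0)"
proof -
  have restr: "\<gamma> t = \<Gamma> (\<gamma> 0) (C t - C 0)" if t: "t \<in> {0..T}" and m: "\<And>s. s \<in> {0..t} \<Longrightarrow> \<gamma> s \<in> cball w0 (R / 8)" for t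
  proof (rule straighten[of t \<gamma> C C'])
    fix s assume s: "s \<in> {0..t}"
    then have s': "s \<in> {0..T}" "{0..t} \<subseteq> {0..T}" using t by auto
    show "(C has_vector_derivative C' s) (at s within {0..t})"
      by (rule has_vector_derivative_within_subset[OF C[OF s'(1)] s'(2)])
    show "(\<gamma> has_vector_derivative F (C' s) (\<gamma> s)) (at s within {0..t})"
      by (rule has_vector_derivative_within_subset[OF d[OF s'(1) m[OF s]] s'(2)])
    show "norm (C s - C 0) < \<epsilon> / 4" by (rule sm[OF s'(1)])
  qed (use t m in auto)
  have all: "\<gamma> s \<in> cball w0 (R / 8)" if "s \<in> {0..T}" for s
  proof (rule ccontr)
    assume no: "\<gamma> s \<notin> cball w0 (R / 8)"
    have c: "continuous_on {0..s} (\<lambda>s. dist w0 (\<gamma> s))"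
      using that by (intro continuous_intros continuous_on_subset[OF g(2)]) auto
    define Y where "Y = {t\<in>{0..s}. R / 8 \<le> dist w0 (\<gamma> t)}"
    have "compact Y"
    proof -
      have "closed ({0..s} \<inter> (\<lambda>s. dist w0 (\<gamma> s)) -` {R / 8..})"
        by (rule continuous_closed_preimage[OF c]) auto
      then have "compact ({0..s} \<inter> ({0..s} \<inter> (\<lambda>s. dist w0 (\<gamma> s)) -` {R / 8..}))"
        by (intro compact_Int_closed) auto
      also have "{0..s} \<inter> ({0..s} \<inter> (\<lambda>s. dist w0 (\<gamma> s)) -` {R / 8..}) = Y" by (auto simp: Y_def)
      finally show ?thesis .
    qed
    moreover have "s \<in> Y" using no that by (auto simp: Y_def)
    ultimately obtain t where t: "t \<in> Y" "\<And>t'. t' \<in> Y \<Longrightarrow> t \<le> t'" using compact_attains_inf[of Y] by blast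
    have tT: "t \<in> {0..T}" "t \<le> s" using t(1) that by (auto simp: Y_def)
    have below: "dist w0 (\<gamma> t') < R / 8" if "t' \<in> {0..<t}" for t'
      using t(2)[of t'] that tT by (fastforce simp: Y_def)
    have "dist w0 (\<gamma> t) \<le> R / 8"
    proof (rule ccontr)
      assume gt: "\<not> dist w0 (\<gamma> t) \<le> R / 8"
      have "continuous_on {0..t} (\<lambda>s. dist w0 (\<gamma> s))" by (rule continuous_on_subset[OF c]) (use tT in auto)
      moreover have "dist w0 (\<gamma> 0) \<le> R / 8" using g(1) R by auto
      ultimately obtain t' where t': "0 \<le> t'" "t' \<le> t" "dist w0 (\<gamma> t') = R / 8"
        using IVT'[of "\<lambda>s. dist w0 (\<gamma> s)" 0 "R / 8" t] gt tT by auto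
      then have "t' \<in> Y" using tT by (simp add: Y_def)
      then have "t \<le> t'" by (rule t(2))
      then show False using t' gt by simp
    qed
    then have m: "\<gamma> t' \<in> cball w0 (R / 8)" if "t' \<in> {0..t}" for t'
      using below[of t'] that by (cases "t' = t") auto
    have sm': "norm (C t - C 0) \<le> \<epsilon>" using sm[OF tT(1)] \<epsilon>_pos by linarith
    have z: "\<gamma> 0 \<in> cball w0 (R / 2)" using g(1) R by auto
    have "M * norm (C t - C 0) \<le> M * (\<epsilon> / 4)" using sm[OF tT(1)] M by (intro mult_left_mono) auto
    also have "\<dots> \<le> M * (R / (8 * M)) / 4"
    proof -
      have "M * \<epsilon> \<le> M * (R / (8 * M))" using M by (intro mult_left_mono) (auto simp: \<epsilon>_def)
      then show ?thesis by simp
    qed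
    also have "\<dots> = R / 32" using M by simp
    finally have "norm (\<gamma> t - \<gamma> 0) \<le> R / 32"
      using \<Gamma>_near[OF z sm'] restr[OF tT(1) m] by simp
    then have "dist w0 (\<gamma> t) \<le> R / 16 + R / 32"
      using g(1) dist_triangle[of w0 "\<gamma> t" "\<gamma> 0"] by (simp add: dist_norm norm_minus_commute)
    moreover have "R / 8 \<le> dist w0 (\<gamma> t)" using t(1) by (simp add: Y_def)
    ultimately show False using R by linarith
  qed
  show ?thesis using all s by (intro restr) auto
qed

end

section \<open>Local estimates\<close>

lemma linear_norm_le:
  fixes f :: "'a::euclidean_space \<Rightarrow> 'b::real_normed_vector"
  assumes "linear f" "\<And>b. b \<in> Basis \<Longrightarrow> norm (f b) \<le> B b"
  shows "norm (f v) \<le> (\<Sum>b\<in>Basis. B b) * norm v"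
proof -
  have "norm (f v) = norm (\<Sum>b\<in>Basis. (v \<bullet> b) *\<^sub>R f b)" using linear_Basis_sum[OF assms(1), of v] by simp
  also have "\<dots> \<le> (\<Sum>b\<in>Basis. norm v * B b)"
  proof (rule sum_norm_le)
    fix b :: 'a assume b: "b \<in> Basis"
    have "norm ((v \<bullet> b) *\<^sub>R f b) = \<bar>v \<bullet> b\<bar> * norm (f b)" by simp
    also have "\<dots> \<le> norm v * B b" using Basis_le_norm[OF b, of v] assms(2)[OF b] by (intro mult_mono) auto
    finally show "norm ((v \<bullet> b) *\<^sub>R f b) \<le> norm v * B b" .
  qed
  finally show ?thesis by (simp add: sum_distrib_right mult.commute sum_distrib_left)
qed

lemma continuous_bounded_cball:
  fixes f :: "'a::euclidean_space \<Rightarrow> 'b::real_normed_vector"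
  assumes "continuous_on (cball w R) f" obtains B where "0 \<le> B" "\<And>x. x \<in> cball w R \<Longrightarrow> norm (f x) \<le> B"
proof -
  have "bounded (f ` cball w R)" using compact_imp_bounded[OF compact_continuous_image[OF assms compact_cball]] .
  then obtain B where "0 < B" "\<forall>x\<in>cball w R. norm (f x) \<le> B" unfolding bounded_pos by auto
  then show ?thesis by (intro that[of B]) auto
qed

lemma smooth_on_deriv_bound:
  fixes f :: "'a::euclidean_space \<Rightarrow> 'b::real_normed_vector"
  assumes "smooth_on N f" "cball w R \<subseteq> N"
  obtains B where "0 \<le> B" "\<And>x v. x \<in> cball w R \<Longrightarrow> norm (frechet_derivative f (at x) v) \<le> B * norm v"
proof -
  have "\<exists>B. 0 \<le> B \<and> (\<forall>x\<in>cball w R. norm (frechet_derivative f (at x) b) \<le> B)" for b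
  proof -
    have "continuous_on (cball w R) (\<lambda>x. frechet_derivative f (at x) b)"
      using smooth_on_imp_continuous_on[OF smooth_on_deriv[OF assms(1)]] assms(2) by (rule continuous_on_subset)
    then show ?thesis using continuous_bounded_cball by metis
  qed
  then obtain B where B: "\<And>b. 0 \<le> B b" "\<And>b x. x \<in> cball w R \<Longrightarrow> norm (frechet_derivative f (at x) b) \<le> B b" by metis
  show ?thesis
  proof (rule that[of "\<Sum>b\<in>Basis. B b"])
    show "0 \<le> (\<Sum>b\<in>Basis. B b)" using B(1) by (intro sum_nonneg) auto
    show "norm (frechet_derivative f (at x) v) \<le> (\<Sum>b\<in>Basis. B b) * norm v" if "x \<in> cball w R" for x v
      using that assms(2) by (intro linear_norm_le smooth_on_deriv_linear[OF assms(1)] B(2)) auto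
  qed
qed

lemma smooth_on_lipschitz:
  fixes f :: "'a::euclidean_space \<Rightarrow> 'b::real_normed_vector"
  assumes "smooth_on N f" "cball w R \<subseteq> N"
  obtains B where "0 \<le> B" "\<And>x y. x \<in> cball w R \<Longrightarrow> y \<in> cball w R \<Longrightarrow> norm (f x - f y) \<le> B * norm (x - y)"
proof -
  obtain B where B: "0 \<le> B" "\<And>x v. x \<in> cball w R \<Longrightarrow> norm (frechet_derivative f (at x) v) \<le> B * norm v"
    by (rule smooth_on_deriv_bound[OF assms]) blast
  show ?thesis
  proof (rule that[OF B(1)])
    show "norm (f x - f y) \<le> B * norm (x - y)" if xy: "x \<in> cball w R" "y \<in> cball w R" for x y
    proof (rule differentiable_bound[OF convex_cball _ _ xy])
      fix z assume z: "z \<in> cball w R"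
      then have "z \<in> N" using assms(2) by blast
      then show "(f has_derivative frechet_derivative f (at z)) (at z within cball w R)"
        by (rule has_derivative_at_withinI[OF smooth_on_has_derivative[OF assms(1)]])
      show "onorm (frechet_derivative f (at z)) \<le> B" by (rule onorm_bound[OF B(1) B(2)[OF z]])
    qed
  qed
qed

lemma smooth_on_quadratic:
  fixes f :: "'a::euclidean_space \<Rightarrow> 'b::real_normed_vector"
  assumes "smooth_on N f" "cball w R \<subseteq> N"
  obtains B where "0 \<le> B" "\<And>x y. x \<in> cball w R \<Longrightarrow> y \<in> cball w R \<Longrightarrow>
     norm (f y - f x - frechet_derivative f (at x) (y - x)) \<le> B * (norm (y - x))\<^sup>2"
proof -
  have "\<exists>B. 0 \<le> B \<and> (\<forall>x\<in>cball w R. \<forall>y\<in>cball w R. norm (frechet_derivative f (at x) b - frechet_derivative f (at y) b) \<le> B * norm (x - y))" for b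
    by (rule smooth_on_lipschitz[OF smooth_on_deriv[OF assms(1)] assms(2), of b]) blast
  then obtain B where B: "\<And>b. 0 \<le> B b" "\<And>b x y. x \<in> cball w R \<Longrightarrow> y \<in> cball w R \<Longrightarrow>
     norm (frechet_derivative f (at x) b - frechet_derivative f (at y) b) \<le> B b * norm (x - y)" by metis
  let ?B = "\<Sum>b\<in>Basis. B b"
  have B0: "0 \<le> ?B" using B(1) by (intro sum_nonneg) auto
  have lin: "linear (frechet_derivative f (at x))" if "x \<in> cball w R" for x
    using that assms(2) by (intro smooth_on_deriv_linear[OF assms(1)]) auto
  show ?thesis
  proof (rule that[OF B0])
    fix x y assume x: "x \<in> cball w R" and y: "y \<in> cball w R"
    have seg: "closed_segment x y \<subseteq> cball w R" using x y by (simp add: closed_segment_subset)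
    have "norm (f y - f x - frechet_derivative f (at x) (y - x)) \<le> norm (y - x) * (?B * norm (y - x))"
    proof (rule differentiable_bound_linearization[where S = "closed_segment x y"])
      show "x + t *\<^sub>R (y - x) \<in> closed_segment x y" if "t \<in> {0..1}" for t
        unfolding closed_segment_def by (intro CollectI exI[of _ t]) (use that in \<open>auto simp: algebra_simps\<close>)
      show "(f has_derivative frechet_derivative f (at z)) (at z within closed_segment x y)" if "z \<in> closed_segment x y" for z
        by (rule has_derivative_at_withinI[OF smooth_on_has_derivative[OF assms(1)]]) (use that seg assms(2) in auto)
      show "onorm (frechet_derivative f (at z) - frechet_derivative f (at x)) \<le> ?B * norm (y - x)" if z: "z \<in> closed_segment x y" for z
      proof (rule onorm_bound)
        show "0 \<le> ?B * norm (y - x)" using B0 by simp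
        fix v
        have zc: "z \<in> cball w R" using z seg by blast
        have "norm (frechet_derivative f (at z) v - frechet_derivative f (at x) v) \<le> (\<Sum>b\<in>Basis. B b * norm (z - x)) * norm v"
          by (rule linear_norm_le[of "\<lambda>v. frechet_derivative f (at z) v - frechet_derivative f (at x) v"])
             (use lin[OF zc] lin[OF x] B(2)[OF zc x] in \<open>auto intro: linear_compose_sub\<close>)
        also have "\<dots> = ?B * norm (z - x) * norm v" by (simp add: sum_distrib_right)
        also have "\<dots> \<le> ?B * norm (y - x) * norm v"
          using B0 segment_bound1[OF z] by (intro mult_right_mono mult_left_mono) auto
        finally show "norm ((frechet_derivative f (at z) - frechet_derivative f (at x)) v) \<le> ?B * norm (y - x) * norm v" by simp
      qed
    qed simp
    then show "norm (f y - f x - frechet_derivative f (at x) (y - x)) \<le> ?B * (norm (y - x))\<^sup>2"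
      by (simp add: power2_eq_square mult_ac)
  qed
qed

text \<open>Compactness of a ball bounds the finitely many fields \<open>F b\<close> with
  \<open>b\<close> in \<open>Basis\<close>, and linearity in \<open>c\<close> extends the bounds to
  all parameters.\<close>

lemma commuting_fields_exists:
  fixes F :: "'c::euclidean_space \<Rightarrow> 'e::euclidean_space \<Rightarrow> 'e"
  assumes N: "open N" "w0 \<in> N" and lin: "\<And>w. w \<in> N \<Longrightarrow> linear (\<lambda>c. F c w)" and sm: "\<And>c. smooth_on N (F c)"
    and com: "\<And>c e w. w \<in> N \<Longrightarrow> frechet_derivative (F c) (at w) (F e w) = frechet_derivative (F e) (at w) (F c w)"
  obtains R M where "commuting_fields F (\<lambda>c w. frechet_derivative (F c) (at w)) w0 R M" "cball w0 R \<subseteq> N"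
proof -
  obtain R where R: "0 < R" "cball w0 R \<subseteq> N" using N open_contains_cball by metis
  have "\<exists>B. 0 \<le> B \<and> (\<forall>x\<in>cball w0 R. norm (F b x) \<le> B)" for b
    using continuous_bounded_cball[of w0 R "F b"] continuous_on_subset[OF smooth_on_imp_continuous_on[OF sm] R(2)] by metis
  then obtain A where A: "\<And>b. 0 \<le> A b" "\<And>b x. x \<in> cball w0 R \<Longrightarrow> norm (F b x) \<le> A b" by metis
  have "\<exists>B. 0 \<le> B \<and> (\<forall>x\<in>cball w0 R. \<forall>y\<in>cball w0 R. norm (F b x - F b y) \<le> B * norm (x - y))" for b
    by (rule smooth_on_lipschitz[OF sm R(2), of b]) blast
  then obtain B where B: "\<And>b. 0 \<le> B b" "\<And>b x y. x \<in> cball w0 R \<Longrightarrow> y \<in> cball w0 R \<Longrightarrow> norm (F b x - F b y) \<le> B b * norm (x - y)"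
    by metis
  have "\<exists>B. 0 \<le> B \<and> (\<forall>x\<in>cball w0 R. \<forall>y\<in>cball w0 R. norm (F b y - F b x - frechet_derivative (F b) (at x) (y - x)) \<le> B * (norm (y - x))\<^sup>2)" for b
    by (rule smooth_on_quadratic[OF sm R(2), of b]) blast
  then obtain C where C: "\<And>b. 0 \<le> C b" "\<And>b x y. x \<in> cball w0 R \<Longrightarrow> y \<in> cball w0 R \<Longrightarrow>
     norm (F b y - F b x - frechet_derivative (F b) (at x) (y - x)) \<le> C b * (norm (y - x))\<^sup>2"
    by metis
  define M where "M = 1 + (\<Sum>b\<in>Basis. A b + B b + C b)"
  have nn: "0 \<le> (\<Sum>b\<in>Basis. A b)" "0 \<le> (\<Sum>b\<in>Basis. B b)" "0 \<le> (\<Sum>b\<in>Basis. C b)"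
    using A(1) B(1) C(1) by (auto intro!: sum_nonneg)
  have Ms: "(\<Sum>b\<in>Basis. A b) \<le> M" "(\<Sum>b\<in>Basis. B b) \<le> M" "(\<Sum>b\<in>Basis. C b) \<le> M" "1 \<le> M"
    unfolding M_def sum.distrib using nn by linarith+
  have linw: "linear (\<lambda>c. F c w)" if "w \<in> cball w0 R" for w using that R(2) by (intro lin) auto
  have dlin: "linear (\<lambda>c. frechet_derivative (F c) (at w) v)" if w: "w \<in> cball w0 R" for w v
  proof -
    have wN: "w \<in> N" using w R(2) by auto
    have d: "(F c has_derivative frechet_derivative (F c) (at w)) (at w)" for c by (rule smooth_on_has_derivative[OF sm wN])
    have "frechet_derivative (F (c + e)) (at w) = (\<lambda>v. frechet_derivative (F c) (at w) v + frechet_derivative (F e) (at w) v)" for c e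
      by (rule frechet_derivative_eqI, rule has_derivative_transform_within_open[OF has_derivative_add[OF d d] N(1) wN])
         (simp add: linear_add[OF lin])
    moreover have "frechet_derivative (F (k *\<^sub>R c)) (at w) = (\<lambda>v. k *\<^sub>R frechet_derivative (F c) (at w) v)" for k c
      by (rule frechet_derivative_eqI, rule has_derivative_transform_within_open[OF has_derivative_scaleR_right[OF d] N(1) wN])
         (simp add: linear_cmul[OF lin])
    ultimately show ?thesis by (intro linearI) auto
  qed
  have "commuting_fields F (\<lambda>c w. frechet_derivative (F c) (at w)) w0 R M"
  proof (rule commuting_fields.intro)
    fix c e w w' assume w: "w \<in> cball w0 R"
    show "norm (F c w) \<le> M * norm c"
      using linear_norm_le[OF linw[OF w], of A c] A(2)[OF w] Ms(1) mult_right_mono[OF Ms(1), of "norm c"] by fastforce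
    show "linear (\<lambda>c. F c w)" by (rule linw[OF w])
    show "(F c has_derivative frechet_derivative (F c) (at w)) (at w)"
      using w R(2) by (intro smooth_on_has_derivative[OF sm]) auto
    show "frechet_derivative (F c) (at w) (F e w) = frechet_derivative (F e) (at w) (F c w)"
      using w R(2) by (intro com) auto
    assume w': "w' \<in> cball w0 R"
    have "norm (F c w - F c w') \<le> (\<Sum>b\<in>Basis. B b * norm (w - w')) * norm c"
      by (rule linear_norm_le[of "\<lambda>c. F c w - F c w'"])
         (use linw[OF w] linw[OF w'] B(2)[OF w w'] in \<open>auto intro: linear_compose_sub\<close>)
    also have "\<dots> = (\<Sum>b\<in>Basis. B b) * (norm c * norm (w - w'))" by (simp add: sum_distrib_right mult_ac)
    also have "\<dots> \<le> M * (norm c * norm (w - w'))" by (intro mult_right_mono Ms) simp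
    finally show "norm (F c w - F c w') \<le> M * norm c * norm (w - w')" by (simp add: mult_ac)
    have "norm (F c w' - F c w - frechet_derivative (F c) (at w) (w' - w)) \<le> (\<Sum>b\<in>Basis. C b * (norm (w' - w))\<^sup>2) * norm c"
      by (rule linear_norm_le[of "\<lambda>c. F c w' - F c w - frechet_derivative (F c) (at w) (w' - w)"])
         (use linw[OF w] linw[OF w'] dlin[OF w] C(2)[OF w w'] in \<open>auto intro!: linear_compose_sub\<close>)
    also have "\<dots> = (\<Sum>b\<in>Basis. C b) * (norm c * (norm (w' - w))\<^sup>2)" by (simp add: sum_distrib_right mult_ac)
    also have "\<dots> \<le> M * (norm c * (norm (w' - w))\<^sup>2)" by (intro mult_right_mono Ms) simp
    finally show "norm (F c w' - F c w - frechet_derivative (F c) (at w) (w' - w)) \<le> M * norm c * (norm (w' - w))\<^sup>2"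
      by (simp add: mult_ac)
  qed (use R Ms in auto)
  then show ?thesis using R(2) by (rule that)
qed

section \<open>A boundary value problem\<close>

lemma (in commuting_fields) \<Gamma>_lipschitz2:
  assumes z: "z \<in> cball w0 (R / 2)" and c: "norm c < \<epsilon>" "norm c' < \<epsilon>"
  shows "norm (\<Gamma> z c - \<Gamma> z c') \<le> M * norm (c - c')"
proof (rule differentiable_bound[of "ball 0 \<epsilon>" "\<Gamma> z" "\<lambda>c e. F e (\<Gamma> z c)"])
  fix x :: 'c assume x: "x \<in> ball 0 \<epsilon>"
  show "(\<Gamma> z has_derivative (\<lambda>e. F e (\<Gamma> z x))) (at x within ball 0 \<epsilon>)"
    by (rule has_derivative_at_withinI[OF \<Gamma>_has_derivative[OF z]]) (use x in simp)
  have m: "\<Gamma> z x \<in> cball w0 R" using \<Gamma>_mem(2)[OF z order_refl, of x] x R by auto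
  show "onorm (\<lambda>e. F e (\<Gamma> z x)) \<le> M" by (rule onorm_bound) (use M bound[OF m] in auto)
qed (use c in auto)

text \<open>Any nearby end point is reached by a curve whose leaf velocity is controlled by one
  constant \<open>c\<close>. In the application \<open>b\<close> and \<open>\<beta> c\<close> are
  the \<open>x\<close> components of the field of \<open>Re q\<close> and of a limit leaf field. The
  term \<open>c - \<beta> c w0\<close> turns the leading part of the leaf velocity into
  \<open>c\<close> itself, so that solving for \<open>c\<close> is a perturbation of the identity;
  there it will lie in the kernel of the projection.\<close>

lemma commuting_fields_bvp:
  fixes F :: "real \<times> 'x::euclidean_space \<Rightarrow> 'e::euclidean_space \<Rightarrow> 'e" and b :: "'e \<Rightarrow> 'x" and \<beta> :: "'x \<Rightarrow> 'e \<Rightarrow> 'x"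
  assumes cf: "commuting_fields F DF w0 R M" and L: "1 \<le> L" and w0: "w0 \<in> S"
    and inv: "\<And>z c. z \<in> S \<Longrightarrow> z \<in> cball w0 (R / 2) \<Longrightarrow> norm c < commuting_fields.\<epsilon> R M \<Longrightarrow> commuting_fields.\<Gamma> F w0 R z c \<in> S"
    and b: "\<And>w. w \<in> S \<Longrightarrow> w \<in> cball w0 R \<Longrightarrow> norm (b w) \<le> L"
      "\<And>w w'. w \<in> S \<Longrightarrow> w \<in> cball w0 R \<Longrightarrow> w' \<in> S \<Longrightarrow> w' \<in> cball w0 R \<Longrightarrow> norm (b w - b w') \<le> L * norm (w - w')"
    and \<beta>: "\<And>w. w \<in> S \<Longrightarrow> w \<in> cball w0 R \<Longrightarrow> linear (\<lambda>c. \<beta> c w)"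
      "\<And>w w' c. w \<in> S \<Longrightarrow> w \<in> cball w0 R \<Longrightarrow> w' \<in> S \<Longrightarrow> w' \<in> cball w0 R \<Longrightarrow> norm (\<beta> c w - \<beta> c w') \<le> L * norm c * norm (w - w')"
  obtains \<rho> where "0 < \<rho>" "\<And>z T y. z \<in> S \<Longrightarrow> z \<in> cball w0 \<rho> \<Longrightarrow> 0 \<le> T \<Longrightarrow> T \<le> \<rho> \<Longrightarrow> norm y \<le> \<rho> \<Longrightarrow>
     \<exists>c \<delta>. \<delta> 0 = z \<and> \<delta> 1 = commuting_fields.\<Gamma> F w0 R z (T, y) \<and> (\<forall>s\<in>{0..1}. \<delta> s \<in> S \<and> \<delta> s \<in> cball w0 R \<and>
       (\<delta> has_vector_derivative F (T, T *\<^sub>R b (\<delta> s) + \<beta> c (\<delta> s) + (c - \<beta> c w0)) (\<delta> s)) (at s within {0..1}))"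
proof -
  interpret commuting_fields F DF w0 R M by fact
  \<comment> \<open>\<open>r\<close> bounds the unknowns. Its entries keep the arguments of
    \<open>\<Gamma>\<close> below \<open>\<epsilon>\<close>, the curve inside the ball, and the
    Lipschitz constants small. The data are bounded by the smaller \<open>\<rho>\<close>, chosen
    such that the contribution of \<open>b\<close> is at most \<open>r / 4\<close>.\<close>
  define r where "r = min (\<epsilon> / 8) (min (R / (100 * M)) (1 / (100 * L * M)))"
  define \<rho> where "\<rho> = min r (r / (4 * L * M))"
  have r: "0 < r" using \<epsilon>_pos R M L by (simp add: r_def)
  have \<rho>: "0 < \<rho>" "\<rho> \<le> r" using r M L by (auto simp: \<rho>_def)
  have r1: "4 * r < \<epsilon>" using \<epsilon>_pos by (auto simp: r_def min_def)
  have r2: "M * r \<le> R / 100"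
  proof -
    have "M * r \<le> M * (R / (100 * M))" using M by (intro mult_left_mono) (auto simp: r_def)
    then show ?thesis using M by simp
  qed
  have r3: "L * M * r \<le> 1 / 100"
  proof -
    have "L * M * r \<le> L * M * (1 / (100 * L * M))" using M L by (intro mult_left_mono) (auto simp: r_def)
    then show ?thesis using M L by simp
  qed
  have r0: "r \<le> M * r" using mult_right_mono[OF M, of r] r by simp
  have w0R: "w0 \<in> cball w0 R" using R by simp
  show ?thesis
  proof (rule that[OF \<rho>(1)])
    fix z T and y :: 'x assume z: "z \<in> S" "z \<in> cball w0 \<rho>" and T: "0 \<le> T" "T \<le> \<rho>" and y: "norm y \<le> \<rho>"
    have zr: "dist w0 z \<le> M * r" using z(2) \<rho>(2) r0 unfolding mem_cball by linarith
    then have z2: "z \<in> cball w0 (R / 2)" using r2 R unfolding mem_cball by linarith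
    have TL: "L * M * T \<le> r / 4"
    proof -
      have "L * M * T \<le> L * M * (r / (4 * L * M))" using T M L by (intro mult_left_mono) (auto simp: \<rho>_def)
      then show ?thesis using M L by simp
    qed
    \<comment> \<open>Ansatz: \<open>a\<close> stands for the correction \<open>u s\<close> and
      \<open>v\<close> for its final value \<open>u 1\<close>. With \<open>a = v\<close> at
      \<open>s = 1\<close> the end point is the prescribed one for every correction. The velocity is
      right precisely if \<open>u\<close> has derivative \<open>h\<close> and
      \<open>c = y - u 1\<close>, which is the fixed point problem with dependence on the final
      value.\<close>
    define W where "W s a v = \<Gamma> z (s * T, s *\<^sub>R (y - v) + a)" for s a v
    define h where "h s a v = T *\<^sub>R b (W s a v) + (\<beta> (y - v) (W s a v) - \<beta> (y - v) w0)" for s a v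
    have nyv: "norm (y - v) \<le> 2 * r" if "v \<in> cball 0 r" for v
      using norm_triangle_ineq4[of y v] y that \<rho> by simp
    have arg: "norm (s * T, s *\<^sub>R (y - v) + a) \<le> 4 * r" if "s \<in> {0..1}" "a \<in> cball 0 r" "v \<in> cball 0 r" for s a v
    proof -
      have "norm (s * T, s *\<^sub>R (y - v) + a) \<le> norm (s * T) + norm (s *\<^sub>R (y - v) + a)" by (rule norm_Pair_le)
      also have "norm (s * T) \<le> r" using that(1) T \<rho> mult_left_le_one_le[of T s] by (simp add: abs_mult)
      also have "norm (s *\<^sub>R (y - v) + a) \<le> norm (s *\<^sub>R (y - v)) + norm a" by (rule norm_triangle_ineq)
      also have "norm (s *\<^sub>R (y - v)) \<le> norm (y - v)" using that(1) by (simp add: mult_left_le_one_le)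
      finally show ?thesis using nyv[OF that(3)] that(2) by simp
    qed
    have arg\<epsilon>: "norm (s * T, s *\<^sub>R (y - v) + a) < \<epsilon>" if "s \<in> {0..1}" "a \<in> cball 0 r" "v \<in> cball 0 r" for s a v
      using arg[OF that] r1 by linarith
    have WS: "W s a v \<in> S" if "s \<in> {0..1}" "a \<in> cball 0 r" "v \<in> cball 0 r" for s a v
      unfolding W_def by (rule inv[OF z(1) z2 arg\<epsilon>[OF that]])
    have Ww: "norm (W s a v - w0) \<le> 5 * (M * r)" if "s \<in> {0..1}" "a \<in> cball 0 r" "v \<in> cball 0 r" for s a v
    proof -
      have "norm (W s a v - z) \<le> M * norm (s * T, s *\<^sub>R (y - v) + a)"
        unfolding W_def by (rule \<Gamma>_near[OF z2 less_imp_le[OF arg\<epsilon>[OF that]]])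
      also have "\<dots> \<le> M * (4 * r)" using arg[OF that] M by (intro mult_left_mono) auto
      finally have "norm (W s a v - z) \<le> 4 * (M * r)" by simp
      moreover have "norm (z - w0) \<le> M * r" using zr by (simp add: dist_norm norm_minus_commute)
      ultimately show ?thesis using norm_triangle_ineq[of "W s a v - z" "z - w0"] by simp
    qed
    have WR: "W s a v \<in> cball w0 R" if "s \<in> {0..1}" "a \<in> cball 0 r" "v \<in> cball 0 r" for s a v
      using Ww[OF that] r2 R by (simp add: dist_norm norm_minus_commute)
    have LW: "L * norm (W s a v - w0) \<le> 1 / 20" if "s \<in> {0..1}" "a \<in> cball 0 r" "v \<in> cball 0 r" for s a v
    proof -
      have "L * norm (W s a v - w0) \<le> L * (5 * (M * r))" using Ww[OF that] L by (intro mult_left_mono) auto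
      then show ?thesis using r3 by simp
    qed
    have hb: "norm (h s a v) \<le> r" if "s \<in> {0..1}" "a \<in> cball 0 r" "v \<in> cball 0 r" for s a v
    proof -
      have "norm (T *\<^sub>R b (W s a v)) \<le> T * L" using b(1)[OF WS[OF that] WR[OF that]] T by (simp add: mult_left_mono)
      also have "\<dots> \<le> L * M * T" using mult_right_mono[OF M, of "T * L"] T L by (simp add: mult_ac)
      finally have 1: "norm (T *\<^sub>R b (W s a v)) \<le> r / 4" using TL by linarith
      have "norm (\<beta> (y - v) (W s a v) - \<beta> (y - v) w0) \<le> L * norm (y - v) * norm (W s a v - w0)"
        by (rule \<beta>(2)[OF WS[OF that] WR[OF that] w0 w0R])
      also have "\<dots> = L * norm (W s a v - w0) * norm (y - v)" by simp
      also have "\<dots> \<le> 1 / 20 * (2 * r)" using LW[OF that] nyv[OF that(3)] L r by (intro mult_mono) auto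
      finally have 2: "norm (\<beta> (y - v) (W s a v) - \<beta> (y - v) w0) \<le> r / 10" by simp
      show ?thesis unfolding h_def using norm_triangle_ineq[of "T *\<^sub>R b (W s a v)" "\<beta> (y - v) (W s a v) - \<beta> (y - v) w0"] 1 2 r by linarith
    qed
    have hl: "norm (h s a v - h s a' v') \<le> (norm (a - a') + norm (v - v')) / 4"
      if s: "s \<in> {0..1}" and a: "a \<in> cball 0 r" "v \<in> cball 0 r" and a': "a' \<in> cball 0 r" "v' \<in> cball 0 r" for s a v a' v'
    proof -
      define \<Delta> where "\<Delta> = norm (a - a') + norm (v - v')"
      note m = WS[OF s a] WR[OF s a] and m' = WS[OF s a'] WR[OF s a']
      have \<Delta>: "norm (W s a v - W s a' v') \<le> M * \<Delta>"
      proof -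
        have "norm (W s a v - W s a' v') \<le> M * norm ((s * T, s *\<^sub>R (y - v) + a) - (s * T, s *\<^sub>R (y - v') + a'))"
          unfolding W_def by (rule \<Gamma>_lipschitz2[OF z2 arg\<epsilon>[OF s a] arg\<epsilon>[OF s a']])
        also have "(s * T, s *\<^sub>R (y - v) + a) - (s * T, s *\<^sub>R (y - v') + a') = (0, (a - a') - s *\<^sub>R (v - v'))"
          by (simp add: algebra_simps)
        also have "norm (0::real, (a - a') - s *\<^sub>R (v - v')) = norm ((a - a') - s *\<^sub>R (v - v'))" by (simp add: norm_Pair)
        also have "M * norm ((a - a') - s *\<^sub>R (v - v')) \<le> M * \<Delta>"
        proof (rule mult_left_mono)
          have "norm (s *\<^sub>R (v - v')) \<le> norm (v - v')" using s by (simp add: mult_left_le_one_le)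
          then show "norm ((a - a') - s *\<^sub>R (v - v')) \<le> \<Delta>"
            unfolding \<Delta>_def using norm_triangle_ineq4[of "a - a'" "s *\<^sub>R (v - v')"] by linarith
        qed (use M in simp)
        finally show ?thesis .
      qed
      have \<Delta>0: "0 \<le> \<Delta>" by (simp add: \<Delta>_def)
      have "norm (T *\<^sub>R (b (W s a v) - b (W s a' v'))) \<le> T * (L * (M * \<Delta>))"
      proof -
        have "norm (b (W s a v) - b (W s a' v')) \<le> L * norm (W s a v - W s a' v')" by (rule b(2)[OF m m'])
        also have "\<dots> \<le> L * (M * \<Delta>)" using \<Delta> L by (intro mult_left_mono) auto
        finally show ?thesis using T by (simp add: mult_left_mono)
      qed
      also have "\<dots> = L * M * T * \<Delta>" by simp
      also have "\<dots> \<le> 1 / 400 * \<Delta>"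
      proof (rule mult_right_mono[OF _ \<Delta>0])
        have "1 * (M * r) \<le> L * (M * r)" using L M r by (intro mult_right_mono) auto
        then have "M * r \<le> L * M * r" by (simp only: mult_1 mult.assoc)
        then show "L * M * T \<le> 1 / 400" using r0 TL r3 by linarith
      qed
      finally have 1: "norm (T *\<^sub>R (b (W s a v) - b (W s a' v'))) \<le> 1 / 400 * \<Delta>" .
      have "norm (\<beta> (y - v) (W s a v) - \<beta> (y - v) (W s a' v')) \<le> L * norm (y - v) * norm (W s a v - W s a' v')"
        by (rule \<beta>(2)[OF m m'])
      also have "\<dots> \<le> L * (2 * r) * (M * \<Delta>)"
        using nyv[OF a(2)] \<Delta> L r by (intro mult_mono) auto
      also have "\<dots> = 2 * (L * M * r) * \<Delta>" by simp
      also have "\<dots> \<le> 1 / 50 * \<Delta>" using r3 by (intro mult_right_mono[OF _ \<Delta>0]) simp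
      finally have 2: "norm (\<beta> (y - v) (W s a v) - \<beta> (y - v) (W s a' v')) \<le> 1 / 50 * \<Delta>" .
      have "norm (\<beta> (v' - v) (W s a' v') - \<beta> (v' - v) w0) \<le> L * norm (v' - v) * norm (W s a' v' - w0)"
        by (rule \<beta>(2)[OF m' w0 w0R])
      also have "\<dots> = L * norm (W s a' v' - w0) * norm (v' - v)" by simp
      also have "\<dots> \<le> 1 / 20 * norm (v' - v)" by (rule mult_right_mono[OF LW[OF s a']]) simp
      also have "\<dots> \<le> 1 / 20 * \<Delta>" by (simp add: \<Delta>_def norm_minus_commute)
      finally have 3: "norm (\<beta> (v' - v) (W s a' v') - \<beta> (v' - v) w0) \<le> 1 / 20 * \<Delta>" .
      \<comment> \<open>Linearity in the parameter splits the difference of \<open>h\<close> into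
        the change of \<open>b\<close>, the change of the point in \<open>\<beta>\<close> and the
        change of the parameter. The factors 1/400, 1/50 and 1/20 add up to less than 1/4.\<close>
      have "\<beta> (v' - v) w = \<beta> (y - v) w - \<beta> (y - v') w" if "w \<in> S" "w \<in> cball w0 R" for w
        by (simp flip: linear_diff[OF \<beta>(1)[OF that]])
      then have "h s a v - h s a' v' = T *\<^sub>R (b (W s a v) - b (W s a' v')) + (\<beta> (y - v) (W s a v) - \<beta> (y - v) (W s a' v'))
          + (\<beta> (v' - v) (W s a' v') - \<beta> (v' - v) w0)"
        using m' w0 w0R by (simp add: h_def algebra_simps)
      then have "norm (h s a v - h s a' v') \<le> 1 / 400 * \<Delta> + 1 / 50 * \<Delta> + 1 / 20 * \<Delta>"
        using 1 2 3 by (simp only:) (intro norm_triangle_mono)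
      then have "norm (h s a v - h s a' v') \<le> \<Delta> / 4" using \<Delta>0 by linarith
      then show ?thesis by (simp only: \<Delta>_def)
    qed
    have hc: "continuous_on ({0..1} \<times> cball 0 r \<times> cball 0 r) (\<lambda>p. h (fst p) (fst (snd p)) (snd (snd p)))"
    proof -
      let ?X = "{0..1} \<times> cball (0::'x) r \<times> cball (0::'x) r"
      let ?W = "\<lambda>p. W (fst p) (fst (snd p)) (snd (snd p))"
      let ?c = "\<lambda>p :: real \<times> 'x \<times> 'x. y - snd (snd p)"
      have pm: "fst p \<in> {0..1}" "fst (snd p) \<in> cball 0 r" "snd (snd p) \<in> cball 0 r" if "p \<in> ?X" for p using that by auto
      have "continuous_on (ball 0 \<epsilon>) (\<Gamma> z)"
        by (intro continuous_at_imp_continuous_on ballI has_derivative_continuous[OF \<Gamma>_has_derivative[OF z2]]) simp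
      then have cW: "continuous_on ?X ?W"
        unfolding W_def by (rule continuous_on_compose2) (use arg\<epsilon> pm in \<open>auto intro!: continuous_intros\<close>)
      have lc: "continuous_on (S \<inter> cball w0 R) k" if "\<And>w w'. w \<in> S \<inter> cball w0 R \<Longrightarrow> w' \<in> S \<inter> cball w0 R \<Longrightarrow> norm (k w - k w') \<le> B * norm (w - w')" for k :: "'e \<Rightarrow> 'x" and B
      proof -
        have "(max 0 B)-lipschitz_on (S \<inter> cball w0 R) k"
        proof (rule lipschitz_onI)
          fix w w' assume "w \<in> S \<inter> cball w0 R" "w' \<in> S \<inter> cball w0 R"
          then have "norm (k w - k w') \<le> B * norm (w - w')" by (rule that)
          also have "\<dots> \<le> max 0 B * norm (w - w')" by (intro mult_right_mono) auto
          finally show "dist (k w) (k w') \<le> max 0 B * dist w w'" by (simp add: dist_norm)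
        qed simp
        then show ?thesis by (rule lipschitz_on_continuous_on)
      qed
      have im: "?W ` ?X \<subseteq> S \<inter> cball w0 R"
        by (intro image_subsetI IntI WS WR pm)
      have cb: "continuous_on ?X (\<lambda>p. b (?W p))"
        by (rule continuous_on_compose2[OF lc[of b L] cW im]) (use b(2) in auto)
      have c\<beta>: "continuous_on ?X (\<lambda>p. \<beta> e (?W p))" for e
        by (rule continuous_on_compose2[OF lc[of "\<beta> e" "L * norm e"] cW im]) (use \<beta>(2) in auto)
      \<comment> \<open>The Lipschitz bound on \<open>S\<close> gives continuity for each fixed
        parameter; the expansion in \<open>Basis\<close> makes it joint.\<close>
      have e\<beta>: "\<beta> c w = (\<Sum>e\<in>Basis. (c \<bullet> e) *\<^sub>R \<beta> e w)" if "w \<in> S" "w \<in> cball w0 R" for c w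
        by (rule linear_Basis_sum[OF \<beta>(1)[OF that]])
      have "continuous_on ?X (\<lambda>p. T *\<^sub>R b (?W p) + ((\<Sum>e\<in>Basis. (?c p \<bullet> e) *\<^sub>R \<beta> e (?W p)) - (\<Sum>e\<in>Basis. (?c p \<bullet> e) *\<^sub>R \<beta> e w0)))"
        by (intro continuous_intros cb c\<beta>)
      then show ?thesis
      proof (rule continuous_on_eq)
        fix p :: "real \<times> 'x \<times> 'x" assume "p \<in> ?X"
        note p = pm[OF this]
        show "T *\<^sub>R b (?W p) + ((\<Sum>e\<in>Basis. (?c p \<bullet> e) *\<^sub>R \<beta> e (?W p)) - (\<Sum>e\<in>Basis. (?c p \<bullet> e) *\<^sub>R \<beta> e w0)) =
          h (fst p) (fst (snd p)) (snd (snd p))"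
          unfolding e\<beta>[OF WS[OF p] WR[OF p], symmetric] e\<beta>[OF w0 w0R, symmetric] by (simp add: h_def)
      qed
    qed
    obtain u where u: "u 0 = 0" "\<And>s. s \<in> {0..1} \<Longrightarrow> norm (u s) \<le> r"
       "\<And>s. s \<in> {0..1} \<Longrightarrow> (u has_vector_derivative h s (u s) (u 1)) (at s within {0..1})"
      by (rule integral_fixpoint[OF hc hb hl]) (use r in auto)
    define c where "c = y - u 1"
    define \<delta> where "\<delta> s = W s (u s) (u 1)" for s
    have um: "u s \<in> cball 0 r" if "s \<in> {0..1}" for s using u(2)[OF that] by simp
    have u1: "u 1 \<in> cball 0 r" by (rule um) simp
    have "(\<delta> has_vector_derivative F (T, T *\<^sub>R b (\<delta> s) + \<beta> c (\<delta> s) + (c - \<beta> c w0)) (\<delta> s)) (at s within {0..1})"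
      if s: "s \<in> {0..1}" for s
    proof -
      have "((\<lambda>s. (s * T, s *\<^sub>R c + u s)) has_derivative (\<lambda>x. x *\<^sub>R (T, c + h s (u s) (u 1)))) (at s within {0..1})"
        using u(3)[OF s] unfolding has_vector_derivative_def
        by (auto intro!: derivative_eq_intros simp: algebra_simps)
      moreover have "(\<Gamma> z has_derivative (\<lambda>e. F e (\<Gamma> z (s * T, s *\<^sub>R c + u s)))) (at (s * T, s *\<^sub>R c + u s))"
        using arg\<epsilon>[OF s um[OF s] u1] by (intro \<Gamma>_has_derivative[OF z2]) (simp add: c_def)
      ultimately have "((\<lambda>s. \<Gamma> z (s * T, s *\<^sub>R c + u s)) has_derivative (\<lambda>x. F (x *\<^sub>R (T, c + h s (u s) (u 1))) (\<Gamma> z (s * T, s *\<^sub>R c + u s)))) (at s within {0..1})"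
        by (rule has_derivative_compose)
      moreover have "(\<lambda>s. \<Gamma> z (s * T, s *\<^sub>R c + u s)) = \<delta>" by (rule ext) (simp add: \<delta>_def W_def c_def)
      moreover have "\<Gamma> z (s * T, s *\<^sub>R c + u s) = \<delta> s" by (simp add: \<delta>_def W_def c_def)
      moreover have "\<delta> s \<in> cball w0 R" unfolding \<delta>_def by (rule WR[OF s um[OF s] u1])
      moreover have "c + h s (u s) (u 1) = T *\<^sub>R b (\<delta> s) + \<beta> c (\<delta> s) + (c - \<beta> c w0)"
        by (simp add: h_def \<delta>_def c_def algebra_simps)
      ultimately show ?thesis by (simp only: has_vector_derivative_def linear_cmul[OF lin])
    qed
    moreover have "\<delta> 0 = z" by (simp add: \<delta>_def W_def u(1) \<Gamma>_0[OF z2] flip: zero_prod_def)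
    moreover have "\<delta> 1 = \<Gamma> z (T, y)" by (simp add: \<delta>_def W_def)
    moreover have "\<delta> s \<in> S" "\<delta> s \<in> cball w0 R" if "s \<in> {0..1}" for s
      unfolding \<delta>_def using WS[OF that um[OF that] u1] WR[OF that um[OF that] u1] by auto
    ultimately have "\<delta> 0 = z \<and> \<delta> 1 = \<Gamma> z (T, y) \<and> (\<forall>s\<in>{0..1}. \<delta> s \<in> S \<and> \<delta> s \<in> cball w0 R \<and>
       (\<delta> has_vector_derivative F (T, T *\<^sub>R b (\<delta> s) + \<beta> c (\<delta> s) + (c - \<beta> c w0)) (\<delta> s)) (at s within {0..1}))"
      by simp
    then show "\<exists>c \<delta>. \<delta> 0 = z \<and> \<delta> 1 = \<Gamma> z (T, y) \<and> (\<forall>s\<in>{0..1}. \<delta> s \<in> S \<and> \<delta> s \<in> cball w0 R \<and>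
       (\<delta> has_vector_derivative F (T, T *\<^sub>R b (\<delta> s) + \<beta> c (\<delta> s) + (c - \<beta> c w0)) (\<delta> s)) (at s within {0..1}))"
      by blast
  qed
qed

section \<open>Commuting Hamilton fields\<close>

lemma smooth_on_vec:
  fixes f :: "'i::finite \<Rightarrow> 'a::real_normed_vector \<Rightarrow> real"
  assumes "open S" "\<And>j. smooth_on S (f j)" shows "smooth_on S (\<lambda>z. \<chi> j. f j z)"
proof -
  have "smooth_on S (\<lambda>z. \<Sum>j\<in>UNIV. f j z *\<^sub>R axis j (1::real))"
    by (intro smooth_on_sum smooth_on_scaleR smooth_on_const assms) auto
  moreover have "(\<lambda>z. \<Sum>j\<in>UNIV. f j z *\<^sub>R axis j (1::real)) = (\<lambda>z. \<chi> j. f j z)"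
    using basis_expansion[of "\<chi> j. f j z" for z] by (intro ext) (simp add: scalar_mult_eq_scaleR)
  ultimately show ?thesis by simp
qed

lemma smooth_on_ham: "open S \<Longrightarrow> smooth_on S f \<Longrightarrow> smooth_on S (ham f)"
  unfolding ham_def[abs_def] by (intro smooth_on_Pair smooth_on_vec smooth_on_minus smooth_on_deriv) auto

lemma symp_deriv_ham:
  assumes "open S" "smooth_on S f" "z \<in> S"
  shows "symp u (frechet_derivative (ham f) (at z) v) = hess f z v u"
proof -
  have bs: "bounded_linear (symp u)"
    using linear_conv_bounded_linear[of "symp u"] by (auto simp: linear_iff symp_simps)
  have "((\<lambda>z. symp u (ham f z)) has_derivative (\<lambda>v. symp u (frechet_derivative (ham f) (at z) v))) (at z)"
    by (rule bounded_linear.has_derivative[OF bs smooth_on_has_derivative[OF smooth_on_ham[OF assms(1,2)] assms(3)]])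
  then have "((\<lambda>z. frechet_derivative f (at z) u) has_derivative (\<lambda>v. symp u (frechet_derivative (ham f) (at z) v))) (at z)"
    by (rule has_derivative_transform_within_open[OF _ assms(1,3)])
      (simp add: deriv_ham differentiableI[OF smooth_on_has_derivative[OF assms(2)]])
  then show ?thesis by (simp add: hess_eq frechet_derivative_eqI)
qed

lemma bounded_bilinear_symp: "bounded_bilinear symp"
proof
  show "\<exists>K. \<forall>a b :: 'a phase. norm (symp a b) \<le> norm a * norm b * K"
  proof (intro exI[of _ 2] allI)
    fix a b :: "'a phase"
    have n: "norm (fst x) \<le> norm x" "norm (snd x) \<le> norm x" for x :: "'a phase"
      by (simp_all add: norm_prod_def real_le_rsqrt)
    have "\<bar>snd a \<bullet> fst b\<bar> \<le> norm a * norm b"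
      by (rule order_trans[OF Cauchy_Schwarz_ineq2 mult_mono[OF n(2) n(1)]]) auto
    moreover have "\<bar>fst a \<bullet> snd b\<bar> \<le> norm a * norm b"
      by (rule order_trans[OF Cauchy_Schwarz_ineq2 mult_mono[OF n(1) n(2)]]) auto
    ultimately show "norm (symp a b) \<le> norm a * norm b * 2" unfolding symp_def by (simp add: abs_le_iff)
  qed
qed (auto simp: symp_simps)

text \<open>Differentiating \<open>symp (ham f z) (ham g z) = 0\<close> in direction
  \<open>v\<close> equates two values of Hessians. By symmetry of the Hessians these are the
  pairings of \<open>v\<close> with the two sides.\<close>

lemma ham_commute:
  assumes S: "open S" "smooth_on S f" "smooth_on S g" and br: "\<And>z. z \<in> S \<Longrightarrow> poisson f g z = 0" and z: "z \<in> S"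
  shows "frechet_derivative (ham f) (at z) (ham g z) = frechet_derivative (ham g) (at z) (ham f z)"
proof (rule symp_nondegenerate)
  fix v
  have df: "(ham f has_derivative frechet_derivative (ham f) (at z)) (at z)"
    and dg: "(ham g has_derivative frechet_derivative (ham g) (at z)) (at z)"
    by (rule smooth_on_has_derivative[OF smooth_on_ham[OF S(1)] z], rule S)+
  have "((\<lambda>z. symp (ham f z) (ham g z)) has_derivative
      (\<lambda>v. symp (ham f z) (frechet_derivative (ham g) (at z) v) + symp (frechet_derivative (ham f) (at z) v) (ham g z))) (at z)"
    by (rule bounded_bilinear.FDERIV[OF bounded_bilinear_symp df dg])
  moreover have "((\<lambda>z. symp (ham f z) (ham g z)) has_derivative (\<lambda>v. 0)) (at z)"
    by (rule has_derivative_transform_within_open[OF has_derivative_const[of 0] S(1) z])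
      (use br poisson_symp[OF differentiableI[OF smooth_on_has_derivative[OF S(3)]]] in simp)
  ultimately have "symp (ham f z) (frechet_derivative (ham g) (at z) v) + symp (frechet_derivative (ham f) (at z) v) (ham g z) = 0"
    by (rule fun_cong[OF has_derivative_unique])
  then have "hess g z v (ham f z) = hess f z v (ham g z)"
    using symp_commute[of "frechet_derivative (ham f) (at z) v" "ham g z"] symp_deriv_ham[OF S(1,2) z] symp_deriv_ham[OF S(1,3) z] by simp
  then show "symp v (frechet_derivative (ham f) (at z) (ham g z)) = symp v (frechet_derivative (ham g) (at z) (ham f z))"
    unfolding symp_deriv_ham[OF S(1,2) z] symp_deriv_ham[OF S(1,3) z]
    using hess_commute[OF S(1,2) z, of v] hess_commute[OF S(1,3) z, of v] by simp
qed

section \<open>The limit fields along the leaves\<close>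

lemma linear_family_bounds:
  fixes G :: "'e::euclidean_space \<Rightarrow> 'c::euclidean_space \<Rightarrow> 'b::real_normed_vector"
  assumes lin: "\<And>w. w \<in> N \<Longrightarrow> linear (G w)" and sm: "\<And>c. smooth_on N (\<lambda>w. G w c)" and R: "cball w0 R \<subseteq> N"
  obtains B where "0 \<le> B" "\<And>w c. w \<in> cball w0 R \<Longrightarrow> norm (G w c) \<le> B * norm c"
    "\<And>w w' c. w \<in> cball w0 R \<Longrightarrow> w' \<in> cball w0 R \<Longrightarrow> norm (G w c - G w' c) \<le> B * norm c * norm (w - w')"
proof -
  have linR: "linear (G w)" if "w \<in> cball w0 R" for w using that R by (intro lin) auto
  have "\<exists>B. 0 \<le> B \<and> (\<forall>w\<in>cball w0 R. norm (G w b) \<le> B)" for b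
    using continuous_bounded_cball[of w0 R "\<lambda>w. G w b"] continuous_on_subset[OF smooth_on_imp_continuous_on[OF sm] R] by metis
  then obtain A where A: "\<And>b. 0 \<le> A b" "\<And>b w. w \<in> cball w0 R \<Longrightarrow> norm (G w b) \<le> A b" by metis
  have "\<exists>B. 0 \<le> B \<and> (\<forall>x\<in>cball w0 R. \<forall>y\<in>cball w0 R. norm (G x b - G y b) \<le> B * norm (x - y))" for b
    by (rule smooth_on_lipschitz[OF sm R, of b]) blast
  then obtain B where B: "\<And>b. 0 \<le> B b" "\<And>b x y. x \<in> cball w0 R \<Longrightarrow> y \<in> cball w0 R \<Longrightarrow> norm (G x b - G y b) \<le> B b * norm (x - y)"
    by metis
  define M where "M = (\<Sum>b\<in>Basis. A b) + (\<Sum>b\<in>Basis. B b)"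
  have nn: "0 \<le> (\<Sum>b\<in>Basis. A b)" "0 \<le> (\<Sum>b\<in>Basis. B b)" using A(1) B(1) by (auto intro!: sum_nonneg)
  then have Ms: "(\<Sum>b\<in>Basis. A b) \<le> M" "(\<Sum>b\<in>Basis. B b) \<le> M" "0 \<le> M" by (auto simp: M_def)
  show ?thesis
  proof (rule that[OF Ms(3)])
    fix w w' c assume w: "w \<in> cball w0 R"
    have "norm (G w c) \<le> (\<Sum>b\<in>Basis. A b) * norm c" by (rule linear_norm_le[OF linR[OF w] A(2)[OF w]])
    also have "\<dots> \<le> M * norm c" by (intro mult_right_mono Ms) simp
    finally show "norm (G w c) \<le> M * norm c" .
    assume w': "w' \<in> cball w0 R"
    have "norm (G w c - G w' c) \<le> (\<Sum>b\<in>Basis. B b * norm (w - w')) * norm c"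
      by (rule linear_norm_le[OF linear_compose_sub[OF linR[OF w] linR[OF w']] B(2)[OF w w']])
    also have "\<dots> = (\<Sum>b\<in>Basis. B b) * (norm c * norm (w - w'))" by (simp add: sum_distrib_right mult_ac)
    also have "\<dots> \<le> M * (norm c * norm (w - w'))" by (intro mult_right_mono Ms) simp
    finally show "norm (G w c - G w' c) \<le> M * norm c * norm (w - w')" by (simp add: mult_ac)
  qed
qed

lemma smooth_on_deriv_apply:
  fixes f :: "'a::euclidean_space \<Rightarrow> 'b::real_normed_vector"
  assumes "open S" "smooth_on S f" "smooth_on S k"
  shows "smooth_on S (\<lambda>z. frechet_derivative f (at z) (k z))"
proof (rule smooth_on_cong[OF assms(1)])
  show "smooth_on S (\<lambda>z. \<Sum>b\<in>Basis. (k z \<bullet> b) *\<^sub>R frechet_derivative f (at z) b)"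
    by (intro smooth_on_sum smooth_on_scaleR smooth_on_deriv smooth_on_bounded_linear[OF bounded_linear_inner_left] assms) auto
  show "(\<Sum>b\<in>Basis. (k z \<bullet> b) *\<^sub>R frechet_derivative f (at z) b) = frechet_derivative f (at z) (k z)" if "z \<in> S" for z
    using linear_Basis_sum[OF smooth_on_deriv_linear[OF assms(2) that], of "k z"] by simp
qed

lemma linear_leaf_field:
  assumes "\<And>j. linear (\<lambda>c. \<Theta> c j)" shows "linear (\<lambda>c. leaf_field d \<xi> A (\<Theta> c) w)"
  unfolding leaf_field_def
  by (rule linearI) (simp_all add: linear_add[OF assms] linear_cmul[OF assms] scaleR_add_left distrib_left
       sum.distrib scaleR_right.sum mult.left_commute scaleR_add_right)

locale char_chart = double_char U p q r + chart?: involutive_chart U1 "Sigma2 U p" d n m \<zeta> x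
  for U :: "'n::finite phase set" and p q r U1 d n m \<zeta> x +
  assumes U1: "U1 \<subseteq> U"
begin

lemma open_U1: "open U1" by (rule chart.open_U)

lemma deriv_x_proj: "z \<in> U1 \<Longrightarrow> \<pi> (frechet_derivative x (at z) v) = frechet_derivative x (at z) v"
proof -
  assume z: "z \<in> U1"
  have d: "(x has_derivative frechet_derivative x (at z)) (at z)" by (rule smooth_on_has_derivative[OF smooth_x z])
  have "((\<lambda>z. \<pi> (x z)) has_derivative (\<lambda>v. \<pi> (frechet_derivative x (at z) v))) (at z)"
    by (rule bounded_linear.has_derivative[OF bounded_linear_proj d])
  then have "(x has_derivative (\<lambda>v. \<pi> (frechet_derivative x (at z) v))) (at z)" by (simp add: proj_x)
  from fun_cong[OF has_derivative_unique[OF this d]] show ?thesis .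
qed

lemma ann_eq_H: "w \<in> S \<Longrightarrow> w \<in> U1 \<Longrightarrow> v \<in> tangent_ann S w \<Longrightarrow> v = H (frechet_derivative x (at w) v) w"
  using tangent_ann_S[of w] deriv_x_H[of w] H_proj[of w] by auto

lemma smooth_\<nu>: "smooth_on U1 (\<nu> a)"
  unfolding \<nu>_def[abs_def] by (intro smooth_on_minus smooth_on_ham smooth_inner_x open_U1)

text \<open>The fundamental matrix (Hamilton map) of \<open>Re p\<close> applied to
  \<open>\<nu> a\<close>, written as a derivative of the Hamilton field so that its smoothness is
  visible; \<open>symp_fund\<close> is its defining property.\<close>

definition fund :: "real ^ 'n \<Rightarrow> 'n phase \<Rightarrow> 'n phase" where
  "fund a w = (\<Sum>b\<in>Basis. (\<nu> a w \<bullet> b) *\<^sub>R ham (\<lambda>z. frechet_derivative (\<lambda>z. Re (p z)) (at z) b) w)"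

lemma smooth_fund: "smooth_on U1 (fund a)"
  unfolding fund_def[abs_def]
  by (intro smooth_on_sum smooth_on_scaleR smooth_on_bounded_linear[OF bounded_linear_inner_left] smooth_\<nu> smooth_on_ham
      smooth_on_deriv smooth_on_subset[OF smooth_Re_p U1] open_U1) auto

lemma linear_fund: "w \<in> U1 \<Longrightarrow> linear (\<lambda>a. fund a w)"
  unfolding fund_def
  by (rule linearI) (simp_all add: linear_add[OF linear_\<nu>] linear_cmul[OF linear_\<nu>] inner_add_left scaleR_add_left sum.distrib scaleR_right.sum)

lemma symp_fund:
  assumes w: "w \<in> U1" shows "symp v (fund a w) = hess (\<lambda>z. Re (p z)) w v (\<nu> a w)"
proof -
  have wU: "w \<in> U" using w U1 by auto
  have "symp v (ham (\<lambda>z. frechet_derivative (\<lambda>z. Re (p z)) (at z) b) w) = hess (\<lambda>z. Re (p z)) w v b" for b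
    unfolding hess_eq
    by (rule deriv_ham[symmetric, OF differentiableI[OF smooth_on_has_derivative[OF smooth_on_deriv[OF smooth_Re_p] wU]]])
  then show ?thesis
    unfolding fund_def linear_Basis_sum[OF linear_hess(2)[OF open_domain smooth_Re_p wU], of v "\<nu> a w"]
    by (simp add: symp_sum_right symp_simps)
qed

context
  fixes d' :: nat and \<xi> :: "nat \<Rightarrow> 'n phase \<Rightarrow> real" and A
  assumes frame: "sympl_frame U S d' \<xi>" and quad: "quadratic_coeffs S (\<lambda>z. Re (p z)) d' \<xi> A"
begin

lemma smooth_frame: "j < d' \<Longrightarrow> smooth_on U (\<xi> j)"
  using frame by (simp add: sympl_frame_def)

lemma deriv_frame: "z \<in> U \<Longrightarrow> j < d' \<Longrightarrow> frechet_derivative (\<xi> j) (at z) v = symp v (ham (\<xi> j) z)"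
  by (rule deriv_ham[OF differentiableI[OF smooth_on_has_derivative[OF smooth_frame]]])

lemma linear_frame: "z \<in> U \<Longrightarrow> j < d' \<Longrightarrow> linear (frechet_derivative (\<xi> j) (at z))"
  by (rule smooth_on_deriv_linear[OF smooth_frame])

lemma independent_frame:
  assumes z: "z \<in> U" shows "independent_at d' \<xi> z"
  unfolding independent_at_def
proof (intro allI impI)
  fix c j assume c: "\<forall>v. (\<Sum>j<d'. c j * frechet_derivative (\<xi> j) (at z) v) = 0" and j: "j < d'"
  have "(\<Sum>j<d'. c j *\<^sub>R ham (\<xi> j) z) = 0"
  proof (rule symp_nondegenerate)
    fix v
    show "symp v (\<Sum>j<d'. c j *\<^sub>R ham (\<xi> j) z) = symp v 0"
      using c[rule_format, of v] by (simp add: deriv_frame[OF z] symp_sum_right symp_simps)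
  qed
  then have "(\<Sum>j<d'. c j *\<^sub>R ham (\<xi> j) z) = 0 *\<^sub>R radial z" by simp
  then show "c j = 0" using frame z j unfolding sympl_frame_def by blast
qed

lemma tangent_frame:
  assumes w: "w \<in> S" shows "tangent S w = {v. \<forall>j<d'. frechet_derivative (\<xi> j) (at w) v = 0}"
proof (rule tangent_regular[OF open_domain])
  show "S \<inter> U = {z\<in>U. \<forall>j<d'. \<xi> j z = 0}" using frame Sigma2_subset[of U p] by (auto simp: sympl_frame_def)
qed (use w Sigma2_subset in \<open>auto intro: smooth_frame independent_frame\<close>)

lemma symp_leaf_field: "w \<in> U \<Longrightarrow> symp v (leaf_field d' \<xi> A \<theta> w) = 2 * (\<Sum>j<d'. \<Sum>k<d'. A j k w * \<theta> j * frechet_derivative (\<xi> k) (at w) v)"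
  by (simp add: leaf_field_def symp_simps symp_sum_right deriv_frame)

lemma leaf_field_ann:
  assumes "w \<in> S" shows "leaf_field d' \<xi> A \<theta> w \<in> tangent_ann S w"
  unfolding tangent_ann_def
proof (intro CollectI ballI)
  fix v assume "v \<in> tangent S w"
  then have "symp v (leaf_field d' \<xi> A \<theta> w) = 0"
    using assms Sigma2_subset[of U p] by (subst symp_leaf_field) (auto simp: tangent_frame)
  then show "symp (leaf_field d' \<xi> A \<theta> w) v = 0" by (subst symp_commute) simp
qed

lemma leaf_field_eq_fund:
  assumes w: "w \<in> S" "w \<in> U1" and \<theta>: "\<And>j. j < d' \<Longrightarrow> \<theta> j = frechet_derivative (\<xi> j) (at w) (\<nu> a w)"
  shows "leaf_field d' \<xi> A \<theta> w = fund a w"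
proof (rule symp_nondegenerate)
  fix v
  have wU: "w \<in> U" using w U1 by auto
  have "symp v (fund a w) = hess (\<lambda>z. Re (p z)) w (\<nu> a w) v"
    unfolding symp_fund[OF w(2)] by (rule hess_commute[OF open_domain smooth_Re_p wU])
  also have "\<dots> = 2 * (\<Sum>j<d'. \<Sum>k<d'. A j k w * frechet_derivative (\<xi> j) (at w) (\<nu> a w) * frechet_derivative (\<xi> k) (at w) v)"
    using quad w(1) unfolding quadratic_coeffs_def by blast
  finally show "symp v (leaf_field d' \<xi> A \<theta> w) = symp v (fund a w)"
    unfolding symp_leaf_field[OF wU] using \<theta> by simp
qed

text \<open>With \<open>\<theta> = d\<xi>(\<nu> a)\<close> the field is the fundamental matrix applied to \<open>\<nu> a\<close>. For fixed \<open>\<theta>\<close> the vector \<open>a\<close> depends on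
  the point, as the solution of a linear system whose matrix is smooth and close to its value at \<open>w0\<close>.\<close>

lemma normalized_leaf_field:
  assumes w0: "w0 \<in> S" "w0 \<in> U1"
  obtains \<Theta> L R where "0 < R" "cball w0 R \<subseteq> U1" "1 \<le> L" "\<And>j. linear (\<lambda>c. \<Theta> c j)"
    "\<And>c. frechet_derivative x (at w0) (leaf_field d' \<xi> A (\<Theta> c) w0) = \<pi> c"
    "\<And>c w w'. w \<in> S \<Longrightarrow> w \<in> cball w0 R \<Longrightarrow> w' \<in> S \<Longrightarrow> w' \<in> cball w0 R \<Longrightarrow>
       norm (frechet_derivative x (at w) (leaf_field d' \<xi> A (\<Theta> c) w) - frechet_derivative x (at w') (leaf_field d' \<xi> A (\<Theta> c) w'))
         \<le> L * norm c * norm (w - w')"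
proof -
  have SU: "w \<in> U" if "w \<in> S" for w using that Sigma2_subset by auto
  \<comment> \<open>The components of the direction \<open>\<theta>\<close> whose leaf field at a
    point \<open>w\<close> of \<open>S\<close> is \<open>fund a w\<close>.\<close>
  define C where "C w a j = frechet_derivative (\<xi> j) (at w) (\<nu> a w)" for w a j
  have linC: "linear (\<lambda>a. C w a j)" if "w \<in> U1" "j < d'" for w j
    using linear_compose[OF linear_\<nu>[OF that(1)] linear_frame[of w j]] that U1 by (auto simp: C_def o_def)
  have dual: "\<exists>\<mu>. \<forall>i<d'. \<forall>j<d'. frechet_derivative (\<xi> i) (at w) (\<mu> j) = (if i = j then 1 else 0)" if w: "w \<in> U" for w
  proof -
    obtain \<mu> n where "\<And>i j. i < d' \<Longrightarrow> j < d' \<Longrightarrow> frechet_derivative (\<xi> i) (at w) (\<mu> j) = (if i = j then 1 else 0)"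
      by (rule dual_functionals[of d' "\<lambda>j. frechet_derivative (\<xi> j) (at w)"])
         (use linear_frame[OF w] independent_frame[OF w] independent_at_def in blast)+
    then show ?thesis by blast
  qed
  have dsum: "frechet_derivative (\<xi> i) (at w) (\<Sum>j<d'. t j *\<^sub>R \<mu> j) = t i"
    if w: "w \<in> U" and \<mu>: "\<forall>i<d'. \<forall>j<d'. frechet_derivative (\<xi> i) (at w) (\<mu> j) = (if i = j then 1 else 0)" and i: "i < d'" for w \<mu> i t
  proof -
    have "frechet_derivative (\<xi> i) (at w) (\<Sum>j<d'. t j *\<^sub>R \<mu> j) = (\<Sum>j<d'. if i = j then t j else 0)"
      unfolding linear_sum[OF linear_frame[OF w i]] using \<mu> i by (intro sum.cong) (auto simp: linear_cmul[OF linear_frame[OF w i]])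
    then show ?thesis using i by simp
  qed
  have ker: "frechet_derivative \<zeta> (at w) v = 0 \<longleftrightarrow> (\<forall>j<d'. frechet_derivative (\<xi> j) (at w) v = 0)" if "w \<in> S" "w \<in> U1" for w v
    using tangent_S[OF that] tangent_frame[OF that(1)] by blast
  obtain \<mu> where \<mu>: "\<forall>i<d'. \<forall>j<d'. frechet_derivative (\<xi> i) (at w0) (\<mu> j) = (if i = j then 1 else 0)"
    using dual[OF SU[OF w0(1)]] by blast
  define e where "e j = frechet_derivative \<zeta> (at w0) (\<mu> j)" for j
  \<comment> \<open>The fixed vectors \<open>e j\<close> convert frame components back to the range
    of \<open>\<pi>\<close>, so that the family becomes the projection at \<open>w0\<close>. A
    constant \<open>\<theta>\<close> amounts to a constant value of \<open>Dm w a\<close>, and this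
    is the system to be solved for \<open>a\<close>.\<close>
  define Dm where "Dm w a = (\<Sum>j<d'. C w a j *\<^sub>R e j)" for w a
  have Dm0: "Dm w0 a = \<pi> a" for a
  proof -
    have "frechet_derivative (\<xi> j) (at w0) (\<nu> a w0 - (\<Sum>j<d'. C w0 a j *\<^sub>R \<mu> j)) = 0" if "j < d'" for j
      by (simp add: linear_diff[OF linear_frame[OF SU[OF w0(1)] that]] dsum[OF SU[OF w0(1)] \<mu> that]) (simp add: C_def)
    then have "frechet_derivative \<zeta> (at w0) (\<nu> a w0 - (\<Sum>j<d'. C w0 a j *\<^sub>R \<mu> j)) = 0" using ker[OF w0] by blast
    then show ?thesis
      by (simp add: Dm_def e_def linear_diff[OF smooth_on_deriv_linear[OF smooth_\<zeta> w0(2)]] linear_sum[OF smooth_on_deriv_linear[OF smooth_\<zeta> w0(2)]]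
         linear_cmul[OF smooth_on_deriv_linear[OF smooth_\<zeta> w0(2)]] deriv_\<zeta>_\<nu>[OF w0(2)])
  qed
  have linDm: "linear (Dm w)" if w: "w \<in> U1" for w
    unfolding Dm_def[abs_def]
    by (rule linearI) (simp_all add: linear_add[OF linC[OF w]] linear_cmul[OF linC[OF w]] scaleR_add_left sum.distrib scaleR_right.sum)
  have smDm: "smooth_on U1 (\<lambda>w. Dm w a)" for a
    unfolding Dm_def C_def
    by (intro smooth_on_sum smooth_on_scaleR smooth_on_const smooth_on_deriv_apply smooth_\<nu> open_U1)
       (auto intro: smooth_on_subset[OF smooth_frame U1])
  define Q where "Q w a = frechet_derivative x (at w) (fund a w)" for w a
  have linx: "linear (frechet_derivative x (at w))" if "w \<in> U1" for w by (rule smooth_on_deriv_linear[OF smooth_x that])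
  have linQ: "linear (Q w)" if "w \<in> U1" for w
    using linear_compose[OF linear_fund[OF that] linx[OF that]] by (simp add: o_def Q_def[abs_def])
  have smQ: "smooth_on U1 (\<lambda>w. Q w a)" for a
    unfolding Q_def by (rule smooth_on_deriv_apply[OF open_U1 smooth_x smooth_fund])
  obtain R0 where R0: "0 < R0" "cball w0 R0 \<subseteq> U1" using open_U1 w0(2) open_contains_cball by metis
  obtain L1 where L1: "0 \<le> L1" "\<And>w w' a. w \<in> cball w0 R0 \<Longrightarrow> w' \<in> cball w0 R0 \<Longrightarrow> norm (Dm w a - Dm w' a) \<le> L1 * norm a * norm (w - w')"
    by (rule linear_family_bounds[of U1 Dm w0 R0]) (use linDm smDm R0 in blast)+
  obtain L2 where L2: "0 \<le> L2" "\<And>w a. w \<in> cball w0 R0 \<Longrightarrow> norm (Q w a) \<le> L2 * norm a"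
     "\<And>w w' a. w \<in> cball w0 R0 \<Longrightarrow> w' \<in> cball w0 R0 \<Longrightarrow> norm (Q w a - Q w' a) \<le> L2 * norm a * norm (w - w')"
    by (rule linear_family_bounds[of U1 Q w0 R0]) (use linQ smQ R0 in blast)+
  \<comment> \<open>On this ball \<open>Dm w\<close> differs from \<open>Dm w0\<close> by at most
    1/2 in norm, hence is bounded below on the range of \<open>\<pi>\<close>.\<close>
  define R where "R = min R0 (1 / (2 * (L1 + 1)))"
  have R: "0 < R" "R \<le> R0" "L1 * R \<le> 1 / 2"
  proof -
    show "0 < R" "R \<le> R0" using R0 L1(1) by (auto simp: R_def)
    have "L1 * R \<le> (L1 + 1) * (1 / (2 * (L1 + 1)))" using L1(1) R0 by (intro mult_mono) (auto simp: R_def)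
    also have "\<dots> = 1 / 2" using L1(1) by (simp add: divide_simps)
    finally show "L1 * R \<le> 1 / 2" .
  qed
  have cb: "w \<in> cball w0 R0" "w \<in> U1" if "w \<in> cball w0 R" for w using that R(2) R0(2) by auto
  have w0R0: "w0 \<in> cball w0 R0" using R0 by simp
  have coercive: "norm a / 2 \<le> norm (Dm w a)" if w: "w \<in> cball w0 R" and a: "\<pi> a = a" for w a
  proof -
    have "norm (Dm w a - Dm w0 a) \<le> L1 * norm a * norm (w - w0)" by (rule L1(2)[OF cb(1)[OF w] w0R0])
    also have "\<dots> = (L1 * norm (w - w0)) * norm a" by simp
    also have "\<dots> \<le> 1 / 2 * norm a"
    proof (rule mult_right_mono)
      have "L1 * norm (w - w0) \<le> L1 * R" using w L1(1) by (intro mult_left_mono) (auto simp: dist_norm norm_minus_commute)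
      then show "L1 * norm (w - w0) \<le> 1 / 2" using R(3) by linarith
    qed simp
    finally have "norm (Dm w a - a) \<le> norm a / 2" by (simp add: Dm0 a)
    then show ?thesis using norm_triangle_ineq3[of "Dm w a" a] by linarith
  qed
  \<comment> \<open>The frame and \<open>\<zeta>\<close> have the same kernel of derivatives on
    \<open>S\<close>, namely the tangent space. So a vector with prescribed frame components may be
    replaced by the normal vector \<open>\<nu> a\<close> with the same \<open>\<zeta>\<close>
    derivative.\<close>
  have solve: "\<exists>a. \<pi> a = a \<and> (\<forall>j<d'. C w a j = t j)" if w: "w \<in> S" "w \<in> U1" for w t
  proof -
    obtain \<mu> where \<mu>: "\<forall>i<d'. \<forall>j<d'. frechet_derivative (\<xi> i) (at w) (\<mu> j) = (if i = j then 1 else 0)"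
      using dual[OF SU[OF w(1)]] by blast
    define v where "v = (\<Sum>j<d'. t j *\<^sub>R \<mu> j)"
    define a where "a = frechet_derivative \<zeta> (at w) v"
    have a: "\<pi> a = a" unfolding a_def by (rule deriv_\<zeta>_proj[OF w(2)])
    have "frechet_derivative \<zeta> (at w) (\<nu> a w - v) = 0"
      by (simp add: linear_diff[OF smooth_on_deriv_linear[OF smooth_\<zeta> w(2)]] deriv_\<zeta>_\<nu>[OF w(2)] a) (simp add: a_def)
    then have z: "\<forall>j<d'. frechet_derivative (\<xi> j) (at w) (\<nu> a w - v) = 0" using ker[OF w, of "\<nu> a w - v"] by simp
    have "C w a j = t j" if "j < d'" for j
      using z[rule_format, OF that] dsum[OF SU[OF w(1)] \<mu> that, of t]
      by (simp add: C_def v_def linear_diff[OF linear_frame[OF SU[OF w(1)] that]])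
    with a show ?thesis by blast
  qed
  \<comment> \<open>Here the nondegenerate Hessian is used: \<open>fund a w0 = 0\<close> puts
    \<open>\<nu> a\<close> into the radical of the Hessian, hence into the tangent space, where the
    derivative of \<open>\<zeta>\<close> vanishes.\<close>
  have injQ: "a = 0" if a: "Q w0 a = 0" "\<pi> a = a" for a
  proof -
    have "fund a w0 = leaf_field d' \<xi> A (C w0 a) w0" by (rule leaf_field_eq_fund[symmetric, OF w0]) (simp add: C_def)
    then have "fund a w0 \<in> tangent_ann S w0" using leaf_field_ann[OF w0(1)] by simp
    then have "fund a w0 = H (Q w0 a) w0" unfolding Q_def by (rule ann_eq_H[OF w0])
    then have "fund a w0 = 0" using a(1) linear_0[OF linear_H[OF w0(2)]] by simp
    then have h0: "hess (\<lambda>z. Re (p z)) w0 v (\<nu> a w0) = 0" for v using symp_fund[OF w0(2), of v a] by (simp add: symp_simps)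
    have "\<forall>v. hess (\<lambda>z. Re (p z)) w0 (\<nu> a w0) v = 0"
      by (subst hess_commute[OF open_domain smooth_Re_p SU[OF w0(1)]]) (simp add: h0)
    then have "\<nu> a w0 \<in> tangent S w0" using rdc w0(1) by (auto simp: real_double_char_def)
    then have "frechet_derivative \<zeta> (at w0) (\<nu> a w0) = 0" by (simp add: tangent_S[OF w0])
    then show ?thesis using a(2) by (simp add: deriv_\<zeta>_\<nu>[OF w0(2)])
  qed
  have \<pi>Q: "\<pi> (Q w0 a) = Q w0 a" for a unfolding Q_def by (rule deriv_x_proj[OF w0(2)])
  note \<pi>lin = linear_proj[of d n m]
  \<comment> \<open>\<open>Q w0\<close> on the range of \<open>\<pi>\<close>, completed by the
    identity on the kernel, so that an endomorphism of the whole space can be inverted. Its inverse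
    normalizes \<open>\<Theta>\<close> at \<open>w0\<close>.\<close>
  define T0 where "T0 a = Q w0 (\<pi> a) + (a - \<pi> a)" for a
  have linT0: "linear T0"
    unfolding T0_def[abs_def]
    by (rule linearI) (simp_all add: linear_add[OF \<pi>lin] linear_cmul[OF \<pi>lin] linear_add[OF linQ[OF w0(2)]] linear_cmul[OF linQ[OF w0(2)]] algebra_simps)
  have \<pi>T0: "\<pi> (T0 a) = Q w0 (\<pi> a)" for a
    by (simp add: T0_def linear_add[OF \<pi>lin] linear_diff[OF \<pi>lin] \<pi>Q proj_proj[OF chart.dual])
  have "a = 0" if "T0 a = 0" for a
  proof -
    have "Q w0 (\<pi> a) = 0" using \<pi>T0[of a] that linear_0[OF \<pi>lin] by simp
    then have "\<pi> a = 0" by (rule injQ) (rule proj_proj[OF chart.dual])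
    then show ?thesis using that linear_0[OF linQ[OF w0(2)]] by (simp add: T0_def)
  qed
  then have injT0: "inj T0" using linear_injective_0[OF linT0] by blast
  obtain K0 where K0: "linear K0" "\<And>c. T0 (K0 c) = c" using linear_injective_isomorphism[OF linT0 injT0] by blast
  have QK: "Q w0 (\<pi> (K0 c)) = \<pi> c" for c using \<pi>T0[of "K0 c"] K0(2) by simp
  obtain K where K: "0 < K" "\<And>c. norm (\<pi> (K0 c)) \<le> norm c * K"
    using bounded_linear.pos_bounded[of "\<lambda>c. \<pi> (K0 c)"] linear_compose[OF K0(1) \<pi>lin] by (auto simp: o_def linear_conv_bounded_linear)
  define \<Theta> where "\<Theta> c j = (if j < d' then C w0 (K0 c) j else 0)" for c j
  have sol: "\<exists>a. \<pi> a = a \<and> frechet_derivative x (at w) (leaf_field d' \<xi> A (\<Theta> c) w) = Q w a \<and> Dm w a = \<pi> (K0 c)" if w: "w \<in> S" "w \<in> U1" for w c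
  proof -
    obtain a where a: "\<pi> a = a" "\<forall>j<d'. C w a j = \<Theta> c j" using solve[OF w] by blast
    have "leaf_field d' \<xi> A (\<Theta> c) w = fund a w" by (rule leaf_field_eq_fund[OF w]) (use a(2) in \<open>simp add: C_def\<close>)
    moreover have "Dm w a = Dm w0 (K0 c)" unfolding Dm_def using a(2) by (intro sum.cong) (auto simp: \<Theta>_def)
    ultimately show ?thesis using a(1) by (auto simp: Q_def Dm0)
  qed
  \<comment> \<open>The term with \<open>L1\<close> comes from the variation of \<open>a\<close>,
    the other one from that of \<open>Q\<close>; \<open>2 * K\<close> bounds \<open>a\<close> in
    terms of \<open>c\<close>. The summand 1 guarantees \<open>1 \<le> L\<close>.\<close>
  define L where "L = 1 + (L2 * (2 * L1) + L2) * (2 * K)"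
  show ?thesis
  proof (rule that[of R L \<Theta>])
    show "cball w0 R \<subseteq> U1" using cb(2) by blast
    show "1 \<le> L" using L1(1) L2(1) K(1) by (simp add: L_def)
    show "linear (\<lambda>c. \<Theta> c j)" for j
      using linear_compose[OF K0(1) linC[OF w0(2), of j]] by (cases "j < d'") (auto simp: \<Theta>_def o_def linear_zero)
    show "frechet_derivative x (at w0) (leaf_field d' \<xi> A (\<Theta> c) w0) = \<pi> c" for c
    proof -
      obtain a where "\<pi> a = a" "frechet_derivative x (at w0) (leaf_field d' \<xi> A (\<Theta> c) w0) = Q w0 a" "Dm w0 a = \<pi> (K0 c)" using sol[OF w0] by blast
      then show ?thesis using Dm0[of a] QK[of c] by simp
    qed
    fix c w w' assume w: "w \<in> S" "w \<in> cball w0 R" and w': "w' \<in> S" "w' \<in> cball w0 R"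
    obtain a where a: "\<pi> a = a" "frechet_derivative x (at w) (leaf_field d' \<xi> A (\<Theta> c) w) = Q w a" "Dm w a = \<pi> (K0 c)"
      using sol[OF w(1) cb(2)[OF w(2)]] by blast
    obtain a' where a': "\<pi> a' = a'" "frechet_derivative x (at w') (leaf_field d' \<xi> A (\<Theta> c) w') = Q w' a'" "Dm w' a' = \<pi> (K0 c)"
      using sol[OF w'(1) cb(2)[OF w'(2)]] by blast
    have na': "norm a' \<le> 2 * K * norm c" using coercive[OF w'(2) a'(1)] K(2)[of c] by (simp add: a'(3) mult_ac)
    have "norm (a - a') / 2 \<le> norm (Dm w (a - a'))" by (rule coercive[OF w(2)]) (simp add: linear_diff[OF \<pi>lin] a(1) a'(1))
    also have "Dm w (a - a') = Dm w' a' - Dm w a'" by (simp add: linear_diff[OF linDm[OF cb(2)[OF w(2)]]] a(3) a'(3))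
    also have "norm (Dm w' a' - Dm w a') \<le> L1 * norm a' * norm (w' - w)" by (rule L1(2)[OF cb(1)[OF w'(2)] cb(1)[OF w(2)]])
    finally have da: "norm (a - a') \<le> 2 * L1 * norm a' * norm (w - w')" by (simp add: norm_minus_commute)
    have "Q w a - Q w' a' = Q w (a - a') + (Q w a' - Q w' a')" by (simp add: linear_diff[OF linQ[OF cb(2)[OF w(2)]]])
    then have "norm (Q w a - Q w' a') \<le> norm (Q w (a - a')) + norm (Q w a' - Q w' a')" by (metis norm_triangle_ineq)
    also have "norm (Q w (a - a')) \<le> L2 * norm (a - a')" by (rule L2(2)[OF cb(1)[OF w(2)]])
    also have "\<dots> \<le> L2 * (2 * L1 * norm a' * norm (w - w'))" by (rule mult_left_mono[OF da L2(1)])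
    also have "norm (Q w a' - Q w' a') \<le> L2 * norm a' * norm (w - w')" by (rule L2(3)[OF cb(1)[OF w(2)] cb(1)[OF w'(2)]])
    also have "L2 * (2 * L1 * norm a' * norm (w - w')) + L2 * norm a' * norm (w - w') = (L2 * (2 * L1) + L2) * (norm a' * norm (w - w'))"
      by (simp add: algebra_simps)
    also have "\<dots> \<le> (L2 * (2 * L1) + L2) * ((2 * K * norm c) * norm (w - w'))"
      using na' L1(1) L2(1) by (intro mult_left_mono mult_right_mono) auto
    also have "\<dots> \<le> L * norm c * norm (w - w')" by (simp add: L_def algebra_simps)
    finally show "norm (frechet_derivative x (at w) (leaf_field d' \<xi> A (\<Theta> c) w) - frechet_derivative x (at w') (leaf_field d' \<xi> A (\<Theta> c) w'))
         \<le> L * norm c * norm (w - w')" by (simp add: a(2) a'(2))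
  qed (rule R)
qed

end

end

section \<open>From the limit bicharacteristics to the leaf conditions\<close>

lemma tangent_scl:
  assumes "\<And>z. z \<in> S \<Longrightarrow> scl t z \<in> S" "v \<in> tangent S w"
  shows "scl t v \<in> tangent S (scl t w)"
proof -
  obtain \<gamma> where g: "\<gamma> (0::real) = w" "\<forall>\<^sub>F s in nhds 0. \<gamma> s \<in> S" "(\<gamma> has_vector_derivative v) (at 0)"
    using assms(2) by (auto simp: tangent_def)
  have "\<forall>\<^sub>F s in nhds 0. scl t (\<gamma> s) \<in> S" using g(2) by eventually_elim (rule assms(1))
  moreover have "((\<lambda>s. scl t (\<gamma> s)) has_vector_derivative scl t v) (at 0)"
    by (rule bounded_linear.has_vector_derivative[OF bounded_linear_scl g(3)])
  ultimately show ?thesis using g(1) unfolding tangent_def by (intro CollectI exI[of _ "\<lambda>s. scl t (\<gamma> s)"]) auto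
qed

context double_char
begin

lemma scl_S: "z \<in> S \<Longrightarrow> 0 < t \<Longrightarrow> scl t z \<in> S"
  by (rule Sigma2_scl[OF domain smooth_p hom_p])

lemma tangent_scl_S:
  assumes t: "0 < t" shows "v \<in> tangent S (scl t w) \<longleftrightarrow> scl (1 / t) v \<in> tangent S w"
proof
  assume "v \<in> tangent S (scl t w)"
  from tangent_scl[OF _ this, of "1 / t"] show "scl (1 / t) v \<in> tangent S w" using scl_S t by simp
next
  assume "scl (1 / t) v \<in> tangent S w"
  from tangent_scl[OF _ this, of t] show "v \<in> tangent S (scl t w)" using scl_S t by simp
qed

lemma tangent_ann_scl_S:
  assumes t: "0 < t" and v: "v \<in> tangent_ann S w" shows "scl t v \<in> tangent_ann S (scl t w)"
  unfolding tangent_ann_def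
proof (intro CollectI ballI)
  fix v' assume "v' \<in> tangent S (scl t w)"
  then have "symp v (scl (1 / t) v') = 0" using v tangent_scl_S[OF t] by (auto simp: tangent_ann_def)
  then have "t * symp v (scl (1 / t) v') = 0" by simp
  then show "symp (scl t v) v' = 0" using t by (simp flip: symp_scl)
qed

lemma f_scl: "z \<in> U \<Longrightarrow> 0 < t \<Longrightarrow> f (scl t z) = t powr (r - 1) * f z"
  using homogeneousD[OF hom_q, of z t] by simp

lemma g_scl: "homogeneous (r - 1) U g"
  using hom_q by (simp add: homogeneous_def)

end

lemma orbit_rescale:
  assumes d: "\<And>s. s \<in> {0..1} \<Longrightarrow> \<delta> s \<in> S \<and> (\<delta> has_vector_derivative k *\<^sub>R V (\<delta> s)) (at s within {0..1})" and k: "0 < k"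
  shows "orbit S V (\<lambda>t. \<delta> (t / k)) 0 k"
  unfolding orbit_def
proof
  fix t assume t: "t \<in> {0..k}"
  have im: "(\<lambda>s. 0 + 1 / k * s) ` {0..k} \<subseteq> {0..1}" using k by (auto simp: field_simps)
  have m: "0 + 1 / k * t \<in> {0..1}" using t im by blast
  have "((\<lambda>s. \<delta> (0 + 1 / k * s)) has_vector_derivative (1 / k) *\<^sub>R (k *\<^sub>R V (\<delta> (0 + 1 / k * t)))) (at t within {0..k})"
    by (rule has_vector_derivative_affine[OF _ im]) (use d[OF m] in blast)
  then show "\<delta> (t / k) \<in> S \<and> ((\<lambda>t. \<delta> (t / k)) has_vector_derivative V (\<delta> (t / k))) (at t within {0..k})"
    using d[OF m] k by simp
qed

text \<open>After subtraction of \<open>s *\<^sub>R K\<close> the function is constant along the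
  flow. Applied to \<open>\<zeta>\<close> with \<open>K = 0\<close> this shows that the action
  preserves \<open>Sigma2\<close>.\<close>

lemma (in commuting_fields) \<Gamma>_integral:
  fixes k :: "'e \<Rightarrow> 'k::euclidean_space"
  assumes z: "z \<in> cball w0 (R / 2)" and c: "norm c < \<epsilon>"
    and k: "\<And>w. w \<in> cball w0 R \<Longrightarrow> (k has_derivative k' w) (at w)" "\<And>w. w \<in> cball w0 R \<Longrightarrow> k' w (F c w) = K"
  shows "k (\<Gamma> z c) = k z + K"
proof -
  have ct: "norm (s *\<^sub>R c) < \<epsilon>" if "s \<in> {0..1}" for s :: real
    using that c by (auto intro: order.strict_trans1[OF mult_left_le_one_le])
  have "((\<lambda>s. k (\<Gamma> z (s *\<^sub>R c)) - s *\<^sub>R K) has_derivative (\<lambda>_. 0)) (at s within {0..1})" if s: "s \<in> {0..1}" for s :: real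
  proof -
    have m: "\<Gamma> z (s *\<^sub>R c) \<in> cball w0 R" using \<Gamma>_mem(2)[OF z order_refl less_imp_le[OF ct[OF s]]] R by auto
    have "((\<lambda>s. s *\<^sub>R c) has_derivative (\<lambda>s. s *\<^sub>R c)) (at s within {0..1})" by (auto intro!: derivative_eq_intros)
    from has_derivative_compose[OF this \<Gamma>_has_derivative[OF z ct[OF s]]]
    have "((\<lambda>s. \<Gamma> z (s *\<^sub>R c)) has_derivative (\<lambda>t. F (t *\<^sub>R c) (\<Gamma> z (s *\<^sub>R c)))) (at s within {0..1})" .
    from has_derivative_compose[OF this k(1)[OF m]]
    have "((\<lambda>s. k (\<Gamma> z (s *\<^sub>R c))) has_derivative (\<lambda>t. t *\<^sub>R K)) (at s within {0..1})"
      by (simp add: linear_cmul[OF lin[OF m]] linear_cmul[OF has_derivative_linear[OF k(1)[OF m]]] k(2)[OF m])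
    then have "((\<lambda>s. k (\<Gamma> z (s *\<^sub>R c)) - s *\<^sub>R K) has_derivative (\<lambda>t. t *\<^sub>R K - t *\<^sub>R K)) (at s within {0..1})"
      by (rule has_derivative_diff) (auto intro!: derivative_eq_intros)
    then show ?thesis by simp
  qed
  then obtain b where "\<forall>s\<in>{0..1::real}. k (\<Gamma> z (s *\<^sub>R c)) - s *\<^sub>R K = b"
    using has_derivative_zero_constant[of "{0..1::real}" "\<lambda>s. k (\<Gamma> z (s *\<^sub>R c)) - s *\<^sub>R K"] by auto
  from this[rule_format, of 0] this[rule_format, of 1] show ?thesis by (simp add: \<Gamma>_0[OF z] diff_eq_eq add.commute)
qed

section \<open>The local action of time and leaf displacement\<close>

locale flow_chart = char_chart U p q r U1 d n m \<zeta> x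
  for U :: "'n::finite phase set" and p q r U1 d n m \<zeta> x +
  fixes D :: "'n phase set" and gt :: "'n phase \<Rightarrow> real" and w0 :: "'n phase"
  assumes w0: "w0 \<in> S" "w0 \<in> D" and D: "open D" "D \<subseteq> U1" and smooth_gt: "smooth_on D gt"
    and gt: "\<And>z. z \<in> S \<inter> D \<Longrightarrow> gt z = g z"
    and gt_bracket: "\<And>z a. z \<in> D \<Longrightarrow> poisson gt (\<lambda>z. a \<bullet> \<zeta> z) z = 0"
    and gt_x: "\<And>z. z \<in> D \<Longrightarrow> frechet_derivative x (at z) (ham gt z) = 0"
begin

definition F :: "real \<times> (real ^ 'n) \<Rightarrow> 'n phase \<Rightarrow> 'n phase" where
  "F c w = fst c *\<^sub>R ham gt w + H (snd c) w"

lemma D_U1: "w \<in> D \<Longrightarrow> w \<in> U1" using D by blast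

lemma linear_F: "w \<in> D \<Longrightarrow> linear (\<lambda>c. F c w)"
  unfolding F_def by (rule linearI) (simp_all add: linear_add[OF linear_H[OF D_U1]] linear_cmul[OF linear_H[OF D_U1]] algebra_simps)

lemma diff_gt: "w \<in> D \<Longrightarrow> gt differentiable (at w)"
  by (rule differentiableI[OF smooth_on_has_derivative[OF smooth_gt]])

lemma symp_gt_H: "w \<in> D \<Longrightarrow> symp (ham gt w) (H a w) = 0"
  using gt_bracket[of w a] poisson_symp[OF diff_\<zeta>[OF D_U1], of w gt a] by (simp add: H_def)

lemma symp_F: "w \<in> D \<Longrightarrow> symp (F c w) (F e w) = 0"
  using symp_gt_H[of w] symp_HH[of w] D_U1[of w] symp_commute[of "H (snd c) w" "ham gt w"]
  by (simp add: F_def symp_simps)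

lemma smooth_F: "smooth_on D (F c)"
  unfolding F_def[abs_def] H_def
  by (intro smooth_on_add smooth_on_scaleR smooth_on_const smooth_on_ham smooth_gt smooth_on_subset[OF smooth_inner_\<zeta> D(2)] D(1))

text \<open>Each \<open>F c\<close> is the Hamilton field of a linear combination of
  \<open>gt\<close> and the components of \<open>\<zeta>\<close>. These functions Poisson commute on
  the open set \<open>D\<close>, so their fields commute.\<close>

lemma commute_F:
  assumes w: "w \<in> D"
  shows "frechet_derivative (F c) (at w) (F e w) = frechet_derivative (F e) (at w) (F c w)"
proof -
  define k where "k c z = fst c * gt z + snd c \<bullet> \<zeta> z" for c z
  have sk: "smooth_on D (k c)" for c
    unfolding k_def[abs_def]
    by (intro smooth_on_add smooth_on_mult smooth_on_const smooth_gt smooth_on_subset[OF smooth_inner_\<zeta> D(2)] D(1))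
  have hk: "ham (k c) z = F c z" if "z \<in> D" for c z
  proof -
    have "((\<lambda>z. fst c * gt z) has_derivative (\<lambda>v. fst c * frechet_derivative gt (at z) v)) (at z)"
      by (rule has_derivative_mult_right[OF smooth_on_has_derivative[OF smooth_gt that]])
    then have e: "(\<lambda>z. fst c * gt z) differentiable (at z)"
      "frechet_derivative (\<lambda>z. fst c * gt z) (at z) = (\<lambda>v. fst c * frechet_derivative gt (at z) v)"
      by (rule differentiableI, rule frechet_derivative_eqI)
    have "ham (\<lambda>z. fst c * gt z) z = fst c *\<^sub>R ham gt z"
      by (rule ham_unique[OF e(1)]) (simp add: e(2) deriv_ham[OF diff_gt[OF that]] symp_simps)
    then show ?thesis unfolding k_def[abs_def] F_def H_def
      by (subst ham_add[OF e(1) diff_\<zeta>[OF D_U1[OF that]]]) simp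
  qed
  have "poisson (k c) (k e) z = 0" if "z \<in> D" for z
    unfolding poisson_symp[OF differentiableI[OF smooth_on_has_derivative[OF sk that]]] hk[OF that] by (rule symp_F[OF that])
  then have "frechet_derivative (ham (k c)) (at w) (ham (k e) w) = frechet_derivative (ham (k e)) (at w) (ham (k c) w)"
    by (intro ham_commute[OF D(1) sk sk _ w])
  moreover have "frechet_derivative (ham (k c)) (at w) = frechet_derivative (F c) (at w)" for c
    by (rule frechet_derivative_cong_open(1)[OF D(1) w hk])
  ultimately show ?thesis unfolding hk[OF w] by simp
qed

text \<open>\<open>Re q\<close> and \<open>gt\<close> agree on \<open>Sigma2\<close>, so their
  fields differ by a vector of the annihilator. Its coefficient is read off by the derivative of
  \<open>x\<close>, which kills the field of \<open>gt\<close>.\<close>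

lemma ham_g_eq:
  assumes w: "w \<in> S" "w \<in> D"
  shows "ham g w = ham gt w + H (frechet_derivative x (at w) (ham g w)) w"
proof -
  have wU: "w \<in> U1" "w \<in> U" using w D_U1 U1 by blast+
  have dg: "(g has_derivative frechet_derivative g (at w)) (at w)" by (rule smooth_on_has_derivative[OF smooth_g wU(2)])
  have dgt: "(gt has_derivative frechet_derivative gt (at w)) (at w)" by (rule smooth_on_has_derivative[OF smooth_gt w(2)])
  have "ham g w - ham gt w \<in> tangent_ann S w"
    unfolding tangent_ann_def
  proof (intro CollectI ballI)
    fix v assume v: "v \<in> tangent S w"
    have "frechet_derivative g (at w) v - frechet_derivative gt (at w) v = 0"
      by (rule tangent_deriv_zero[OF v has_derivative_diff[OF dg dgt] D(1) w(2), of 0]) (use gt in simp)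
    then have "symp v (ham g w - ham gt w) = 0"
      by (simp add: symp_simps deriv_ham[OF diff_g[OF wU(2)]] deriv_ham[OF diff_gt[OF w(2)]])
    then show "symp (ham g w - ham gt w) v = 0" by (subst symp_commute) simp
  qed
  from ann_eq_H[OF w(1) wU(1) this] show ?thesis
    by (simp add: linear_diff[OF smooth_on_deriv_linear[OF smooth_x wU(1)]] gt_x[OF w(2)] algebra_simps)
qed

end

locale flow_box = flow_chart U p q r U1 d n m \<zeta> x D gt w0
  for U :: "'n::finite phase set" and p q r U1 d n m \<zeta> x D gt w0 +
  fixes R M :: real
  assumes cf: "commuting_fields F (\<lambda>c w. frechet_derivative (F c) (at w)) w0 R M" and cball_D: "cball w0 R \<subseteq> D"
begin

sublocale flow?: commuting_fields F "\<lambda>c w. frechet_derivative (F c) (at w)" w0 R M by (rule cf)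

lemma \<Gamma>_S:
  assumes z: "z \<in> S" "z \<in> cball w0 (R / 2)" and c: "norm c < \<epsilon>" shows "\<Gamma> z c \<in> S" "\<Gamma> z c \<in> D"
proof -
  have "\<zeta> (\<Gamma> z c) = \<zeta> z + 0"
  proof (rule \<Gamma>_integral[OF z(2) c])
    fix w assume w: "w \<in> cball w0 R"
    then have wD: "w \<in> D" "w \<in> U1" using cball_D D by auto
    show "(\<zeta> has_derivative frechet_derivative \<zeta> (at w)) (at w)" by (rule smooth_on_has_derivative[OF smooth_\<zeta> wD(2)])
    have "a \<bullet> frechet_derivative \<zeta> (at w) (ham gt w) = 0" for a
      using symp_H[OF wD(2), of "ham gt w" a] symp_gt_H[OF wD(1), of a] by simp
    then have "frechet_derivative \<zeta> (at w) (ham gt w) = 0" by (metis inner_eq_zero_iff)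
    then show "frechet_derivative \<zeta> (at w) (F c w) = 0"
      using smooth_on_deriv_linear[OF smooth_\<zeta> wD(2)] by (simp add: F_def linear_add linear_cmul deriv_\<zeta>_H[OF wD(2)])
  qed
  moreover have "\<zeta> z = 0"
  proof -
    have "cball w0 (R / 2) \<subseteq> cball w0 R" using R by (intro subset_cball) simp
    then have "z \<in> U1" using z(2) cball_D D by blast
    then show ?thesis using z(1) zero by blast
  qed
  moreover have m: "\<Gamma> z c \<in> cball w0 R" using \<Gamma>_mem(2)[OF z(2) order_refl less_imp_le[OF c]] R by auto
  moreover have "\<Gamma> z c \<in> U1" using m cball_D D by auto
  ultimately show "\<Gamma> z c \<in> S" "\<Gamma> z c \<in> D" using zero cball_D by auto
qed

text \<open>The boundary value problem joins \<open>z\<close> to its image by a curve with velocity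
  \<open>T\<close> times the field of \<open>Re q\<close> plus a leaf field with constant direction.
  Up to a positive factor this is one of the limit fields, whose orbits admit no change from - to
  +.\<close>

lemma no_sign_change_\<Gamma>:
  assumes lim: "sympl_frame U S d' \<xi>" "quadratic_coeffs S (\<lambda>z. Re (p z)) d' \<xi> A"
    "\<And>V \<gamma> a b s s'. V \<in> limit_fields d' \<xi> A g \<Longrightarrow> orbit S V \<gamma> a b \<Longrightarrow> a \<le> s \<Longrightarrow> s < s' \<Longrightarrow> s' \<le> b \<Longrightarrow> f (\<gamma> s) < 0 \<Longrightarrow> 0 < f (\<gamma> s') \<Longrightarrow> False"
    and \<Theta>: "1 \<le> L" "\<And>j. linear (\<lambda>c. \<Theta> c j)"
    "\<And>c. frechet_derivative x (at w0) (leaf_field d' \<xi> A (\<Theta> c) w0) = \<pi> c"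
    "\<And>c w w'. w \<in> S \<Longrightarrow> w \<in> cball w0 R \<Longrightarrow> w' \<in> S \<Longrightarrow> w' \<in> cball w0 R \<Longrightarrow>
       norm (frechet_derivative x (at w) (leaf_field d' \<xi> A (\<Theta> c) w) - frechet_derivative x (at w') (leaf_field d' \<xi> A (\<Theta> c) w'))
         \<le> L * norm c * norm (w - w')"
  obtains \<rho> where "0 < \<rho>" "\<And>z T y. z \<in> S \<Longrightarrow> z \<in> cball w0 \<rho> \<Longrightarrow> 0 \<le> T \<Longrightarrow> T \<le> \<rho> \<Longrightarrow> norm y \<le> \<rho> \<Longrightarrow>
     f z < 0 \<Longrightarrow> 0 < f (\<Gamma> z (T, y)) \<Longrightarrow> False"
proof -
  define b where "b w = frechet_derivative x (at w) (ham g w)" for w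
  define V where "V c w = leaf_field d' \<xi> A (\<Theta> c) w" for c w
  define \<beta> where "\<beta> c w = frechet_derivative x (at w) (V c w)" for c w
  have RU1: "cball w0 R \<subseteq> U1" using cball_D D by blast
  have sb: "smooth_on U1 b" unfolding b_def[abs_def]
    by (intro smooth_on_deriv_apply open_U1 smooth_x smooth_on_subset[OF smooth_on_ham[OF open_domain smooth_g] U1])
  obtain B1 where B1: "0 \<le> B1" "\<And>w. w \<in> cball w0 R \<Longrightarrow> norm (b w) \<le> B1"
    by (rule continuous_bounded_cball[OF continuous_on_subset[OF smooth_on_imp_continuous_on[OF sb] RU1]]) blast
  obtain B2 where B2: "0 \<le> B2" "\<And>w w'. w \<in> cball w0 R \<Longrightarrow> w' \<in> cball w0 R \<Longrightarrow> norm (b w - b w') \<le> B2 * norm (w - w')"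
    by (rule smooth_on_lipschitz[OF sb RU1]) blast
  define L' where "L' = max L (max B1 B2)"
  have L': "1 \<le> L'" "L \<le> L'" "B1 \<le> L'" "B2 \<le> L'" using \<Theta>(1) by (auto simp: L'_def)
  have lin\<beta>: "linear (\<lambda>c. \<beta> c w)" if "w \<in> cball w0 R" for w
  proof -
    have "w \<in> U1" using that RU1 by blast
    from linear_compose[OF linear_leaf_field[OF \<Theta>(2)] smooth_on_deriv_linear[OF smooth_x this]]
    have "linear (frechet_derivative x (at w) \<circ> (\<lambda>c. leaf_field d' \<xi> A (\<Theta> c) w))" .
    then show ?thesis by (simp add: \<beta>_def V_def o_def)
  qed
  obtain \<rho> where \<rho>: "0 < \<rho>" "\<And>z T y. z \<in> S \<Longrightarrow> z \<in> cball w0 \<rho> \<Longrightarrow> 0 \<le> T \<Longrightarrow> T \<le> \<rho> \<Longrightarrow> norm y \<le> \<rho> \<Longrightarrow>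
     \<exists>c \<delta>. \<delta> 0 = z \<and> \<delta> 1 = \<Gamma> z (T, y) \<and> (\<forall>s\<in>{0..1}. \<delta> s \<in> S \<and> \<delta> s \<in> cball w0 R \<and>
       (\<delta> has_vector_derivative F (T, T *\<^sub>R b (\<delta> s) + \<beta> c (\<delta> s) + (c - \<beta> c w0)) (\<delta> s)) (at s within {0..1}))"
  proof (rule commuting_fields_bvp[OF cf L'(1) w0(1), of b \<beta>])
    show "\<Gamma> z c \<in> S" if "z \<in> S" "z \<in> cball w0 (R / 2)" "norm c < \<epsilon>" for z c by (rule \<Gamma>_S(1)[OF that])
    show "norm (b w) \<le> L'" if "w \<in> S" "w \<in> cball w0 R" for w using B1(2)[OF that(2)] L' by linarith
    show "norm (b w - b w') \<le> L' * norm (w - w')" if "w \<in> cball w0 R" "w' \<in> cball w0 R" for w w'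
      using B2(2)[OF that] mult_right_mono[OF L'(4), of "norm (w - w')"] by simp
    show "linear (\<lambda>c. \<beta> c w)" if "w \<in> cball w0 R" for w by (rule lin\<beta>[OF that])
    show "norm (\<beta> c w - \<beta> c w') \<le> L' * norm c * norm (w - w')"
      if "w \<in> S" "w \<in> cball w0 R" "w' \<in> S" "w' \<in> cball w0 R" for w w' c
      using \<Theta>(4)[OF that, of c] mult_right_mono[OF L'(2), of "norm c * norm (w - w')"] by (simp add: \<beta>_def V_def mult.assoc)
  qed blast
  show ?thesis
  proof (rule that[OF \<rho>(1)])
    fix z T y assume z: "z \<in> S" "z \<in> cball w0 \<rho>" and T: "0 \<le> T" "T \<le> \<rho>" and y: "norm y \<le> \<rho>"
      and neg: "f z < 0" and pos: "0 < f (\<Gamma> z (T, y))"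
    obtain c \<delta> where d: "\<delta> 0 = z" "\<delta> 1 = \<Gamma> z (T, y)" "\<And>s. s \<in> {0..1} \<Longrightarrow> \<delta> s \<in> S \<and> \<delta> s \<in> cball w0 R \<and>
       (\<delta> has_vector_derivative F (T, T *\<^sub>R b (\<delta> s) + \<beta> c (\<delta> s) + (c - \<beta> c w0)) (\<delta> s)) (at s within {0..1})"
      using \<rho>(2)[OF z T y] by blast
    \<comment> \<open>The \<open>x\<close> components determine the leaf parts. As
      \<open>\<beta> c w0\<close> is \<open>\<pi> c\<close>, the correction
      \<open>c - \<beta> c w0\<close> contributes nothing, because \<open>H\<close> depends only on
      the projection of its parameter.\<close>
    have FV: "F (T, T *\<^sub>R b w + \<beta> c w + (c - \<beta> c w0)) w = T *\<^sub>R ham g w + V c w" if w: "w \<in> S" "w \<in> cball w0 R" for w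
    proof -
      have wU: "w \<in> D" "w \<in> U1" using w cball_D RU1 by auto
      have "H (c - \<pi> c) w = 0" by (simp add: linear_diff[OF linear_H[OF wU(2)]] H_proj[OF wU(2)])
      moreover have "\<beta> c w0 = \<pi> c" using \<Theta>(3) by (simp add: \<beta>_def V_def)
      moreover have "H (\<beta> c w) w = V c w" unfolding \<beta>_def V_def
        by (rule ann_eq_H[OF w(1) wU(2) leaf_field_ann[OF lim(1,2) w(1)], symmetric])
      moreover have "ham gt w + H (b w) w = ham g w" using ham_g_eq[OF w(1) wU(1)] by (simp add: b_def)
      moreover have "F (T, T *\<^sub>R b w + \<beta> c w + (c - \<beta> c w0)) w = T *\<^sub>R (ham gt w + H (b w) w) + H (\<beta> c w) w + H (c - \<beta> c w0) w"
        using linear_add[OF linear_H[OF wU(2)]] linear_cmul[OF linear_H[OF wU(2)]] by (simp add: F_def scaleR_add_right)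
      ultimately show ?thesis by simp
    qed
    have d': "\<delta> s \<in> S" "(\<delta> has_vector_derivative T *\<^sub>R ham g (\<delta> s) + V c (\<delta> s)) (at s within {0..1})" if "s \<in> {0..1}" for s
      using d(3)[OF that] FV[of "\<delta> s"] by auto
    \<comment> \<open>Limit fields take unit directions; \<open>N\<close> is the length that has to
      be divided out.\<close>
    define N where "N = sqrt (\<Sum>j<d'. (\<Theta> c j)\<^sup>2)"
    have N0: "0 \<le> (\<Sum>j<d'. (\<Theta> c j)\<^sup>2)" by (intro sum_nonneg) auto
    define \<theta> where "\<theta> j = \<Theta> c j / N" for j
    have VN: "V c w = N *\<^sub>R leaf_field d' \<xi> A \<theta> w" if "N \<noteq> 0" for w
      using that by (simp add: V_def leaf_field_def \<theta>_def scaleR_right.sum)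
    have \<theta>1: "(\<Sum>j<d'. (\<theta> j)\<^sup>2) = 1" if "N \<noteq> 0"
    proof -
      have "(\<Sum>j<d'. (\<theta> j)\<^sup>2) = (\<Sum>j<d'. (\<Theta> c j)\<^sup>2) / N\<^sup>2" by (simp add: \<theta>_def power_divide sum_divide_distrib)
      also have "N\<^sup>2 = (\<Sum>j<d'. (\<Theta> c j)\<^sup>2)" using N0 by (simp add: N_def)
      finally show ?thesis using that N0 by (auto simp: N_def)
    qed
    have V0: "V c w = 0" if "N = 0" for w
    proof -
      have "(\<Sum>j<d'. (\<Theta> c j)\<^sup>2) = 0" using that by (simp add: N_def)
      then have "\<forall>j\<in>{..<d'}. \<Theta> c j = 0" by (subst (asm) sum_nonneg_eq_0_iff) auto
      then show ?thesis by (simp add: V_def leaf_field_def)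
    qed
    have fin: False if "V' \<in> limit_fields d' \<xi> A g" "0 < k" "\<And>s. s \<in> {0..1} \<Longrightarrow> T *\<^sub>R ham g (\<delta> s) + V c (\<delta> s) = k *\<^sub>R V' (\<delta> s)" for V' k
    proof -
      have "orbit S V' (\<lambda>t. \<delta> (t / k)) 0 k"
        by (rule orbit_rescale[OF _ that(2)]) (use d' that(3) in auto)
      from lim(3)[OF that(1) this, of 0 k] show False using that(2) neg pos d(1,2) by simp
    qed
    \<comment> \<open>Apart from the first case these are the three kinds of limit fields. In the
      first case the curve is constant, so its end points cannot have opposite signs.\<close>
    consider "T = 0" "N = 0" | "T = 0" "N \<noteq> 0" | "T \<noteq> 0" "N = 0" | "T \<noteq> 0" "N \<noteq> 0" by blast
    then show False
    proof cases
      case 1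
      have "(\<delta> has_derivative (\<lambda>_. 0)) (at s within {0..1})" if "s \<in> {0..1}" for s
        using d'(2)[OF that] V0[OF 1(2)] 1(1) by (simp add: has_vector_derivative_def)
      then obtain k where "\<forall>s\<in>{0..1}. \<delta> s = k" using has_derivative_zero_constant[of "{0..1::real}" \<delta>] by auto
      then have "\<delta> 0 = \<delta> 1" by simp
      then show False using neg pos d(1,2) by simp
    next
      case 2
      have "leaf_field d' \<xi> A \<theta> \<in> limit_fields d' \<xi> A g" unfolding limit_fields_def using \<theta>1[OF 2(2)] by blast
      then show False by (rule fin[of _ N]) (use 2 VN N0 in \<open>auto simp: N_def\<close>)
    next
      case 3
      have "ham g \<in> limit_fields d' \<xi> A g" unfolding limit_fields_def by blast
      then show False by (rule fin[of _ T]) (use 3 V0 T in auto)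
    next
      case 4
      have "0 \<le> N / T" using T N0 by (simp add: N_def)
      then have "(\<lambda>w. ham g w + (N / T) *\<^sub>R leaf_field d' \<xi> A \<theta> w) \<in> limit_fields d' \<xi> A g"
        unfolding limit_fields_def using \<theta>1[OF 4(2)] by blast
      then show False by (rule fin[of _ T]) (use 4 VN T in \<open>auto simp: scaleR_add_right\<close>)
    qed
  qed
qed

text \<open>The velocity of a leaf path is \<open>H\<close> of its \<open>x\<close> component, so
  \<open>straighten_global\<close> applies with the increment of \<open>x\<close> as parameter. The
  dilation brings the starting point into the ball and does not affect \<open>x\<close>; the small
  oscillation of \<open>x\<close> on \<open>U'\<close> keeps the parameter below its bound.\<close>

lemma leaf_\<Gamma>:
  assumes U': "conic_open U'" "U' \<subseteq> U1" and xs: "\<And>z z'. z \<in> U' \<Longrightarrow> z' \<in> U' \<Longrightarrow> norm (x z - x z') < \<epsilon> / 4"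
    and t: "0 < t" "scl t w \<in> cball w0 (R / 16)" and z: "z \<in> leaf (S \<inter> U') w"
  shows "scl t z = \<Gamma> (scl t w) (0, x z - x w)" "z \<in> S" "z \<in> U'"
proof -
  obtain \<gamma> where \<gamma>: "\<gamma> (0::real) = w" "\<gamma> 1 = z" and s: "\<And>s. s \<in> {0..1} \<Longrightarrow> \<gamma> s \<in> S \<inter> U' \<and>
        (\<exists>v\<in>tangent_ann (S \<inter> U') (\<gamma> s). (\<gamma> has_vector_derivative v) (at s within {0..1}))"
    using z unfolding leaf_def by blast
  have "\<exists>v. \<forall>s\<in>{0..1}. v s \<in> tangent_ann S (\<gamma> s) \<and> (\<gamma> has_vector_derivative v s) (at s within {0..1})"
    using s tangent_ann_localize[OF conic_open_open[OF U'(1)]] by (metis IntD2)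
  then obtain v where v: "\<And>s. s \<in> {0..1} \<Longrightarrow> v s \<in> tangent_ann S (\<gamma> s)"
    "\<And>s. s \<in> {0..1} \<Longrightarrow> (\<gamma> has_vector_derivative v s) (at s within {0..1})" by blast
  define \<delta> where "\<delta> s = scl t (\<gamma> s)" for s
  have \<delta>: "\<delta> s \<in> S" "\<delta> s \<in> U1" if "s \<in> {0..1}" for s
    using s[OF that] scl_S[of "\<gamma> s" t] conic_open_scl[OF chart.U, of "\<gamma> s" t] t U'(2) by (auto simp: \<delta>_def)
  have x\<delta>: "x (\<delta> s) = x (\<gamma> s)" if "s \<in> {0..1}" for s
    using s[OF that] homogeneousD[OF hom_x, of "\<gamma> s" t] t U'(2) by (auto simp: \<delta>_def)
  have d\<delta>: "(\<delta> has_vector_derivative scl t (v s)) (at s within {0..1})" if "s \<in> {0..1}" for s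
    unfolding \<delta>_def by (rule bounded_linear.has_vector_derivative[OF bounded_linear_scl v(2)[OF that]])
  let ?C = "\<lambda>s. (0::real, x (\<delta> s))"
  have "\<delta> 1 = \<Gamma> (\<delta> 0) (?C 1 - ?C 0)"
  proof (rule straighten_global[of 1 \<delta> ?C "\<lambda>s. (0, frechet_derivative x (at (\<delta> s)) (scl t (v s)))" 1])
    show "\<delta> 0 \<in> cball w0 (R / 16)" using t \<gamma> by (simp add: \<delta>_def)
    show "continuous_on {0..1} \<delta>"
      by (rule continuous_on_vector_derivative[OF d\<delta>])
    fix s :: real assume s01: "s \<in> {0..1}"
    have dx: "((\<lambda>s. x (\<delta> s)) has_derivative (\<lambda>h. h *\<^sub>R frechet_derivative x (at (\<delta> s)) (scl t (v s)))) (at s within {0..1})"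
      using has_derivative_compose[OF d\<delta>[OF s01, unfolded has_vector_derivative_def] smooth_on_has_derivative[OF smooth_x \<delta>(2)[OF s01]]]
      by (simp add: linear_cmul[OF smooth_on_deriv_linear[OF smooth_x \<delta>(2)[OF s01]]])
    then show "(?C has_vector_derivative (0, frechet_derivative x (at (\<delta> s)) (scl t (v s)))) (at s within {0..1})"
      unfolding has_vector_derivative_def by (auto intro!: derivative_eq_intros)
    have "scl t (v s) \<in> tangent_ann S (\<delta> s)" unfolding \<delta>_def by (rule tangent_ann_scl_S[OF t(1) v(1)[OF s01]])
    then have "scl t (v s) = F (0, frechet_derivative x (at (\<delta> s)) (scl t (v s))) (\<delta> s)"
      using ann_eq_H[OF \<delta>[OF s01]] by (simp add: F_def)
    then show "(\<delta> has_vector_derivative F (0, frechet_derivative x (at (\<delta> s)) (scl t (v s))) (\<delta> s)) (at s within {0..1})"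
      using d\<delta>[OF s01] by simp
    have "norm (x (\<gamma> s) - x (\<gamma> 0)) < \<epsilon> / 4" using s[OF s01] s[of 0] by (intro xs) auto
    then show "norm (?C s - ?C 0) < \<epsilon> / 4" by (simp add: x\<delta>[OF s01] x\<delta>[of 0] norm_Pair)
  qed auto
  then show "scl t z = \<Gamma> (scl t w) (0, x z - x w)" using x\<delta>[of 0] x\<delta>[of 1] \<gamma> by (simp add: \<delta>_def)
  show "z \<in> S" "z \<in> U'" using s[of 1] \<gamma> by auto
qed

text \<open>Modulo the annihilator the velocity is the field of \<open>Re q\<close>, hence that of
  \<open>gt\<close>. Since the latter has no \<open>x\<close> component, the velocity is
  \<open>F (1, X')\<close> with \<open>X'\<close> the derivative of \<open>x\<close> along the
  curve.\<close>

lemma bichar_\<Gamma>: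
  assumes T: "0 \<le> T" "T < \<epsilon> / 8" and \<delta>: "\<delta> 0 \<in> cball w0 (R / 16)" "\<And>s. s \<in> {0..T} \<Longrightarrow> \<delta> s \<in> S" "\<And>s. s \<in> {0..T} \<Longrightarrow> \<delta> s \<in> U1"
    and v: "\<And>s. s \<in> {0..T} \<Longrightarrow> (\<delta> has_vector_derivative v s) (at s within {0..T})"
      "\<And>s v'. s \<in> {0..T} \<Longrightarrow> v' \<in> tangent S (\<delta> s) \<Longrightarrow> symp v' (v s) = frechet_derivative g (at (\<delta> s)) v'"
    and xs: "\<And>s. s \<in> {0..T} \<Longrightarrow> norm (x (\<delta> s) - x (\<delta> 0)) < \<epsilon> / 8"
  shows "\<delta> T = \<Gamma> (\<delta> 0) (T, x (\<delta> T) - x (\<delta> 0))"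
proof -
  let ?C = "\<lambda>s. (s, x (\<delta> s))" and ?C' = "\<lambda>s. (1::real, frechet_derivative x (at (\<delta> s)) (v s))"
  have "\<delta> T = \<Gamma> (\<delta> 0) (?C T - ?C 0)"
  proof (rule straighten_global[of T \<delta> ?C ?C' T])
    show "continuous_on {0..T} \<delta>"
      by (rule continuous_on_vector_derivative[OF v(1)])
    fix s assume s: "s \<in> {0..T}"
    have "((\<lambda>s. x (\<delta> s)) has_derivative (\<lambda>h. h *\<^sub>R frechet_derivative x (at (\<delta> s)) (v s))) (at s within {0..T})"
      using has_derivative_compose[OF v(1)[OF s, unfolded has_vector_derivative_def] smooth_on_has_derivative[OF smooth_x \<delta>(3)[OF s]]]
      by (simp add: linear_cmul[OF smooth_on_deriv_linear[OF smooth_x \<delta>(3)[OF s]]])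
    then show "(?C has_vector_derivative ?C' s) (at s within {0..T})"
      unfolding has_vector_derivative_def by (auto intro!: derivative_eq_intros)
    have "norm (?C s - ?C 0) \<le> norm s + norm (x (\<delta> s) - x (\<delta> 0))" using norm_Pair_le[of s] by simp
    then show "norm (?C s - ?C 0) < \<epsilon> / 4" using xs[OF s] s T by simp
    assume "\<delta> s \<in> cball w0 (R / 8)"
    then have sD: "\<delta> s \<in> D" using cball_D R by auto
    have "v s - ham g (\<delta> s) \<in> tangent_ann S (\<delta> s)"
      unfolding tangent_ann_def
    proof (intro CollectI ballI)
      fix v' assume "v' \<in> tangent S (\<delta> s)"
      from v(2)[OF s this] have "symp v' (v s - ham g (\<delta> s)) = 0"
        using \<delta>(3)[OF s] U1 deriv_ham[OF diff_g, of "\<delta> s" v'] by (auto simp: symp_simps)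
      then show "symp (v s - ham g (\<delta> s)) v' = 0" by (subst symp_commute) simp
    qed
    from ann_eq_H[OF \<delta>(2)[OF s] \<delta>(3)[OF s] this]
    have "v s = ham g (\<delta> s) + H (frechet_derivative x (at (\<delta> s)) (v s - ham g (\<delta> s))) (\<delta> s)" by (simp add: algebra_simps)
    also have "\<dots> = F (?C' s) (\<delta> s)"
      using ham_g_eq[OF \<delta>(2)[OF s] sD]
      by (simp add: F_def linear_diff[OF smooth_on_deriv_linear[OF smooth_x \<delta>(3)[OF s]]] linear_diff[OF linear_H[OF \<delta>(3)[OF s]]])
        (metis add_diff_cancel_right')
    finally show "(\<delta> has_vector_derivative F (?C' s) (\<delta> s)) (at s within {0..T})" using v(1)[OF s] by simp
  qed (use T \<delta> in auto)
  then show ?thesis by simp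
qed

end

section \<open>Leaf conditions in a thin cone\<close>

lemma leaf_sign_negD: "leaf_sign h L = -1 \<Longrightarrow> \<exists>z\<in>L. h z < 0"
  unfolding leaf_sign_def by (auto split: if_splits intro: order.not_eq_order_implies_strict)

lemma leaf_sign_posD: "leaf_sign h L = 1 \<Longrightarrow> \<exists>z\<in>L. 0 < h z"
  unfolding leaf_sign_def by (auto split: if_splits simp: less_le)

context flow_box
begin

text \<open>Along the flow of \<open>gt\<close> alone \<open>k\<close> grows at least at the rate
  \<open>\<kappa>\<close>. Adding the leaf displacement \<open>X\<close> moves the end point by at
  most \<open>M * norm X\<close>.\<close>

lemma transversal_\<Gamma>:
  fixes k :: "'n phase \<Rightarrow> real"
  assumes k: "smooth_on D k" and K: "0 \<le> K" "\<And>w w'. w \<in> cball w0 R \<Longrightarrow> w' \<in> cball w0 R \<Longrightarrow> norm (k w - k w') \<le> K * norm (w - w')"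
    and \<kappa>: "\<And>w. w \<in> cball w0 R \<Longrightarrow> \<kappa> \<le> frechet_derivative k (at w) (ham gt w)"
    and z: "z \<in> cball w0 (R / 2)" and T: "0 \<le> T" "norm (T, X) < \<epsilon>"
  shows "k z + \<kappa> * T - K * M * norm X \<le> k (\<Gamma> z (T, X))"
proof -
  let ?c = "(T, 0) :: real \<times> (real ^ 'n)"
  have "norm ?c \<le> norm (T, X)" using T by (simp add: norm_Pair real_le_rsqrt)
  then have c: "norm ?c < \<epsilon>" using T by simp
  have mem: "\<Gamma> z c \<in> cball w0 R" if "norm c < \<epsilon>" for c
    using \<Gamma>_mem(2)[OF z order_refl less_imp_le[OF that]] R by auto
  have ct: "norm (s *\<^sub>R ?c) < \<epsilon>" if "s \<in> {0..1}" for s :: real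
    using that mult_left_le_one_le[of "norm ?c" s] c by (simp only: norm_scaleR) auto
  let ?h' = "\<lambda>s t. t * T * frechet_derivative k (at (\<Gamma> z (s *\<^sub>R ?c))) (ham gt (\<Gamma> z (s *\<^sub>R ?c)))"
  have "((\<lambda>s. k (\<Gamma> z (s *\<^sub>R ?c))) has_derivative ?h' s) (at s within {0..1})" if "0 \<le> s" "s \<le> 1" for s :: real
  proof -
    have s: "s \<in> {0..1}" using that by simp
    have mD: "\<Gamma> z (s *\<^sub>R ?c) \<in> D" using mem[OF ct[OF s]] cball_D by blast
    have l: "linear (frechet_derivative k (at (\<Gamma> z (s *\<^sub>R ?c))))" by (rule smooth_on_deriv_linear[OF k mD])
    have F: "F (t *\<^sub>R ?c) (\<Gamma> z (s *\<^sub>R ?c)) = (t * T) *\<^sub>R ham gt (\<Gamma> z (s *\<^sub>R ?c))" for t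
      using linear_0[OF linear_H[OF D_U1[OF mD]]] by (simp add: F_def)
    have "((\<lambda>s. s *\<^sub>R ?c) has_derivative (\<lambda>s. s *\<^sub>R ?c)) (at s within {0..1})" by (auto intro!: derivative_eq_intros)
    from has_derivative_compose[OF this \<Gamma>_has_derivative[OF z ct[OF s]]]
    have "((\<lambda>s. \<Gamma> z (s *\<^sub>R ?c)) has_derivative (\<lambda>t. F (t *\<^sub>R ?c) (\<Gamma> z (s *\<^sub>R ?c)))) (at s within {0..1})" .
    from has_derivative_compose[OF this smooth_on_has_derivative[OF k mD]]
    show ?thesis unfolding F linear_cmul[OF l] by simp
  qed
  then have "\<exists>s\<in>{0<..<1}. k (\<Gamma> z (1 *\<^sub>R ?c)) - k (\<Gamma> z (0 *\<^sub>R ?c)) = ?h' s (1 - 0)"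
    by (intro mvt_simple) auto
  then obtain s where s: "s \<in> {0<..<1}" "k (\<Gamma> z (1 *\<^sub>R ?c)) - k (\<Gamma> z (0 *\<^sub>R ?c)) = ?h' s (1 - 0)" by blast
  have "T * \<kappa> \<le> T * frechet_derivative k (at (\<Gamma> z (s *\<^sub>R ?c))) (ham gt (\<Gamma> z (s *\<^sub>R ?c)))"
    using s(1) by (intro mult_left_mono \<kappa> mem ct T) auto
  then have 1: "\<kappa> * T \<le> k (\<Gamma> z ?c) - k z" using s(2) \<Gamma>_0[OF z] by (simp add: zero_prod_def[symmetric] mult.commute)
  have "norm (k (\<Gamma> z ?c) - k (\<Gamma> z (T, X))) \<le> K * norm (\<Gamma> z ?c - \<Gamma> z (T, X))" by (intro K mem c T)
  also have "\<dots> \<le> K * (M * norm (?c - (T, X)))" by (intro mult_left_mono \<Gamma>_lipschitz2 z c T K)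
  also have "\<dots> = K * M * norm X" by (simp add: norm_Pair)
  finally have "k (\<Gamma> z ?c) - k (\<Gamma> z (T, X)) \<le> K * M * norm X" by simp
  then show ?thesis using 1 by linarith
qed

text \<open>\<open>E\<close> and \<open>E'\<close> bound the oscillations of \<open>x\<close> and
  \<open>\<tau>\<close> on the cone \<open>U'\<close>. A bicharacteristic that stays there for the
  time \<open>T2\<close> would raise \<open>\<tau>\<close> by more than these oscillations allow, so
  all durations are below \<open>T2\<close>. Points on its leaves are then related by a small pair
  \<open>(T, X)\<close>, for which \<open>nosign\<close> forbids the change of sign.\<close>

lemma leaf_conditions_local:
  assumes nosign: "\<And>z T y. z \<in> S \<Longrightarrow> z \<in> cball w0 \<rho> \<Longrightarrow> 0 \<le> T \<Longrightarrow> T \<le> \<rho> \<Longrightarrow> norm y \<le> \<rho> \<Longrightarrow> f z < 0 \<Longrightarrow> 0 < f (\<Gamma> z (T, y)) \<Longrightarrow> False"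
    and U': "conic_open U'" "U' \<subseteq> U1" "\<And>z. z \<in> U' \<Longrightarrow> \<exists>t>0. scl t z \<in> cball w0 \<eta>"
    and xs: "\<And>z z'. z \<in> U' \<Longrightarrow> z' \<in> U' \<Longrightarrow> norm (x z - x z') \<le> E"
    and \<tau>s: "\<And>z z'. z \<in> U' \<Longrightarrow> z' \<in> U' \<Longrightarrow> \<tau> z' \<le> \<tau> z + E'"
    and \<tau>: "\<And>z T X. z \<in> cball w0 (R / 2) \<Longrightarrow> 0 \<le> T \<Longrightarrow> norm (T, X) < \<epsilon> \<Longrightarrow> \<tau> z + \<kappa> * T - K * norm X \<le> \<tau> (\<Gamma> z (T, X))"
    and T2: "0 < T2" "T2 < \<epsilon> / 8" "T2 \<le> \<rho>" "M * T2 \<le> R / 32" "K * E + E' < \<kappa> * T2" and K: "0 \<le> K"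
    and E: "E < \<epsilon> / 8" "E \<le> \<rho>" "\<eta> + M * E \<le> \<rho>" "\<eta> + M * E \<le> R / 32"
  shows "leaf_conditions U' p q"
proof -
  have S': "Sigma2 U' p = S \<inter> U'" using U' U1 by (intro Sigma2_restrict) blast
  have xE: "norm (x z - x z') < \<epsilon> / 8" "norm (x z - x z') < \<epsilon> / 4" if "z \<in> U'" "z' \<in> U'" for z z'
    using xs[OF that] E(1) \<epsilon>_pos by linarith+
  have E0: "0 \<le> M * E" if "z \<in> U'" for z using xs[OF that that] M by simp
  have Mx: "M * norm (x z - x z') \<le> M * E" if "z \<in> U'" "z' \<in> U'" for z z'
    using xs[OF that] M by (intro mult_left_mono) auto
  have wR: "w1 \<in> cball w0 (R / 16)" "w1 \<in> cball w0 (R / 2)" "w1 \<in> cball w0 (R / 4)" if "w1 \<in> cball w0 \<eta>" "z \<in> U'" for w1 z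
  proof -
    have "dist w0 w1 \<le> R / 32" using that E0[OF that(2)] E(4) by simp
    then show "w1 \<in> cball w0 (R / 16)" "w1 \<in> cball w0 (R / 2)" "w1 \<in> cball w0 (R / 4)" using R by auto
  qed
  have fU: "f (scl t z) < 0 \<longleftrightarrow> f z < 0" "0 < f (scl t z) \<longleftrightarrow> 0 < f z" if "z \<in> U'" "0 < t" for z t
    using f_scl[of z t] that U' U1 by (auto simp: mult_less_0_iff zero_less_mult_iff)
  have leafp: "scl t z = \<Gamma> (scl t w) (0, x z - x w)" "z \<in> S" "z \<in> U'"
    if "0 < t" "scl t w \<in> cball w0 (R / 16)" "z \<in> leaf (S \<inter> U') w" for t z w
    using leaf_\<Gamma>[OF U'(1,2) _ that] xE(2) by blast+
  \<comment> \<open>\<open>zn\<close> and \<open>zp\<close> are reached from the same point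
    \<open>w\<close> with the parameters \<open>(0, x zn - x w)\<close> and
    \<open>(T, x zp - x w)\<close>. By additivity \<open>zp\<close> is reached from
    \<open>zn\<close> with the difference of the two.\<close>
  have fin: False if w: "w \<in> S \<inter> U'" "0 < t" "scl t w \<in> cball w0 \<eta>" and zn: "zn \<in> leaf (S \<inter> U') w" "f zn < 0"
     and T: "0 \<le> T" "T \<le> T2" and zp: "zp \<in> U'" "scl t zp = \<Gamma> (scl t w) (T, x zp - x w)" "0 < f zp" for w t zn T zp
  proof -
    have wR': "scl t w \<in> cball w0 (R / 16)" "scl t w \<in> cball w0 (R / 2)" "scl t w \<in> cball w0 (R / 4)"
      using wR[OF w(3), of w] w by auto
    note n = leafp[OF w(2) wR'(1) zn(1)]
    let ?c = "(0, x zn - x w) :: real \<times> (real ^ 'n)" and ?c' = "(T, x zp - x zn)"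
    have nc: "norm ?c < \<epsilon> / 8" using xE(1)[OF n(3), of w] w by (simp add: norm_Pair)
    have "norm ?c' \<le> norm T + norm (x zp - x zn)" by (rule norm_Pair_le)
    then have nc': "norm ?c' < \<epsilon> / 4" using xE(1)[OF zp(1) n(3)] T T2 by simp
    have "norm (scl t zn - scl t w) \<le> M * norm ?c" unfolding n(1)
      using nc \<epsilon>_pos by (intro \<Gamma>_near wR') simp
    also have "\<dots> \<le> M * E" using Mx[OF n(3), of w] w by (simp add: norm_Pair)
    finally have "norm (scl t zn - scl t w) \<le> M * E" .
    then have "dist w0 (scl t zn) \<le> \<eta> + M * E" using w(3) dist_triangle[of w0 "scl t zn" "scl t w"]
      by (simp add: dist_norm norm_minus_commute)
    then have m: "scl t zn \<in> cball w0 \<rho>" using E(3) by simp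
    have "scl t zp = \<Gamma> (scl t w) (?c + ?c')" using zp(2) by simp
    also have "\<dots> = \<Gamma> (scl t zn) ?c'" unfolding n(1) using nc nc' \<epsilon>_pos by (intro \<Gamma>_add[symmetric] wR') simp
    finally have "0 < f (\<Gamma> (scl t zn) ?c')" using fU(2)[OF zp(1) w(2)] zp(3) by simp
    then show False
      using nosign[OF scl_S[OF n(2) w(2)] m T(1), of "x zp - x zn"] T(2) T2(3) xs[OF zp(1) n(3)] E(2) fU(1)[OF n(3) w(2)] zn(2) by simp
  qed
  have "no_sign_change_on_leaves U' p q"
    unfolding no_sign_change_on_leaves_def S'
  proof (intro ballI notI, elim bexE conjE)
    fix w zn zp assume w: "w \<in> S \<inter> U'" and z: "zn \<in> leaf (S \<inter> U') w" "zp \<in> leaf (S \<inter> U') w" "f zn < 0" "0 < f zp"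
    obtain t where t: "0 < t" "scl t w \<in> cball w0 \<eta>" using U'(3)[of w] w by blast
    have "scl t w \<in> cball w0 (R / 16)" using wR[OF t(2), of w] w by auto
    note zp = leafp[OF t(1) this z(2)]
    show False by (rule fin[OF w t z(1,3) _ _ zp(3) zp(1) z(4)]) (use T2 in auto)
  qed
  moreover have "no_leaf_sign_change_at U' p q c" for c
    unfolding no_leaf_sign_change_at_def S'
  proof (intro allI impI notI, elim exE conjE)
    fix \<gamma> a b s s' assume bi: "subprincipal_bichar (S \<inter> U') g c \<gamma> a b" and s: "a \<le> s" "s < s'" "s' \<le> b"
      and ls: "leaf_sign f (leaf (S \<inter> U') (\<gamma> s)) = -1" "leaf_sign f (leaf (S \<inter> U') (\<gamma> s')) = 1"
    define B where "B s v \<longleftrightarrow> (\<gamma> has_vector_derivative v) (at s within {a..b}) \<and>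
       (\<forall>v'\<in>tangent S (\<gamma> s). symp v' v = frechet_derivative g (at (\<gamma> s)) v')" for s v
    define v where "v s = (SOME v. B s v)" for s
    have B: "B s (v s)" if "s \<in> {a..b}" for s
    proof -
      have "\<gamma> s \<in> S" "\<gamma> s \<in> U'" and "\<exists>v\<in>tangent (S \<inter> U') (\<gamma> s). (\<gamma> has_vector_derivative v) (at s within {a..b}) \<and>
           (\<forall>v'\<in>tangent (S \<inter> U') (\<gamma> s). symp v' v = frechet_derivative g (at (\<gamma> s)) v')"
        using bi that unfolding subprincipal_bichar_def by blast+
      then have "\<exists>v. B s v" unfolding tangent_localize[OF conic_open_open[OF U'(1)] \<open>\<gamma> s \<in> U'\<close>] B_def by blast
      then show ?thesis unfolding v_def by (rule someI_ex)
    qed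
    then have v: "\<And>s. s \<in> {a..b} \<Longrightarrow> (\<gamma> has_vector_derivative v s) (at s within {a..b})"
      "\<And>s v'. s \<in> {a..b} \<Longrightarrow> v' \<in> tangent S (\<gamma> s) \<Longrightarrow> symp v' (v s) = frechet_derivative g (at (\<gamma> s)) v'" by (auto simp: B_def)
    have \<gamma>: "\<gamma> \<sigma> \<in> S" "\<gamma> \<sigma> \<in> U'" "\<gamma> \<sigma> \<in> U" if "\<sigma> \<in> {a..b}" for \<sigma>
      using bi that U' U1 unfolding subprincipal_bichar_def by blast+
    have sab: "s \<in> {a..b}" "s' \<in> {a..b}" using s by auto
    obtain t where t: "0 < t" "scl t (\<gamma> s) \<in> cball w0 \<eta>" using U'(3) \<gamma>(2)[OF sab(1)] by blast
    have wR': "scl t (\<gamma> s) \<in> cball w0 (R / 16)" "scl t (\<gamma> s) \<in> cball w0 (R / 2)" "scl t (\<gamma> s) \<in> cball w0 (R / 4)"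
      using wR[OF t(2) \<gamma>(2)[OF sab(1)]] by auto
    \<comment> \<open>The field of \<open>Re q\<close> is homogeneous up to the factor
      \<open>t powr (r - 2)\<close>, so the dilated curve is a bicharacteristic only after time is
      rescaled by this factor.\<close>
    define k where "k = t powr (r - 2)"
    have k: "0 < k" "k * t = t powr (r - 1)" using t(1) powr_add[of t "r - 2" 1] by (auto simp: k_def)
    define T where "T = (s' - s) / k"
    have T: "0 < T" "s' = s + k * T" using s k by (auto simp: T_def)
    define \<delta> where "\<delta> \<sigma> = scl t (\<gamma> (s + k * \<sigma>))" for \<sigma>
    have \<delta>0: "\<delta> 0 = scl t (\<gamma> s)" "\<delta> T = scl t (\<gamma> s')" using T by (auto simp: \<delta>_def)
    have im: "(\<lambda>\<sigma>. s + k * \<sigma>) ` {0..T'} \<subseteq> {a..b}" if "T' \<le> T" for T'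
    proof (intro image_subsetI)
      fix \<sigma> assume "\<sigma> \<in> {0..T'}"
      then have "0 \<le> k * \<sigma>" "k * \<sigma> \<le> k * T" using k that by (auto intro: mult_left_mono)
      then show "s + k * \<sigma> \<in> {a..b}" using s T by auto
    qed
    have \<delta>: "\<delta> \<sigma> \<in> S" "\<delta> \<sigma> \<in> U'" if "\<sigma> \<in> {0..T}" for \<sigma>
    proof -
      have m: "s + k * \<sigma> \<in> {a..b}" using im[OF order_refl] that by blast
      show "\<delta> \<sigma> \<in> S" "\<delta> \<sigma> \<in> U'" unfolding \<delta>_def by (intro scl_S conic_open_scl[OF U'(1)] \<gamma> m t)+
    qed
    have x\<delta>: "x (\<delta> \<sigma>) = x (\<gamma> (s + k * \<sigma>))" if "\<sigma> \<in> {0..T}" for \<sigma>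
    proof -
      have "s + k * \<sigma> \<in> {a..b}" using im[OF order_refl] that by blast
      from \<gamma>(2)[OF this] show ?thesis using homogeneousD[OF hom_x, of "\<gamma> (s + k * \<sigma>)" t] t U'(2) by (auto simp: \<delta>_def)
    qed
    have flow: "\<delta> T' = \<Gamma> (\<delta> 0) (T', x (\<delta> T') - x (\<delta> 0))" if T': "0 \<le> T'" "T' \<le> T" "T' < \<epsilon> / 8" for T'
    proof (rule bichar_\<Gamma>[OF T'(1,3)])
      show "\<delta> 0 \<in> cball w0 (R / 16)" unfolding \<delta>0 by (rule wR')
      fix \<sigma> assume *: "\<sigma> \<in> {0..T'}"
      then have \<sigma>: "\<sigma> \<in> {0..T}" using T' by auto
      have m: "s + k * \<sigma> \<in> {a..b}" using * im[OF T'(2)] by blast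
      show "\<delta> \<sigma> \<in> S" "\<delta> \<sigma> \<in> U1" using \<delta>[OF \<sigma>] U'(2) by auto
      show "norm (x (\<delta> \<sigma>) - x (\<delta> 0)) < \<epsilon> / 8" using \<sigma> T by (intro xE \<delta>) auto
      show "(\<delta> has_vector_derivative scl t (k *\<^sub>R v (s + k * \<sigma>))) (at \<sigma> within {0..T'})"
        unfolding \<delta>_def
        by (intro bounded_linear.has_vector_derivative[OF bounded_linear_scl] has_vector_derivative_affine[OF v(1)[OF m] im[OF T'(2)]])
      fix v' assume "v' \<in> tangent S (\<delta> \<sigma>)"
      then have v': "scl (1 / t) v' \<in> tangent S (\<gamma> (s + k * \<sigma>))" unfolding \<delta>_def tangent_scl_S[OF t(1)] .
      have "symp v' (scl t (k *\<^sub>R v (s + k * \<sigma>))) = symp (scl t (scl (1 / t) v')) (scl t (k *\<^sub>R v (s + k * \<sigma>)))" using t(1) by simp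
      also have "\<dots> = (k * t) * symp (scl (1 / t) v') (v (s + k * \<sigma>))" unfolding symp_scl by (simp add: symp_simps)
      also have "\<dots> = (t powr (r - 1)) *\<^sub>R frechet_derivative g (at (\<gamma> (s + k * \<sigma>))) (scl (1 / t) v')"
        by (simp add: k v(2)[OF m v'])
      also have "\<dots> = frechet_derivative g (at (scl t (\<gamma> (s + k * \<sigma>)))) (scl t (scl (1 / t) v'))"
        by (intro homogeneous_deriv[symmetric, OF domain g_scl] \<gamma> m t diff_g conic_open_scl[OF domain])
      finally show "symp v' (scl t (k *\<^sub>R v (s + k * \<sigma>))) = frechet_derivative g (at (\<delta> \<sigma>)) v'" using t(1) by (simp add: \<delta>_def)
    qed
    have nX: "norm (T', x (\<delta> T') - x (\<delta> 0)) < \<epsilon> / 4" if "0 \<le> T'" "T' \<le> T" "T' < \<epsilon> / 8" for T'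
    proof -
      have "norm (T', x (\<delta> T') - x (\<delta> 0)) \<le> norm T' + norm (x (\<delta> T') - x (\<delta> 0))" by (rule norm_Pair_le)
      moreover have "norm (x (\<delta> T') - x (\<delta> 0)) < \<epsilon> / 8" using that T by (intro xE \<delta>) auto
      ultimately show ?thesis using that by simp
    qed
    \<comment> \<open>A longer bicharacteristic is stopped at the time \<open>T2\<close>, where the
      growth of \<open>\<tau>\<close> exceeds its possible oscillation together with the loss caused
      by the leaf displacement.\<close>
    have TT2: "T \<le> T2"
    proof (rule ccontr)
      assume "\<not> T \<le> T2"
      then have T2': "0 \<le> T2" "T2 \<le> T" using T2 by auto
      have "\<tau> (\<delta> 0) + \<kappa> * T2 - K * norm (x (\<delta> T2) - x (\<delta> 0)) \<le> \<tau> (\<Gamma> (\<delta> 0) (T2, x (\<delta> T2) - x (\<delta> 0)))"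
        using nX[OF T2' T2(2)] \<epsilon>_pos T2'(1) wR' by (intro \<tau>) (simp_all add: \<delta>0)
      also have "\<dots> = \<tau> (\<delta> T2)" using flow[OF T2' T2(2)] by simp
      also have "\<dots> \<le> \<tau> (\<delta> 0) + E'" using T2' T by (intro \<tau>s \<delta>) auto
      finally have "\<kappa> * T2 \<le> K * norm (x (\<delta> T2) - x (\<delta> 0)) + E'" by simp
      moreover have "K * norm (x (\<delta> T2) - x (\<delta> 0)) \<le> K * E" using T2' T by (intro mult_left_mono xs \<delta> K) auto
      ultimately show False using T2(5) by linarith
    qed
    have T': "0 \<le> T" "T < \<epsilon> / 8" using TT2 T2 T by auto
    have \<delta>T: "\<delta> 0 \<in> U'" "\<delta> T \<in> U'" using T by (auto intro: \<delta>)
    obtain zn where zn: "zn \<in> leaf (S \<inter> U') (\<gamma> s)" "f zn < 0" using leaf_sign_negD[OF ls(1)] by blast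
    obtain zp where zp: "zp \<in> leaf (S \<inter> U') (\<gamma> s')" "0 < f zp" using leaf_sign_posD[OF ls(2)] by blast
    define C where "C = (T, x (\<delta> T) - x (\<delta> 0))"
    have \<delta>TC: "\<delta> T = \<Gamma> (\<delta> 0) C" unfolding C_def by (rule flow[OF T'(1) order_refl T'(2)])
    have nC: "norm C < \<epsilon> / 4" unfolding C_def by (rule nX[OF T'(1) order_refl T'(2)])
    have "norm (\<delta> T - \<delta> 0) \<le> M * norm C"
      unfolding \<delta>TC using nC \<epsilon>_pos wR' by (intro \<Gamma>_near) (simp_all add: \<delta>0)
    also have "\<dots> \<le> M * (norm T + norm (x (\<delta> T) - x (\<delta> 0)))" unfolding C_def using M by (intro mult_left_mono norm_Pair_le) auto
    also have "\<dots> \<le> M * (T2 + E)" using M TT2 T xs[OF \<delta>T(2,1)] by (intro mult_left_mono add_mono) auto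
    finally have "norm (\<delta> T - \<delta> 0) \<le> M * T2 + M * E" by (simp add: distrib_left)
    moreover have "dist w0 (\<delta> T) \<le> dist w0 (\<delta> 0) + norm (\<delta> T - \<delta> 0)"
      using dist_triangle[of w0 "\<delta> T" "\<delta> 0"] by (simp add: dist_norm norm_minus_commute)
    moreover have "dist w0 (\<delta> 0) \<le> \<eta>" using t by (simp add: \<delta>0)
    ultimately have "dist w0 (\<delta> T) \<le> R / 16" using E(4) T2(4) by linarith
    then have "scl t (\<gamma> s') \<in> cball w0 (R / 16)" by (simp add: \<delta>0)
    note p = leafp[OF t(1) this zp(1)]
    have xT: "x (\<delta> T) = x (\<gamma> s')" "x (\<delta> 0) = x (\<gamma> s)" using x\<delta>[of T] x\<delta>[of 0] T by auto
    have np: "norm (0::real, x zp - x (\<gamma> s')) < \<epsilon> / 8" using xE(1)[OF p(3) \<gamma>(2)[OF sab(2)]] by (simp add: norm_Pair)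
    \<comment> \<open>The bicharacteristic and the path in the final leaf are composed into a single
      pair by additivity.\<close>
    have "scl t zp = \<Gamma> (\<Gamma> (\<delta> 0) C) (0, x zp - x (\<gamma> s'))"
      unfolding \<delta>TC[symmetric] unfolding \<delta>0 by (rule p(1))
    also have "\<dots> = \<Gamma> (\<delta> 0) (C + (0, x zp - x (\<gamma> s')))"
      using nC np \<epsilon>_pos wR' by (intro \<Gamma>_add) (simp_all add: \<delta>0)
    finally have "scl t zp = \<Gamma> (scl t (\<gamma> s)) (T, x zp - x (\<gamma> s))" by (simp add: C_def xT) (simp add: \<delta>0)
    moreover have "\<gamma> s \<in> S \<inter> U'" using \<gamma>[OF sab(1)] by simp
    ultimately show False by (intro fin[OF _ t zn T'(1) TT2 p(3) _ zp(2)])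
  qed
  ultimately show ?thesis by (simp add: leaf_conditions_def)
qed

end

text \<open>Every point is a dilate of its projection to the sphere. Where the projection has
  derivative zero, only the derivative of the dilation factor remains, and that moves the point
  radially.\<close>

lemma rescale_deriv_radial:
  fixes w :: "'n::finite phase"
  assumes w: "snd w \<noteq> 0" and v: "frechet_derivative (rescale (norm (snd w))) (at w) v = 0"
  obtains c where "v = c *\<^sub>R radial w"
proof -
  define y where "y = (rescale (norm (snd w)) :: 'n phase \<Rightarrow> 'n phase)"
  define h where "h z = norm (snd z) * inverse (norm (snd w))" for z :: "'n phase"
  define O' where "O' = {z :: 'n phase. snd z \<noteq> 0}"
  have O': "open O'" "w \<in> O'" using open_snd_nonzero w by (auto simp: O'_def)
  have "smooth_on O' h"
    unfolding h_def[abs_def] O'_def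
    by (intro smooth_on_mult smooth_on_norm smooth_on_const smooth_on_linear[OF bounded_linear_snd] open_snd_nonzero) auto
  then have dh: "(h has_derivative frechet_derivative h (at w)) (at w)" using O'(2) smooth_on_has_derivative by blast
  have dy: "(y has_derivative frechet_derivative y (at w)) (at w)"
    using smooth_on_has_derivative[OF smooth_on_rescale, of w] w unfolding y_def by blast
  have y0: "y w = w" "h w = 1" using rescale_self[of w] w by (auto simp: y_def h_def)
  have e: "(fst (y z), h z *\<^sub>R snd (y z)) = z" if "z \<in> O'" for z
    using scl_rescale[of z "norm (snd w)"] that w unfolding O'_def y_def h_def scl_def by auto
  have d1: "((\<lambda>z. fst (y z)) has_derivative (\<lambda>v. fst (frechet_derivative y (at w) v))) (at w)"
   and d2: "((\<lambda>z. snd (y z)) has_derivative (\<lambda>v. snd (frechet_derivative y (at w) v))) (at w)"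
    by (rule bounded_linear.has_derivative[OF bounded_linear_fst dy] bounded_linear.has_derivative[OF bounded_linear_snd dy])+
  have "((\<lambda>z. (fst (y z), h z *\<^sub>R snd (y z))) has_derivative
     (\<lambda>v. (fst (frechet_derivative y (at w) v), h w *\<^sub>R snd (frechet_derivative y (at w) v) + frechet_derivative h (at w) v *\<^sub>R snd (y w)))) (at w)"
    by (intro has_derivative_Pair d1 has_derivative_scaleR dh d2)
  then have "((\<lambda>z. z) has_derivative
     (\<lambda>v. (fst (frechet_derivative y (at w) v), h w *\<^sub>R snd (frechet_derivative y (at w) v) + frechet_derivative h (at w) v *\<^sub>R snd (y w)))) (at w)"
    by (rule has_derivative_transform_within_open[OF _ O' e])
  from fun_cong[OF has_derivative_unique[OF this has_derivative_ident], of v]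
  have "v = frechet_derivative h (at w) v *\<^sub>R radial w" using v by (simp add: y_def[symmetric] y0 radial_def)
  then show ?thesis by (rule that)
qed

text \<open>The fields of \<open>gt\<close> and \<open>Re q\<close> agree modulo the annihilator,
  and real subprincipal type excludes the radial direction in exactly this quotient.\<close>

lemma (in flow_chart) ham_gt_nonradial: "ham gt w0 \<noteq> c *\<^sub>R radial w0"
proof
  assume "ham gt w0 = c *\<^sub>R radial w0"
  then have "ham g w0 - c *\<^sub>R radial w0 = H (frechet_derivative x (at w0) (ham g w0)) w0"
    using ham_g_eq[OF w0] by (metis add_diff_cancel_left')
  then have "ham g w0 - c *\<^sub>R radial w0 \<in> tangent_ann S w0"
    unfolding tangent_ann_S[OF w0(1) D_U1[OF w0(2)]] by simp
  then show False using rst w0(1) unfolding real_subprincipal_type_def by blast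
qed

text \<open>Both \<open>x\<close> and the monotone function \<open>\<tau>\<close> are unchanged by
  dilations, so their oscillation on a cone is that on its trace on the sphere, which is of the
  order of the radius \<open>\<eta>\<close>.\<close>

lemma (in flow_box) leaf_conditions_near:
  assumes \<rho>: "0 < \<rho>" and nosign: "\<And>z T y. z \<in> S \<Longrightarrow> z \<in> cball w0 \<rho> \<Longrightarrow> 0 \<le> T \<Longrightarrow> T \<le> \<rho> \<Longrightarrow> norm y \<le> \<rho> \<Longrightarrow> f z < 0 \<Longrightarrow> 0 < f (\<Gamma> z (T, y)) \<Longrightarrow> False"
    and \<kappa>: "0 < \<kappa>" "\<And>w. w \<in> cball w0 R \<Longrightarrow> \<kappa> \<le> frechet_derivative (\<lambda>z. v0 \<bullet> rescale (norm (snd w0)) z) (at w) (ham gt w)"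
  obtains U' where "conic_open U'" "w0 \<in> U'" "U' \<subseteq> U1" "leaf_conditions U' p q"
proof -
  define r0 where "r0 = norm (snd w0)"
  define \<tau> where "\<tau> z = v0 \<bullet> rescale r0 z" for z
  have w0U: "w0 \<in> U1" by (rule D_U1[OF w0(2)])
  have U1s: "snd z \<noteq> 0" if "z \<in> U1" for z using that chart.U by (auto simp: conic_open_def)
  have r0: "0 < r0" using U1s[OF w0U] by (simp add: r0_def)
  have RU1: "cball w0 R \<subseteq> U1" using cball_D D by blast
  have s\<tau>: "smooth_on D \<tau>"
    unfolding \<tau>_def[abs_def]
    by (intro smooth_on_bounded_linear[OF bounded_linear_inner_right D(1)] smooth_on_subset[OF smooth_on_rescale]) (use U1s D in auto)
  obtain K where K: "0 \<le> K" "\<And>w w'. w \<in> cball w0 R \<Longrightarrow> w' \<in> cball w0 R \<Longrightarrow> norm (\<tau> w - \<tau> w') \<le> K * norm (w - w')"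
    by (rule smooth_on_lipschitz[OF s\<tau> cball_D]) blast
  obtain Lx where Lx: "0 \<le> Lx" "\<And>w w'. w \<in> cball w0 R \<Longrightarrow> w' \<in> cball w0 R \<Longrightarrow> norm (x w - x w') \<le> Lx * norm (w - w')"
    by (rule smooth_on_lipschitz[OF smooth_x RU1]) blast
  \<comment> \<open>\<open>T2\<close> depends only on the flow and on \<open>\<rho>\<close>; it is
    fixed before \<open>\<eta>\<close>, which afterwards is made small compared with
    \<open>\<kappa> * T2\<close>.\<close>
  define T2 where "T2 = min (\<epsilon> / 16) (min \<rho> (R / (32 * M)))"
  have T2: "0 < T2" "T2 < \<epsilon> / 8" "T2 \<le> \<rho>" using \<epsilon>_pos R M \<rho> by (auto simp: T2_def)
  have "M * T2 \<le> M * (R / (32 * M))" using M by (intro mult_left_mono) (auto simp: T2_def)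
  then have T2M: "M * T2 \<le> R / 32" using M by simp
  \<comment> \<open>Collects the coefficients with which \<open>\<eta>\<close> occurs in all
    smallness conditions, so that \<open>s / (2 * C)\<close> meets every one of them at
    once.\<close>
  define C where "C = 1 + 2 * Lx + 2 * M * Lx + 2 * K * M * Lx + 2 * norm v0"
  have nn: "0 \<le> Lx" "0 \<le> M * Lx" "0 \<le> K * M * Lx" "0 \<le> norm v0" using Lx(1) M K(1) by auto
  have C: "1 \<le> C" using nn unfolding C_def by linarith
  define s where "s = min (\<epsilon> / 8) (min \<rho> (min (R / 32) (\<kappa> * T2)))"
  have s: "0 < s" "s \<le> \<epsilon> / 8" "s \<le> \<rho>" "s \<le> R / 32" "s \<le> \<kappa> * T2" using \<epsilon>_pos \<rho> R \<kappa>(1) T2 by (auto simp: s_def)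
  define \<eta> where "\<eta> = s / (2 * C)"
  have \<eta>: "0 < \<eta>" using s C by (simp add: \<eta>_def)
  have "C * \<eta> = s / 2" using C by (simp add: \<eta>_def)
  then have "\<eta> + 2 * Lx * \<eta> + M * (2 * Lx * \<eta>) + (K * M) * (2 * Lx * \<eta>) + 2 * norm v0 * \<eta> = s / 2"
    unfolding C_def by (simp add: algebra_simps)
  moreover have "0 \<le> 2 * Lx * \<eta>" "0 \<le> M * (2 * Lx * \<eta>)" "0 \<le> (K * M) * (2 * Lx * \<eta>)" "0 \<le> 2 * norm v0 * \<eta>"
    using Lx(1) M K(1) \<eta> by auto
  ultimately have sm: "2 * Lx * \<eta> < s" "\<eta> + M * (2 * Lx * \<eta>) \<le> s" "(K * M) * (2 * Lx * \<eta>) + 2 * norm v0 * \<eta> < s" "\<eta> \<le> s"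
    using s(1) \<eta> by linarith+
  define U' where "U' = cone r0 (ball w0 \<eta>)"
  have bR: "ball w0 \<eta> \<subseteq> cball w0 R" using sm(4) s(4) R by auto
  have cU': "conic_open U'" unfolding U'_def by (rule conic_open_cone[OF open_ball])
  have U'1: "U' \<subseteq> U1" unfolding U'_def by (rule cone_subset[OF chart.U _ r0]) (use bR RU1 in blast)
  have "rescale r0 w0 = w0" using rescale_self[OF r0_def[symmetric]] U1s[OF w0U] by simp
  then have wU': "w0 \<in> U'" using U1s[OF w0U] \<eta> by (simp add: U'_def cone_def)
  have resc: "rescale r0 z \<in> ball w0 \<eta>" if "z \<in> U'" for z using that by (simp add: U'_def cone_def)
  have nresc: "norm (rescale r0 z - rescale r0 z') \<le> 2 * \<eta>" if "z \<in> U'" "z' \<in> U'" for z z'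
    using resc[OF that(1)] resc[OF that(2)] dist_triangle2[of "rescale r0 z" "rescale r0 z'" w0] by (simp add: dist_norm[symmetric] dist_commute)
  have tz: "0 < r0 * inverse (norm (snd z))" if "z \<in> U'" for z
    using r0 U1s[of z] U'1 that by auto
  have xr: "x (rescale r0 z) = x z" if "z \<in> U'" for z
  proof -
    have z: "z \<in> U1" using that U'1 by blast
    have "(r0 * inverse (norm (snd z))) powr 0 = 1"
      using less_imp_neq[OF tz[OF that]] by (metis powr_zero_eq_one)
    then show ?thesis unfolding rescale_def homogeneousD[OF hom_x z tz[OF that]] by simp
  qed
  have "leaf_conditions U' p q"
  proof (rule leaf_conditions_local[of \<rho> U' \<eta> "2 * Lx * \<eta>" \<tau> "2 * norm v0 * \<eta>" \<kappa> "K * M" T2])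
    show "\<exists>t>0. scl t z \<in> cball w0 \<eta>" if "z \<in> U'" for z
      using resc[OF that] tz[OF that] unfolding rescale_def by (intro exI[of _ "r0 * inverse (norm (snd z))"]) auto
    show "norm (x z - x z') \<le> 2 * Lx * \<eta>" if "z \<in> U'" "z' \<in> U'" for z z'
    proof -
      have "norm (x z - x z') = norm (x (rescale r0 z) - x (rescale r0 z'))" by (simp add: xr that)
      also have "\<dots> \<le> Lx * norm (rescale r0 z - rescale r0 z')" using resc that bR by (intro Lx) blast+
      also have "\<dots> \<le> Lx * (2 * \<eta>)" by (intro mult_left_mono nresc that Lx)
      finally show ?thesis by simp
    qed
    show "\<tau> z' \<le> \<tau> z + 2 * norm v0 * \<eta>" if "z \<in> U'" "z' \<in> U'" for z z'
    proof -
      have "\<tau> z' - \<tau> z = v0 \<bullet> (rescale r0 z' - rescale r0 z)" by (simp add: \<tau>_def inner_diff_right)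
      also have "\<dots> \<le> norm v0 * norm (rescale r0 z' - rescale r0 z)" by (rule norm_cauchy_schwarz)
      also have "\<dots> \<le> norm v0 * (2 * \<eta>)" by (intro mult_left_mono nresc that) simp
      finally show ?thesis by simp
    qed
    show "\<tau> z + \<kappa> * T - K * M * norm X \<le> \<tau> (\<Gamma> z (T, X))" if "z \<in> cball w0 (R / 2)" "0 \<le> T" "norm (T, X) < \<epsilon>" for z T X
      by (rule transversal_\<Gamma>[OF s\<tau> K _ that]) (use \<kappa>(2) in \<open>auto simp: \<tau>_def[abs_def] r0_def\<close>)
    show "K * M * (2 * Lx * \<eta>) + 2 * norm v0 * \<eta> < \<kappa> * T2" using sm(3) s(5) by simp
    show "0 \<le> K * M" using K M by simp
    show "2 * Lx * \<eta> < \<epsilon> / 8" "2 * Lx * \<eta> \<le> \<rho>" "\<eta> + M * (2 * Lx * \<eta>) \<le> \<rho>" "\<eta> + M * (2 * Lx * \<eta>) \<le> R / 32"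
      using sm s by linarith+
  qed (fact nosign cU' U'1 T2 T2M)+
  then show ?thesis by (rule that[OF cU' wU' U'1])
qed

lemma (in double_char) leaf_conditions_if_limit_bichar_cond:
  assumes lim: "limit_bichar_cond U p q" and w0: "w0 \<in> S"
  obtains U' where "conic_open U'" "w0 \<in> U'" "U' \<subseteq> U" "leaf_conditions U' p q"
proof -
  obtain d' \<xi> A where frame: "sympl_frame U S d' \<xi>" "quadratic_coeffs S (\<lambda>z. Re (p z)) d' \<xi> A"
    and nolim: "\<forall>V\<in>limit_fields d' \<xi> A g. \<forall>\<gamma> a b. orbit S V \<gamma> a b \<longrightarrow>
           \<not> (\<exists>s s'. a \<le> s \<and> s < s' \<and> s' \<le> b \<and> Im (p (\<gamma> s) + q (\<gamma> s)) < 0 \<and> 0 < Im (p (\<gamma> s') + q (\<gamma> s')))"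
    using lim unfolding limit_bichar_cond_def by blast
  have nolim': False if V: "V \<in> limit_fields d' \<xi> A g" and o: "orbit S V \<gamma> a b"
    and s: "a \<le> s" "s < s'" "s' \<le> b" and sgn: "f (\<gamma> s) < 0" "0 < f (\<gamma> s')" for V \<gamma> a b s s'
  proof -
    have "\<gamma> s \<in> S" "\<gamma> s' \<in> S" using o s by (auto simp: orbit_def)
    then have "Im (p (\<gamma> s) + q (\<gamma> s)) < 0" "0 < Im (p (\<gamma> s') + q (\<gamma> s'))" using sgn by (auto simp: Sigma2_def)
    then show False using bspec[OF nolim V] o s by blast
  qed
  obtain U1 D d n m \<zeta> x gt where ch: "involutive_chart U1 S d n m \<zeta> x" "w0 \<in> U1" "U1 \<subseteq> U"
    "open D" "w0 \<in> D" "D \<subseteq> U1" "smooth_on D gt" "\<And>z. z \<in> S \<inter> D \<Longrightarrow> gt z = g z"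
    "\<And>z a. z \<in> D \<Longrightarrow> poisson gt (\<lambda>z. a \<bullet> \<zeta> z) z = 0"
    "\<And>z. z \<in> D \<Longrightarrow> frechet_derivative x (at z) (ham gt z) = 0"
    by (rule chart_exists[OF w0], rule that; assumption)
  have "char_chart U p q r U1 d n m \<zeta> x"
    by (intro char_chart.intro double_char_axioms ch(1) char_chart_axioms.intro ch(3))
  then interpret flow_chart U p q r U1 d n m \<zeta> x D gt w0
    by (rule flow_chart.intro) (rule flow_chart_axioms.intro; fact w0 ch)
  obtain \<Theta> L R1 where \<Theta>: "0 < R1" "cball w0 R1 \<subseteq> U1" "1 \<le> L" "\<And>j. linear (\<lambda>c. \<Theta> c j)"
    "\<And>c. frechet_derivative x (at w0) (leaf_field d' \<xi> A (\<Theta> c) w0) = \<pi> c"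
    "\<And>c w w'. w \<in> S \<Longrightarrow> w \<in> cball w0 R1 \<Longrightarrow> w' \<in> S \<Longrightarrow> w' \<in> cball w0 R1 \<Longrightarrow>
       norm (frechet_derivative x (at w) (leaf_field d' \<xi> A (\<Theta> c) w) - frechet_derivative x (at w') (leaf_field d' \<xi> A (\<Theta> c) w'))
         \<le> L * norm c * norm (w - w')"
    by (rule normalized_leaf_field[OF frame w0(1) ch(2)], rule that; assumption)
  \<comment> \<open>The velocity of the flow of \<open>gt\<close> at \<open>w0\<close> after
    projection to the sphere, nonzero because the field is not radial. Along the flow
    \<open>\<tau>\<close> has the derivative \<open>v0 \<bullet> v0\<close> at \<open>w0\<close>,
    hence more than half of it nearby.\<close>
  define v0 where "v0 = frechet_derivative (rescale (norm (snd w0))) (at w0) (ham gt w0)"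
  define \<tau> where "\<tau> z = v0 \<bullet> rescale (norm (snd w0)) z" for z
  have U1s: "snd z \<noteq> 0" if "z \<in> U1" for z using that chart.U by (auto simp: conic_open_def)
  have v0: "v0 \<noteq> 0"
    unfolding v0_def using rescale_deriv_radial[OF U1s[OF ch(2)], of "ham gt w0"] ham_gt_nonradial by metis
  have sr: "smooth_on D (rescale (norm (snd w0)))" by (rule smooth_on_subset[OF smooth_on_rescale]) (use U1s D in auto)
  have s\<tau>: "smooth_on D \<tau>" unfolding \<tau>_def[abs_def] by (rule smooth_on_bounded_linear[OF bounded_linear_inner_right D(1) sr])
  have d\<tau>: "frechet_derivative \<tau> (at w0) (ham gt w0) = v0 \<bullet> v0"
    unfolding \<tau>_def[abs_def]
    using fun_cong[OF frechet_derivative_eqI[OF bounded_linear.has_derivative[OF bounded_linear_inner_right smooth_on_has_derivative[OF sr ch(5)]]]]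
    by (simp add: v0_def)
  define h where "h w = frechet_derivative \<tau> (at w) (ham gt w)" for w
  have "smooth_on D h" unfolding h_def[abs_def] by (intro smooth_on_deriv_apply D(1) s\<tau> smooth_on_ham smooth_gt)
  then have "continuous_on D h" by (rule smooth_on_imp_continuous_on)
  then have "open (h -` {v0 \<bullet> v0 / 2 <..} \<inter> D)"
    by (rule continuous_on_open_vimage[OF D(1), THEN iffD1, rule_format]) simp
  moreover have "w0 \<in> h -` {v0 \<bullet> v0 / 2 <..}" using d\<tau> v0 by (simp add: h_def)
  ultimately have N: "open (h -` {v0 \<bullet> v0 / 2 <..} \<inter> D \<inter> ball w0 R1)" "w0 \<in> h -` {v0 \<bullet> v0 / 2 <..} \<inter> D \<inter> ball w0 R1"
    using ch(5) \<Theta>(1) by auto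
  obtain R M where cf: "commuting_fields F (\<lambda>c w. frechet_derivative (F c) (at w)) w0 R M"
    and cb: "cball w0 R \<subseteq> h -` {v0 \<bullet> v0 / 2 <..} \<inter> D \<inter> ball w0 R1"
    by (rule commuting_fields_exists[OF N, of F]) (auto intro: linear_F commute_F smooth_on_subset[OF smooth_F])
  have "cball w0 R \<subseteq> D" using cb by blast
  then interpret flow_box U p q r U1 d n m \<zeta> x D gt w0 R M
    by (intro flow_box.intro flow_chart_axioms flow_box_axioms.intro cf)
  have cb1: "w \<in> cball w0 R1" if "w \<in> cball w0 R" for w using that cb by fastforce
  obtain \<rho> where \<rho>: "0 < \<rho>" "\<And>z T y. z \<in> S \<Longrightarrow> z \<in> cball w0 \<rho> \<Longrightarrow> 0 \<le> T \<Longrightarrow> T \<le> \<rho> \<Longrightarrow> norm y \<le> \<rho> \<Longrightarrow>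
     f z < 0 \<Longrightarrow> 0 < f (\<Gamma> z (T, y)) \<Longrightarrow> False"
  proof (rule no_sign_change_\<Gamma>[OF frame _ \<Theta>(3,4,5)])
    show False if "V \<in> limit_fields d' \<xi> A g" "orbit S V \<gamma> a b" "a \<le> s" "s < s'" "s' \<le> b" "f (\<gamma> s) < 0" "0 < f (\<gamma> s')" for V \<gamma> a b s s'
      by (rule nolim'[OF that])
    show "norm (frechet_derivative x (at w) (leaf_field d' \<xi> A (\<Theta> c) w) - frechet_derivative x (at w') (leaf_field d' \<xi> A (\<Theta> c) w'))
         \<le> L * norm c * norm (w - w')" if "w \<in> S" "w \<in> cball w0 R" "w' \<in> S" "w' \<in> cball w0 R" for c w w'
      by (intro \<Theta>(6) that cb1)
  qed (rule that; assumption)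
  show ?thesis
  proof (rule leaf_conditions_near[OF \<rho>(1), of "v0 \<bullet> v0 / 2" v0])
    show False if "z \<in> S" "z \<in> cball w0 \<rho>" "0 \<le> T" "T \<le> \<rho>" "norm y \<le> \<rho>" "f z < 0" "0 < f (\<Gamma> z (T, y))" for z T y
      by (rule \<rho>(2)[OF that])
    show "0 < v0 \<bullet> v0 / 2" using v0 by simp
    show "v0 \<bullet> v0 / 2 \<le> frechet_derivative (\<lambda>z. v0 \<bullet> rescale (norm (snd w0)) z) (at w) (ham gt w)" if "w \<in> cball w0 R" for w
      using that cb by (auto simp: h_def \<tau>_def[abs_def])
    fix U' assume "conic_open U'" "w0 \<in> U'" "U' \<subseteq> U1" "leaf_conditions U' p q"
    then show thesis using ch(3) by (intro that[of U']) auto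
  qed
qed

section \<open>Elliptic multipliers\<close>

text \<open>\<open>\<phi>\<close> is the inverse of a primitive of \<open>1 / k\<close>. Outside the
  interval \<open>k\<close> is continued by its boundary values, so that the primitive lives on a
  larger open interval and two-sided derivatives exist at the end points too.\<close>

lemma time_change:
  fixes k :: "real \<Rightarrow> real"
  assumes k: "continuous_on {a..b} k" "\<And>s. s \<in> {a..b} \<Longrightarrow> 0 < k s" and ab: "a < b"
  obtains \<phi> T where "0 < T" "\<phi> 0 = a" "\<phi> T = b" "\<And>t. t \<in> {0..T} \<Longrightarrow> \<phi> t \<in> {a..b}"
    "\<And>t. t \<in> {0..T} \<Longrightarrow> (\<phi> has_real_derivative k (\<phi> t)) (at t)"
proof -
  define c where "c s = max a (min b s)" for s
  have c: "c s \<in> {a..b}" for s using ab by (auto simp: c_def)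
  have cc: "c s = s" if "s \<in> {a..b}" for s using that by (auto simp: c_def)
  have "continuous_on {a-1..b+1} c" unfolding c_def[abs_def] by (intro continuous_intros)
  then have "continuous_on {a-1..b+1} (\<lambda>s. k (c s))"
    by (rule continuous_on_compose2[OF k(1)]) (use c in blast)
  then have "continuous_on {a-1..b+1} (\<lambda>s. inverse (k (c s)))"
    using k(2)[OF c] by (intro continuous_on_inverse) (auto simp: less_imp_neq[symmetric])
  then obtain \<psi> where \<psi>: "\<And>s. s \<in> {a-1..b+1} \<Longrightarrow> (\<psi> has_vector_derivative inverse (k (c s))) (at s within {a-1..b+1})"
    by (rule antiderivative_continuous) blast
  have D\<psi>: "(\<psi> has_real_derivative inverse (k (c s))) (at s)" if "a - 1 < s" "s < b + 1" for s
    using \<psi>[of s] that at_within_interior[of s "{a-1..b+1}"] by (simp add: has_real_derivative_iff_has_vector_derivative)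
  let ?I = "{a - 1 <..< b + 1}"
  have mono: "\<psi> s < \<psi> s'" if "s \<in> ?I" "s' \<in> ?I" "s < s'" for s s'
  proof (rule DERIV_pos_imp_increasing[OF that(3)])
    fix u assume "s \<le> u" "u \<le> s'"
    then show "\<exists>y. DERIV \<psi> u :> y \<and> 0 < y" using that k(2)[OF c, of u] by (intro exI[of _ "inverse (k (c u))"] conjI D\<psi>) auto
  qed
  then have inj: "inj_on \<psi> ?I" by (intro linorder_inj_onI) force+
  have cont: "isCont \<psi> s" if "s \<in> ?I" for s using D\<psi>[of s] that by (intro DERIV_isCont) auto
  define \<Psi> where "\<Psi> s = \<psi> s - \<psi> a" for s
  define \<phi> where "\<phi> t = inv_into ?I \<psi> (\<psi> a + t)" for t
  have \<phi>\<Psi>: "\<phi> (\<Psi> s) = s" if "s \<in> ?I" for s using inv_into_f_f[OF inj that] by (simp add: \<phi>_def \<Psi>_def)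
  have surj: "\<exists>s\<in>{u..u'}. \<Psi> s = t" if "u \<in> ?I" "u' \<in> ?I" "u \<le> u'" "\<Psi> u \<le> t" "t \<le> \<Psi> u'" for t u u'
  proof -
    have "\<exists>s\<ge>u. s \<le> u' \<and> \<psi> s = t + \<psi> a"
      using that by (intro IVT') (auto simp: \<Psi>_def intro!: continuous_at_imp_continuous_on cont)
    then obtain s where "u \<le> s" "s \<le> u'" "\<psi> s = t + \<psi> a" by blast
    then show ?thesis by (intro bexI[of _ s]) (auto simp: \<Psi>_def)
  qed
  have aI: "a \<in> ?I" "b \<in> ?I" "a - 1 / 2 \<in> ?I" "b + 1 / 2 \<in> ?I" using ab by auto
  have T: "0 < \<Psi> b" using mono[OF aI(1,2) ab] by (simp add: \<Psi>_def)
  show ?thesis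
  proof (rule that[OF T])
    show "\<phi> 0 = a" using \<phi>\<Psi>[OF aI(1)] by (simp add: \<Psi>_def)
    show "\<phi> (\<Psi> b) = b" by (rule \<phi>\<Psi>[OF aI(2)])
    fix t assume t: "t \<in> {0..\<Psi> b}"
    obtain s where s: "s \<in> {a..b}" "\<Psi> s = t" using surj[OF aI(1,2), of t] t ab by (auto simp: \<Psi>_def)
    have sI: "s \<in> ?I" using s by auto
    have \<phi>t: "\<phi> t = s" using \<phi>\<Psi>[OF sI] s(2) by simp
    show "\<phi> t \<in> {a..b}" using \<phi>t s by simp
    have cont\<Psi>: "isCont \<Psi> z" if "z \<in> ?I" for z unfolding \<Psi>_def[abs_def] by (intro continuous_intros cont that)
    have zI: "z \<in> ?I" if "\<bar>z - s\<bar> \<le> 1 / 2" for z using that s(1) unfolding abs_le_iff by auto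
    have "isCont \<phi> (\<Psi> s)"
      by (rule isCont_inverse_function[of "1/2" s \<phi> \<Psi>]) (auto intro!: \<phi>\<Psi>[OF zI] cont\<Psi>[OF zI])
    then have ct: "isCont \<phi> t" by (simp add: s(2))
    have "DERIV \<Psi> (\<phi> t) :> inverse (k (c s))"
      unfolding \<phi>t \<Psi>_def[abs_def] using sI D\<psi>[of s] by (auto intro!: derivative_eq_intros)
    moreover have "\<Psi> (a - 1 / 2) < t" "t < \<Psi> (b + 1 / 2)"
      using mono[OF aI(3,1)] mono[OF aI(2,4)] t by (auto simp: \<Psi>_def)
    moreover have "\<Psi> (\<phi> y) = y" if y: "\<Psi> (a - 1 / 2) < y" "y < \<Psi> (b + 1 / 2)" for y
    proof -
      obtain u where u: "u \<in> {a - 1 / 2..b + 1 / 2}" "\<Psi> u = y" using surj[OF aI(3,4), of y] y ab by auto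
      then show ?thesis using \<phi>\<Psi>[of u] by auto
    qed
    moreover have "inverse (k (c s)) \<noteq> 0" using k(2)[OF c, of s] by simp
    ultimately have "DERIV \<phi> t :> inverse (inverse (k (c s)))"
      by (intro DERIV_inverse_function[OF _ _ _ _ _ ct])
    then show "(\<phi> has_real_derivative k (\<phi> t)) (at t)" using s(1) by (simp add: cc \<phi>t)
  qed
qed

lemma leaf_sign_scale:
  assumes h: "\<And>z. z \<in> L \<Longrightarrow> h z = c z * g z"
  shows "(\<And>z. z \<in> L \<Longrightarrow> 0 < c z) \<Longrightarrow> leaf_sign h L = leaf_sign g L"
    and "(\<And>z. z \<in> L \<Longrightarrow> c z < 0) \<Longrightarrow> leaf_sign h L = - leaf_sign g L"
proof -
  assume "\<And>z. z \<in> L \<Longrightarrow> 0 < c z"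
  then have "0 \<le> h z \<longleftrightarrow> 0 \<le> g z" "h z \<le> 0 \<longleftrightarrow> g z \<le> 0" "h z = 0 \<longleftrightarrow> g z = 0" if "z \<in> L" for z
    using that by (force simp: h zero_le_mult_iff mult_le_0_iff)+
  then show "leaf_sign h L = leaf_sign g L" unfolding leaf_sign_def by (simp cong: ball_cong bex_cong)
next
  assume "\<And>z. z \<in> L \<Longrightarrow> c z < 0"
  then have "0 \<le> h z \<longleftrightarrow> g z \<le> 0" "h z \<le> 0 \<longleftrightarrow> 0 \<le> g z" "h z = 0 \<longleftrightarrow> g z = 0" if "z \<in> L" for z
    using that by (force simp: h zero_le_mult_iff mult_le_0_iff)+
  then have "leaf_sign h L = (if (\<forall>z\<in>L. g z \<le> 0) \<and> (\<exists>z\<in>L. g z \<noteq> 0) then 1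
      else if (\<forall>z\<in>L. 0 \<le> g z) \<and> (\<exists>z\<in>L. g z \<noteq> 0) then -1 else 0)"
    unfolding leaf_sign_def by (simp cong: ball_cong bex_cong)
  \<comment> \<open>A function that is both nonnegative and nonpositive on \<open>L\<close> vanishes
    there, so the order in which \<open>leaf_sign\<close> makes its two tests does not
    matter.\<close>
  moreover have "\<not> ((\<forall>z\<in>L. g z \<le> 0) \<and> (\<forall>z\<in>L. 0 \<le> g z) \<and> (\<exists>z\<in>L. g z \<noteq> 0))" by (meson order_antisym)
  ultimately show "leaf_sign h L = - leaf_sign g L" unfolding leaf_sign_def by auto
qed

lemma nonzero_constant_sign:
  fixes k :: "real \<Rightarrow> real"
  assumes "continuous_on {a..b} k" "\<And>s. s \<in> {a..b} \<Longrightarrow> k s \<noteq> 0" "s \<in> {a..b}" "s' \<in> {a..b}"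
  shows "0 < k s \<longleftrightarrow> 0 < k s'"
proof -
  have c: "connected (k ` {a..b})" by (intro connected_continuous_image assms) simp
  have m: "k s \<in> k ` {a..b}" "k s' \<in> k ` {a..b}" "0 \<notin> k ` {a..b}" using assms by auto
  have "\<not> (k s \<le> 0 \<and> 0 \<le> k s')" "\<not> (k s' \<le> 0 \<and> 0 \<le> k s)"
    using connectedD_interval[OF c m(1,2), of 0] connectedD_interval[OF c m(2,1), of 0] m(3) by auto
  then show ?thesis by linarith
qed

lemma double_char_restrict:
  assumes "double_char U p q r" "conic_open U'" "U' \<subseteq> U" shows "double_char U' p q r"
proof -
  interpret double_char U p q r by fact
  show ?thesis
    using hom_p hom_q assms(2,3)
    by unfold_locales (auto intro: smooth_on_subset[OF smooth_p] smooth_on_subset[OF smooth_q] conic_open_open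
       real_double_char_restrict[OF rdc _ assms(3)] real_subprincipal_type_restrict[OF rst _ assms(3)] simp: homogeneous_def subset_iff)
qed

lemma double_char_multiplier:
  assumes "double_char U p q r" "sub_r_multiplier U p q a"
  shows "double_char U (\<lambda>z. a z * p z) (\<lambda>z. a z * q z) r"
proof -
  interpret double_char U p q r by fact
  have a: "smooth_on U a" "homogeneous 0 U a" using assms(2) by (auto simp: sub_r_multiplier_def)
  have "homogeneous s U (\<lambda>z. a z * b z)" if "homogeneous s U b" for s and b :: "'a phase \<Rightarrow> complex"
    using a(2) that by (simp add: homogeneous_def)
  then show ?thesis
    using assms(2) hom_p hom_q
    by unfold_locales (auto simp: sub_r_multiplier_def intro!: domain smooth_on_mult open_domain smooth_p smooth_q a)
qed

locale multiplier = double_char U p q r for U :: "'n::finite phase set" and p q r +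
  fixes a :: "'n phase \<Rightarrow> complex"
  assumes mult: "sub_r_multiplier U p q a"
begin

lemma smooth_a: "smooth_on U a" and a_nonzero: "z \<in> U \<Longrightarrow> a z \<noteq> 0"
  using mult by (auto simp: sub_r_multiplier_def)

text \<open>At a zero of \<open>p\<close> the product rule leaves only \<open>a\<close> times the
  differential of \<open>p\<close>, and \<open>a\<close> has no zeros.\<close>

lemma Sigma2_mult: "Sigma2 U (\<lambda>z. a z * p z) = S"
proof -
  have "a z * p z = 0 \<and> (\<forall>v. frechet_derivative (\<lambda>z. a z * p z) (at z) v = 0) \<longleftrightarrow> p z = 0 \<and> (\<forall>v. frechet_derivative p (at z) v = 0)"
    if z: "z \<in> U" for z
  proof (cases "p z = 0")
    case True
    then have "frechet_derivative (\<lambda>z. a z * p z) (at z) v = a z * frechet_derivative p (at z) v" for v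
      using fun_cong[OF frechet_derivative_eqI[OF has_derivative_mult[OF smooth_on_has_derivative[OF smooth_a z] smooth_on_has_derivative[OF smooth_p z]]]]
      by simp
    then show ?thesis using True a_nonzero[OF z] by simp
  qed (use a_nonzero[OF z] in simp)
  then show ?thesis unfolding Sigma2_def by (intro Collect_cong) blast
qed

text \<open>\<open>p\<close> cannot vanish near a point of \<open>\<Sigma>\<^sub>2\<close>, since then \<open>\<Sigma>\<^sub>2\<close> would be open there. Where it does not vanish, \<open>a\<close> is real.\<close>

lemma a_real:
  assumes w: "w \<in> S" shows "Im (a w) = 0"
proof (rule ccontr)
  assume ne: "Im (a w) \<noteq> 0"
  have wU: "w \<in> U" using w Sigma2_subset by auto
  have "continuous_on U (\<lambda>z. Im (a z))"
    by (rule smooth_on_imp_continuous_on[OF smooth_on_bounded_linear[OF bounded_linear_Im open_domain smooth_a]])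
  then have "open ((\<lambda>z. Im (a z)) -` (- {0}) \<inter> U)"
    by (rule continuous_on_open_vimage[OF open_domain, THEN iffD1, rule_format]) auto
  moreover define W where "W = (\<lambda>z. Im (a z)) -` (- {0}) \<inter> U"
  ultimately have W: "open W" "w \<in> W" "W \<subseteq> U" using ne wU by auto
  have p0: "p z = 0" if "z \<in> W" for z
  proof -
    have "z \<in> U" using that W by auto
    then have "Im (p z) = 0" "Im (a z * p z) = 0" "Im (a z) \<noteq> 0"
      using rdc mult that by (auto simp: real_double_char_def sub_r_multiplier_def W_def)
    then show "p z = 0" by (simp add: complex_eq_iff)
  qed
  have WS: "W \<subseteq> S"
  proof
    fix z assume z: "z \<in> W"
    have "frechet_derivative p (at z) = frechet_derivative (\<lambda>_. 0) (at z)" by (rule frechet_derivative_cong_open(1)[OF W(1) z p0])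
    then show "z \<in> S" using z p0 W(3) by (auto simp: Sigma2_def)
  qed
  have sub: "submanifold S" using rdc by (simp add: real_double_char_def)
  obtain V d and u :: "nat \<Rightarrow> 'n phase \<Rightarrow> real" where *: "open V" "w \<in> V" "0 < d" "\<And>j. j < d \<Longrightarrow> smooth_on V (u j)"
    "S \<inter> V = {z\<in>V. \<forall>j<d. u j z = 0}" "\<And>z. z \<in> V \<Longrightarrow> independent_at d u z"
    by (rule submanifoldE[OF sub w]) blast
  have "frechet_derivative (u j) (at w) = frechet_derivative (\<lambda>_. 0) (at w)" if "j < d" for j
  proof (rule frechet_derivative_cong_open(1))
    show "open (V \<inter> W)" "w \<in> V \<inter> W" using * W by auto
    show "u j z = 0" if "z \<in> V \<inter> W" for z using that WS *(5) \<open>j < d\<close> by blast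
  qed
  then have "\<forall>v. (\<Sum>j<d. 1 * frechet_derivative (u j) (at w) v) = 0" by simp
  from spec[OF *(6)[OF *(2), unfolded independent_at_def], of "\<lambda>_. 1"] this *(3) show False by simp
qed

definition "\<alpha> z = Re (a z)"

lemma a_eq: "w \<in> S \<Longrightarrow> a w = of_real (\<alpha> w)"
  using a_real by (simp add: \<alpha>_def complex_eq_iff)

lemma \<alpha>_nonzero: "w \<in> S \<Longrightarrow> \<alpha> w \<noteq> 0"
  using a_eq[of w] a_nonzero[of w] Sigma2_subset[of U p] by auto

lemma Im_mult: "w \<in> S \<Longrightarrow> Im (a w * q w) = \<alpha> w * f w" and Re_mult: "w \<in> S \<Longrightarrow> Re (a w * q w) = \<alpha> w * g w"
  by (simp_all add: a_eq)

lemma \<alpha>_constant_sign: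
  fixes \<gamma> :: "real \<Rightarrow> 'n phase"
  assumes "continuous_on {s..s'} \<gamma>" "\<And>u. u \<in> {s..s'} \<Longrightarrow> \<gamma> u \<in> S" "t \<in> {s..s'}" "t' \<in> {s..s'}"
  shows "0 < \<alpha> (\<gamma> t) \<longleftrightarrow> 0 < \<alpha> (\<gamma> t')"
proof (rule nonzero_constant_sign[of s s' "\<lambda>u. \<alpha> (\<gamma> u)"])
  show "continuous_on {s..s'} (\<lambda>u. \<alpha> (\<gamma> u))"
    unfolding \<alpha>_def using assms(2) Sigma2_subset[of U p]
    by (intro continuous_on_Re continuous_on_compose2[OF smooth_on_imp_continuous_on[OF smooth_a] assms(1)]) auto
qed (use assms \<alpha>_nonzero in auto)

lemma leaf_subset: "z \<in> leaf S w \<Longrightarrow> z \<in> S"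
  unfolding leaf_def by force

lemma \<alpha>_leaf:
  assumes "z \<in> leaf S w" shows "0 < \<alpha> z \<longleftrightarrow> 0 < \<alpha> w"
proof -
  obtain \<gamma> where \<gamma>: "\<gamma> (0::real) = w" "\<gamma> 1 = z" and s: "\<And>s. s \<in> {0..1} \<Longrightarrow> \<gamma> s \<in> S \<and>
        (\<exists>v\<in>tangent_ann S (\<gamma> s). (\<gamma> has_vector_derivative v) (at s within {0..1}))"
    using assms unfolding leaf_def by blast
  have "continuous_on {0..1} \<gamma>"
    unfolding continuous_on_eq_continuous_within using s has_vector_derivative_continuous by blast
  from \<alpha>_constant_sign[OF this, of 1 0] show ?thesis using s \<gamma> by auto
qed

lemma leaf_sign_mult:
  assumes "w \<in> S"
  shows "leaf_sign (\<lambda>z. Im (a z * q z)) (leaf S w) = (if 0 < \<alpha> w then leaf_sign f (leaf S w) else - leaf_sign f (leaf S w))"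
proof -
  have h: "Im (a z * q z) = \<alpha> z * f z" if "z \<in> leaf S w" for z using Im_mult leaf_subset[OF that] .
  have "z \<in> leaf S w \<Longrightarrow> 0 < \<alpha> z" if "0 < \<alpha> w" for z using \<alpha>_leaf that by blast
  moreover have "z \<in> leaf S w \<Longrightarrow> \<alpha> z < 0" if "\<not> 0 < \<alpha> w" for z
    using \<alpha>_leaf[of z w] \<alpha>_nonzero[OF leaf_subset, of z w] that by auto
  ultimately show ?thesis using leaf_sign_scale[of "leaf S w" "\<lambda>z. Im (a z * q z)" \<alpha> f, OF h] by auto
qed

lemma no_sign_change_on_leaves_mult:
  assumes "no_sign_change_on_leaves U (\<lambda>z. a z * p z) (\<lambda>z. a z * q z)"
  shows "no_sign_change_on_leaves U p q"
  unfolding no_sign_change_on_leaves_def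
proof (intro ballI notI, elim bexE conjE)
  fix w z z' assume w: "w \<in> S" and z: "z \<in> leaf S w" "z' \<in> leaf S w" "f z < 0" "0 < f z'"
  have no: "\<not> (\<exists>z\<in>leaf S w. \<exists>z'\<in>leaf S w. Im (a z * q z) < 0 \<and> 0 < Im (a z' * q z'))"
    using assms w unfolding no_sign_change_on_leaves_def Sigma2_mult by blast
  have S: "z \<in> S" "z' \<in> S" using z leaf_subset by auto
  have e: "0 < \<alpha> z \<longleftrightarrow> 0 < \<alpha> z'" using \<alpha>_leaf z by blast
  show False
  proof (cases "0 < \<alpha> z")
    case True
    then have "Im (a z * q z) < 0" "0 < Im (a z' * q z')" using z e unfolding Im_mult[OF S(1)] Im_mult[OF S(2)] by (auto simp: mult_less_0_iff zero_less_mult_iff)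
    then show False using no z by blast
  next
    case False
    then have "\<alpha> z < 0" "\<alpha> z' < 0" using e \<alpha>_nonzero[OF S(1)] \<alpha>_nonzero[OF S(2)] by linarith+
    then have "Im (a z' * q z') < 0" "0 < Im (a z * q z)" using z unfolding Im_mult[OF S(1)] Im_mult[OF S(2)] by (auto simp: mult_less_0_iff zero_less_mult_iff)
    then show False using no z by blast
  qed
qed

text \<open>On \<open>Sigma2\<close> the function is \<open>\<alpha>\<close> times
  \<open>Re q\<close>, and the derivative of \<open>\<alpha>\<close> enters with the factor
  \<open>Re q\<close>, which vanishes on this level. Only tangential derivatives are compared, since
  \<open>a\<close> is known to be real only on \<open>Sigma2\<close>.\<close>

lemma deriv_mult_level_0:
  assumes w: "w \<in> S" "g w = 0" and v: "v \<in> tangent S w"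
  shows "frechet_derivative (\<lambda>z. Re (a z * q z)) (at w) v = \<alpha> w * frechet_derivative g (at w) v"
proof -
  have wU: "w \<in> U" using w Sigma2_subset by auto
  have s: "smooth_on U (\<lambda>z. Re (a z * q z))" "smooth_on U \<alpha>"
    unfolding \<alpha>_def[abs_def]
    by (rule smooth_on_bounded_linear[OF bounded_linear_Re open_domain] smooth_on_mult open_domain smooth_a smooth_q)+
  have "((\<lambda>z. \<alpha> z * g z) has_derivative (\<lambda>v. \<alpha> w * frechet_derivative g (at w) v + frechet_derivative \<alpha> (at w) v * g w)) (at w)"
    by (rule has_derivative_mult[OF smooth_on_has_derivative[OF s(2) wU] smooth_on_has_derivative[OF smooth_g wU]])
  from has_derivative_diff[OF smooth_on_has_derivative[OF s(1) wU] this]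
  have "frechet_derivative (\<lambda>z. Re (a z * q z)) (at w) v - (\<alpha> w * frechet_derivative g (at w) v + frechet_derivative \<alpha> (at w) v * g w) = 0"
    by (rule tangent_deriv_zero[OF v _ open_domain wU, of _ _ 0]) (elim IntE, simp only: Re_mult diff_self)
  then show ?thesis using w(2) by simp
qed

lemma no_leaf_sign_change_at_0_mult:
  assumes no: "no_leaf_sign_change_at U (\<lambda>z. a z * p z) (\<lambda>z. a z * q z) 0"
  shows "no_leaf_sign_change_at U p q 0"
  unfolding no_leaf_sign_change_at_def
proof (intro allI impI notI, elim exE conjE)
  fix \<gamma> b b' s s' assume bi: "subprincipal_bichar S g 0 \<gamma> b b'" and s: "b \<le> s" "s < s'" "s' \<le> b'"
    and ls: "leaf_sign f (leaf S (\<gamma> s)) = -1" "leaf_sign f (leaf S (\<gamma> s')) = 1"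
  have sub: "{s..s'} \<subseteq> {b..b'}" using s by auto
  have \<gamma>: "\<gamma> u \<in> S" "g (\<gamma> u) = 0" "\<exists>v\<in>tangent S (\<gamma> u). (\<gamma> has_vector_derivative v) (at u within {s..s'}) \<and>
           (\<forall>v'\<in>tangent S (\<gamma> u). symp v' v = frechet_derivative g (at (\<gamma> u)) v')" if "u \<in> {s..s'}" for u
  proof -
    have u: "u \<in> {b..b'}" using that sub by auto
    show "\<gamma> u \<in> S" "g (\<gamma> u) = 0" using bi u unfolding subprincipal_bichar_def by blast+
    obtain v where "v\<in>tangent S (\<gamma> u)" "(\<gamma> has_vector_derivative v) (at u within {b..b'})"
           "\<forall>v'\<in>tangent S (\<gamma> u). symp v' v = frechet_derivative g (at (\<gamma> u)) v'"
      using bi u unfolding subprincipal_bichar_def by blast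
    then show "\<exists>v\<in>tangent S (\<gamma> u). (\<gamma> has_vector_derivative v) (at u within {s..s'}) \<and>
           (\<forall>v'\<in>tangent S (\<gamma> u). symp v' v = frechet_derivative g (at (\<gamma> u)) v')"
      using has_vector_derivative_within_subset[OF _ sub] by blast
  qed
  have cont: "continuous_on {s..s'} \<gamma>"
    unfolding continuous_on_eq_continuous_within using \<gamma>(3) has_vector_derivative_continuous by blast
  have "continuous_on {s..s'} (\<lambda>u. \<bar>\<alpha> (\<gamma> u)\<bar>)"
    unfolding \<alpha>_def using \<gamma>(1) Sigma2_subset[of U p]
    by (intro continuous_intros continuous_on_compose2[OF smooth_on_imp_continuous_on[OF smooth_a] cont]) auto
  moreover have "0 < \<bar>\<alpha> (\<gamma> u)\<bar>" if "u \<in> {s..s'}" for u using \<alpha>_nonzero[OF \<gamma>(1)[OF that]] by simp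
  ultimately obtain \<phi> T where \<phi>: "0 < T" "\<phi> 0 = s" "\<phi> T = s'" "\<And>t. t \<in> {0..T} \<Longrightarrow> \<phi> t \<in> {s..s'}"
    "\<And>t. t \<in> {0..T} \<Longrightarrow> (\<phi> has_real_derivative \<bar>\<alpha> (\<gamma> (\<phi> t))\<bar>) (at t)"
    by (rule time_change[OF _ _ s(2)]) blast+
  \<comment> \<open>The speed \<open>\<alpha>\<close> may have either sign: for positive
    \<open>\<alpha>\<close> the time change \<open>\<phi>\<close> is inserted for
    \<open>\<psi>\<close>, for negative \<open>\<alpha>\<close> its reversal.\<close>
  have bich: "subprincipal_bichar S (\<lambda>z. Re (a z * q z)) 0 (\<lambda>t. \<gamma> (\<psi> t)) 0 T"
    if \<psi>: "\<And>t. t \<in> {0..T} \<Longrightarrow> \<psi> t \<in> {s..s'}" "\<And>t. t \<in> {0..T} \<Longrightarrow> (\<psi> has_real_derivative \<alpha> (\<gamma> (\<psi> t))) (at t within {0..T})" for \<psi>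
    unfolding subprincipal_bichar_def
  proof (intro ballI conjI)
    fix t assume t: "t \<in> {0..T}"
    note c = \<psi>(1)[OF t]
    show "\<gamma> (\<psi> t) \<in> S" by (rule \<gamma>(1)[OF c])
    show "Re (a (\<gamma> (\<psi> t)) * q (\<gamma> (\<psi> t))) = 0" using Re_mult[OF \<gamma>(1)[OF c]] \<gamma>(2)[OF c] by simp
    obtain v where v: "v\<in>tangent S (\<gamma> (\<psi> t))" "(\<gamma> has_vector_derivative v) (at (\<psi> t) within {s..s'})"
           "\<And>v'. v'\<in>tangent S (\<gamma> (\<psi> t)) \<Longrightarrow> symp v' v = frechet_derivative g (at (\<gamma> (\<psi> t))) v'"
      using \<gamma>(3)[OF c] by blast
    have "(\<gamma> has_vector_derivative v) (at (\<psi> t) within \<psi> ` {0..T})"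
      by (rule has_vector_derivative_within_subset[OF v(2)]) (use \<psi>(1) in auto)
    with \<psi>(2)[OF t] have d: "((\<lambda>t. \<gamma> (\<psi> t)) has_vector_derivative \<alpha> (\<gamma> (\<psi> t)) *\<^sub>R v) (at t within {0..T})"
      using vector_diff_chain_within[of \<psi> "\<alpha> (\<gamma> (\<psi> t))" t "{0..T}" \<gamma> v] by (simp add: o_def has_real_derivative_iff_has_vector_derivative)
    obtain U1 D d n m \<zeta> x gt where "involutive_chart U1 S d n m \<zeta> x" "\<gamma> (\<psi> t) \<in> U1"
      by (rule chart_exists[OF \<gamma>(1)[OF c]])
    then have "\<alpha> (\<gamma> (\<psi> t)) *\<^sub>R v \<in> tangent S (\<gamma> (\<psi> t))"
      using v(1) involutive_chart.tangent_S[OF _ \<gamma>(1)[OF c]] linear_cmul[OF smooth_on_deriv_linear[OF involutive_chart.smooth_\<zeta>]]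
      by fastforce
    moreover have "symp v' (\<alpha> (\<gamma> (\<psi> t)) *\<^sub>R v) = frechet_derivative (\<lambda>z. Re (a z * q z)) (at (\<gamma> (\<psi> t))) v'" if "v' \<in> tangent S (\<gamma> (\<psi> t))" for v'
      using deriv_mult_level_0[OF \<gamma>(1,2)[OF c] that] v(3)[OF that] by (simp add: symp_simps)
    ultimately show "\<exists>v\<in>tangent S (\<gamma> (\<psi> t)). ((\<lambda>t. \<gamma> (\<psi> t)) has_vector_derivative v) (at t within {0..T}) \<and>
      (\<forall>v'\<in>tangent S (\<gamma> (\<psi> t)). symp v' v = frechet_derivative (\<lambda>z. Re (a z * q z)) (at (\<gamma> (\<psi> t))) v')"
      using d by blast
  qed
  have sgn: "0 < \<alpha> (\<gamma> u) \<longleftrightarrow> 0 < \<alpha> (\<gamma> s)" if "u \<in> {s..s'}" for u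
    using s by (intro \<alpha>_constant_sign[OF cont \<gamma>(1)] that) auto
  have S: "\<gamma> s \<in> S" "\<gamma> s' \<in> S" using \<gamma>(1) s by auto
  have no': False if "subprincipal_bichar S (\<lambda>z. Re (a z * q z)) 0 \<delta> 0 T"
      "leaf_sign (\<lambda>z. Im (a z * q z)) (leaf S (\<delta> 0)) = -1" "leaf_sign (\<lambda>z. Im (a z * q z)) (leaf S (\<delta> T)) = 1" for \<delta>
    using no that \<phi>(1) unfolding no_leaf_sign_change_at_def Sigma2_mult by blast
  show False
  proof (cases "0 < \<alpha> (\<gamma> s)")
    case True
    have "subprincipal_bichar S (\<lambda>z. Re (a z * q z)) 0 (\<lambda>t. \<gamma> (\<phi> t)) 0 T"
    proof (rule bich[OF \<phi>(4)])
      fix t assume t: "t \<in> {0..T}"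
      have "\<bar>\<alpha> (\<gamma> (\<phi> t))\<bar> = \<alpha> (\<gamma> (\<phi> t))" using True sgn[OF \<phi>(4)[OF t]] by simp
      then show "(\<phi> has_real_derivative \<alpha> (\<gamma> (\<phi> t))) (at t within {0..T})" using \<phi>(5)[OF t] by (auto intro: has_field_derivative_at_within)
    qed
    then show False
      by (rule no') (use True sgn[of s'] s ls leaf_sign_mult[OF S(1)] leaf_sign_mult[OF S(2)] in \<open>simp_all add: \<phi>\<close>)
  next
    case False
    have "subprincipal_bichar S (\<lambda>z. Re (a z * q z)) 0 (\<lambda>t. \<gamma> (\<phi> (T - t))) 0 T"
    proof (rule bich)
      fix t assume "t \<in> {0..T}"
      then have t: "T - t \<in> {0..T}" by auto
      show "\<phi> (T - t) \<in> {s..s'}" by (rule \<phi>(4)[OF t])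
      have "\<bar>\<alpha> (\<gamma> (\<phi> (T - t)))\<bar> = - \<alpha> (\<gamma> (\<phi> (T - t)))" using False sgn[OF \<phi>(4)[OF t]] by simp
      then have "(\<phi> has_real_derivative - \<alpha> (\<gamma> (\<phi> (T - t)))) (at (T - t))" using \<phi>(5)[OF t] by simp
      moreover have "((\<lambda>t. T - t) has_real_derivative -1) (at t)" by (auto intro!: derivative_eq_intros)
      ultimately have "((\<lambda>t. \<phi> (T - t)) has_real_derivative - \<alpha> (\<gamma> (\<phi> (T - t))) * -1) (at t)" by (rule DERIV_chain2)
      then show "((\<lambda>t. \<phi> (T - t)) has_real_derivative \<alpha> (\<gamma> (\<phi> (T - t)))) (at t within {0..T})" by (auto intro: has_field_derivative_at_within)
    qed
    then show False
      by (rule no') (use False sgn[of s'] s ls leaf_sign_mult[OF S(1)] leaf_sign_mult[OF S(2)] in \<open>simp_all add: \<phi>\<close>)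
  qed
qed

end

section \<open>The equivalences\<close>

text \<open>Of the two derivatives of \<open>p 0\<close>, the one in the fibre lowers the degree by
  1 and the one in the base preserves it, which matches the degree of \<open>p 1\<close>.\<close>

lemma subprincipal_smooth_homogeneous:
  assumes U: "conic_open U" and p0: "smooth_on U (p 0)" "homogeneous r U (p 0)" and p1: "smooth_on U (p 1)" "homogeneous (r - 1) U (p 1)"
  shows "smooth_on U (subprincipal p)" "homogeneous (r - 1) U (subprincipal p)"
proof -
  have o: "open U" by (rule conic_open_open[OF U])
  let ?D = "\<lambda>j z. frechet_derivative (p 0) (at z) (0, axis j 1)"
  have smD: "smooth_on U (?D j)" for j by (rule smooth_on_deriv[OF p0(1)])
  have eq: "subprincipal p = (\<lambda>z. p 1 z + \<i> / 2 * (\<Sum>j\<in>UNIV. frechet_derivative (?D j) (at z) (axis j 1, 0)))"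
    by (simp add: subprincipal_def fun_eq_iff)
  show "smooth_on U (subprincipal p)"
    unfolding eq by (intro smooth_on_add smooth_on_mult smooth_on_const smooth_on_sum smooth_on_deriv p1 smD o) simp
  have dif: "p 0 differentiable (at z)" "?D j differentiable (at z)" if "z \<in> U" for j z
    by (rule differentiableI[OF smooth_on_has_derivative[OF p0(1) that]] differentiableI[OF smooth_on_has_derivative[OF smD that]])+
  have homD: "homogeneous (r - 1) U (?D j)" for j
    unfolding homogeneous_def
  proof (intro ballI allI impI)
    fix z t assume z: "z \<in> U" and t: "(0::real) < t"
    have tz: "scl t z \<in> U" by (rule conic_open_scl[OF U z t])
    have "t *\<^sub>R ?D j (scl t z) = frechet_derivative (p 0) (at (scl t z)) (t *\<^sub>R (0, axis j 1))"
      by (rule linear_cmul[OF smooth_on_deriv_linear[OF p0(1) tz], symmetric])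
    also have "t *\<^sub>R (0, axis j 1) = scl t (0, axis j 1)" by (simp add: scl_def)
    also have "frechet_derivative (p 0) (at (scl t z)) (scl t (0, axis j 1)) = (t powr r) *\<^sub>R ?D j z"
      by (rule homogeneous_deriv[OF U p0(2) z t dif(1)[OF z] dif(1)[OF tz]])
    also have "t powr r = t * t powr (r - 1)" using t powr_add[of t 1 "r - 1"] by simp
    finally show "?D j (fst z, t *\<^sub>R snd z) = (t powr (r - 1)) *\<^sub>R ?D j z" using t by (simp add: scl_def flip: scaleR_scaleR)
  qed
  show "homogeneous (r - 1) U (subprincipal p)"
    unfolding homogeneous_def
  proof (intro ballI allI impI)
    fix z t assume z: "z \<in> U" and t: "(0::real) < t"
    have tz: "scl t z \<in> U" by (rule conic_open_scl[OF U z t])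
    have "frechet_derivative (?D j) (at (scl t z)) (axis j 1, 0) = (t powr (r - 1)) *\<^sub>R frechet_derivative (?D j) (at z) (axis j 1, 0)" for j
      using homogeneous_deriv[OF U homD z t dif(2)[OF z] dif(2)[OF tz], where v = "(axis j 1, 0)"] by (simp add: scl_def)
    then have "subprincipal p (scl t z) = (t powr (r - 1)) *\<^sub>R subprincipal p z"
      unfolding eq homogeneousD[OF p1(2) z t] by (simp add: scaleR_add_right flip: scaleR_sum_right)
    then show "subprincipal p (fst z, t *\<^sub>R snd z) = (t powr (r - 1)) *\<^sub>R subprincipal p z" by (simp add: scl_def)
  qed
qed

lemma (in double_char) leaf_conditions_microlocally:
  assumes "w0 \<in> S" "limit_bichar_cond U p q" shows "microlocally U w0 (\<lambda>U. leaf_conditions U p q)"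
  unfolding microlocally_def by (rule leaf_conditions_if_limit_bichar_cond[OF assms(2,1)]) blast

lemma (in double_char) limit_bichar_cond_microlocally:
  assumes "w0 \<in> S" "leaf_conditions U p q" shows "microlocally U w0 (\<lambda>U. limit_bichar_cond U p q)"
proof -
  obtain U1 d n m \<zeta> x where ch: "involutive_chart U1 S d n m \<zeta> x" "w0 \<in> U1" "U1 \<subseteq> U"
    by (rule chart_exists[OF assms(1)])
  from limit_bichar_cond_if_leaf_conditions[OF ch(1,3) assms(2)] show ?thesis
    unfolding microlocally_def using ch(2,3) involutive_chart.U[OF ch(1)] by blast
qed

text \<open>Each implication between the conditions may shrink the cone once more; the result is
  still a cone in the original set.\<close>

lemma microlocally_bind:
  assumes "microlocally \<Omega> w \<Phi>"
    and "\<And>U. U \<subseteq> \<Omega> \<Longrightarrow> conic_open U \<Longrightarrow> w \<in> U \<Longrightarrow> \<Phi> U \<Longrightarrow> microlocally U w \<Psi>"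
  shows "microlocally \<Omega> w \<Psi>"
  using assms unfolding microlocally_def by (metis order_trans)

lemma microlocally_mono:
  assumes "microlocally \<Omega> w \<Phi>" "\<And>U. U \<subseteq> \<Omega> \<Longrightarrow> conic_open U \<Longrightarrow> w \<in> U \<Longrightarrow> \<Phi> U \<Longrightarrow> \<Psi> U"
  shows "microlocally \<Omega> w \<Psi>"
  using assms unfolding microlocally_def by blast

context double_char
begin

lemma multiplier_one: "sub_r_multiplier U p q (\<lambda>_. 1)"
  using rdc rst by (simp add: sub_r_multiplier_def homogeneous_def smooth_on_const open_domain)

context
  fixes w0 assumes w0: "w0 \<in> S"
begin

lemma local_double_char:
  assumes "U' \<subseteq> U" "conic_open U'" "w0 \<in> U'" "sub_r_multiplier U' p q a"
  shows "multiplier U' p q r a" "double_char U' (\<lambda>z. a z * p z) (\<lambda>z. a z * q z) r" "w0 \<in> Sigma2 U' (\<lambda>z. a z * p z)"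
proof -
  have dc: "double_char U' p q r" by (rule double_char_restrict[OF double_char_axioms assms(2,1)])
  show m: "multiplier U' p q r a" by (intro multiplier.intro dc multiplier_axioms.intro assms(4))
  show "double_char U' (\<lambda>z. a z * p z) (\<lambda>z. a z * q z) r" by (rule double_char_multiplier[OF dc assms(4)])
  show "w0 \<in> Sigma2 U' (\<lambda>z. a z * p z)"
    using multiplier.Sigma2_mult[OF m] Sigma2_restrict[OF assms(1), of p] w0 assms(3) by blast
qed

lemma leaf_conditions_if_Sub_r_Psi_with:
  assumes U': "U' \<subseteq> U" "conic_open U'" "w0 \<in> U'" and "Sub_r_Psi_with U' p q a"
  shows "microlocally U' w0 (\<lambda>U. sub_r_multiplier U p q a \<and> leaf_conditions U (\<lambda>z. a z * p z) (\<lambda>z. a z * q z))"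
proof -
  have a: "sub_r_multiplier U' p q a" "limit_bichar_cond U' (\<lambda>z. a z * p z) (\<lambda>z. a z * q z)"
    using assms(4) by (auto simp: Sub_r_Psi_with_def)
  note l = local_double_char[OF U' a(1)]
  show ?thesis
    by (rule microlocally_mono[OF double_char.leaf_conditions_microlocally[OF l(2,3) a(2)]])
       (use sub_r_multiplier_restrict[OF a(1)] conic_open_open in blast)
qed

lemma Sub_r_Psi_with_if_leaf_conditions:
  assumes U': "U' \<subseteq> U" "conic_open U'" "w0 \<in> U'" and a: "sub_r_multiplier U' p q a" "leaf_conditions U' (\<lambda>z. a z * p z) (\<lambda>z. a z * q z)"
  shows "microlocally U' w0 (\<lambda>U. Sub_r_Psi_with U p q a)"
proof -
  note l = local_double_char[OF U' a(1)]
  show ?thesis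
    unfolding Sub_r_Psi_with_def
    by (rule microlocally_mono[OF double_char.limit_bichar_cond_microlocally[OF l(2,3) a(2)]])
       (use sub_r_multiplier_restrict[OF a(1)] conic_open_open in blast)
qed

lemma local_multiplier_one: "U' \<subseteq> U \<Longrightarrow> conic_open U' \<Longrightarrow> sub_r_multiplier U' p q (\<lambda>_. 1)"
  using sub_r_multiplier_restrict[OF multiplier_one] conic_open_open by blast

theorem Sub_r_Psi_with_one_iff:
  "microlocally U w0 (\<lambda>U. Sub_r_Psi_with U p q (\<lambda>_. 1)) \<longleftrightarrow> microlocally U w0 (\<lambda>U. leaf_conditions U p q)"
proof
  assume "microlocally U w0 (\<lambda>U. Sub_r_Psi_with U p q (\<lambda>_. 1))"
  then show "microlocally U w0 (\<lambda>U. leaf_conditions U p q)"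
  proof (rule microlocally_bind)
    fix U' assume "U' \<subseteq> U" "conic_open U'" "w0 \<in> U'" "Sub_r_Psi_with U' p q (\<lambda>_. 1)"
    from microlocally_mono[OF leaf_conditions_if_Sub_r_Psi_with[OF this]]
    show "microlocally U' w0 (\<lambda>U. leaf_conditions U p q)" by simp
  qed
next
  assume "microlocally U w0 (\<lambda>U. leaf_conditions U p q)"
  then show "microlocally U w0 (\<lambda>U. Sub_r_Psi_with U p q (\<lambda>_. 1))"
  proof (rule microlocally_bind)
    fix U' assume U': "U' \<subseteq> U" "conic_open U'" "w0 \<in> U'" and "leaf_conditions U' p q"
    then show "microlocally U' w0 (\<lambda>U. Sub_r_Psi_with U p q (\<lambda>_. 1))"
      using Sub_r_Psi_with_if_leaf_conditions[OF U' local_multiplier_one[OF U'(1,2)]] by simp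
  qed
qed

theorem Sub_r_Psi_iff:
  "microlocally U w0 (\<lambda>U. Sub_r_Psi U p q) \<longleftrightarrow> microlocally U w0 (\<lambda>U. \<exists>a. sub_r_multiplier U p q a \<and>
     leaf_conditions U (\<lambda>z. a z * p z) (\<lambda>z. a z * q z))"
proof
  assume "microlocally U w0 (\<lambda>U. Sub_r_Psi U p q)"
  then show "microlocally U w0 (\<lambda>U. \<exists>a. sub_r_multiplier U p q a \<and> leaf_conditions U (\<lambda>z. a z * p z) (\<lambda>z. a z * q z))"
  proof (rule microlocally_bind)
    fix U' assume U': "U' \<subseteq> U" "conic_open U'" "w0 \<in> U'" and "Sub_r_Psi U' p q"
    then obtain a where "Sub_r_Psi_with U' p q a" by (auto simp: Sub_r_Psi_def)
    from leaf_conditions_if_Sub_r_Psi_with[OF U' this]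
    show "microlocally U' w0 (\<lambda>U. \<exists>a. sub_r_multiplier U p q a \<and> leaf_conditions U (\<lambda>z. a z * p z) (\<lambda>z. a z * q z))"
      by (rule microlocally_mono) blast
  qed
next
  assume "microlocally U w0 (\<lambda>U. \<exists>a. sub_r_multiplier U p q a \<and> leaf_conditions U (\<lambda>z. a z * p z) (\<lambda>z. a z * q z))"
  then show "microlocally U w0 (\<lambda>U. Sub_r_Psi U p q)"
  proof (rule microlocally_bind)
    fix U' assume U': "U' \<subseteq> U" "conic_open U'" "w0 \<in> U'"
      and "\<exists>a. sub_r_multiplier U' p q a \<and> leaf_conditions U' (\<lambda>z. a z * p z) (\<lambda>z. a z * q z)"
    then obtain a where "sub_r_multiplier U' p q a" "leaf_conditions U' (\<lambda>z. a z * p z) (\<lambda>z. a z * q z)" by blast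
    from Sub_r_Psi_with_if_leaf_conditions[OF U' this] show "microlocally U' w0 (\<lambda>U. Sub_r_Psi U p q)"
      by (rule microlocally_mono) (auto simp: Sub_r_Psi_def)
  qed
qed

theorem Sub_r_Psi_if_leaf_conditions:
  assumes "microlocally U w0 (\<lambda>U. leaf_conditions U p q)" shows "microlocally U w0 (\<lambda>U. Sub_r_Psi U p q)"
  using assms unfolding Sub_r_Psi_with_one_iff[symmetric]
  by (rule microlocally_mono) (auto simp: Sub_r_Psi_def)

theorem leaf_conditions_at_0_if_Sub_r_Psi:
  assumes "microlocally U w0 (\<lambda>U. Sub_r_Psi U p q)"
  shows "microlocally U w0 (\<lambda>U. no_sign_change_on_leaves U p q \<and> no_leaf_sign_change_at U p q 0)"
  using assms unfolding Sub_r_Psi_iff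
proof (rule microlocally_mono)
  fix U' assume U': "U' \<subseteq> U" "conic_open U'" "w0 \<in> U'"
    and "\<exists>a. sub_r_multiplier U' p q a \<and> leaf_conditions U' (\<lambda>z. a z * p z) (\<lambda>z. a z * q z)"
  then obtain a where a: "sub_r_multiplier U' p q a" "leaf_conditions U' (\<lambda>z. a z * p z) (\<lambda>z. a z * q z)" by blast
  note m = local_double_char(1)[OF U' a(1)]
  show "no_sign_change_on_leaves U' p q \<and> no_leaf_sign_change_at U' p q 0"
    using multiplier.no_sign_change_on_leaves_mult[OF m] multiplier.no_leaf_sign_change_at_0_mult[OF m] a(2)
    by (auto simp: leaf_conditions_def)
qed

end

end

text \<open>A multiplier alters the bicharacteristics on levels of \<open>Re q\<close> other than 0.
  Hence the criterion is stated for the multiplier 1 and, with the multiplied symbols, for an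
  arbitrary one; the last two statements compare the latter with the leaf conditions on the original
  symbols. The operator supplies the smoothness and homogeneity of \<open>p 0\<close> and
  \<open>p 1\<close>; what follows is symplectic geometry.\<close>

theorem proposition1p13:
  fixes P :: "(real ^ 'n::finite \<Rightarrow> complex) \<Rightarrow> real ^ 'n \<Rightarrow> complex"
    and p :: "nat \<Rightarrow> 'n phase \<Rightarrow> complex"
    and m :: real and X :: "(real ^ 'n) set" and \<Omega> :: "'n phase set" and w0 :: "'n phase"
  assumes "open X"
    and "Psi_cl m X P p"
    and "conic_open \<Omega>" and "\<Omega> \<subseteq> X \<times> UNIV"
    and "real_double_char \<Omega> (p 0)"
    and "real_subprincipal_type \<Omega> (p 0) (subprincipal p)"
    and "w0 \<in> Sigma2 \<Omega> (p 0)"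
  shows "(microlocally \<Omega> w0 (\<lambda>U. Sub_r_Psi_with U (p 0) (subprincipal p) (\<lambda>_. 1)) \<longleftrightarrow>
            microlocally \<Omega> w0 (\<lambda>U. leaf_conditions U (p 0) (subprincipal p)))
       \<and> (microlocally \<Omega> w0 (\<lambda>U. Sub_r_Psi U (p 0) (subprincipal p)) \<longleftrightarrow>
            microlocally \<Omega> w0 (\<lambda>U. \<exists>a. sub_r_multiplier U (p 0) (subprincipal p) a \<and>
              leaf_conditions U (\<lambda>z. a z * p 0 z) (\<lambda>z. a z * subprincipal p z)))
       \<and> (microlocally \<Omega> w0 (\<lambda>U. leaf_conditions U (p 0) (subprincipal p)) \<longrightarrow>
            microlocally \<Omega> w0 (\<lambda>U. Sub_r_Psi U (p 0) (subprincipal p)))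
       \<and> (microlocally \<Omega> w0 (\<lambda>U. Sub_r_Psi U (p 0) (subprincipal p)) \<longrightarrow>
            microlocally \<Omega> w0 (\<lambda>U. no_sign_change_on_leaves U (p 0) (subprincipal p) \<and>
              no_leaf_sign_change_at U (p 0) (subprincipal p) 0))"
proof -
  have sub: "\<Omega> \<subseteq> X \<times> (- {0})" using assms(3,4) by (force simp: conic_open_def)
  have sm: "smooth_on (X \<times> (- {0})) (p j)" and hom: "homogeneous (m - real j) (X \<times> (- {0})) (p j)" for j
    using assms(2) unfolding Psi_cl_def classical_symbol_def by blast+
  have sm\<Omega>: "smooth_on \<Omega> (p j)" and hom\<Omega>: "homogeneous (m - real j) \<Omega> (p j)" for j
    using smooth_on_subset[OF sm sub] hom[of j] sub unfolding homogeneous_def by blast+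
  interpret double_char \<Omega> "p 0" "subprincipal p" m
    using subprincipal_smooth_homogeneous[OF assms(3), of p m] sm\<Omega> hom\<Omega>[of 0] hom\<Omega>[of 1] assms(3,5,6)
    by unfold_locales auto
  show ?thesis
    using Sub_r_Psi_with_one_iff[OF assms(7)] Sub_r_Psi_iff[OF assms(7)] Sub_r_Psi_if_leaf_conditions[OF assms(7)]
      leaf_conditions_at_0_if_Sub_r_Psi[OF assms(7)] by blast
qed

end
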